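(* Let $n$ be a positive integer. (a) Suppose $G_1, \ldots, G_n$ are (isomorphic, as profinite groups, to) absolute Galois groups of fields. Then their free profinite product $\mathop{*}_{i=1}^n G_i$ is (isomorphic to) the absolute Galois group of a field of characteristic $0$. (b) If $G_1, \ldots, G_n$ are absolute Galois groups of fields of a common characteristic $p$, then $\mathop{*}_{i=1}^n G_i$ is the absolute Galois group of a field of characteristic $p$.
   Context: For a field $K$, let $K_s$ be its separable algebraic closure; the absolute Galois group of $K$ is the profinite group $G(K)=\mathrm{Gal}(K_s/K)$. Homomorphisms of profinite groups are continuous. A profinite group $G$ is the free product of closed subgroups $G_1,\ldots,G_n$, written $G=\mathop{*}_{i=1}^n G_i$, if $G_1,\ldots,G_n$ (topologically) generate $G$ and, for every profinite group $H$ and all homomorphisms $\eta_i\colon G_i\to H$, $i=1,\ldots,n$, there is a unique homomorphism $\eta\colon G\to H$ with $\eta|_{G_i}=\eta_i$ for $i=1,\ldots,n$. For given profinite groups $G_1,\ldots,G_n$, the free product $\mathop{*}_{i=1}^n G_i$ is their coproduct in the category of profinite groups: the (unique up to isomorphism) profinite group which is (topologically) generated by closed subgroups identified with $G_1,\ldots,G_n$ and has the property that, for every profinite group $H$, all homomorphisms $\eta_i\colon G_i\to H$, $i=1,\ldots,n$, extend to a unique homomorphism from it to $H$ whose restriction to $G_i$ is $\eta_i$ for $i=1,\ldots,n$. *)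

theory Defs
  imports
    "HOL-Algebra.Algebra"
    "HOL-Algebra.Algebraic_Closure"
    "HOL-Analysis.Abstract_Topological_Spaces"
    "HOL-Library.Infinite_Typeclass"
begin

section \<open>Profinite groups\<close>

record 'a top_group = "'a monoid" +
  topol :: "'a topology"

definition totally_disconnected_space :: "'a topology \<Rightarrow> bool" where
  "totally_disconnected_space T \<longleftrightarrow>
     (\<forall>x \<in> topspace T. connected_component_of_set T x = {x})"

definition topological_group :: "('a, 'm) top_group_scheme \<Rightarrow> bool" where
  "topological_group G \<longleftrightarrow>
     group G \<and> topspace (topol G) = carrier G \<and>
     continuous_map (prod_topology (topol G) (topol G)) (topol G) (\<lambda>(x, y). x \<otimes>\<^bsub>G\<^esub> y) \<and>
     continuous_map (topol G) (topol G) (\<lambda>x. inv\<^bsub>G\<^esub> x)"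

definition profinite_group :: "('a, 'm) top_group_scheme \<Rightarrow> bool" where
  "profinite_group G \<longleftrightarrow>
     topological_group G \<and> compact_space (topol G) \<and> Hausdorff_space (topol G) \<and>
     totally_disconnected_space (topol G)"

definition cont_hom :: "('a, 'm) top_group_scheme \<Rightarrow> ('b, 'n) top_group_scheme \<Rightarrow> ('a \<Rightarrow> 'b) set"
  where "cont_hom G H = {f \<in> hom G H. continuous_map (topol G) (topol H) f}"

definition top_group_isomorphic ::
    "('a, 'm) top_group_scheme \<Rightarrow> ('b, 'n) top_group_scheme \<Rightarrow> bool" where
  "top_group_isomorphic G H \<longleftrightarrow>
     (\<exists>f \<in> iso G H. homeomorphic_map (topol G) (topol H) f)"

definition top_subgroup :: "('a, 'm) top_group_scheme \<Rightarrow> 'a set \<Rightarrow> ('a, 'm) top_group_scheme" where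
  "top_subgroup G A = G\<lparr>carrier := A, topol := subtopology (topol G) A\<rparr>"


section \<open>Free products of profinite groups\<close>

text \<open>HOL cannot quantify over the types carrying the test groups \<open>H\<close>, so their type \<open>'u\<close> is a
  parameter.  For every infinite type \<open>'u\<close> the universal property is the full one: every finite
  group has a copy on \<open>'u\<close>, and the universal property for finite \<open>H\<close> yields the one for all
  profinite \<open>H\<close>, on whatever type, by passing to the inverse limit of the finite quotients of \<open>H\<close>.\<close>

definition internal_free_product ::
    "'u itself \<Rightarrow> ('a, 'm) top_group_scheme \<Rightarrow> nat \<Rightarrow> (nat \<Rightarrow> 'a set) \<Rightarrow> bool" where
  "internal_free_product _ P n A \<longleftrightarrow>
     profinite_group P \<and>
     (\<forall>i \<in> {1..n}. subgroup (A i) P \<and> closedin (topol P) (A i)) \<and>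
     topol P closure_of (generate P (\<Union>i \<in> {1..n}. A i)) = carrier P \<and>
     (\<forall>H :: 'u top_group. profinite_group H \<longrightarrow>
       (\<forall>\<eta>. (\<forall>i \<in> {1..n}. \<eta> i \<in> cont_hom (top_subgroup P (A i)) H) \<longrightarrow>
         (\<exists>\<phi> \<in> cont_hom P H.
            (\<forall>i \<in> {1..n}. \<forall>x \<in> A i. \<phi> x = \<eta> i x) \<and>
            (\<forall>\<psi> \<in> cont_hom P H. (\<forall>i \<in> {1..n}. \<forall>x \<in> A i. \<psi> x = \<eta> i x) \<longrightarrow>
               (\<forall>x \<in> carrier P. \<psi> x = \<phi> x)))))"

definition is_free_profinite_product ::
    "'u itself \<Rightarrow> ('a, 'm) top_group_scheme \<Rightarrow> nat \<Rightarrow> (nat \<Rightarrow> ('b, 'k) top_group_scheme) \<Rightarrow> bool"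
  where
  "is_free_profinite_product U P n G \<longleftrightarrow>
     (\<exists>A. internal_free_product U P n A \<and>
          (\<forall>i \<in> {1..n}. top_group_isomorphic (G i) (top_subgroup P (A i))))"


section \<open>Absolute Galois groups\<close>

definition ring_characteristic :: "('a, 'm) ring_scheme \<Rightarrow> nat" where
  "ring_characteristic R =
     (if \<exists>m::nat. m > 0 \<and> [m] \<cdot>\<^bsub>R\<^esub> \<one>\<^bsub>R\<^esub> = \<zero>\<^bsub>R\<^esub>
      then (LEAST m. m > 0 \<and> [m] \<cdot>\<^bsub>R\<^esub> \<one>\<^bsub>R\<^esub> = \<zero>\<^bsub>R\<^esub>) else 0)"

text \<open>The copy of \<open>K\<close> inside its algebraic closure.\<close>

definition base_field :: "('a, 'm) ring_scheme \<Rightarrow> (('a list \<times> nat) multiset \<Rightarrow> 'a) set" where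
  "base_field K = ring.indexed_const K ` carrier K"

text \<open>\<open>L\<close> is meant to be algebraically closed, so that all roots of the minimal polynomial
  are seen in \<open>L\<close>.\<close>

definition separable_over :: "('a, 'm) ring_scheme \<Rightarrow> 'a set \<Rightarrow> 'a \<Rightarrow> bool" where
  "separable_over L K x \<longleftrightarrow>
     ring.algebraic L K x \<and> (\<forall>y \<in> carrier L. ring.alg_mult L (ring.Irr L K x) y \<le> 1)"

definition sep_closure :: "('a, 'm) ring_scheme \<Rightarrow> (('a list \<times> nat) multiset \<Rightarrow> 'a) ring" where
  "sep_closure K = (field.alg_closure K)
     \<lparr>carrier := {x \<in> carrier (field.alg_closure K).
                    separable_over (field.alg_closure K) (base_field K) x}\<rparr>"

definition absolute_galois_carrier ::
    "('a, 'm) ring_scheme \<Rightarrow>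
     ((('a list \<times> nat) multiset \<Rightarrow> 'a) \<Rightarrow> (('a list \<times> nat) multiset \<Rightarrow> 'a)) set" where
  "absolute_galois_carrier K =
     {\<sigma> \<in> extensional (carrier (sep_closure K)).
        \<sigma> \<in> ring_iso (sep_closure K) (sep_closure K) \<and> (\<forall>x \<in> base_field K. \<sigma> x = x)}"

text \<open>The Krull topology: the cosets \<open>\<sigma> Gal(K\<^sub>s/E)\<close>, where \<open>E\<close> is a finite extension of \<open>K\<close>
  inside \<open>K\<^sub>s\<close>, form a basis.\<close>

definition krull_topology ::
    "('a, 'm) ring_scheme \<Rightarrow>
     ((('a list \<times> nat) multiset \<Rightarrow> 'a) \<Rightarrow> (('a list \<times> nat) multiset \<Rightarrow> 'a)) topology" where
  "krull_topology K = topology_generated_by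
     {{\<tau> \<in> absolute_galois_carrier K. \<forall>x \<in> E. \<tau> x = \<sigma> x} | \<sigma> E.
        \<sigma> \<in> absolute_galois_carrier K \<and> subfield E (sep_closure K) \<and> base_field K \<subseteq> E \<and>
        ring.finite_dimension (sep_closure K) (base_field K) E}"

definition absolute_galois_group ::
    "('a, 'm) ring_scheme \<Rightarrow>
     ((('a list \<times> nat) multiset \<Rightarrow> 'a) \<Rightarrow> (('a list \<times> nat) multiset \<Rightarrow> 'a)) top_group" where
  "absolute_galois_group K =
     \<lparr>carrier = absolute_galois_carrier K,
      monoid.mult = compose (carrier (sep_closure K)),
      monoid.one = (\<lambda>x \<in> carrier (sep_closure K). x),
      topol = krull_topology K\<rparr>"

text \<open>The type on which the field realizing a free product \<open>P\<close> on \<open>'h\<close> is sought.  This is no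
  restriction: by a Loewenheim--Skolem argument, an absolute Galois group \<open>P\<close> of a field is
  already that of a field of the same characteristic with at most \<open>max(|P|, \<aleph>\<^sub>0)\<close> elements.
  The summand \<open>'k\<close> and the power set make room for the usual constructions (algebraic closures,
  Laurent series, completions) starting from fields on \<open>'k\<close>.\<close>

type_synonym ('k, 'h) field_universe = "('k + 'h + nat) set"

end

theory Submission
 imports Defs "HOL-Library.Poly_Mapping" "HOL-Library.Multiset" "HOL-Computational_Algebra.Polynomial"
begin

text \<open>Let \<open>L i\<close> be the algebraic closure of the \<open>i\<close>-th field. A ring of Hahn series modulo a prime ideal
 \<open>N i\<close> is an algebraically closed field containing \<open>L i\<close>, of characteristic \<open>0\<close> if so desired (a mixed
 characteristic version, with \<open>p\<close> as a monomial); \<open>A i\<close> acts on it, permuting monomials like the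
 clopen subsets of \<open>P\<close>. Partial isomorphisms (\<open>corr\<close>) between these fields extend to relative algebraic closures,
 so all \<open>A i\<close> act, with finite orbits, on the algebraic closure of the field generated by the monomials; by the universal
 property these actions come from one faithful action of \<open>P\<close>, and \<open>P\<close> is the absolute
 Galois group of its fixed field.\<close>

text \<open>The free product acts on a field as soon as all \<open>A i\<close> act on the same one,
  but the given fields have nothing in common, in general not even the characteristic. The bridge is
  a family \<open>yy U\<close>, indexed by the sets \<open>U\<close> of elements of \<open>P\<close>
  and found in each of the Hahn fields. It is algebraically independent over the prime ring of the
  wanted characteristic, so it generates isomorphic rings everywhere; and \<open>A i\<close>
  permutes it by left translation of clopen sets, an action that comes from \<open>P\<close> and is
  faithful. The action of \<open>A i\<close> on series is coefficientwise and fixes every power of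
  the variables; the permuted elements are combinations of such powers, with coefficients that
  separate the points of a finite orbit. Such coefficients exist because \<open>A i\<close> acts
  faithfully on \<open>L i\<close>. The Hahn fields are made algebraically closed so that the
  algebraic closures lie inside them, already equipped with an action. The test groups live on a
  type known only to be infinite; permutation groups of finite invariant sets have copies there,
  which is why finiteness of orbits matters.\<close>

abbreviation "plk \<equiv> Poly_Mapping.lookup"
abbreviation "pkeys \<equiv> Poly_Mapping.keys"
abbreviation "psingle \<equiv> Poly_Mapping.single"
abbreviation "pcoeff \<equiv> Polynomial.coeff"
abbreviation "pdegree \<equiv> Polynomial.degree"
abbreviation "pmonom \<equiv> Polynomial.monom"
abbreviation "psmult \<equiv> Polynomial.smult"

section \<open>Polynomial rings in arbitrarily many variables and presentations of rings by
  them\<close>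

definition rhom :: "('a::comm_ring_1 \<Rightarrow> 'b::comm_ring_1) \<Rightarrow> bool" where
 "rhom f \<equiv> f 1 = 1 \<and> (\<forall>x y. f (x + y) = f x + f y) \<and> (\<forall>x y. f (x * y) = f x * f y)"

lemma rhomD:
 assumes "rhom f"
 shows "f 1 = 1" "f (x + y) = f x + f y" "f (x * y) = f x * f y" "f 0 = 0" "f (- x) = - f x"
  "f (x - y) = f x - f y" "f (x ^ n) = f x ^ n" "f (sum g A) = (\<Sum>a\<in>A. f (g a))"
  "f (prod g A) = (\<Prod>a\<in>A. f (g a))"  "f (of_int i) = of_int i" "f (of_nat j) = of_nat j"
proof -
 show 1: "f 1 = 1" and a: "f (x + y) = f x + f y" and m: "f (x * y) = f x * f y" for x y using assms by (auto simp: rhom_def)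
 have "f 0 = f 0 + f 0" using a[of 0 0] by simp
 thus z: "f 0 = 0" by simp
 have n: "f (- x) = - f x" for x using a[of x "-x"] z by (simp add: eq_neg_iff_add_eq_0 add.commute)
 show "f (- x) = - f x" by (rule n)
 show "f (x - y) = f x - f y" using a[of x "-y"] n by simp
 show "f (x ^ n) = f x ^ n" by (induction n) (auto simp: 1 m)
 show "f (sum g A) = (\<Sum>a\<in>A. f (g a))" by (induction A rule: infinite_finite_induct) (auto simp: z a)
 show "f (prod g A) = (\<Prod>a\<in>A. f (g a))" by (induction A rule: infinite_finite_induct) (auto simp: 1 m)
 show ofn: "f (of_nat j) = of_nat j" for j by (induction j) (auto simp: z a 1)
 show "f (of_int i) = of_int i" by (cases i rule: int_cases2) (auto simp: n ofn)
qed

lemma rhom_comp: "rhom f \<Longrightarrow> rhom g \<Longrightarrow> rhom (\<lambda>x. f (g x))" by (simp add: rhom_def)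

lemma rhom_id: "rhom (\<lambda>x. x)" by (simp add: rhom_def)

lemma rhom_of_int: "rhom (of_int :: int \<Rightarrow> 'a::comm_ring_1)" by (simp add: rhom_def)

text \<open>Monomials are multisets of variables under addition, so the convolution product of
  finitely supported maps is the multiplication of the commutative polynomial ring in the variables
  \<open>'v\<close>.\<close>

type_synonym ('v, 'c) mpol = "'v multiset \<Rightarrow>\<^sub>0 'c"

definition mvar :: "'v \<Rightarrow> ('v, 'c::comm_ring_1) mpol" where
 "mvar a = psingle {#a#} 1"

definition mconst :: "'c \<Rightarrow> ('v, 'c::comm_ring_1) mpol" where
 "mconst c = psingle {#} c"

lemma rhom_mconst: "rhom (mconst :: 'c::comm_ring_1 \<Rightarrow> ('v, 'c) mpol)"
 by (auto simp: rhom_def mconst_def single_add mult_single single_one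
   simp flip: Multiset.empty_neutral single_one zero_multiset_def)

lemma single_mpol_eq:
 "psingle m c = mconst c * (\<Prod>a\<in>#m. mvar a)"
proof (induction m)
 case empty
 thus ?case by (simp add: mconst_def)
next
 case (add a m)
 have "psingle (add_mset a m) c = psingle m c * mvar a" by (simp add: mvar_def mult_single)
 thus ?case using add by (simp add: mult_ac)
qed

lemma mpol_sum_single: "z = (\<Sum>m\<in>pkeys z. psingle m (plk z m))" by (rule poly_mapping_eqI)
   (auto simp: lookup_sum lookup_single when_def in_keys_iff)

lemma mpol_induct [case_names const var add mult]:
 assumes c: "\<And>c. P (mconst c)" and v: "\<And>a. P (mvar a)"
  and a: "\<And>x y. P x \<Longrightarrow> P y \<Longrightarrow> P (x + y)" and m: "\<And>x y. P x \<Longrightarrow> P y \<Longrightarrow> P (x * y)"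
 shows "P (z :: ('v, 'c::comm_ring_1) mpol)"
proof -
 have 1: "P 1" using c[of 1] rhomD(1)[OF rhom_mconst] by metis
 have 0: "P 0" using c[of 0] rhomD(4)[OF rhom_mconst] by metis
 have "P (\<Prod>a\<in>#m. mvar a)" for m by (induction m) (auto simp: 1 v m)
 hence s: "P (psingle k b)" for k b by (simp add: single_mpol_eq c m)
 have "P (\<Sum>m\<in>A. psingle m (plk z m))" for A by (induction A rule: infinite_finite_induct) (auto simp: 0 s a)
 thus ?thesis using mpol_sum_single[of z] by metis
qed

definition meval :: "('c::comm_ring_1 \<Rightarrow> 'd::comm_ring_1) \<Rightarrow> ('v \<Rightarrow> 'd) \<Rightarrow> ('v, 'c) mpol \<Rightarrow> 'd" where
 "meval \<phi> g z = (\<Sum>m\<in>pkeys z. \<phi> (plk z m) * (\<Prod>a\<in>#m. g a))"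

lemma meval_superset:
 assumes "rhom \<phi>" "finite A" "pkeys z \<subseteq> A"
 shows "meval \<phi> g z = (\<Sum>m\<in>A. \<phi> (plk z m) * (\<Prod>a\<in>#m. g a))" unfolding meval_def
 by (rule sum.mono_neutral_left) (use assms in "auto simp: in_keys_iff rhomD")

lemma meval_single: "rhom \<phi> \<Longrightarrow> meval \<phi> g (psingle m c) = \<phi> c * (\<Prod>a\<in>#m. g a)"
 by (subst meval_superset[of _ "{m}"]) (auto simp: lookup_single)

lemma meval_add:
 assumes "rhom \<phi>"
 shows "meval \<phi> g (x + y) = meval \<phi> g x + meval \<phi> g y"
proof -
 let ?A = "pkeys x \<union> pkeys y"
 have "pkeys (x + y) \<subseteq> ?A" by (rule Poly_Mapping.keys_add)
 thus ?thesis using assms by (simp add: meval_superset[of \<phi> ?A] lookup_add rhomD ring_distribs sum.distrib)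
qed

lemma rhom_meval:
 assumes "rhom \<phi>"
 shows "rhom (meval \<phi> g)" unfolding rhom_def
proof (intro conjI allI)
 show "meval \<phi> g 1 = 1" using meval_single[OF assms, of g "{#}" 1] assms by (simp add: rhomD flip: single_one)
 show "meval \<phi> g (x + y) = meval \<phi> g x + meval \<phi> g y" for x y by (rule meval_add[OF assms])
 have 0: "meval \<phi> g 0 = 0" by (simp add: meval_def)
 have sumA: "meval \<phi> g (sum h A) = (\<Sum>a\<in>A. meval \<phi> g (h a))" for h :: "'c multiset \<Rightarrow> ('c, 'a) mpol" and A
  by (induction A rule: infinite_finite_induct) (auto simp: 0 meval_add[OF assms])
 show "meval \<phi> g (x * y) = meval \<phi> g x * meval \<phi> g y" for x y
 proof -
  have "meval \<phi> g (x * y) = meval \<phi> g ((\<Sum>m\<in>pkeys x. psingle m (plk x m)) *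
    (\<Sum>m\<in>pkeys y. psingle m (plk y m)))" by (simp flip: mpol_sum_single)
  also have "\<dots> = (\<Sum>m\<in>pkeys x. \<Sum>n\<in>pkeys y.
    (\<phi> (plk x m) * (\<Prod>a\<in>#m. g a)) * (\<phi> (plk y n) * (\<Prod>a\<in>#n. g a)))"
   by (simp add: sum_product sumA mult_single meval_single assms rhomD mult_ac)
  finally show ?thesis by (simp add: meval_def sum_product)
 qed
qed

lemma meval_mvar: "rhom \<phi> \<Longrightarrow> meval \<phi> g (mvar a) = g a" by (simp add: mvar_def meval_single rhomD)

lemma meval_mconst: "rhom \<phi> \<Longrightarrow> meval \<phi> g (mconst c) = \<phi> c" by (simp add: mconst_def meval_single)

definition phom :: "('a, 'm) ring_scheme \<Rightarrow> ('c::comm_ring_1 \<Rightarrow> 'a) \<Rightarrow> bool" where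
 "phom R h \<equiv> range h = carrier R \<and> h 1 = \<one>\<^bsub>R\<^esub> \<and>
   (\<forall>x y. h (x + y) = h x \<oplus>\<^bsub>R\<^esub> h y) \<and> (\<forall>x y. h (x * y) = h x \<otimes>\<^bsub>R\<^esub> h y)"

context cring
begin

text \<open>Elements of the type outside the carrier are read as zero, so that evaluation is defined
  on polynomials in all elements of the type.\<close>

definition mon :: "'a multiset \<Rightarrow> 'a" where
 "mon m = (\<Otimes>a\<in>set_mset m. (if a \<in> carrier R then a else \<zero>) [^] count m a)"

text \<open>The presentation of \<open>R\<close> as a quotient of the integral polynomial ring with
  one variable for each element. Its merit is functoriality: endomorphisms lift to renamings of the
  variables, and raising all variables to the power \<open>p\<close> lifts the Frobenius
  map.\<close>

definition mev :: "('a, int) mpol \<Rightarrow> 'a" where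
 "mev z = (\<Oplus>m\<in>pkeys z. [plk z m] \<cdot> \<one> \<otimes> mon m)"

lemma int_closed [simp]: "[(i::int)] \<cdot> \<one> \<in> carrier R" by simp

lemma int_zero [simp]: "[(0::int)] \<cdot> \<one> = \<zero>" and int_one [simp]: "[(1::int)] \<cdot> \<one> = \<one>" by (simp_all add: add_pow_int_ge)

lemma mon_closed [simp]: "mon m \<in> carrier R" unfolding mon_def by (rule finprod_closed) auto

lemma mon_superset:
 assumes "finite A" "set_mset m \<subseteq> A"
 shows "mon m = (\<Otimes>a\<in>A. (if a \<in> carrier R then a else \<zero>) [^] count m a)" unfolding mon_def
 by (rule finprod_mono_neutral_cong_left) (use assms in "auto simp: not_in_iff")

lemma mon_add: "mon (m + n) = mon m \<otimes> mon n"
proof -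
 let ?A = "set_mset m \<union> set_mset n"
 let ?g = "\<lambda>a. if a \<in> carrier R then a else \<zero>"
 have "mon (m + n) = (\<Otimes>a\<in>?A. ?g a [^] count m a \<otimes> ?g a [^] count n a)"
  by (subst mon_superset[of ?A]) (auto intro!: finprod_cong' simp: nat_pow_mult)
 also have "\<dots> = (\<Otimes>a\<in>?A. ?g a [^] count m a) \<otimes> (\<Otimes>a\<in>?A. ?g a [^] count n a)" by (rule finprod_multf) auto
 finally show ?thesis by (simp add: mon_superset[of ?A])
qed

lemma mev_superset:
 assumes "finite A" "pkeys z \<subseteq> A"
 shows "mev z = (\<Oplus>m\<in>A. [plk z m] \<cdot> \<one> \<otimes> mon m)" unfolding mev_def
 by (rule add.finprod_mono_neutral_cong_left) (use assms in "auto simp: in_keys_iff")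

lemma mev_closed [simp]: "mev z \<in> carrier R" unfolding mev_def by (rule finsum_closed) auto

lemma mev_single: "mev (psingle m c) = [c] \<cdot> \<one> \<otimes> mon m" by (subst mev_superset[of "{m}"]) auto

lemma mev_add: "mev (x + y) = mev x \<oplus> mev y"
proof -
 let ?A = "pkeys x \<union> pkeys y"
 have "mev (x + y) = (\<Oplus>m\<in>?A. [plk x m] \<cdot> \<one> \<otimes> mon m \<oplus> [plk y m] \<cdot> \<one> \<otimes> mon m)" by (subst mev_superset[of ?A])
    (auto intro!: add.finprod_cong' simp: Poly_Mapping.keys_add lookup_add add.int_pow_mult l_distr)
 also have "\<dots> = (\<Oplus>m\<in>?A. [plk x m] \<cdot> \<one> \<otimes> mon m) \<oplus> (\<Oplus>m\<in>?A. [plk y m] \<cdot> \<one> \<otimes> mon m)" by (rule finsum_addf) auto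
 finally show ?thesis by (simp add: mev_superset[of ?A])
qed

lemma int_mult_one: "[(i * j::int)] \<cdot> \<one> = [i] \<cdot> \<one> \<otimes> [j] \<cdot> \<one>" by (simp add: add_pow_ldistr_int add.int_pow_pow mult.commute)

lemma mev_const: "mev (mconst c) = [c] \<cdot> \<one>" by (simp add: mconst_def mev_single mon_def)

lemma mev_one: "mev 1 = \<one>"
proof -
 have "mconst 1 = (1 :: ('a, int) mpol)" by (rule rhomD(1)[OF rhom_mconst])
 thus ?thesis using mev_const[of 1] by simp
qed

lemma mev_zero: "mev 0 = \<zero>" by (simp add: mev_def)

lemma mev_mult: "mev (x * y) = mev x \<otimes> mev y"
proof -
 have ss: "mev (psingle m c * psingle n d) =
   mev (psingle m c) \<otimes> mev (psingle n d)" for m n c d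
  by (simp add: mult_single mev_single mon_add int_mult_one) (simp add: m_ac)
 have 1: "mev (psingle m c * (\<Sum>n\<in>A. psingle n (plk y n))) =
   mev (psingle m c) \<otimes> mev (\<Sum>n\<in>A. psingle n (plk y n))" for m c A by (induction A rule: infinite_finite_induct)
    (auto simp: mev_zero ring_distribs(1) mev_add ss r_distr)
 have "mev ((\<Sum>m\<in>B. psingle m (plk x m)) * y) =
   mev (\<Sum>m\<in>B. psingle m (plk x m)) \<otimes> mev y" for B using 1[of _ _ "pkeys y"] by (induction B rule: infinite_finite_induct)
    (auto simp: mev_zero ring_distribs(2) mev_add l_distr simp flip: mpol_sum_single)
 from this[of "pkeys x"] show ?thesis by (simp flip: mpol_sum_single)
qed

lemma mev_var: "mev (mvar a) = (if a \<in> carrier R then a else \<zero>)" by (simp add: mvar_def mev_single mon_def)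

lemma phom_mev: "phom R mev" unfolding phom_def
proof (intro conjI allI)
 have "a \<in> range mev" if "a \<in> carrier R" for a using mev_var[of a] that by (metis rangeI)
 thus "range mev = carrier R" by auto
qed (auto simp: mev_one mev_add mev_mult)

end

lemma phomD:
 fixes R (structure)
 assumes "cring R" "phom R h"
 shows "h x \<in> carrier R" "h 1 = \<one>\<^bsub>R\<^esub>" "h 0 = \<zero>\<^bsub>R\<^esub>" "h (x + y) = h x \<oplus>\<^bsub>R\<^esub> h y"
  "h (x * y) = h x \<otimes>\<^bsub>R\<^esub> h y" "h (- x) = \<ominus>\<^bsub>R\<^esub> h x" "h (x - y) = h x \<ominus>\<^bsub>R\<^esub> h y"
  "h (x ^ n) = h x [^]\<^bsub>R\<^esub> n" "a \<in> carrier R \<Longrightarrow> \<exists>z. h z = a"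
  "h (x - y) = \<zero>\<^bsub>R\<^esub> \<longleftrightarrow> h x = h y"
  "h (of_nat n) = [n] \<cdot>\<^bsub>R\<^esub> \<one>\<^bsub>R\<^esub>"
proof -
 interpret cring R by fact
 show c: "h x \<in> carrier R" for x using assms(2) by (auto simp: phom_def)
 show 1: "h 1 = \<one>\<^bsub>R\<^esub>" and a: "h (x + y) = h x \<oplus>\<^bsub>R\<^esub> h y" and m: "h (x * y) = h x \<otimes>\<^bsub>R\<^esub> h y" for x y
  using assms(2) by (auto simp: phom_def)
 have "h 0 \<oplus> h 0 = h 0" using a[of 0 0] by simp
 thus z: "h 0 = \<zero>\<^bsub>R\<^esub>" using c[of 0] by (metis add.l_cancel_one')
 have "h (- x) \<oplus> h x = \<zero>" for x using a[of "- x" x] z by simp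
 thus n: "h (- x) = \<ominus>\<^bsub>R\<^esub> h x" for x using c by (metis minus_equality)
 show d: "h (x - y) = h x \<ominus>\<^bsub>R\<^esub> h y" using a[of x "- y"] n[of y] by (simp add: a_minus_def)
 show "h (x ^ n) = h x [^]\<^bsub>R\<^esub> n" by (induction n) (use c in "auto simp: 1 m m_comm")
 show "a \<in> carrier R \<Longrightarrow> \<exists>z. h z = a" using assms(2) by (metis imageE phom_def)
 show "h (x - y) = \<zero>\<^bsub>R\<^esub> \<longleftrightarrow> h x = h y" unfolding d using c by simp
 show "h (of_nat n) = [n] \<cdot>\<^bsub>R\<^esub> \<one>\<^bsub>R\<^esub>" by (induction n) (auto simp: z 1 a a_comm)
qed

text \<open>A field is handled through a surjection from a typed commutative ring; \<open>acl N\<close> says that the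
 residue ring modulo \<open>N\<close> is algebraically closed.\<close>

definition pideal :: "'c::comm_ring_1 set \<Rightarrow> bool" where
 "pideal N \<equiv> 0 \<in> N \<and> 1 \<notin> N \<and> (\<forall>x\<in>N. \<forall>y\<in>N. x + y \<in> N) \<and> (\<forall>x y. y \<in> N \<longrightarrow> x * y \<in> N) \<and>
   (\<forall>x y. x * y \<in> N \<longrightarrow> x \<in> N \<or> y \<in> N)"

definition acl :: "'c::comm_ring_1 set \<Rightarrow> bool" where
 "acl N \<equiv> (\<forall>f. (\<exists>i>0. pcoeff f i \<notin> N) \<longrightarrow> (\<exists>x. poly f x \<in> N))"

lemma pidealD:
 assumes "pideal N"
 shows "0 \<in> N" "1 \<notin> N" "x \<in> N \<Longrightarrow> y \<in> N \<Longrightarrow> x + y \<in> N" "y \<in> N \<Longrightarrow> x * y \<in> N" "y \<in> N \<Longrightarrow> y * x \<in> N"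
  "x * y \<in> N \<longleftrightarrow> x \<in> N \<or> y \<in> N" "- x \<in> N \<longleftrightarrow> x \<in> N" "x \<in> N \<Longrightarrow> y \<in> N \<Longrightarrow> x - y \<in> N"
  "(\<And>a. a \<in> A \<Longrightarrow> g a \<in> N) \<Longrightarrow> sum g A \<in> N" "x ^ n \<in> N \<Longrightarrow> x \<in> N"
  "y - z \<in> N \<Longrightarrow> y \<in> N \<longleftrightarrow> z \<in> N" "x - y \<in> N \<longleftrightarrow> y - x \<in> N"
  "finite A \<Longrightarrow> prod g A \<in> N \<longleftrightarrow> (\<exists>a\<in>A. g a \<in> N)"
proof -
 show z: "0 \<in> N" and o: "1 \<notin> N" and a: "x \<in> N \<Longrightarrow> y \<in> N \<Longrightarrow> x + y \<in> N" and m: "y \<in> N \<Longrightarrow> x * y \<in> N" for x y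
  using assms by (auto simp: pideal_def)
 show m': "y \<in> N \<Longrightarrow> y * x \<in> N" for x y using m[of y x] by (simp add: mult.commute)
 show p: "x * y \<in> N \<longleftrightarrow> x \<in> N \<or> y \<in> N" for x y using assms m m' by (auto simp: pideal_def)
 show n: "- x \<in> N \<longleftrightarrow> x \<in> N" for x using m[of x "-1"] m[of "-x" "-1"] by auto
 show d: "x \<in> N \<Longrightarrow> y \<in> N \<Longrightarrow> x - y \<in> N" for x y using a[of x "-y"] n by simp
 show "(\<And>a. a \<in> A \<Longrightarrow> g a \<in> N) \<Longrightarrow> sum g A \<in> N" by (induction A rule: infinite_finite_induct) (auto simp: z a)
 show "x ^ n \<in> N \<Longrightarrow> x \<in> N" by (induction n) (auto simp: o p)
 show "y - z \<in> N \<Longrightarrow> y \<in> N \<longleftrightarrow> z \<in> N" using a[of "y - z" z] d[of y "y - z"] by auto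
 show "x - y \<in> N \<longleftrightarrow> y - x \<in> N" using n[of "x - y"] by simp
 show "finite A \<Longrightarrow> prod g A \<in> N \<longleftrightarrow> (\<exists>a\<in>A. g a \<in> N)" by (induction A rule: finite_induct) (auto simp: o p)
qed

lemma pideal_phom:
 fixes R (structure)
 assumes "domain R" "phom R h"
 shows "pideal {x. h x = \<zero>\<^bsub>R\<^esub>}"
proof -
 interpret domain R by fact
 note [simp] = phomD[OF is_cring assms(2)]
 show ?thesis unfolding pideal_def by (auto dest: integral)
qed

section \<open>Well-ordered sets in ordered groups and the ring of Hahn series\<close>

definition wosupp :: "'g::linordered_ab_group_add set \<Rightarrow> bool" where
 "wosupp A \<equiv> \<not> (\<exists>s::nat \<Rightarrow> 'g. (\<forall>n. s n \<in> A) \<and> (\<forall>n. s (Suc n) < s n))"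

lemma wosupp_subset: "wosupp A \<Longrightarrow> B \<subseteq> A \<Longrightarrow> wosupp B" unfolding wosupp_def by blast

lemma wosupp_min:
 assumes "wosupp A" "D \<subseteq> A" "D \<noteq> {}"
 shows "\<exists>m\<in>D. \<forall>x\<in>D. m \<le> x"
proof (rule ccontr)
 assume "\<not> ?thesis"
 hence *: "\<forall>m\<in>D. \<exists>x\<in>D. x < m" by (auto simp: not_le)
 obtain a where "a \<in> D" using assms(3) by auto
 obtain s where "\<forall>n. s n \<in> D \<and> s (Suc n) < s n"
  using dependent_nat_choice[of "\<lambda>_ x. x \<in> D" "\<lambda>_ x y. y < x"] \<open>a \<in> D\<close> * by blast
 thus False using assms(1,2) unfolding wosupp_def by blast
qed

lemma wosupp_I:
 assumes "\<And>D. D \<subseteq> A \<Longrightarrow> D \<noteq> {} \<Longrightarrow> \<exists>m\<in>D. \<forall>x\<in>D. m \<le> x"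
 shows "wosupp A" unfolding wosupp_def
proof
 assume "\<exists>s. (\<forall>n. s n \<in> A) \<and> (\<forall>n. s (Suc n) < s n)"
 then obtain s where s: "\<forall>n. s n \<in> A" "\<forall>n. s (Suc n) < s n" by blast
 then obtain m where "m \<in> range s" "\<forall>x\<in>range s. m \<le> x" using assms[of "range s"] by auto
 then obtain n where "m = s n" by auto
 thus False using s(2) \<open>\<forall>x\<in>range s. m \<le> x\<close> by (meson not_le rangeI)
qed

text \<open>Every sequence in a linear order has a monotone subsequence; if it decreases, it is
  eventually constant in a well-ordered set, and its tail is increasing after all.\<close>

lemma wosupp_seq:
 assumes "wosupp A" "\<And>n. s n \<in> A"
 shows "\<exists>r::nat \<Rightarrow> nat. strict_mono r \<and> incseq (\<lambda>n. s (r n))"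
proof -
 obtain r where r: "strict_mono r" "monoseq (\<lambda>n. s (r n))" using seq_monosub[of s] by (elim exE conjE)
 show ?thesis
 proof (cases "incseq (\<lambda>n. s (r n))")
  case False
  hence d: "decseq (\<lambda>n. s (r n))" using r(2) by (simp add: monoseq_iff)
  obtain k where k: "\<forall>n. s (r k) \<le> s (r n)" using wosupp_min[OF assms(1), of "range (\<lambda>n. s (r n))"] assms(2) by auto
  hence "s (r (n + k)) = s (r k)" for n using decseqD[OF d, of k "n + k"] by (intro antisym) auto
  hence "incseq (\<lambda>n. s (r (n + k)))" by (simp add: incseq_def)
  moreover have "strict_mono (\<lambda>n. r (n + k))" using r(1) by (simp add: strict_mono_def)
  ultimately show ?thesis by (intro exI[of _ "\<lambda>n. r (n + k)"]) simp
 next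
  case True
  thus ?thesis using r by (intro exI[of _ r]) simp
 qed
qed

lemma wosupp_Un: "wosupp A \<Longrightarrow> wosupp B \<Longrightarrow> wosupp (A \<union> B)"
proof (rule wosupp_I)
 fix D assume AB: "wosupp A" "wosupp B" and D: "D \<subseteq> A \<union> B" "D \<noteq> {}"
 show "\<exists>m\<in>D. \<forall>x\<in>D. m \<le> x"
 proof (cases "D \<inter> A = {} \<or> D \<inter> B = {}")
  case True
  hence "D \<subseteq> A \<or> D \<subseteq> B" using D by blast
  thus ?thesis using wosupp_min AB D(2) by blast
 next
  case False
  then obtain a b where "a \<in> D \<inter> A" "\<forall>x\<in>D \<inter> A. a \<le> x" "b \<in> D \<inter> B" "\<forall>x\<in>D \<inter> B. b \<le> x"
   using wosupp_min[OF AB(1), of "D \<inter> A"] wosupp_min[OF AB(2), of "D \<inter> B"] by auto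
  note ab = this
  show ?thesis
  proof (intro bexI[of _ "min a b"] ballI)
   show "min a b \<in> D" using ab by (simp add: min_def)
   show "min a b \<le> x" if "x \<in> D" for x using that ab D(1) by (cases "x \<in> A") (auto simp: min_le_iff_disj)
  qed
 qed
qed

lemma wosupp_finite: "finite A \<Longrightarrow> wosupp A" by (rule wosupp_I) (metis Min_in Min_le finite_subset)

text \<open>A strictly descending sequence of sums would have a subsequence along which both
  summands increase weakly.\<close>

lemma wosupp_plus:
 assumes "wosupp A" "wosupp B"
 shows "wosupp {a + b | a b. a \<in> A \<and> b \<in> B}" unfolding wosupp_def
proof
 assume "\<exists>s. (\<forall>n. s n \<in> {a + b | a b. a \<in> A \<and> b \<in> B}) \<and> (\<forall>n. s (Suc n) < s n)"
 then obtain s where s: "\<forall>n. s n \<in> {a + b | a b. a \<in> A \<and> b \<in> B}" "\<forall>n. s (Suc n) < s n" by blast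
 hence "\<forall>n. \<exists>p. s n = fst p + snd p \<and> fst p \<in> A \<and> snd p \<in> B" by fastforce
 then obtain p where "\<forall>n. s n = fst (p n) + snd (p n) \<and> fst (p n) \<in> A \<and> snd (p n) \<in> B" by metis
 hence ab: "s n = fst (p n) + snd (p n)" "fst (p n) \<in> A" "snd (p n) \<in> B" for n by auto
 define a where "a = (\<lambda>n. fst (p n))"
 define b where "b = (\<lambda>n. snd (p n))"
 note ab = ab[folded a_def b_def, unfolded a_def[THEN fun_cong, symmetric] b_def[THEN fun_cong, symmetric]]
 obtain r where r: "strict_mono r" "incseq (\<lambda>n. a (r n))" using wosupp_seq[of A a, OF assms(1) ab(2)] by (elim exE conjE)
 obtain q where q: "strict_mono q" "incseq (\<lambda>n. b (r (q n)))"
  using wosupp_seq[of B "\<lambda>n. b (r n)", OF assms(2) ab(3)] by (elim exE conjE)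
 have "strict_mono (\<lambda>n. - s n)" using s(2) by (simp add: strict_mono_Suc_iff)
 moreover have "r (q 0) < r (q 1)" using r(1) q(1) by (simp add: strict_mono_def)
 ultimately have "s (r (q 1)) < s (r (q 0))" by (simp add: strict_mono_def)
 moreover have "a (r (q 0)) \<le> a (r (q 1))" using r(2) q(1) by (simp add: incseq_def strict_mono_less_eq)
 moreover have "b (r (q 0)) \<le> b (r (q 1))" using q(2) by (simp add: incseq_def)
 ultimately show False using ab(1) by (metis add_mono not_le)
qed

text \<open>Infinitely many such \<open>a\<close> contain a strictly increasing sequence, along
  which \<open>g - a\<close> descends strictly in \<open>B\<close>. This finiteness makes the
  product of Hahn series well defined.\<close>

lemma wosupp_fibre:
 assumes "wosupp A" "wosupp B"
 shows "finite {a \<in> A. g - a \<in> B}"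
proof (rule ccontr)
 assume "infinite {a \<in> A. g - a \<in> B}"
 then obtain s :: "nat \<Rightarrow> 'a" where s: "inj s" "range s \<subseteq> {a \<in> A. g - a \<in> B}" using infinite_countable_subset by blast
 obtain r where r: "strict_mono r" "incseq (\<lambda>n. s (r n))"
 proof -
  have "s n \<in> A" for n using s(2) by auto
  from wosupp_seq[of A s, OF assms(1) this] show ?thesis using that by (elim exE conjE)
 qed
 have "s (r n) < s (r (Suc n))" for n
 proof -
  have "s (r n) \<le> s (r (Suc n))" using r(2) by (simp add: incseq_def)
  moreover have "r n \<noteq> r (Suc n)" using r(1) by (metis n_not_Suc_n strict_mono_eq)
  ultimately show ?thesis using s(1) by (metis injD order_le_imp_less_or_eq)
 qed
 hence "\<forall>n. g - s (r (Suc n)) < g - s (r n)" by simp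
 moreover have "\<forall>n. g - s (r n) \<in> B" using s(2) by blast
 ultimately have "\<exists>s. (\<forall>n. s n \<in> B) \<and> (\<forall>n. s (Suc n) < s n)" by (intro exI[of _ "\<lambda>n. g - s (r n)"]) simp
 thus False using assms(2) unfolding wosupp_def by simp
qed

typedef (overloaded) ('g, 'c) hahn =
 "{f :: 'g::linordered_ab_group_add \<Rightarrow> 'c::comm_ring_1. wosupp {g. f g \<noteq> 0}}"
 morphisms hco Abs_hahn by (rule exI[of _ "\<lambda>_. 0"]) (simp add: wosupp_finite)

setup_lifting type_definition_hahn

lemma hahn_eqI: "(\<And>g. hco f g = hco h g) \<Longrightarrow> f = h" using hco_inject by blast

definition hsupp :: "('g::linordered_ab_group_add, 'c::comm_ring_1) hahn \<Rightarrow> 'g set" where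
 "hsupp f = {g. hco f g \<noteq> 0}"

lemma wosupp_hsupp: "wosupp (hsupp f)" using hco[of f] by (simp add: hsupp_def)

lemma hsupp_fibre: "finite {a. hco f a \<noteq> 0 \<and> hco h (g - a) \<noteq> 0}"
 using wosupp_fibre[OF wosupp_hsupp[of f] wosupp_hsupp[of h], of g] by (simp add: hsupp_def)

lemma hsupp_cases: "(\<And>g. f g \<noteq> 0 \<Longrightarrow> hco h g \<noteq> 0) \<Longrightarrow> wosupp {g. f g \<noteq> 0}"
 by (rule wosupp_subset[OF wosupp_hsupp[of h]]) (auto simp: hsupp_def)

instantiation hahn :: (linordered_ab_group_add, comm_ring_1) comm_ring_1
begin

lift_definition zero_hahn :: "('a, 'b) hahn" is "\<lambda>_. 0" by (simp add: wosupp_finite)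
lift_definition one_hahn :: "('a, 'b) hahn" is "\<lambda>g. if g = 0 then 1 else 0"
 by (rule wosupp_subset[of "{0}"]) (auto simp: wosupp_finite)
lift_definition plus_hahn :: "('a, 'b) hahn \<Rightarrow> ('a, 'b) hahn \<Rightarrow> ('a, 'b) hahn"
 is "\<lambda>f h g. f g + h g" by (rule wosupp_subset[OF wosupp_Un]) (assumption | force)+
lift_definition uminus_hahn :: "('a, 'b) hahn \<Rightarrow> ('a, 'b) hahn" is "\<lambda>f g. - f g" by simp
lift_definition minus_hahn :: "('a, 'b) hahn \<Rightarrow> ('a, 'b) hahn \<Rightarrow> ('a, 'b) hahn"
 is "\<lambda>f h g. f g - h g" by (rule wosupp_subset[OF wosupp_Un]) (assumption | force)+

lemma wosupp_times:
 fixes f h :: "('a, 'b) hahn"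
 shows "wosupp {g. (\<Sum>a | hco f a \<noteq> 0 \<and> hco h (g - a) \<noteq> 0. hco f a * hco h (g - a)) \<noteq> 0}"
proof (rule wosupp_subset[OF wosupp_plus[OF wosupp_hsupp[of f] wosupp_hsupp[of h]]], rule subsetI, clarify)
 fix g assume "(\<Sum>a | hco f a \<noteq> 0 \<and> hco h (g - a) \<noteq> 0. hco f a * hco h (g - a)) \<noteq> 0"
 then obtain a where "hco f a \<noteq> 0" "hco h (g - a) \<noteq> 0"
  by (metis (mono_tags, lifting) mem_Collect_eq sum.not_neutral_contains_not_neutral)
 thus "\<exists>a b. g = a + b \<and> a \<in> hsupp f \<and> b \<in> hsupp h" by (intro exI[of _ a] exI[of _ "g - a"]) (simp add: hsupp_def)
qed

definition times_hahn :: "('a, 'b) hahn \<Rightarrow> ('a, 'b) hahn \<Rightarrow> ('a, 'b) hahn" where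
 "times_hahn f h = Abs_hahn (\<lambda>g. \<Sum>a | hco f a \<noteq> 0 \<and> hco h (g - a) \<noteq> 0. hco f a * hco h (g - a))"

lemma hco_times:
 fixes f h :: "('a, 'b) hahn"
 assumes "finite A" "{a. hco f a \<noteq> 0 \<and> hco h (g - a) \<noteq> 0} \<subseteq> A"
 shows "hco (f * h) g = (\<Sum>a\<in>A. hco f a * hco h (g - a))"
proof -
 have "hco (f * h) g = (\<Sum>a | hco f a \<noteq> 0 \<and> hco h (g - a) \<noteq> 0. hco f a * hco h (g - a))"
  unfolding times_hahn_def using wosupp_times[of f h] by (simp add: Abs_hahn_inverse)
 also have "\<dots> = (\<Sum>a\<in>A. hco f a * hco h (g - a))" by (rule sum.mono_neutral_left) (use assms in auto)
 finally show ?thesis .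
qed

lemma hco_times': "hco (f * h :: ('a, 'b) hahn) g = (\<Sum>a | hco f a \<noteq> 0 \<and> hco h (g - a) \<noteq> 0. hco f a * hco h (g - a))"
 by (rule hco_times) (auto simp: hsupp_fibre)

lemma hco_times_nonzero:
 fixes f h :: "('a, 'b) hahn"
 assumes "hco (f * h) g \<noteq> 0"
 shows "\<exists>a. hco f a \<noteq> 0 \<and> hco h (g - a) \<noteq> 0"
 using assms unfolding hco_times' by (metis (mono_tags, lifting) mem_Collect_eq sum.not_neutral_contains_not_neutral)

lemma times_hahn_comm: "f * h = h * (f :: ('a, 'b) hahn)"
proof (rule hahn_eqI)
 fix g
 show "hco (f * h) g = hco (h * f) g" unfolding hco_times'
  by (rule sum.reindex_bij_witness[of _ "\<lambda>a. g - a" "\<lambda>a. g - a"]) (auto simp: mult.commute)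
qed

text \<open>A form of the triple product in which the three exponents enter alike, so that
  associativity becomes a change of the summation variables combined with commutativity.\<close>

lemma times_hahn_triple:
 fixes f h k :: "('a, 'b) hahn"
 shows "hco ((f * h) * k) g = (\<Sum>(x, y) | hco f x \<noteq> 0 \<and> hco h y \<noteq> 0 \<and> hco k (g - x - y) \<noteq> 0.
      hco f x * hco h y * hco k (g - x - y))"
proof -
 let ?B = "{a. a \<in> {x + y | x y. x \<in> hsupp f \<and> y \<in> hsupp h} \<and> g - a \<in> hsupp k}"
 let ?X = "\<lambda>a. {x. hco f x \<noteq> 0 \<and> hco h (a - x) \<noteq> 0}"
 let ?T = "{(x, y). hco f x \<noteq> 0 \<and> hco h y \<noteq> 0 \<and> hco k (g - x - y) \<noteq> 0}"
 have finB: "finite ?B"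
  using wosupp_fibre[OF wosupp_plus[OF wosupp_hsupp[of f] wosupp_hsupp[of h]] wosupp_hsupp[of k]] by simp
 have sub: "{a. hco (f * h) a \<noteq> 0 \<and> hco k (g - a) \<noteq> 0} \<subseteq> ?B"
 proof (rule subsetI)
  fix a assume "a \<in> {a. hco (f * h) a \<noteq> 0 \<and> hco k (g - a) \<noteq> 0}"
  hence a: "hco (f * h) a \<noteq> 0" "hco k (g - a) \<noteq> 0" by auto
  then obtain x where "hco f x \<noteq> 0" "hco h (a - x) \<noteq> 0" using hco_times_nonzero by blast
  hence "\<exists>x y. a = x + y \<and> x \<in> hsupp f \<and> y \<in> hsupp h" by (intro exI[of _ x] exI[of _ "a - x"]) (simp add: hsupp_def)
  thus "a \<in> ?B" using a by (simp add: hsupp_def)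
 qed
 have "hco ((f * h) * k) g = (\<Sum>a\<in>?B. \<Sum>x\<in>?X a. hco f x * hco h (a - x) * hco k (g - a))"
  unfolding hco_times[OF finB sub] by (simp add: hco_times' sum_distrib_right)
 also have "\<dots> = (\<Sum>(a, x)\<in>Sigma ?B ?X. hco f x * hco h (a - x) * hco k (g - a))"
  by (rule sum.Sigma[OF finB]) (simp add: hsupp_fibre)
 also have "\<dots> = (\<Sum>(x, y)\<in>?T. hco f x * hco h y * hco k (g - x - y))"
  by (rule sum.reindex_bij_witness[of _ "\<lambda>(x, y). (x + y, x)" "\<lambda>(a, x). (x, a - x)"]) (auto simp: hsupp_def algebra_simps)
 finally show ?thesis .
qed

instance
proof
 fix f h k :: "('a, 'b) hahn"
 show "f + h + k = f + (h + k)" "f + h = h + f" "0 + f = f" "- f + f = 0" "f - h = f + - h" by (transfer; simp add: add_ac)+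
 show "f * h = h * f" by (rule times_hahn_comm)
 show "f * h * k = f * (h * k)"
 proof (rule hahn_eqI)
  fix g
  have "hco (f * (h * k)) g = hco ((k * h) * f) g" by (simp add: times_hahn_comm)
  also have "\<dots> = hco ((f * h) * k) g" unfolding times_hahn_triple
   by (rule sum.reindex_bij_witness[of _ "\<lambda>(x, y). (g - x - y, y)" "\<lambda>(x, y). (g - x - y, y)"]) (auto simp: algebra_simps)
  finally show "hco (f * h * k) g = hco (f * (h * k)) g" by simp
 qed
 show "1 * f = f"
 proof (rule hahn_eqI)
  fix g show "hco (1 * f) g = hco f g" by (subst hco_times[of "{0}"]) (auto simp: one_hahn.rep_eq split: if_splits)
 qed
 show "(f + h) * k = f * k + h * k"
 proof (rule hahn_eqI)
  fix g
  let ?A = "{a. hco f a \<noteq> 0 \<and> hco k (g - a) \<noteq> 0} \<union> {a. hco h a \<noteq> 0 \<and> hco k (g - a) \<noteq> 0}"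
  have fin: "finite ?A" by (simp add: hsupp_fibre)
  have "hco ((f + h) * k) g = (\<Sum>a\<in>?A. hco (f + h) a * hco k (g - a))"
   by (rule hco_times[OF fin]) (auto simp: plus_hahn.rep_eq)
  moreover have "hco (f * k) g = (\<Sum>a\<in>?A. hco f a * hco k (g - a))" by (rule hco_times[OF fin]) auto
  moreover have "hco (h * k) g = (\<Sum>a\<in>?A. hco h a * hco k (g - a))" by (rule hco_times[OF fin]) auto
  ultimately show "hco ((f + h) * k) g = hco (f * k + h * k) g" by (simp add: plus_hahn.rep_eq ring_distribs sum.distrib)
 qed
 show "(0 :: ('a, 'b) hahn) \<noteq> 1" by transfer (metis one_neq_zero)
qed

end

lemmas hco_simps [simp] = plus_hahn.rep_eq minus_hahn.rep_eq uminus_hahn.rep_eq zero_hahn.rep_eq one_hahn.rep_eq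

lift_definition hmon :: "'g::linordered_ab_group_add \<Rightarrow> 'c::comm_ring_1 \<Rightarrow> ('g, 'c) hahn"
 is "\<lambda>g c x. if x = g then c else 0" by (rule wosupp_finite, rule finite_subset[of _ "{g}" for g]) auto

lemma hco_hmon [simp]: "hco (hmon g c) x = (if x = g then c else 0)" by (simp add: hmon.rep_eq)

lemma hco_hmon_times: "hco (hmon g c * f) x = c * hco f (x - g)" by (subst hco_times[of "{g}"]) auto

lemma hmon_mult: "hmon a c * hmon b d = hmon (a + b) (c * d)" by (rule hahn_eqI) (auto simp: hco_hmon_times algebra_simps)

lemma hmon_add: "hmon a (c + d) = hmon a c + hmon a d" by (rule hahn_eqI) auto

lemma hmon_zero [simp]: "hmon a 0 = 0" by (rule hahn_eqI) auto

lemma hmon_one: "hmon 0 1 = 1" by (rule hahn_eqI) auto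

lemma rhom_hmon: "rhom (hmon 0 :: 'c \<Rightarrow> ('g::linordered_ab_group_add, 'c::comm_ring_1) hahn)"
 by (simp add: rhom_def hmon_mult hmon_add hmon_one)

lemma hmon_inverse: "hmon a 1 * hmon (- a) 1 = 1" by (simp add: hmon_mult hmon_one)

lemma hco_sum: "hco (sum f A) g = (\<Sum>a\<in>A. hco (f a) g)" by (induction A rule: infinite_finite_induct) auto

text \<open>A total constructor: functions without well-ordered support give 0, which keeps
  \<open>hmap\<close>, \<open>hrestr\<close> and the normal forms free of side conditions.\<close>

lift_definition hfun :: "('g::linordered_ab_group_add \<Rightarrow> 'c::comm_ring_1) \<Rightarrow> ('g, 'c) hahn" is
 "\<lambda>f. if wosupp {g. f g \<noteq> 0} then f else (\<lambda>_. 0)" by (auto simp: wosupp_finite)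

lemma hco_hfun: "wosupp {g. f g \<noteq> 0} \<Longrightarrow> hco (hfun f) = f" by transfer simp

definition hmap :: "('c::comm_ring_1 \<Rightarrow> 'd::comm_ring_1) \<Rightarrow> ('g::linordered_ab_group_add, 'c) hahn \<Rightarrow> ('g, 'd) hahn" where
 "hmap \<phi> f = hfun (\<lambda>g. \<phi> (hco f g))"

lemma hco_hmap:
 assumes "\<phi> 0 = 0"
 shows "hco (hmap \<phi> f) g = \<phi> (hco f g)" unfolding hmap_def by (subst hco_hfun) (auto intro: hsupp_cases[of _ f] simp: assms)

lemma rhom_hmap:
 assumes "rhom \<phi>"
 shows "rhom (hmap \<phi> :: ('g::linordered_ab_group_add, 'c::comm_ring_1) hahn \<Rightarrow> ('g, 'd::comm_ring_1) hahn)" unfolding rhom_def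
proof (intro conjI allI)
 note c = hco_hmap[of \<phi>, OF rhomD(4)[OF assms]]
 show "hmap \<phi> (1 :: ('g, 'c) hahn) = 1" by (rule hahn_eqI) (auto simp: c rhomD[OF assms])
 fix x y :: "('g, 'c) hahn"
 show "hmap \<phi> (x + y) = hmap \<phi> x + hmap \<phi> y" by (rule hahn_eqI) (auto simp: c rhomD[OF assms])
 show "hmap \<phi> (x * y) = hmap \<phi> x * hmap \<phi> y"
 proof (rule hahn_eqI)
  fix g
  have "hco (hmap \<phi> x * hmap \<phi> y) g =
    (\<Sum>a | hco x a \<noteq> 0 \<and> hco y (g - a) \<noteq> 0. hco (hmap \<phi> x) a * hco (hmap \<phi> y) (g - a))"
   by (rule hco_times[OF hsupp_fibre]) (auto simp: c rhomD[OF assms])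
  thus "hco (hmap \<phi> (x * y)) g = hco (hmap \<phi> x * hmap \<phi> y) g" by (simp add: c hco_times' rhomD[OF assms])
 qed
qed

lemma hmap_hmon: "\<phi> 0 = 0 \<Longrightarrow> hmap \<phi> (hmon g c) = hmon g (\<phi> c)" by (rule hahn_eqI) (auto simp: hco_hmap)

section \<open>Witt vector congruences derived from a lift of Frobenius\<close>

definition fresh :: "nat \<Rightarrow> 's::comm_ring_1 \<Rightarrow> 's \<Rightarrow> 's" where
 "fresh p x y = (\<Sum>i\<in>{0<..<p}. of_nat ((p choose i) div p) * x ^ i * y ^ (p - i))"

text \<open>\<open>fresh p x y\<close> is the integral form of ((x + y)^p - x^p - y^p) / p: the
  inner binomial coefficients are divisible by the prime \<open>p\<close>.\<close>

lemma freshman_prime: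
 fixes x y :: "'s::comm_ring_1"
 assumes p: "Factorial_Ring.prime p"
 shows "(x + y) ^ p = x ^ p + y ^ p + of_nat p * fresh p x y"
proof -
 have p2: "p \<ge> 2" using p by (simp add: prime_ge_2_nat)
 have d: "of_nat (p choose i) * z = of_nat p * (of_nat ((p choose i) div p) * z)" if "i \<in> {0<..<p}" for i and z :: 's
 proof -
  have "p dvd p choose i" using that p by (intro dvd_choose_prime) auto
  hence "(p choose i) = p * ((p choose i) div p)" by simp
  hence "(of_nat (p choose i) :: 's) = of_nat p * of_nat ((p choose i) div p)" by (metis of_nat_mult)
  thus ?thesis by (simp add: mult.assoc)
 qed
 have "{..p} = insert 0 (insert p {0<..<p})" using p2 by auto
 hence "(x + y) ^ p = y ^ p + (x ^ p + (\<Sum>i\<in>{0<..<p}. of_nat (p choose i) * (x ^ i * y ^ (p - i))))"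
  using p2 by (simp add: binomial_ring mult.assoc)
 also have "(\<Sum>i\<in>{0<..<p}. of_nat (p choose i) * (x ^ i * y ^ (p - i))) = of_nat p * fresh p x y"
  unfolding fresh_def sum_distrib_left by (rule sum.cong) (auto simp: d mult.assoc)
 finally show ?thesis by (simp add: add_ac)
qed

text \<open>\<open>J n\<close> is the kernel of the map to the Witt vectors of length \<open>n\<close> of the perfect field with
 elements \<open>K\<close>; it is described without Witt vectors, by iterating
 \<open>\<delta> z = (\<phi> z - z ^ p) / p\<close>.\<close>

locale frobenius_lift =
 fixes p :: nat and \<phi> :: "'s::comm_ring_1 \<Rightarrow> 's" and \<pi> :: "'s \<Rightarrow> 'k" and I :: "'s set" and K :: "'k set" and T :: "'k \<Rightarrow> 's"
 assumes p: "Factorial_Ring.prime p" and phi: "rhom \<phi>" and torsion_free: "of_nat p * z = 0 \<Longrightarrow> z = 0"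
  and frob: "\<exists>w. \<phi> z = z ^ p + of_nat p * w" and I: "pideal I" and p_I: "of_nat p \<in> I" and pi_I: "x - y \<in> I \<longleftrightarrow> \<pi> x = \<pi> y"
  and pi_K: "\<pi> z \<in> K" and pi_T: "a \<in> K \<Longrightarrow> \<pi> (T a) = a" and phi_T: "\<phi> (T a) = T a ^ p"
  and T_root: "a \<in> K \<Longrightarrow> \<exists>b\<in>K. T a - T b ^ p \<in> I" and T_gen: "Q 1 \<Longrightarrow> (\<And>t. \<phi> t = t ^ p \<Longrightarrow> Q t) \<Longrightarrow> (\<And>x y. Q x \<Longrightarrow> Q y \<Longrightarrow> Q (x - y)) \<Longrightarrow>
    (\<And>x y. Q x \<Longrightarrow> Q y \<Longrightarrow> Q (x * y)) \<Longrightarrow> Q z"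
begin

lemma p2: "p \<ge> 2" using p by (simp add: prime_ge_2_nat)

definition \<delta> :: "'s \<Rightarrow> 's" where "\<delta> z = (THE w. \<phi> z = z ^ p + of_nat p * w)"

lemma tf_eq: "of_nat p * x = of_nat p * y \<longleftrightarrow> x = y"
 for x y :: 's using torsion_free[of "x - y"] by (auto simp: right_diff_distrib)

lemma phi_delta: "\<phi> z = z ^ p + of_nat p * \<delta> z"
proof -
 have "\<exists>!w. \<phi> z = z ^ p + of_nat p * w" using frob[of z] by (auto simp: tf_eq)
 thus ?thesis unfolding \<delta>_def by (rule theI')
qed

lemma delta_eqI: "\<phi> z = z ^ p + of_nat p * w \<Longrightarrow> \<delta> z = w" using phi_delta[of z] by (simp add: tf_eq)

abbreviation B :: "'s \<Rightarrow> 's \<Rightarrow> 's" where "B \<equiv> fresh p"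

lemma freshman: "(x + y) ^ p = x ^ p + y ^ p + of_nat p * B x y" by (rule freshman_prime[OF p])

text \<open>Together with \<open>delta_mult\<close> and \<open>delta_p\<close> these are the laws of
  a p-derivation. Each is a law of the homomorphism \<phi> divided by \<open>p\<close>, which is
  legitimate in the absence of p-torsion.\<close>

lemma delta_add: "\<delta> (x + y) = \<delta> x + \<delta> y - B x y"
 by (rule delta_eqI) (simp add: rhomD[OF phi] phi_delta[of x] phi_delta[of y] freshman algebra_simps)

lemma delta_mult: "\<delta> (x * y) = x ^ p * \<delta> y + \<phi> y * \<delta> x" by (rule delta_eqI)
   (simp add: rhomD[OF phi] phi_delta[of x] phi_delta[of y] power_mult_distrib algebra_simps)

lemma delta_p: "\<delta> (of_nat p * x) = \<phi> x - of_nat p ^ (p - 1) * x ^ p"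
proof (rule delta_eqI)
 have "(of_nat p :: 's) ^ p = of_nat p * of_nat p ^ (p - 1)"
  using p2 by (metis One_nat_def Suc_pred power_Suc less_le_trans pos2)
 thus "\<phi> (of_nat p * x) = (of_nat p * x) ^ p + of_nat p * (\<phi> x - of_nat p ^ (p - 1) * x ^ p)"
  by (simp add: rhomD[OF phi] power_mult_distrib algebra_simps)
qed

lemma delta_phi: "\<delta> (\<phi> z) = \<phi> (\<delta> z)" by (rule delta_eqI) (subst (2) phi_delta, simp add: rhomD[OF phi])

primrec J :: "nat \<Rightarrow> 's set" where
 "J 0 = UNIV"
| "J (Suc n) = {z \<in> I. \<delta> z \<in> J n}"

text \<open>Each term of \<open>fresh p x y\<close> contains a positive power of \<open>y\<close>,
  because \<open>i < p\<close>.\<close>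

lemma B_ideal:
 assumes "\<And>x y. x \<in> N \<Longrightarrow> y \<in> N \<Longrightarrow> x + y \<in> N" "\<And>s x. x \<in> N \<Longrightarrow> s * x \<in> N" "y \<in> N"
 shows "B x y \<in> N"
proof -
 have "(\<Sum>i\<in>A. of_nat ((p choose i) div p) * x ^ i * y ^ (p - i)) \<in> N" if "A \<subseteq> {0<..<p}" for A using that
 proof (induction A rule: infinite_finite_induct)
  case empty
  thus ?case using assms(2)[OF assms(3), of 0] by simp
 next
  case (insert i A)
  hence "y ^ (p - i) = y ^ (p - i - 1) * y"
   by (metis Suc_diff_1 atLeastSucLessThan_greaterThanLessThan greaterThanLessThan_iff insert_subset
     power_Suc2 zero_less_diff)
  thus ?case using insert assms by (simp add: mult.assoc)
 next
  case (infinite A)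
  thus ?case using finite_subset by blast
 qed
 thus ?thesis unfolding fresh_def by blast
qed

text \<open>The three claims need a joint induction: closure of \<open>J (Suc n)\<close> under
  addition and multiplication involves \<open>fresh p x y\<close> and \<open>x ^ p\<close>, which
  are controlled only if elements of \<open>J (Suc n)\<close> lie in \<open>J n\<close> too.\<close>

lemma J_props: "(\<forall>x\<in>J n. \<forall>y\<in>J n. x + y \<in> J n) \<and> (\<forall>x\<in>J n. \<forall>s. s * x \<in> J n) \<and> J (Suc n) \<subseteq> J n"
proof (induction n)
 case (Suc n)
 hence a: "\<And>x y. x \<in> J n \<Longrightarrow> y \<in> J n \<Longrightarrow> x + y \<in> J n" and m: "\<And>s x. x \<in> J n \<Longrightarrow> s * x \<in> J n"
  and d: "\<And>x. x \<in> I \<Longrightarrow> \<delta> x \<in> J n \<Longrightarrow> x \<in> J n" by auto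
 note Ia = pidealD(3)[OF I] and Im = pidealD(4)[OF I]
 have mi: "- x \<in> J n" if "x \<in> J n" for x using m[OF that, of "-1"] by simp
 have "\<delta> (x + y) \<in> J n" if "x \<in> J (Suc n)" "y \<in> J (Suc n)" for x y
 proof -
  have "B x y \<in> J n" by (rule B_ideal[OF a m]) (use that d in auto)
  hence "\<delta> x + \<delta> y + - B x y \<in> J n" using that by (intro a mi) auto
  thus ?thesis by (simp add: delta_add)
 qed
 moreover have "\<delta> (s * x) \<in> J n" if "x \<in> J (Suc n)" for s x
 proof -
  have "x \<in> J n" "\<delta> x \<in> J n" using that d by auto
  hence "x ^ p \<in> J n" "\<delta> x \<in> J n"
   using m[of x "x ^ (p - 1)"] p2 by (metis One_nat_def Suc_pred power_Suc2 less_le_trans pos2, simp)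
  hence "x ^ p * \<delta> s + \<phi> s * \<delta> x \<in> J n" using a m mult.commute by metis
  thus ?thesis by (simp add: delta_mult mult.commute[of s])
 qed
 ultimately show ?case using Ia Im d by auto
qed simp

lemma J_add: "x \<in> J n \<Longrightarrow> y \<in> J n \<Longrightarrow> x + y \<in> J n" and J_mult: "x \<in> J n \<Longrightarrow> s * x \<in> J n" and J_Suc: "x \<in> J (Suc n) \<Longrightarrow> x \<in> J n"
 using J_props[of n] by blast+

lemma J_zero: "0 \<in> J n"
proof (induction n)
 case (Suc n)
 have "\<delta> 0 = 0" by (rule delta_eqI) (use p2 in "simp add: rhomD[OF phi] zero_power")
 thus ?case using Suc pidealD(1)[OF I] by simp
qed simp

lemma J_mult': "x \<in> J n \<Longrightarrow> x * s \<in> J n" using J_mult[of x n s] by (simp add: mult.commute)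

lemma J_minus: "x \<in> J n \<Longrightarrow> - x \<in> J n" using J_mult[of x n "-1"] by simp

lemma J_diff: "x \<in> J n \<Longrightarrow> y \<in> J n \<Longrightarrow> x - y \<in> J n" using J_add[OF _ J_minus] by fastforce

lemma J_cong: "x - y \<in> J n \<Longrightarrow> x \<in> J n \<longleftrightarrow> y \<in> J n" using J_diff[of x n "x - y"] J_add[of "x - y" n y] by auto

lemma J_le: "x \<in> J n \<Longrightarrow> m \<le> n \<Longrightarrow> x \<in> J m" by (induction n) (use J_Suc le_Suc_eq in blast)+

lemma J_power: "x \<in> J n \<Longrightarrow> x ^ p \<in> J n"
 using J_mult[of x n "x ^ (p - 1)"] p2 by (metis One_nat_def Suc_pred power_Suc2 less_le_trans pos2)

lemma J_sum: "(\<And>a. a \<in> A \<Longrightarrow> f a \<in> J n) \<Longrightarrow> sum f A \<in> J n"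
 by (induction A rule: infinite_finite_induct) (auto simp: J_zero J_add)

lemma J_delta: "x \<in> J (Suc n) \<Longrightarrow> \<delta> x \<in> J n" by simp

lemma J_one: "J 1 = I" by simp

lemma phi_I: "\<phi> z \<in> I \<longleftrightarrow> z \<in> I"
proof -
 have "\<phi> z \<in> I \<longleftrightarrow> z ^ p \<in> I" by (rule pidealD(11)[OF I]) (simp add: phi_delta pidealD(5)[OF I p_I])
 also have "z ^ p \<in> I \<longleftrightarrow> z \<in> I" using pidealD(10)[OF I] J_power[of z 1] by auto
 finally show ?thesis .
qed

lemma phi_J: "\<phi> z \<in> J n \<longleftrightarrow> z \<in> J n" by (induction n arbitrary: z) (auto simp: phi_I delta_phi)

text \<open>Induction on \<open>a + b\<close>: in the product rule for \<delta> each of the two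
  summands is a product of total depth one less.\<close>

lemma J_prod: "x \<in> J a \<Longrightarrow> y \<in> J b \<Longrightarrow> x * y \<in> J (a + b)"
proof (induction "a + b" arbitrary: a b x y rule: less_induct)
 case less
 show ?case
 proof (cases "a = 0 \<or> b = 0")
  case False
  then obtain a' b' where ab: "a = Suc a'" "b = Suc b'" by (metis not0_implies_Suc)
  have "x ^ p * \<delta> y \<in> J (a + b')"
   using less(1)[of a b' "x ^ p" "\<delta> y"] less(2,3) J_power[of x a] ab by (auto simp del: J.simps(2) dest: J_delta)
  moreover have "\<phi> y * \<delta> x \<in> J (b + a')"
   using less(1)[of b a' "\<phi> y" "\<delta> x"] less(2,3) phi_J[of y b] ab by (auto simp del: J.simps(2) dest: J_delta)
  ultimately have "\<delta> (x * y) \<in> J (a + b')" using ab by (simp add: delta_mult J_add add.commute del: J.simps)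
  moreover have "x * y \<in> I" using less(2) ab pidealD(5)[OF I] by auto
  ultimately show ?thesis using ab by simp
 qed (use less J_mult J_mult' in auto)
qed

lemma p_J_forward: "z \<in> J n \<Longrightarrow> of_nat p * z \<in> J (Suc n)"
 using pidealD(5)[OF I p_I] by (simp add: delta_p J_diff phi_J J_mult J_power)

text \<open>Multiplication by \<open>p\<close> shifts the filtration by exactly one step, as in the
  Witt vectors of a perfect field. In \<delta> (p z) = \<phi> z - p^(p - 1) z^p the second term is
  deep enough by induction, and \<phi> preserves and reflects each \<open>J n\<close>.\<close>

lemma p_J: "of_nat p * z \<in> J (Suc n) \<longleftrightarrow> z \<in> J n"
proof
 show "of_nat p * z \<in> J (Suc n) \<Longrightarrow> z \<in> J n"
 proof (induction n arbitrary: z)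
  case (Suc m)
  have "z \<in> J m" using Suc.IH J_Suc[OF Suc.prems] by blast
  hence "of_nat p * (of_nat p ^ (p - 2) * z ^ p) \<in> J (Suc m)" by (intro p_J_forward J_mult J_power)
  moreover have "(of_nat p :: 's) ^ (p - 1) = of_nat p * of_nat p ^ (p - 2)"
   using p2 by (metis Suc_diff_Suc Suc_1 Suc_le_lessD power_Suc diff_Suc_1)
  ultimately have "of_nat p ^ (p - 1) * z ^ p \<in> J (Suc m)" by (simp add: mult.assoc)
  moreover have "\<phi> z - of_nat p ^ (p - 1) * z ^ p \<in> J (Suc m)" using Suc.prems by (simp add: delta_p)
  ultimately have "\<phi> z \<in> J (Suc m)" using J_add by fastforce
  thus ?case by (simp only: phi_J)
 qed simp
qed (rule p_J_forward)

lemma p_power_J: "of_nat p ^ k * z \<in> J (n + k) \<longleftrightarrow> z \<in> J n"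
 by (induction k) (simp_all only: power_0 mult_1 add_0_right power_Suc mult.assoc add_Suc_right p_J)

text \<open>Uniqueness of Teichmueller lifts. For elements on which \<phi> is the p-th power,
  \<delta> (t - u) is \<open>fresh p u (t - u)\<close>, a multiple of t - u, so the congruence
  climbs from each \<open>J n\<close> to the next.\<close>

lemma teichmueller:
 assumes "\<phi> t = t ^ p" "\<phi> u = u ^ p" "t - u \<in> I"
 shows "t - u \<in> J n"
proof (induction n)
 case (Suc n)
 have "\<delta> (t - u) = B u (t - u)"
 proof (rule delta_eqI)
  have "t ^ p = u ^ p + (t - u) ^ p + of_nat p * B u (t - u)" using freshman[of u "t - u"] by simp
  thus "\<phi> (t - u) = (t - u) ^ p + of_nat p * B u (t - u)" using assms by (simp add: rhomD[OF phi])
 qed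
 moreover have "B u (t - u) \<in> J n" by (rule B_ideal) (auto simp: J_add J_mult Suc)
 ultimately show ?case using assms by simp
qed simp

text \<open>Perfectness enters here. The ring is generated by elements on which \<phi> is the p-th
  power; modulo \<open>I\<close> each of them is the p-th power of some \<open>T b\<close>, and then
  also modulo \<open>J n\<close> by uniqueness of Teichmueller lifts.\<close>

lemma phi_surj: "\<exists>w. z - \<phi> w \<in> J n"
proof (induction z rule: T_gen)
 case 1
 show ?case by (rule exI[of _ 1]) (simp add: rhomD[OF phi] J_zero)
next
 case (2 t)
 obtain b where b: "T (\<pi> t) - T b ^ p \<in> I" using T_root[OF pi_K] by blast
 have "t - T (\<pi> t) \<in> I" using pi_I pi_T pi_K by simp
 hence tb: "t - T b ^ p \<in> I" using pidealD(3)[OF I _ b, of "t - T (\<pi> t)"] by simp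
 have "t - T b ^ p \<in> J n" by (rule teichmueller[OF 2 _ tb]) (simp add: phi_T rhomD[OF phi])
 thus ?case using phi_T by metis
next
 case (3 x y)
 then obtain v w where "x - \<phi> v \<in> J n" "y - \<phi> w \<in> J n" by blast
 hence "(x - \<phi> v) - (y - \<phi> w) \<in> J n" by (rule J_diff)
 thus ?case by (intro exI[of _ "v - w"]) (simp add: rhomD[OF phi] algebra_simps)
next
 case (4 x y)
 then obtain v w where vw: "x - \<phi> v \<in> J n" "y - \<phi> w \<in> J n" by blast
 have "x * (y - \<phi> w) + (x - \<phi> v) * \<phi> w \<in> J n" by (intro J_add J_mult J_mult' vw)
 thus ?case by (intro exI[of _ "v * w"]) (simp add: rhomD[OF phi] algebra_simps)
qed

text \<open>Up to deeper terms \<open>z\<close> is \<phi> w = w^p + p \<delta> w with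
  \<open>w\<close> in the same step of the filtration, and w^p is negligible since it is a multiple
  of w w, of twice the depth.\<close>

lemma J_step:
 assumes "z \<in> J (Suc n)"
 shows "\<exists>y. z - of_nat p * y \<in> J (Suc (Suc n))"
proof -
 obtain w where w: "z - \<phi> w \<in> J (Suc (Suc n))" using phi_surj by blast
 hence wJ: "w \<in> J (Suc n)" using J_cong[OF J_Suc[OF w]] assms phi_J by blast
 have "w ^ p = w ^ (p - 2) * (w * w)" using p2 by (metis le_add_diff_inverse2 power2_eq_square power_add)
 moreover have "w * w \<in> J (Suc (Suc n))" by (rule J_le[OF J_prod[OF wJ wJ]]) simp
 ultimately have "w ^ p \<in> J (Suc (Suc n))" using J_mult by metis
 hence "(z - \<phi> w) + w ^ p \<in> J (Suc (Suc n))" using w by (rule J_add[rotated])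
 thus ?thesis by (intro exI[of _ "\<delta> w"]) (simp add: phi_delta)
qed

lemma J_digit_aux: "z \<in> J n \<Longrightarrow> \<exists>w. z - of_nat p ^ n * w \<in> J (Suc n)"
proof (induction n arbitrary: z)
 case 0
 show ?case by (rule exI[of _ z]) (simp add: J_zero del: J.simps)
next
 case (Suc n)
 obtain y where y: "z - of_nat p * y \<in> J (Suc (Suc n))" using J_step Suc.prems by blast
 hence "of_nat p * y \<in> J (Suc n)" using J_cong[OF J_Suc[OF y]] Suc.prems by blast
 then obtain w where w: "y - of_nat p ^ n * w \<in> J (Suc n)" using Suc.IH p_J by blast
 have "(z - of_nat p * y) + of_nat p * (y - of_nat p ^ n * w) \<in> J (Suc (Suc n))"
  using y w by (intro J_add) (simp_all only: p_J)
 thus ?case by (intro exI[of _ w]) (simp add: algebra_simps)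
qed

lemma T_I: "s - T (\<pi> s) \<in> I" using pi_I pi_T pi_K by auto

lemma J_digit:
 assumes "z \<in> J n"
 shows "\<exists>a\<in>K. z - of_nat p ^ n * T a \<in> J (Suc n)"
proof -
 obtain w where w: "z - of_nat p ^ n * w \<in> J (Suc n)" using J_digit_aux[OF assms] by blast
 have "of_nat p ^ n * (w - T (\<pi> w)) \<in> J (1 + n)" using T_I p_power_J[of n _ 1] J_one by metis
 hence "(z - of_nat p ^ n * w) + of_nat p ^ n * (w - T (\<pi> w)) \<in> J (Suc n)" using w J_add[of _ "Suc n"] by (simp del: J.simps)
 thus ?thesis by (intro bexI[of _ "\<pi> w"]) (simp_all add: algebra_simps pi_K)
qed

lemma J_digit_unique:
 assumes "a \<in> K" "b \<in> K" "of_nat p ^ n * T a - of_nat p ^ n * T b \<in> J (Suc n)"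
 shows "a = b"
proof -
 have "of_nat p ^ n * (T a - T b) \<in> J (1 + n)" using assms(3) by (simp add: algebra_simps)
 hence "T a - T b \<in> I" using p_power_J[of n _ 1] J_one by metis
 thus ?thesis using pi_I pi_T assms by metis
qed

text \<open>The Teichmueller expansion \<Sum> p^i T (d i) of the image of \<open>z\<close> in the
  Witt vectors, stated modulo each \<open>J n\<close>.\<close>

definition digits :: "'s \<Rightarrow> (nat \<Rightarrow> 'k) \<Rightarrow> bool" where
 "digits z d \<equiv> (\<forall>n. d n \<in> K) \<and> (\<forall>n. z - (\<Sum>i<n. of_nat p ^ i * T (d i)) \<in> J n)"

lemma digits_exist: "\<exists>d. digits z d"
proof -
 \<comment> \<open>The first component is the remainder after \<open>n\<close> digits, the second
   the next digit.\<close>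
 have "\<exists>g. \<forall>n. (snd (g n) \<in> K \<and> fst (g n) - of_nat p ^ n * T (snd (g n)) \<in> J (Suc n) \<and> (n = 0 \<longrightarrow> fst (g n) = z)) \<and>
   fst (g (Suc n)) = fst (g n) - of_nat p ^ n * T (snd (g n))"
 proof (rule dependent_nat_choice)
  obtain a where "a \<in> K" "z - of_nat p ^ 0 * T a \<in> J (Suc 0)" using J_digit[of z 0] by auto
  thus "\<exists>x. snd x \<in> K \<and> fst x - of_nat p ^ 0 * T (snd x) \<in> J (Suc 0) \<and> ((0::nat) = 0 \<longrightarrow> fst x = z)"
   by (intro exI[of _ "(z, a)"]) simp
 next
  fix x n
  assume "snd x \<in> K \<and> fst x - of_nat p ^ n * T (snd x) \<in> J (Suc n) \<and> (n = 0 \<longrightarrow> fst x = z)"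
  then obtain a where "a \<in> K" "(fst x - of_nat p ^ n * T (snd x)) - of_nat p ^ Suc n * T a \<in> J (Suc (Suc n))"
   using J_digit by blast
  thus "\<exists>y. (snd y \<in> K \<and> fst y - of_nat p ^ Suc n * T (snd y) \<in> J (Suc (Suc n)) \<and> (Suc n = 0 \<longrightarrow> fst y = z)) \<and>
    fst y = fst x - of_nat p ^ n * T (snd x)" by (intro exI[of _ "(fst x - of_nat p ^ n * T (snd x), a)"]) simp
 qed
 then obtain g where g: "\<And>n. snd (g n) \<in> K" "\<And>n. fst (g n) - of_nat p ^ n * T (snd (g n)) \<in> J (Suc n)"
  "fst (g 0) = z" "\<And>n. fst (g (Suc n)) = fst (g n) - of_nat p ^ n * T (snd (g n))" by metis
 have eq: "fst (g n) = z - (\<Sum>i<n. of_nat p ^ i * T (snd (g i)))" for n by (induction n) (auto simp: g(3,4))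
 have "fst (g n) \<in> J n" for n using g(2,4) by (cases n) (auto simp del: J.simps(2))
 thus ?thesis unfolding digits_def using g(1) eq by (intro exI[of _ "\<lambda>n. snd (g n)"]) auto
qed

lemma digits_unique:
 assumes "\<And>i. i < n \<Longrightarrow> a i \<in> K" "\<And>i. i < n \<Longrightarrow> b i \<in> K"
  "(\<Sum>i<n. of_nat p ^ i * T (a i)) - (\<Sum>i<n. of_nat p ^ i * T (b i)) \<in> J n" "i < n"
 shows "a i = b i" using assms
proof (induction n arbitrary: i)
 case (Suc n)
 have pn: "of_nat p ^ n * s \<in> J n" for s using p_power_J[of n s 0] by simp
 let ?A = "(\<Sum>i<n. of_nat p ^ i * T (a i))" and ?B = "(\<Sum>i<n. of_nat p ^ i * T (b i))"
 have "(?A - ?B) - (of_nat p ^ n * T (b n) - of_nat p ^ n * T (a n)) \<in> J (Suc n)"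
  using Suc.prems(3) by (simp add: algebra_simps)
 hence "(?A - ?B) - (of_nat p ^ n * T (b n) - of_nat p ^ n * T (a n)) \<in> J n" by (rule J_Suc)
 hence "?A - ?B \<in> J n" using J_cong J_diff[OF pn pn] by blast
 hence eq: "a i = b i" if "i < n" for i using Suc.IH[of i] Suc.prems(1,2) that by simp
 hence "?A = ?B" by (intro sum.cong) auto
 hence "of_nat p ^ n * T (a n) - of_nat p ^ n * T (b n) \<in> J (Suc n)" using Suc.prems(3) by simp
 hence "a n = b n" using J_digit_unique Suc.prems(1,2) by blast
 thus ?case using eq Suc.prems(4) less_Suc_eq by auto
qed simp

end

section \<open>Quotients of Hahn series rings: axioms and the case of equal characteristic\<close>

primrec nmul :: "nat \<Rightarrow> 'g::monoid_add \<Rightarrow> 'g" where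
 "nmul 0 x = 0"
| "nmul (Suc n) x = x + nmul n x"

lemma nmul_add: "nmul (m + n) x = nmul m x + nmul n (x :: 'g::monoid_add)" by (induction m) (auto simp: add.assoc)

lemma nmul_strict_mono: "(0::'g::linordered_ab_group_add) < e \<Longrightarrow> i < j \<Longrightarrow> nmul i e < nmul j e"
 by (induction j) (auto simp: less_Suc_eq add_strict_increasing intro: less_trans)

lemma hmon_power: "hmon a 1 ^ n = hmon (nmul n a) 1" by (induction n) (auto simp: hmon_one hmon_mult)

definition hrestr :: "'g set \<Rightarrow> ('g::linordered_ab_group_add, 'c::comm_ring_1) hahn \<Rightarrow> ('g, 'c) hahn" where
 "hrestr D c = hfun (\<lambda>g. if g \<in> D then hco c g else 0)"

lemma hco_hrestr: "hco (hrestr D c) g = (if g \<in> D then hco c g else 0)" unfolding hrestr_def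
 by (subst hco_hfun) (auto intro!: wosupp_subset[OF wosupp_hsupp[of c]] simp: hsupp_def split: if_splits)

text \<open>The common axioms of the two quotients. The coefficient ring has the residue ring
  \<open>K\<close>, with residue map \<pi> and section \<open>T\<close>; by \<open>N_nf\<close>
  every class has a representative with coefficients lifted by \<open>T\<close>, and
  \<open>N_lead\<close> makes it unique. \<open>N_restr\<close> says that the ideal respects the
  decomposition of the exponent group into cosets of the multiples of \<open>e\<close>.\<close>

locale hahn_quot =
 fixes \<pi> :: "'s::comm_ring_1 \<Rightarrow> 'k" and I :: "'s set" and K :: "'k set" and T :: "'k \<Rightarrow> 's" and zk :: 'k
  and e :: "'g::linordered_ab_group_add" and N :: "('g, 's) hahn set"
 assumes I: "pideal I" and pi_I: "x - y \<in> I \<longleftrightarrow> \<pi> x = \<pi> y" and pi_K: "\<pi> z \<in> K" and pi_T: "a \<in> K \<Longrightarrow> \<pi> (T a) = a"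
  and T_zk: "T zk = 0" and zk: "zk \<in> K" and N0: "0 \<in> N" and N_add: "c \<in> N \<Longrightarrow> d \<in> N \<Longrightarrow> c + d \<in> N"
  and N_mult: "c \<in> N \<Longrightarrow> d * c \<in> N" and N_nf: "\<exists>f. (\<forall>g. f g \<in> K) \<and> wosupp {g. f g \<noteq> zk} \<and> c - hfun (\<lambda>g. T (f g)) \<in> N"
  and N_lead: "c \<in> N \<Longrightarrow> (\<And>\<beta>. \<beta> < \<gamma> \<Longrightarrow> hco c \<beta> = 0) \<Longrightarrow> hco c \<gamma> \<in> I"
  and N_restr: "c \<in> N \<Longrightarrow> (\<And>g. g \<in> D \<longleftrightarrow> g + e \<in> D) \<Longrightarrow> hrestr D c \<in> N"

text \<open>The quotient is the Hahn series ring over the residue ring, of the same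
  characteristic.\<close>

definition N_eq :: "'s::comm_ring_1 set \<Rightarrow> ('g::linordered_ab_group_add, 's) hahn set" where
 "N_eq I = {c. \<forall>g. hco c g \<in> I}"

lemma hahn_quot_eq:
 fixes I :: "'s::comm_ring_1 set" and e :: "'g::linordered_ab_group_add"
 assumes I: "pideal I" and pi_I: "\<And>x y. x - y \<in> I \<longleftrightarrow> \<pi> x = \<pi> y" and pi_K: "\<And>z. \<pi> z \<in> K" and pi_T: "\<And>a. a \<in> K \<Longrightarrow> \<pi> (T a) = a"
  and T_zk: "T zk = 0" and zk: "zk \<in> K"
 shows "hahn_quot \<pi> I K T zk e (N_eq I)"
proof -
 have nf: "\<exists>f. (\<forall>g. f g \<in> K) \<and> wosupp {g. f g \<noteq> zk} \<and> c - hfun (\<lambda>g. T (f g)) \<in> N_eq I"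
  for c :: "('g, 's) hahn"
 proof (intro exI[of _ "\<lambda>g. if hco c g = 0 then zk else \<pi> (hco c g)"] conjI allI)
  show w: "wosupp {g. (if hco c g = 0 then zk else \<pi> (hco c g)) \<noteq> zk}"
   by (rule wosupp_subset[OF wosupp_hsupp[of c]]) (auto simp: hsupp_def)
  have "wosupp {g. T (if hco c g = 0 then zk else \<pi> (hco c g)) \<noteq> 0}"
   by (rule wosupp_subset[OF wosupp_hsupp[of c]]) (auto simp: hsupp_def T_zk)
  note h = hco_hfun[OF this]
  have "hco c g - T (if hco c g = 0 then zk else \<pi> (hco c g)) \<in> I" for g
  proof (cases "hco c g = 0")
   case True
   thus ?thesis by (simp add: T_zk pidealD(1)[OF I])
  next
   case False
   thus ?thesis by (simp add: pi_I pi_T[OF pi_K])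
  qed
  thus "c - hfun (\<lambda>g. T (if hco c g = 0 then zk else \<pi> (hco c g))) \<in> N_eq I" by (simp add: N_eq_def h)
 qed (simp add: pi_K zk)
 have mult: "x * y \<in> N_eq I" if "y \<in> N_eq I" for x y :: "('g, 's) hahn"
  using that by (simp add: N_eq_def hco_times' pidealD(9)[OF I] pidealD(4)[OF I])
 show ?thesis
  apply (rule hahn_quot.intro)
  subgoal by (rule I)
  subgoal by (rule pi_I)
  subgoal by (rule pi_K)
  subgoal by (rule pi_T)
  subgoal by (rule T_zk)
  subgoal by (rule zk)
  subgoal by (simp add: N_eq_def pidealD(1)[OF I])
  subgoal by (simp add: N_eq_def pidealD(3)[OF I])
  subgoal by (rule mult)
  subgoal by (rule nf)
  subgoal by (simp add: N_eq_def)
  subgoal by (simp add: N_eq_def hco_hrestr pidealD(1)[OF I])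
  done
qed

section \<open>Mixed characteristic: Hahn series with \<open>p\<close> as a monomial\<close>

context frobenius_lift
begin

declare J.simps(2) [simp del]

text \<open>Let t^g denote the monomial of exponent g. When t^e is read as \<open>p\<close>, the
  term of \<open>c\<close> at \<gamma> - i e becomes its coefficient times p^(-i) t^\<gamma>. This
  is the sum of these contributions at \<gamma>, multiplied by p^L to clear the
  denominators.\<close>

definition q :: "'g::linordered_ab_group_add \<Rightarrow> ('g, 's) hahn \<Rightarrow> 'g \<Rightarrow> nat \<Rightarrow> 's" where
 "q e c \<gamma> L = (\<Sum>i\<le>L. of_nat p ^ (L - i) * hco c (\<gamma> - nmul i e))"

definition bd :: "'g::linordered_ab_group_add \<Rightarrow> ('g, 's) hahn \<Rightarrow> 'g \<Rightarrow> nat \<Rightarrow> bool" where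
 "bd e c \<gamma> L \<equiv> (\<forall>i>L. hco c (\<gamma> - nmul i e) = 0)"

text \<open>The null series of the p-adic Mal'cev-Neumann field, which vanish when t^e is replaced
  by \<open>p\<close>. The terms up to each \<gamma> have to add up to a multiple of p t^\<gamma>;
  membership in \<open>J (Suc L)\<close> is divisibility by p^(L + 1) in the Witt vectors.\<close>

definition N_mix :: "'g::linordered_ab_group_add \<Rightarrow> ('g, 's) hahn set" where
 "N_mix e = {c. \<forall>\<gamma> L. bd e c \<gamma> L \<longrightarrow> q e c \<gamma> L \<in> J (Suc L)}"

lemma finite_coset:
 assumes "wosupp A" "0 < e"
 shows "finite {i. \<gamma> - nmul i e \<in> A}"
proof (rule ccontr)
 assume inf: "infinite {i. \<gamma> - nmul i e \<in> A}"
 define r where "r = enumerate {i. \<gamma> - nmul i e \<in> A}"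
 have "\<forall>n. \<gamma> - nmul (r n) e \<in> A" using enumerate_in_set[OF inf] by (auto simp: r_def)
 moreover have "\<forall>n. \<gamma> - nmul (r (Suc n)) e < \<gamma> - nmul (r n) e"
  using nmul_strict_mono[OF assms(2)] enumerate_step[OF inf] by (simp add: r_def)
 ultimately have "\<exists>s. (\<forall>n. s n \<in> A) \<and> (\<forall>n. s (Suc n) < s n)" by (intro exI[of _ "\<lambda>n. \<gamma> - nmul (r n) e"]) simp
 thus False using assms(1) unfolding wosupp_def by simp
qed

lemma bd_ex:
 assumes "0 < e"
 shows "\<exists>M. \<forall>L\<ge>M. bd e c \<gamma> L"
proof -
 have "finite {i. \<gamma> - nmul i e \<in> hsupp c}" by (rule finite_coset[OF wosupp_hsupp assms])
 then obtain M where "\<forall>i\<in>{i. \<gamma> - nmul i e \<in> hsupp c}. i \<le> M" using finite_nat_set_iff_bounded_le by blast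
 thus ?thesis by (intro exI[of _ M]) (force simp: bd_def hsupp_def)
qed

lemma q_shift: "bd e c \<gamma> L \<Longrightarrow> q e c \<gamma> (L + m) = of_nat p ^ m * q e c \<gamma> L"
proof (induction m)
 case (Suc m)
 have "hco c (\<gamma> - nmul (Suc (L + m)) e) = 0" using Suc.prems unfolding bd_def by (metis less_add_Suc1)
 hence "q e c \<gamma> (L + Suc m) = (\<Sum>i\<le>L + m. of_nat p ^ (Suc (L + m) - i) * hco c (\<gamma> - nmul i e))"
  by (simp add: q_def del: nmul.simps)
 also have "\<dots> = of_nat p * q e c \<gamma> (L + m)"
  unfolding q_def sum_distrib_left by (rule sum.cong) (auto simp: Suc_diff_le mult.assoc)
 finally show ?case using Suc by (simp add: mult.assoc)
qed simp

text \<open>Enlarging the bound by \<open>m\<close> multiplies \<open>q\<close> by p^m and raises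
  the required depth by \<open>m\<close>, so a single admissible bound for each \<gamma> decides
  membership.\<close>

lemma q_indep:
 assumes "bd e c \<gamma> L" "bd e c \<gamma> M"
 shows "q e c \<gamma> L \<in> J (Suc L) \<longleftrightarrow> q e c \<gamma> M \<in> J (Suc M)"
proof -
 have "q e c \<gamma> L \<in> J (Suc L) \<longleftrightarrow> q e c \<gamma> M \<in> J (Suc M)" if "L \<le> M" "bd e c \<gamma> L" for L M
 proof -
  obtain m where "M = L + m" using \<open>L \<le> M\<close> le_iff_add by blast
  thus ?thesis using q_shift[OF that(2), of m] p_power_J[of m _ "Suc L"] by simp
 qed
 from this[of L M] this[of M L] show ?thesis using assms nat_le_linear[of L M] by blast
qed

lemma N_mixI:
 assumes "\<And>\<gamma>. \<exists>L. bd e c \<gamma> L \<and> q e c \<gamma> L \<in> J (Suc L)"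
 shows "c \<in> N_mix e" unfolding N_mix_def using assms q_indep by blast

lemma N_mixD: "c \<in> N_mix e \<Longrightarrow> bd e c \<gamma> L \<Longrightarrow> q e c \<gamma> L \<in> J (Suc L)" by (simp add: N_mix_def)

lemma q_add: "q e (c + d) \<gamma> L = q e c \<gamma> L + q e d \<gamma> L" by (simp add: q_def ring_distribs sum.distrib)

lemma q_diff: "q e (c - d) \<gamma> L = q e c \<gamma> L - q e d \<gamma> L" by (simp add: q_def ring_distribs sum_subtractf)

lemma N_mix_add:
 assumes e: "0 < e" and cd: "c \<in> N_mix e" "d \<in> N_mix e"
 shows "c + d \<in> N_mix e"
proof (rule N_mixI)
 fix \<gamma>
 obtain M1 M2 where M: "\<And>L. L \<ge> M1 \<Longrightarrow> bd e c \<gamma> L" "\<And>L. L \<ge> M2 \<Longrightarrow> bd e d \<gamma> L"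
  using bd_ex[OF e, of c \<gamma>] bd_ex[OF e, of d \<gamma>] by blast
 let ?L = "max M1 M2"
 have "bd e c \<gamma> ?L" "bd e d \<gamma> ?L" using M by auto
 thus "\<exists>L. bd e (c + d) \<gamma> L \<and> q e (c + d) \<gamma> L \<in> J (Suc L)" using N_mixD[OF cd(1)] N_mixD[OF cd(2)]
  by (intro exI[of _ ?L]) (auto simp: q_add bd_def simp del: J.simps intro!: J_add)
qed

lemma N_mix_mult:
 assumes e: "0 < e" and c: "c \<in> N_mix e"
 shows "d * c \<in> N_mix e"
proof (rule N_mixI)
 fix \<gamma>
 \<comment> \<open>The pairs that contribute to the coefficients of the product at \<gamma>,
   \<gamma> - e, and so on. They are finitely many, which provides a common bound \<open>L\<close>
   for all the shifts \<gamma> - b that occur.\<close>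
 let ?P = "{(i, b). hco d b \<noteq> 0 \<and> hco c (\<gamma> - nmul i e - b) \<noteq> 0}"
 let ?A = "{i. \<gamma> - nmul i e \<in> {a + b | a b. a \<in> hsupp d \<and> b \<in> hsupp c}}"
 let ?S = "\<lambda>i. {b. hco d b \<noteq> 0 \<and> hco c (\<gamma> - nmul i e - b) \<noteq> 0}"
 have "finite (Sigma ?A ?S)"
 proof (rule finite_SigmaI)
  show "finite ?A" by (rule finite_coset[OF wosupp_plus[OF wosupp_hsupp wosupp_hsupp] e])
 qed (rule hsupp_fibre)
 moreover have "?P \<subseteq> Sigma ?A ?S"
 proof (rule subsetI)
  fix x assume "x \<in> ?P"
  then obtain i b where ib: "x = (i, b)" "hco d b \<noteq> 0" "hco c (\<gamma> - nmul i e - b) \<noteq> 0" by auto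
  hence "i \<in> ?A" by (intro CollectI exI[of _ b] exI[of _ "\<gamma> - nmul i e - b"]) (simp add: hsupp_def)
  thus "x \<in> Sigma ?A ?S" using ib by simp
 qed
 ultimately have finP: "finite ?P" by (rule finite_subset[rotated])
 define B where "B = snd ` ?P"
 have finB: "finite B" using finP by (simp add: B_def)
 have "\<forall>b. \<exists>M. \<forall>L\<ge>M. bd e c (\<gamma> - b) L" using bd_ex[OF e] by blast
 then obtain M where M: "\<And>b L. L \<ge> M b \<Longrightarrow> bd e c (\<gamma> - b) L" by metis
 obtain m where m: "\<forall>i\<in>fst ` ?P. i \<le> m" using finP finite_nat_set_iff_bounded_le by blast
 define L where "L = Max (insert m (M ` B))"
 have L: "m \<le> L" "b \<in> B \<Longrightarrow> M b \<le> L" for b using finB by (auto simp: L_def)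
 have co: "hco (d * c) (\<gamma> - nmul i e) = (\<Sum>b\<in>B. hco d b * hco c (\<gamma> - b - nmul i e))" for i
 proof -
  have "hco (d * c) (\<gamma> - nmul i e) = (\<Sum>b\<in>B. hco d b * hco c (\<gamma> - nmul i e - b))"
   by (rule hco_times[OF finB]) (force simp: B_def)
  thus ?thesis by (simp add: algebra_simps)
 qed
 \<comment> \<open>Exchanging the sums shows \<open>q\<close> of the product as a finite linear
   combination of values of \<open>q\<close> on \<open>c\<close>, each deep enough by
   assumption.\<close>
 have "q e (d * c) \<gamma> L = (\<Sum>b\<in>B. hco d b * q e c (\<gamma> - b) L)"
  unfolding q_def co sum_distrib_left by (subst sum.swap) (simp add: mult_ac)
 moreover have "hco d b * q e c (\<gamma> - b) L \<in> J (Suc L)" if "b \<in> B" for b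
  using N_mixD[OF c M[OF L(2)[OF that]]] by (rule J_mult)
 ultimately have "q e (d * c) \<gamma> L \<in> J (Suc L)" using J_sum[of B _ "Suc L"] by simp
 moreover have "bd e (d * c) \<gamma> L" unfolding bd_def
 proof (intro allI impI)
  fix i assume "L < i"
  hence "i \<notin> fst ` ?P" using m L(1) by (meson leD le_trans)
  have "hco d b * hco c (\<gamma> - nmul i e - b) = 0" for b
  proof (rule ccontr)
   assume "hco d b * hco c (\<gamma> - nmul i e - b) \<noteq> 0"
   hence "(i, b) \<in> ?P" by auto
   hence "fst (i, b) \<in> fst ` ?P" by (rule imageI)
   thus False using \<open>i \<notin> fst ` ?P\<close> by simp
  qed
  hence "hco d b * hco c (\<gamma> - b - nmul i e) = 0" for b by (simp add: algebra_simps)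
  thus "hco (d * c) (\<gamma> - nmul i e) = 0" by (simp add: co)
 qed
 ultimately show "\<exists>L. bd e (d * c) \<gamma> L \<and> q e (d * c) \<gamma> L \<in> J (Suc L)" by blast
qed

lemma q_rev: "q e c \<gamma> L = (\<Sum>j<Suc L. of_nat p ^ j * hco c (\<gamma> - nmul (L - j) e))" unfolding q_def lessThan_Suc_atMost
 by (rule sum.reindex_bij_witness[of _ "\<lambda>j. L - j" "\<lambda>j. L - j"]) auto

text \<open>The normal form has at \<gamma> the Teichmueller digit of index \<open>L\<close> of
  \<open>q e c \<gamma> L\<close>: all terms up to \<gamma> are added, and of their expansion only
  the digit that belongs at \<gamma> is kept. Passing to \<gamma> - j e truncates the sum without
  affecting the lower digits, so the digits kept along a coset are those of one and the same
  expansion.\<close>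

lemma N_mix_nf:
 assumes e: "0 < (e :: 'g::linordered_ab_group_add)" and T0: "T zk = 0" "zk \<in> K"
 shows "\<exists>f. (\<forall>g. f g \<in> K) \<and> wosupp {g. f g \<noteq> zk} \<and> c - hfun (\<lambda>g. T (f g)) \<in> N_mix e"
proof -
 obtain dig where dig: "\<And>z. digits z (dig z)" using digits_exist by metis
 have digK: "dig z i \<in> K" and digJ: "z - (\<Sum>i<n. of_nat p ^ i * T (dig z i)) \<in> J n" for z i n
  using dig[of z] by (auto simp: digits_def)
 have dig_cong: "dig z i = dig z' i" if "z - z' \<in> J n" "i < n" for z z' i n
 proof (rule digits_unique[OF _ _ _ that(2)])
  have "(z - z') - (z - (\<Sum>i<n. of_nat p ^ i * T (dig z i))) + (z' - (\<Sum>i<n. of_nat p ^ i * T (dig z' i))) \<in> J n"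
   by (intro J_add J_diff that digJ)
  thus "(\<Sum>i<n. of_nat p ^ i * T (dig z i)) - (\<Sum>i<n. of_nat p ^ i * T (dig z' i)) \<in> J n" by (simp add: algebra_simps)
 qed (auto simp: digK)
 define LL where "LL \<gamma> = (LEAST L. bd e c \<gamma> L)" for \<gamma>
 have bdLL: "bd e c \<gamma> (LL \<gamma>)" for \<gamma> unfolding LL_def by (rule LeastI_ex) (use bd_ex[OF e, of c \<gamma>] in blast)
 \<comment> \<open>Where \<open>c\<close> has no term at or below \<gamma> on its coset, the value
   is \<open>zk\<close> outright; this confines the support to sums of an exponent of
   \<open>c\<close> and a multiple of \<open>e\<close>.\<close>
 define f where "f \<gamma> = (if \<forall>i. hco c (\<gamma> - nmul i e) = 0 then zk else dig (q e c \<gamma> (LL \<gamma>)) (LL \<gamma>))" for \<gamma>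
 have dig0: "dig 0 i = zk" for i
 proof -
  have "0 - (\<Sum>j<Suc i. of_nat p ^ j * T (dig 0 j)) \<in> J (Suc i)" by (rule digJ)
  hence "(\<Sum>j<Suc i. of_nat p ^ j * T zk) - (\<Sum>j<Suc i. of_nat p ^ j * T (dig 0 j)) \<in> J (Suc i)" using T0 by simp
  hence "zk = dig 0 i" by (rule digits_unique[of "Suc i" "\<lambda>_. zk" "dig 0" i, rotated 2]) (simp_all add: T0 digK)
  thus ?thesis by simp
 qed
 \<comment> \<open>Multiplication by p^m inserts \<open>m\<close> zero digits at the bottom, hence
   \<open>f\<close> can be computed with any admissible bound.\<close>
 have dig_shift: "dig (of_nat p ^ m * z) (n + m) = dig z n" for m z n
 proof -
  let ?d = "\<lambda>i. if i < m then zk else dig z (i - m)"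
  have "of_nat p ^ m * (z - (\<Sum>i<Suc n. of_nat p ^ i * T (dig z i))) \<in> J (Suc n + m)" by (simp only: p_power_J digJ)
  moreover have "(\<Sum>i<Suc n + m. of_nat p ^ i * T (?d i)) = of_nat p ^ m * (\<Sum>i<Suc n. of_nat p ^ i * T (dig z i))"
  proof -
   have "(\<Sum>i<Suc n + m. of_nat p ^ i * T (?d i)) = (\<Sum>i\<in>{m..<Suc n + m}. of_nat p ^ i * T (dig z (i - m)))"
    by (rule sum.mono_neutral_cong_right) (auto simp: T0)
   also have "\<dots> = (\<Sum>i<Suc n. of_nat p ^ (i + m) * T (dig z i))"
    by (rule sum.reindex_bij_witness[of _ "\<lambda>i. i + m" "\<lambda>i. i - m"]) auto
   also have "\<dots> = of_nat p ^ m * (\<Sum>i<Suc n. of_nat p ^ i * T (dig z i))"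
    unfolding sum_distrib_left by (rule sum.cong) (auto simp: power_add mult_ac)
   finally show ?thesis .
  qed
  ultimately have a: "of_nat p ^ m * z - (\<Sum>i<Suc n + m. of_nat p ^ i * T (?d i)) \<in> J (Suc n + m)"
   by (simp only: right_diff_distrib)
  have "(of_nat p ^ m * z - (\<Sum>i<Suc n + m. of_nat p ^ i * T (?d i))) -
    (of_nat p ^ m * z - (\<Sum>i<Suc n + m. of_nat p ^ i * T (dig (of_nat p ^ m * z) i))) \<in> J (Suc n + m)"
   by (rule J_diff[OF a digJ])
  hence b: "(\<Sum>i<Suc n + m. of_nat p ^ i * T (dig (of_nat p ^ m * z) i)) -
    (\<Sum>i<Suc n + m. of_nat p ^ i * T (?d i)) \<in> J (Suc n + m)" by (simp del: J.simps sum.lessThan_Suc)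
  have "dig (of_nat p ^ m * z) (n + m) = ?d (n + m)" by (rule digits_unique[OF _ _ b]) (auto simp: digK T0)
  thus ?thesis by simp
 qed
 have f_eq: "f \<gamma> = dig (q e c \<gamma> L) L" if "bd e c \<gamma> L" for \<gamma> L
 proof (cases "\<forall>i. hco c (\<gamma> - nmul i e) = 0")
  case True
  thus ?thesis by (simp add: f_def q_def dig0)
 next
  case False
  have "LL \<gamma> \<le> L" unfolding LL_def by (rule Least_le) (rule that)
  then obtain m where m: "L = LL \<gamma> + m" using le_iff_add by blast
  have "f \<gamma> = dig (q e c \<gamma> (LL \<gamma>)) (LL \<gamma>)" using False by (auto simp: f_def)
  thus ?thesis unfolding m using q_shift[OF bdLL, of \<gamma> m] by (simp add: dig_shift)
 qed
 have fK: "f g \<in> K" for g by (auto simp: f_def digK T0)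
 have wf: "wosupp {g. f g \<noteq> zk}"
 proof (rule wosupp_subset)
  show "wosupp {a + b | a b. a \<in> hsupp c \<and> b \<in> range (\<lambda>i. nmul i e)}"
  proof (rule wosupp_plus[OF wosupp_hsupp wosupp_I])
   fix D assume D: "D \<subseteq> range (\<lambda>i. nmul i e)" "D \<noteq> {}"
   define i where "i = (LEAST i. nmul i e \<in> D)"
   obtain j where "nmul j e \<in> D" using D by auto
   hence "nmul i e \<in> D" unfolding i_def by (rule LeastI)
   moreover have "nmul i e \<le> x" if x: "x \<in> D" for x
   proof -
    obtain j where "x = nmul j e" using D x by blast
    moreover hence "i \<le> j" unfolding i_def using x by (intro Least_le) simp
    ultimately show ?thesis using nmul_strict_mono[OF e, of i j] by (cases "i = j") auto
   qed
   ultimately show "\<exists>m\<in>D. \<forall>x\<in>D. m \<le> x" by blast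
  qed
  show "{g. f g \<noteq> zk} \<subseteq> {a + b | a b. a \<in> hsupp c \<and> b \<in> range (\<lambda>i. nmul i e)}"
  proof clarify
   fix g assume "f g \<noteq> zk"
   then obtain i where "hco c (g - nmul i e) \<noteq> 0" by (auto simp: f_def split: if_splits)
   thus "\<exists>a b. g = a + b \<and> a \<in> hsupp c \<and> b \<in> range (\<lambda>i. nmul i e)"
    by (intro exI[of _ "g - nmul i e"] exI[of _ "nmul i e"]) (simp add: hsupp_def)
  qed
 qed
 have hf: "hco (hfun (\<lambda>g. T (f g))) g = T (f g)" for g
 proof -
  have "{g. T (f g) \<noteq> 0} \<subseteq> {g. f g \<noteq> zk}" using T0(1) by (metis (mono_tags, lifting) Collect_mono)
  thus ?thesis by (simp add: hco_hfun[OF wosupp_subset[OF wf]])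
 qed
 have "c - hfun (\<lambda>g. T (f g)) \<in> N_mix e"
 proof (rule N_mixI)
  fix \<gamma>
  obtain M1 M2 where M: "\<And>L. L \<ge> M1 \<Longrightarrow> bd e c \<gamma> L" "\<And>L. L \<ge> M2 \<Longrightarrow> bd e (hfun (\<lambda>g. T (f g))) \<gamma> L"
   using bd_ex[OF e, of c \<gamma>] bd_ex[OF e, of "hfun (\<lambda>g. T (f g))" \<gamma>] by blast
  let ?L = "max M1 M2"
  have bdc: "bd e c \<gamma> ?L" and bdf: "bd e (hfun (\<lambda>g. T (f g))) \<gamma> ?L" using M by auto
  have "f (\<gamma> - nmul (?L - j) e) = dig (q e c \<gamma> ?L) j" if j: "j \<le> ?L" for j
  proof -
   have "nmul (?L - j) e + nmul i e = nmul (?L - j + i) e" for i by (simp add: nmul_add)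
   hence sh: "\<gamma> - nmul (?L - j) e - nmul i e = \<gamma> - nmul (?L - j + i) e" for i by (metis diff_diff_add)
   have "bd e c (\<gamma> - nmul (?L - j) e) j" unfolding bd_def sh
   proof (intro allI impI)
    fix i assume "j < i"
    hence "?L < ?L - j + i" using j by linarith
    thus "hco c (\<gamma> - nmul (?L - j + i) e) = 0" using bdc unfolding bd_def by blast
   qed
   hence "f (\<gamma> - nmul (?L - j) e) = dig (q e c (\<gamma> - nmul (?L - j) e) j) j" by (rule f_eq)
   also have "\<dots> = dig (q e c \<gamma> ?L) j"
   proof (rule sym, rule dig_cong)
    have "q e c \<gamma> ?L = (\<Sum>i<Suc j. of_nat p ^ i * hco c (\<gamma> - nmul (?L - i) e)) +
      (\<Sum>i\<in>{Suc j..<Suc ?L}. of_nat p ^ i * hco c (\<gamma> - nmul (?L - i) e))"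
    proof -
     have "{..<Suc ?L} = {..<Suc j} \<union> {Suc j..<Suc ?L}" using j by auto
     hence "q e c \<gamma> ?L = (\<Sum>i\<in>{..<Suc j} \<union> {Suc j..<Suc ?L}. of_nat p ^ i * hco c (\<gamma> - nmul (?L - i) e))"
      unfolding q_rev by (rule arg_cong)
     also have "\<dots> = (\<Sum>i<Suc j. of_nat p ^ i * hco c (\<gamma> - nmul (?L - i) e)) +
       (\<Sum>i\<in>{Suc j..<Suc ?L}. of_nat p ^ i * hco c (\<gamma> - nmul (?L - i) e))" by (rule sum.union_disjoint) auto
     finally show ?thesis .
    qed
    moreover have "(\<Sum>i<Suc j. of_nat p ^ i * hco c (\<gamma> - nmul (?L - i) e)) = q e c (\<gamma> - nmul (?L - j) e) j"
     unfolding q_rev sh using j by (intro sum.cong) auto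
    moreover have "(\<Sum>i\<in>{Suc j..<Suc ?L}. of_nat p ^ i * hco c (\<gamma> - nmul (?L - i) e)) \<in> J (Suc j)"
    proof (rule J_sum)
     fix i assume "i \<in> {Suc j..<Suc ?L}"
     hence "Suc j \<le> i" by simp
     moreover have "of_nat p ^ i * s \<in> J i" for s using p_power_J[of i s 0] by simp
     ultimately show "of_nat p ^ i * hco c (\<gamma> - nmul (?L - i) e) \<in> J (Suc j)" using J_le by blast
    qed
    ultimately show "q e c \<gamma> ?L - q e c (\<gamma> - nmul (?L - j) e) j \<in> J (Suc j)" by simp
   qed simp
   finally show ?thesis .
  qed
  hence "q e (hfun (\<lambda>g. T (f g))) \<gamma> ?L = (\<Sum>j<Suc ?L. of_nat p ^ j * T (dig (q e c \<gamma> ?L) j))"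
   unfolding q_rev hf by (intro sum.cong) auto
  hence "q e (c - hfun (\<lambda>g. T (f g))) \<gamma> ?L \<in> J (Suc ?L)" unfolding q_diff by (simp only: digJ)
  thus "\<exists>L. bd e (c - hfun (\<lambda>g. T (f g))) \<gamma> L \<and> q e (c - hfun (\<lambda>g. T (f g))) \<gamma> L \<in> J (Suc L)"
   using bdc bdf by (intro exI[of _ ?L]) (simp add: bd_def)
 qed
 thus ?thesis using fK wf by blast
qed

text \<open>If no term lies below \<gamma>, the bound 0 is admissible and \<open>q\<close> is the
  coefficient itself.\<close>

lemma N_mix_lead:
 assumes e: "0 < e" and c: "c \<in> N_mix e" "\<And>\<beta>. \<beta> < \<gamma> \<Longrightarrow> hco c \<beta> = 0"
 shows "hco c \<gamma> \<in> I"
proof -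
 have "bd e c \<gamma> 0" unfolding bd_def using c(2) nmul_strict_mono[OF e, of 0] by auto
 from N_mixD[OF c(1) this] show ?thesis by (simp add: q_def J.simps(2))
qed

text \<open>At \<gamma> only one coset of the multiples of \<open>e\<close> enters \<open>q\<close>,
  and \<open>D\<close> contains it entirely or not at all.\<close>

lemma N_mix_restr:
 assumes e: "0 < e" and c: "c \<in> N_mix e" and D: "\<And>g. g \<in> D \<longleftrightarrow> g + e \<in> D"
 shows "hrestr D c \<in> N_mix e"
proof (rule N_mixI)
 fix \<gamma>
 have D': "\<gamma> - nmul i e \<in> D \<longleftrightarrow> \<gamma> \<in> D" for i
 proof (induction i)
  case (Suc i)
  thus ?case using D[of "\<gamma> - nmul (Suc i) e"] by (simp add: algebra_simps)
 qed simp
 obtain L where L: "bd e c \<gamma> L" using bd_ex[OF e] by blast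
 have "q e (hrestr D c) \<gamma> L = (if \<gamma> \<in> D then q e c \<gamma> L else 0)" by (simp add: q_def hco_hrestr D')
 thus "\<exists>L. bd e (hrestr D c) \<gamma> L \<and> q e (hrestr D c) \<gamma> L \<in> J (Suc L)"
  using L N_mixD[OF c L] by (intro exI[of _ L]) (auto simp: bd_def hco_hrestr J_zero simp del: J.simps)
qed

lemma hahn_quot_mix:
 assumes e: "0 < e" and "T zk = 0" "zk \<in> K"
 shows "hahn_quot \<pi> I K T zk e (N_mix e)"
 apply (rule hahn_quot.intro)
 subgoal by (rule I)
 subgoal by (rule pi_I)
 subgoal by (rule pi_K)
 subgoal by (rule pi_T)
 subgoal by (rule assms)
 subgoal by (rule assms)
 subgoal by (rule N_mixI) (auto simp: bd_def q_def J_zero simp del: J.simps)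
 subgoal by (rule N_mix_add[OF e])
 subgoal by (rule N_mix_mult[OF e])
 subgoal by (rule N_mix_nf[OF assms])
 subgoal by (rule N_mix_lead[OF e])
 subgoal by (rule N_mix_restr[OF e])
 done

text \<open>A homomorphism commuting with \<phi> commutes with \<delta>; as it preserves
  \<open>I\<close>, it preserves every \<open>J n\<close>.\<close>

lemma N_mix_hmap:
 assumes \<psi>: "rhom \<psi>" "\<And>z. \<psi> (\<phi> z) = \<phi> (\<psi> z)" "\<And>z. z \<in> I \<Longrightarrow> \<psi> z \<in> I" and c: "c \<in> N_mix e" and e: "0 < e"
 shows "hmap \<psi> c \<in> N_mix e"
proof (rule N_mixI)
 have \<psi>\<delta>: "\<psi> (\<delta> z) = \<delta> (\<psi> z)" for z
 proof (rule sym, rule delta_eqI)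
  show "\<phi> (\<psi> z) = \<psi> z ^ p + of_nat p * \<psi> (\<delta> z)" unfolding \<psi>(2)[symmetric] phi_delta[of z] by (simp add: rhomD[OF \<psi>(1)])
 qed
 have \<psi>J: "\<psi> z \<in> J n" if "z \<in> J n" for z n
  using that by (induction n arbitrary: z) (auto simp: J.simps(2) \<psi>(3) simp flip: \<psi>\<delta>)
 fix \<gamma>
 obtain L where L: "bd e c \<gamma> L" using bd_ex[OF e] by blast
 note h = hco_hmap[of \<psi>, OF rhomD(4)[OF \<psi>(1)]]
 have "q e (hmap \<psi> c) \<gamma> L = \<psi> (q e c \<gamma> L)" by (simp add: q_def h rhomD[OF \<psi>(1)])
 thus "\<exists>L. bd e (hmap \<psi> c) \<gamma> L \<and> q e (hmap \<psi> c) \<gamma> L \<in> J (Suc L)"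
  using L \<psi>J[OF N_mixD[OF c L]] by (intro exI[of _ L]) (auto simp: bd_def h rhomD[OF \<psi>(1)] simp del: J.simps)
qed

text \<open>Tested at the exponent j e with the bound j, the constant series \<open>n\<close> yields
  \<open>n\<close> itself as an element of \<open>J (Suc j)\<close>. So every power of
  \<open>p\<close> divides \<open>n\<close>.\<close>

lemma N_mix_char:
 fixes e :: "'g::linordered_ab_group_add"
 assumes e: "0 < e" and u: "of_int n \<in> N_mix e"
 shows "n = 0"
proof (rule ccontr)
 assume n: "n \<noteq> 0"
 have nI: "of_int n \<in> J (Suc j)" for j
 proof -
  have c: "hco (of_int n) g = (if g = 0 then of_int n else (0 :: 's))" for g :: 'g
  proof -
   have "of_int n = hmon (0::'g) (of_int n :: 's)" using rhomD(10)[OF rhom_hmon] by metis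
   thus ?thesis by (metis (no_types) hco_hmon)
  qed
  have z: "nmul j e - nmul i e = 0 \<longleftrightarrow> i = j" for i
   using nmul_strict_mono[OF e, of i j] nmul_strict_mono[OF e, of j i] by (cases i j rule: linorder_cases) auto
  have "bd e (of_int n) (nmul j e) j" by (auto simp: bd_def c z simp del: right_minus_eq)
  from N_mixD[OF u this] have "(\<Sum>i\<le>j. of_nat p ^ (j - i) * (if i = j then of_int n else 0)) \<in> J (Suc j)"
   by (simp add: q_def c z del: J.simps right_minus_eq)
  moreover have "(\<Sum>i\<le>j. of_nat p ^ (j - i) * (if i = j then of_int n else (0::'s))) = of_int n"
   by (subst sum.remove[of _ j]) (auto intro: sum.neutral)
  ultimately show ?thesis by simp
 qed
 have "int p ^ j dvd m" if "of_int m \<in> J j" for m j using that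
 proof (induction j arbitrary: m)
  case (Suc j)
  have mI: "(of_int m :: 's) \<in> I" using Suc.prems by (simp add: J.simps(2))
  have "int p dvd m"
  proof (rule ccontr)
   assume "\<not> int p dvd m"
   hence "coprime m (int p)" using p by (metis coprime_commute prime_imp_coprime prime_nat_int_transfer)
   then obtain a b where "a * m + b * int p = 1" by (metis bezout_int coprime_iff_gcd_eq_1)
   hence "(of_int a * of_int m + of_int b * of_nat p :: 's) = 1" by (metis of_int_1 of_int_add of_int_mult of_int_of_nat_eq)
   moreover have "(of_int a * of_int m + of_int b * of_nat p :: 's) \<in> I" by (intro pidealD(3,4)[OF I] mI p_I)
   ultimately show False using pidealD(2)[OF I] by simp
  qed
  then obtain m' where m': "m = int p * m'" by blast
  hence "of_nat p * of_int m' \<in> J (Suc j)" using Suc.prems by (simp del: J.simps)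
  hence "of_int m' \<in> J j" by (simp only: p_J)
  thus ?case using Suc.IH m' by simp
 qed simp
 hence "int p ^ Suc (nat \<bar>n\<bar>) dvd n" using nI by blast
 from dvd_imp_le_int[OF n this] have "int (p ^ Suc (nat \<bar>n\<bar>)) \<le> int (nat \<bar>n\<bar>)" by simp
 moreover have "nat \<bar>n\<bar> < 2 ^ Suc (nat \<bar>n\<bar>)" using less_exp[of "nat \<bar>n\<bar>"] unfolding power_Suc by linarith
 moreover have "(2::nat) ^ Suc (nat \<bar>n\<bar>) \<le> p ^ Suc (nat \<bar>n\<bar>)" by (rule power_mono) (use p2 in auto)
 ultimately show False by linarith
qed

end

section \<open>Valuation, Newton approximation and algebraic closedness of the Hahn
  quotients\<close>

lemma poly_shift_closed:
 fixes A :: "'c::comm_ring_1 poly"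
 assumes M: "0 \<in> M" "\<And>x y. x \<in> M \<Longrightarrow> y \<in> M \<Longrightarrow> x + y \<in> M" "\<And>x. x \<in> M \<Longrightarrow> y * x \<in> M" and A: "\<And>k. pcoeff A k \<in> M"
 shows "pcoeff (pcompose A [:y, 1:]) k \<in> M" using A
proof (induction A arbitrary: k)
 case (pCons a A)
 have "a \<in> M" "\<And>k. pcoeff A k \<in> M" using pCons.prems by (metis coeff_pCons_0, metis coeff_pCons_Suc)
 hence a: "a \<in> M" and "pcoeff (pcompose A [:y, 1:]) k \<in> M" for k using pCons.IH by auto
 moreover obtain Q where Q: "Q = pcompose A [:y, 1:]" by simp
 ultimately have "pcoeff Q k \<in> M" for k by simp
 thus ?case unfolding pcompose_pCons Q[symmetric] using M a by (cases k) (auto simp: coeff_pCons split: nat.splits)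
qed (simp add: M)

text \<open>Coefficients of positive index of a Taylor shift do not involve the constant
  coefficient: it is split off, and the rest is treated by \<open>poly_shift_closed\<close>.\<close>

lemma poly_shift_closed':
 fixes A :: "'c::comm_ring_1 poly"
 assumes M: "0 \<in> M" "\<And>x y. x \<in> M \<Longrightarrow> y \<in> M \<Longrightarrow> x + y \<in> M" "\<And>x. x \<in> M \<Longrightarrow> y * x \<in> M"
  and A: "\<And>k. k > 0 \<Longrightarrow> pcoeff A k \<in> M" and k: "k > 0"
 shows "pcoeff (pcompose A [:y, 1:]) k \<in> M"
proof (cases A)
 case (pCons a B)
 have "pcoeff B k \<in> M" for k using A[of "Suc k"] by (simp add: pCons)
 hence B: "pcoeff (pcompose B [:y, 1:]) k \<in> M" for k using poly_shift_closed[of M y B] M by blast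
 from k obtain k' where "k = Suc k'" by (cases k) auto
 moreover obtain Q where Q: "Q = pcompose B [:y, 1:]" by simp
 ultimately show ?thesis unfolding pCons pcompose_pCons Q[symmetric] using B[folded Q] M
  by (auto simp: coeff_pCons split: nat.splits)
qed

lemma pcompose_shift_back: "pcompose (pcompose f [:x, 1:]) [:- x, 1:] = (f :: 'c::comm_ring_1 poly)"
proof -
 have "pcompose [:x, 1:] [:- x, 1:] = [:0, 1:]" by (simp add: pcompose_pCons)
 thus ?thesis by (simp add: pcompose_assoc[symmetric])
qed

lemma coeff_pcompose_scale: "pcoeff (pcompose P [:0, t:]) k = pcoeff P k * (t :: 'c::comm_ring_1) ^ k"
proof (induction P arbitrary: k)
 case (pCons a P)
 thus ?case by (cases k) (auto simp: pcompose_pCons coeff_pCons mult_ac split: nat.splits)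
qed simp

lemma nmul_mono: "(x :: 'g::linordered_ab_group_add) \<le> y \<Longrightarrow> nmul k x \<le> nmul k y" by (induction k) (auto intro: add_mono)

lemma nmul_less: "(x :: 'g::linordered_ab_group_add) < y \<Longrightarrow> k > 0 \<Longrightarrow> nmul k x < nmul k y"
proof (induction k)
 case (Suc k)
 thus ?case using nmul_mono[of x y k] by (auto intro: add_less_le_mono)
qed simp

lemma nmul_less_iff: "k > 0 \<Longrightarrow> nmul k (x :: 'g::linordered_ab_group_add) < nmul k y \<longleftrightarrow> x < y"
 using nmul_less[of x y k] nmul_less[of y x k] by (cases x y rule: linorder_cases) auto

lemma nmul_le_iff: "k > 0 \<Longrightarrow> nmul k (x :: 'g::linordered_ab_group_add) \<le> nmul k y \<longleftrightarrow> x \<le> y"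
 using nmul_less_iff[of k y x] by (simp add: not_less[symmetric])

context hahn_quot
begin

abbreviation TT :: "('g \<Rightarrow> 'k) \<Rightarrow> ('g, 's) hahn" where "TT f \<equiv> hfun (\<lambda>g. T (f g))"

definition wf :: "('g \<Rightarrow> 'k) \<Rightarrow> bool" where
 "wf f \<equiv> (\<forall>g. f g \<in> K) \<and> wosupp {g. f g \<noteq> zk}"

lemma hco_TT: "wf f \<Longrightarrow> hco (TT f) g = T (f g)"
proof -
 assume f: "wf f"
 have "{g. T (f g) \<noteq> 0} \<subseteq> {g. f g \<noteq> zk}" using T_zk by (metis (mono_tags, lifting) Collect_mono)
 hence "wosupp {g. T (f g) \<noteq> 0}" using f wosupp_subset unfolding wf_def by blast
 thus ?thesis by (simp add: hco_hfun)
qed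

definition nf :: "('g, 's) hahn \<Rightarrow> 'g \<Rightarrow> 'k" where
 "nf c = (SOME f. wf f \<and> c - TT f \<in> N)"

lemma nf: "wf (nf c)" "c - TT (nf c) \<in> N"
proof -
 have "\<exists>f. wf f \<and> c - TT f \<in> N" using N_nf[of c] by (auto simp: wf_def)
 hence "wf (nf c) \<and> c - TT (nf c) \<in> N" unfolding nf_def by (rule someI_ex)
 thus "wf (nf c)" "c - TT (nf c) \<in> N" by auto
qed

lemma nf_K: "nf c g \<in> K" using nf(1) by (auto simp: wf_def)

lemma N_minus: "c \<in> N \<Longrightarrow> - c \<in> N" using N_mult[of c "-1"] by simp
lemma N_diff: "c \<in> N \<Longrightarrow> d \<in> N \<Longrightarrow> c - d \<in> N" using N_add[OF _ N_minus] by fastforce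
lemma N_sym: "c - d \<in> N \<Longrightarrow> d - c \<in> N" using N_minus[of "c - d"] by simp
lemma N_trans: "c - d \<in> N \<Longrightarrow> d - b \<in> N \<Longrightarrow> c - b \<in> N" using N_add[of "c - d" "d - b"] by simp

lemma pi_zero: "\<pi> 0 = zk" using pi_T[OF zk] T_zk by simp

lemma I_iff: "s \<in> I \<longleftrightarrow> \<pi> s = zk" using pi_I[of s 0] pi_zero by simp

lemma T_I: "a \<in> K \<Longrightarrow> T a \<in> I \<longleftrightarrow> a = zk" by (simp add: I_iff pi_T)

lemma T_pi: "T (\<pi> s) - s \<in> I" using pi_I pi_T pi_K by simp

text \<open>At the first exponent below \<gamma> where the normal form is nonzero,
  \<open>N_lead\<close> would place the lift of this value in \<open>I\<close>. The value at
  \<gamma> is then read off by \<open>N_lead\<close> again.\<close>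

lemma nf_lead:
 assumes c: "c - d \<in> N" and d: "\<And>\<beta>. \<beta> < \<gamma> \<Longrightarrow> hco d \<beta> = 0"
 shows "\<beta> < \<gamma> \<Longrightarrow> nf c \<beta> = zk" "nf c \<gamma> = \<pi> (hco d \<gamma>)"
proof -
 have td: "TT (nf c) - d \<in> N" by (rule N_trans[OF N_sym[OF nf(2)] c])
 have 1: "nf c \<beta> = zk" if "\<beta> < \<gamma>" for \<beta>
 proof (rule ccontr)
  assume "nf c \<beta> \<noteq> zk"
  hence "\<exists>m\<in>{\<beta>. \<beta> < \<gamma> \<and> nf c \<beta> \<noteq> zk}. \<forall>x\<in>{\<beta>. \<beta> < \<gamma> \<and> nf c \<beta> \<noteq> zk}. m \<le> x"
   using nf(1)[of c] that by (intro wosupp_min[of "{\<beta>. nf c \<beta> \<noteq> zk}"]) (auto simp: wf_def)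
  then obtain m where m: "m < \<gamma>" "nf c m \<noteq> zk" "\<And>x. x < \<gamma> \<Longrightarrow> nf c x \<noteq> zk \<Longrightarrow> m \<le> x" by auto
  have "hco (TT (nf c) - d) m \<in> I"
  proof (rule N_lead[OF td])
   fix \<beta> assume "\<beta> < m"
   hence "nf c \<beta> = zk" "\<beta> < \<gamma>" using m(3)[of \<beta>] m(1) by force+
   thus "hco (TT (nf c) - d) \<beta> = 0" using d[of \<beta>] by (simp add: hco_TT nf(1) T_zk)
  qed
  hence "T (nf c m) \<in> I" using d[OF m(1)] by (simp add: hco_TT nf(1))
  thus False using m(2) T_I nf_K by blast
 qed
 thus "\<beta> < \<gamma> \<Longrightarrow> nf c \<beta> = zk" .
 have "hco (TT (nf c) - d) \<gamma> \<in> I" by (rule N_lead[OF td]) (simp add: hco_TT nf(1) 1 d T_zk)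
 hence "T (nf c \<gamma>) - hco d \<gamma> \<in> I" by (simp add: hco_TT nf(1))
 thus "nf c \<gamma> = \<pi> (hco d \<gamma>)" using pi_I pi_T[OF nf_K] by simp
qed

lemma first_diff:
 assumes "wf f" "wf h" "f \<beta> \<noteq> h \<beta>"
 shows "\<exists>m\<le>\<beta>. f m \<noteq> h m \<and> (\<forall>x<m. f x = h x)"
proof -
 have "wosupp ({g. f g \<noteq> zk} \<union> {g. h g \<noteq> zk})" using assms by (intro wosupp_Un) (auto simp: wf_def)
 hence "\<exists>m\<in>{x. x \<le> \<beta> \<and> f x \<noteq> h x}. \<forall>x\<in>{x. x \<le> \<beta> \<and> f x \<noteq> h x}. m \<le> x" using assms by (intro wosupp_min) auto
 then obtain m where "m \<le> \<beta>" "f m \<noteq> h m" "\<And>x. x \<le> \<beta> \<Longrightarrow> f x \<noteq> h x \<Longrightarrow> m \<le> x" by auto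
 moreover have "f x = h x" if "x < m" for x using that calculation(1) calculation(3)[of x] by force
 ultimately show ?thesis by blast
qed

lemma diff_TT: "c - d - (TT (nf c) - TT (nf d)) \<in> N" using N_diff[OF nf(2)[of c] nf(2)[of d]] by (simp add: algebra_simps)

text \<open>Valuation at least \<gamma>, in a form that includes the zero class and so avoids case
  distinctions.\<close>

definition ge :: "'g \<Rightarrow> ('g, 's) hahn \<Rightarrow> bool" where "ge \<gamma> c \<equiv> (\<forall>\<beta><\<gamma>. nf c \<beta> = zk)"

lemma geI: "c - d \<in> N \<Longrightarrow> (\<And>\<beta>. \<beta> < \<gamma> \<Longrightarrow> hco d \<beta> = 0) \<Longrightarrow> ge \<gamma> c" unfolding ge_def using nf_lead(1)[of c d] by blast

lemma geE: "ge \<gamma> c \<Longrightarrow> \<beta> < \<gamma> \<Longrightarrow> hco (TT (nf c)) \<beta> = 0" by (simp add: hco_TT nf(1) ge_def T_zk)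

text \<open>Balls are given by initial segments of normal forms. Taking normal forms is not
  additive, but the first disagreement of two of them is the leading exponent of the
  difference.\<close>

lemma ge_diff_iff: "ge \<gamma> (c - d) \<longleftrightarrow> (\<forall>\<beta><\<gamma>. nf c \<beta> = nf d \<beta>)"
proof
 assume g: "ge \<gamma> (c - d)"
 show "\<forall>\<beta><\<gamma>. nf c \<beta> = nf d \<beta>"
 proof (intro allI impI, rule ccontr)
  fix \<beta> assume "\<beta> < \<gamma>" "nf c \<beta> \<noteq> nf d \<beta>"
  then obtain m where m: "m < \<gamma>" "nf c m \<noteq> nf d m" "\<And>x. x < m \<Longrightarrow> nf c x = nf d x"
   using first_diff[OF nf(1) nf(1)] by (meson le_less_trans)
  have "nf (c - d) m = \<pi> (hco (TT (nf c) - TT (nf d)) m)" by (rule nf_lead(2)[OF diff_TT]) (simp add: hco_TT nf(1) m(3))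
  hence "T (nf c m) - T (nf d m) \<in> I" using g m(1) by (simp add: ge_def hco_TT nf(1) I_iff)
  thus False using m(2) pi_I pi_T nf_K by metis
 qed
next
 assume "\<forall>\<beta><\<gamma>. nf c \<beta> = nf d \<beta>"
 thus "ge \<gamma> (c - d)" by (intro geI[OF diff_TT]) (simp add: hco_TT nf(1))
qed

lemma nf_TT:
 assumes "wf f"
 shows "nf (TT f) = f"
proof (rule ccontr)
 assume "nf (TT f) \<noteq> f"
 then obtain \<beta> where "nf (TT f) \<beta> \<noteq> f \<beta>" by auto
 then obtain m where m: "nf (TT f) m \<noteq> f m" "\<And>x. x < m \<Longrightarrow> nf (TT f) x = f x" using first_diff[OF nf(1) assms] by blast
 have "hco (TT f - TT (nf (TT f))) m \<in> I" by (rule N_lead[OF nf(2)]) (simp add: hco_TT nf(1) assms m(2))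
 hence "T (f m) - T (nf (TT f) m) \<in> I" by (simp add: hco_TT nf(1) assms)
 thus False using m(1) pi_I pi_T nf_K assms unfolding wf_def by metis
qed

lemma ge_N: "c \<in> N \<Longrightarrow> ge \<gamma> c" by (rule geI[of _ 0]) auto

lemma N_iff: "c \<in> N \<longleftrightarrow> (\<forall>\<beta>. nf c \<beta> = zk)"
proof
 show "c \<in> N \<Longrightarrow> \<forall>\<beta>. nf c \<beta> = zk" using nf_lead(2)[of c 0] pi_zero by simp
 assume "\<forall>\<beta>. nf c \<beta> = zk"
 hence "hco (TT (nf c)) g = 0" for g by (subst hco_TT[OF nf(1)]) (simp add: T_zk)
 hence "TT (nf c) = 0" by (intro hahn_eqI) simp
 thus "c \<in> N" using nf(2)[of c] by simp
qed

lemma nf_eq_iff: "nf c = nf d \<longleftrightarrow> c - d \<in> N"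
proof
 assume "nf c = nf d"
 thus "c - d \<in> N" using diff_TT[of c d] by simp
next
 assume cd: "c - d \<in> N"
 show "nf c = nf d"
 proof (rule ccontr)
  assume "nf c \<noteq> nf d"
  then obtain \<beta> where "nf c \<beta> \<noteq> nf d \<beta>" by auto
  then obtain m where m: "nf c m \<noteq> nf d m" "\<And>x. x < m \<Longrightarrow> nf c x = nf d x" using first_diff[OF nf(1) nf(1)] by blast
  have "TT (nf c) - TT (nf d) \<in> N" using N_diff[OF cd diff_TT[of c d]] by simp
  hence "hco (TT (nf c) - TT (nf d)) m \<in> I" by (rule N_lead) (simp add: hco_TT nf(1) m(2))
  hence "T (nf c m) - T (nf d m) \<in> I" by (simp add: hco_TT nf(1))
  thus False using m(1) pi_I pi_T nf_K by metis
 qed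
qed

lemma ge_add: "ge \<gamma> c \<Longrightarrow> ge \<gamma> d \<Longrightarrow> ge \<gamma> (c + d)"
proof (rule geI)
 show "c + d - (TT (nf c) + TT (nf d)) \<in> N" using N_add[OF nf(2)[of c] nf(2)[of d]] by (simp add: algebra_simps)
qed (simp add: geE)

lemma N_mult_cong: "c - c' \<in> N \<Longrightarrow> d - d' \<in> N \<Longrightarrow> c * d - c' * d' \<in> N"
proof -
 assume a: "c - c' \<in> N" "d - d' \<in> N"
 have "c * (d - d') + d' * (c - c') \<in> N" by (intro N_add N_mult a)
 thus ?thesis by (simp add: algebra_simps)
qed

lemma hco_mult_below:
 fixes c d :: "('g, 's) hahn"
 assumes "\<And>x. x < \<gamma> \<Longrightarrow> hco c x = 0" "\<And>x. x < \<beta> \<Longrightarrow> hco d x = 0"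
 shows "x < \<gamma> + \<beta> \<Longrightarrow> hco (c * d) x = 0" "hco (c * d) (\<gamma> + \<beta>) = hco c \<gamma> * hco d \<beta>"
proof -
 show "hco (c * d) x = 0" if "x < \<gamma> + \<beta>"
 proof (rule ccontr)
  assume "hco (c * d) x \<noteq> 0"
  then obtain a where "hco c a \<noteq> 0" "hco d (x - a) \<noteq> 0" using hco_times_nonzero by blast
  hence "\<gamma> \<le> a" "\<beta> \<le> x - a" using assms by (meson not_le)+
  hence "\<gamma> + \<beta> \<le> x" using add_mono[of \<gamma> a \<beta> "x - a"] by simp
  thus False using that by simp
 qed
 have "{a. hco c a \<noteq> 0 \<and> hco d (\<gamma> + \<beta> - a) \<noteq> 0} \<subseteq> {\<gamma>}"
 proof (rule subsetI)
  fix a assume "a \<in> {a. hco c a \<noteq> 0 \<and> hco d (\<gamma> + \<beta> - a) \<noteq> 0}"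
  hence "\<gamma> \<le> a" "\<beta> \<le> \<gamma> + \<beta> - a" using assms by (auto simp: not_less[symmetric])
  thus "a \<in> {\<gamma>}" by (simp add: algebra_simps)
 qed
 thus "hco (c * d) (\<gamma> + \<beta>) = hco c \<gamma> * hco d \<beta>" by (subst hco_times[of "{\<gamma>}"]) auto
qed

lemma mult_TT: "c * d - TT (nf c) * TT (nf d) \<in> N" by (rule N_mult_cong) (rule nf(2))+

lemma ge_mult: "ge \<gamma> c \<Longrightarrow> ge \<beta> d \<Longrightarrow> ge (\<gamma> + \<beta>) (c * d)"
 by (rule geI[OF mult_TT], rule hco_mult_below(1)[of \<gamma> _ \<beta>]) (auto simp: geE)

lemma nf_mult: "ge \<gamma> c \<Longrightarrow> ge \<beta> d \<Longrightarrow> nf (c * d) (\<gamma> + \<beta>) = \<pi> (T (nf c \<gamma>) * T (nf d \<beta>))"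
proof -
 assume "ge \<gamma> c" "ge \<beta> d"
 note b = hco_mult_below[of \<gamma> "TT (nf c)" \<beta> "TT (nf d)", OF geE[OF this(1)] geE[OF this(2)]]
 show ?thesis using nf_lead(2)[OF mult_TT b(1)] b(2) by (simp add: hco_TT nf(1))
qed

definition v :: "('g, 's) hahn \<Rightarrow> 'g" where "v c = (SOME \<gamma>. ge \<gamma> c \<and> nf c \<gamma> \<noteq> zk)"

lemma v: 
 assumes "c \<notin> N"
 shows "ge (v c) c" "nf c (v c) \<noteq> zk"
proof -
 obtain \<beta> where b: "nf c \<beta> \<noteq> zk" using assms N_iff by blast
 have "wf (\<lambda>_. zk)" by (simp add: wf_def zk wosupp_finite)
 from first_diff[OF nf(1) this b] have "\<exists>\<gamma>. ge \<gamma> c \<and> nf c \<gamma> \<noteq> zk" by (auto simp: ge_def)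
 hence "ge (v c) c \<and> nf c (v c) \<noteq> zk" unfolding v_def by (rule someI_ex)
 thus "ge (v c) c" "nf c (v c) \<noteq> zk" by auto
qed

lemma v_eq: "ge \<gamma> c \<Longrightarrow> nf c \<gamma> \<noteq> zk \<Longrightarrow> v c = \<gamma>" using v[of c] N_iff[of c] unfolding ge_def by (metis linorder_neqE)

lemma ge_iff: "ge \<gamma> c \<longleftrightarrow> c \<in> N \<or> \<gamma> \<le> v c"
proof (cases "c \<in> N")
 case False
 show ?thesis using v[OF False] False unfolding ge_def by (metis le_less_trans linorder_not_less less_le_trans)
qed (simp add: ge_N)

lemma not_zk_notin_N: "nf c \<gamma> \<noteq> zk \<Longrightarrow> c \<notin> N" using N_iff by blast

lemma v_mult:
 assumes "c \<notin> N" "d \<notin> N"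
 shows "c * d \<notin> N" "v (c * d) = v c + v d"
proof -
 have "T (nf c (v c)) * T (nf d (v d)) \<notin> I" using v assms pidealD(6)[OF I] T_I nf_K by blast
 hence "nf (c * d) (v c + v d) \<noteq> zk" using nf_mult[OF v(1) v(1)] assms I_iff by simp
 thus "c * d \<notin> N" "v (c * d) = v c + v d" using not_zk_notin_N v_eq[OF ge_mult[OF v(1) v(1)]] assms by blast+
qed

lemma nf_hmon: "ge \<gamma> (hmon \<gamma> s)" "nf (hmon \<gamma> s) \<gamma> = \<pi> s"
 using geI[of "hmon \<gamma> s" "hmon \<gamma> s" \<gamma>] nf_lead(2)[of "hmon \<gamma> s" "hmon \<gamma> s" \<gamma>] N0 by auto

lemma hmon_N: "s \<notin> I \<Longrightarrow> hmon \<gamma> s \<notin> N" and v_hmon: "s \<notin> I \<Longrightarrow> v (hmon \<gamma> s) = \<gamma>"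
 using nf_hmon[of \<gamma> s] not_zk_notin_N v_eq I_iff by metis+

lemma pideal_N: "pideal N" unfolding pideal_def
proof (intro conjI ballI allI impI)
 show "1 \<notin> N" using hmon_N[of 1 0] pidealD(2)[OF I] by (simp add: hmon_one)
 show "x \<in> N \<or> y \<in> N" if "x * y \<in> N" for x y using v_mult(1) that by blast
qed (auto simp: N0 N_add N_mult)

text \<open>The residue of an element of nonnegative valuation, lifted to the coefficient ring;
  compatibility with the operations holds modulo \<open>I\<close>.\<close>

definition rs :: "('g, 's) hahn \<Rightarrow> 's" where "rs c = T (nf c 0)"

lemma rs_N: "rs c \<in> I \<longleftrightarrow> nf c 0 = zk" by (simp add: rs_def T_I nf_K)

lemma rs_zero: "rs 0 = 0" using N0 N_iff[of 0] T_zk by (simp add: rs_def)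

lemma rs_add: "ge 0 c \<Longrightarrow> ge 0 d \<Longrightarrow> rs (c + d) - (rs c + rs d) \<in> I"
proof -
 assume "ge 0 c" "ge 0 d"
 moreover have "c + d - (TT (nf c) + TT (nf d)) \<in> N" using N_add[OF nf(2)[of c] nf(2)[of d]] by (simp add: algebra_simps)
 ultimately have "nf (c + d) 0 = \<pi> (rs c + rs d)"
  using nf_lead(2)[of "c + d" "TT (nf c) + TT (nf d)" 0] geE by (simp add: hco_TT nf(1) rs_def)
 thus ?thesis using T_pi[of "rs c + rs d"] by (simp add: rs_def)
qed

lemma rs_mult: "ge 0 c \<Longrightarrow> ge 0 d \<Longrightarrow> rs (c * d) - rs c * rs d \<in> I"
 using nf_mult[of 0 c 0 d] T_pi[of "rs c * rs d"] by (simp add: rs_def)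

lemma ge0_mult: "ge 0 c \<Longrightarrow> ge 0 d \<Longrightarrow> ge 0 (c * d)" using ge_mult[of 0 c 0 d] by simp

lemma rs_hmon: "rs (hmon 0 s) - s \<in> I" using nf_hmon[of 0 s] T_pi[of s] by (simp add: rs_def)

lemma rs_poly:
 assumes "\<And>k. ge 0 (pcoeff g k)"
 shows "ge 0 (poly g (hmon 0 s)) \<and> rs (poly g (hmon 0 s)) - poly (map_poly rs g) s \<in> I" using assms
proof (induction g)
 case (pCons a g)
 let ?u = "hmon 0 s"
 have a: "ge 0 a" "\<And>k. ge 0 (pcoeff g k)" using pCons.prems by (metis coeff_pCons_0, metis coeff_pCons_Suc)
 note IH = pCons.IH[OF a(2)]
 have u: "ge 0 ?u" by (rule nf_hmon)
 have 1: "rs (a + ?u * poly g ?u) - (rs a + rs (?u * poly g ?u)) \<in> I" by (intro rs_add a ge0_mult u) (use IH in simp)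
 have 2: "rs (?u * poly g ?u) - rs ?u * rs (poly g ?u) \<in> I" by (intro rs_mult u) (use IH in simp)
 have 3: "s * (rs (poly g ?u) - poly (map_poly rs g) s) \<in> I" by (rule pidealD(4)[OF I]) (use IH in simp)
 have 4: "rs (poly g ?u) * (rs ?u - s) \<in> I" by (rule pidealD(4)[OF I]) (rule rs_hmon)
 have "(rs (a + ?u * poly g ?u) - (rs a + rs (?u * poly g ?u))) + (rs (?u * poly g ?u) - rs ?u * rs (poly g ?u)) +
   s * (rs (poly g ?u) - poly (map_poly rs g) s) + rs (poly g ?u) * (rs ?u - s) \<in> I" by (intro pidealD(3)[OF I] 1 2 3 4)
 hence "rs (a + ?u * poly g ?u) - (rs a + s * poly (map_poly rs g) s) \<in> I" by (simp add: algebra_simps)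
 moreover have "ge 0 (a + ?u * poly g ?u)" by (intro ge_add a ge0_mult u) (use IH in simp)
 ultimately show ?case by (simp add: rs_zero map_poly_pCons)
qed (auto simp: ge_N N0 rs_zero pidealD(1)[OF I])

text \<open>With a_k the Taylor coefficients of \<open>f\<close> at \<open>x\<close>, \<delta> is
  the largest of the slopes (v a_0 - v a_k) / k with k > 0 of the Newton polygon: the distance from
  \<open>x\<close>, measured by the valuation, at which the nearest root is to be expected.\<close>

definition good :: "('g, 's) hahn poly \<Rightarrow> ('g, 's) hahn \<Rightarrow> 'g \<Rightarrow> bool" where
 "good f x \<delta> \<equiv> poly f x \<notin> N \<and>
   (\<forall>k. ge (v (poly f x)) (pcoeff (pcompose f [:x, 1:]) k * hmon (nmul k \<delta>) 1)) \<and>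
   (\<exists>k>0. pcoeff (pcompose f [:x, 1:]) k \<notin> N \<and>
    v (pcoeff (pcompose f [:x, 1:]) k) + nmul k \<delta> = v (poly f x))"

lemma hmon1: "hmon \<gamma> 1 \<notin> N" "v (hmon \<gamma> 1) = \<gamma>" using hmon_N v_hmon pidealD(2)[OF I] by auto

lemma ge_hmon_iff: "ge \<gamma> (c * hmon \<beta> 1) \<longleftrightarrow> c \<in> N \<or> \<gamma> \<le> v c + \<beta>"
 using v_mult[of c "hmon \<beta> 1"] hmon1 ge_iff[of \<gamma>] pidealD(5)[OF pideal_N] by (cases "c \<in> N") auto

lemma coeff_shift_0: "pcoeff (pcompose f [:x, 1:]) 0 = poly f (x :: ('g, 's) hahn)"
 by (metis poly_0_coeff_0 poly_pcompose poly_pCons add.right_neutral mult_zero_left)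

text \<open>Divisibility of the exponent group provides the slopes. Some Taylor coefficient of
  positive index is nonzero, since otherwise shifting back by - x would make \<open>f\<close>
  constant modulo \<open>N\<close>.\<close>

lemma good_exists:
 assumes div: "\<And>k (\<gamma> :: 'g). k > 0 \<Longrightarrow> \<exists>\<beta>. nmul k \<beta> = \<gamma>" and f: "\<exists>i>0. pcoeff f i \<notin> N" and fx: "poly f x \<notin> N"
 shows "\<exists>\<delta>. good f x \<delta>"
proof -
 define a where "a = pcoeff (pcompose f [:x, 1:])"
 define Ks where "Ks = {k. k > 0 \<and> a k \<notin> N}"
 have a0: "a 0 = poly f x" by (simp add: a_def coeff_shift_0)
 have "Ks \<noteq> {}"
 proof
  assume "Ks = {}"
  hence "pcoeff (pcompose f [:x, 1:]) k \<in> N" if "k > 0" for k using that \<open>Ks = {}\<close> unfolding Ks_def a_def by blast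
  hence "pcoeff (pcompose (pcompose f [:x, 1:]) [:- x, 1:]) k \<in> N" if "k > 0" for k
   using poly_shift_closed'[of N "- x", OF N0 N_add N_mult] that by blast
  thus False using f unfolding pcompose_shift_back by blast
 qed
 have "Ks \<subseteq> {..pdegree (pcompose f [:x, 1:])}" using N0 by (auto simp: Ks_def a_def intro!: le_degree)
 hence fin: "finite Ks" using finite_subset by blast
 have "\<forall>k. \<exists>\<beta>. k > 0 \<longrightarrow> nmul k \<beta> = v (a 0) - v (a k)" using div by blast
 then obtain d where d: "\<And>k. k > 0 \<Longrightarrow> nmul k (d k) = v (a 0) - v (a k)" by metis
 define \<delta> where "\<delta> = Max (d ` Ks)"
 have "\<delta> \<in> d ` Ks" unfolding \<delta>_def using fin \<open>Ks \<noteq> {}\<close> by (intro Max_in) auto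
 then obtain k0 where k0: "k0 \<in> Ks" "\<delta> = d k0" by auto
 have le: "v (a 0) \<le> v (a k) + nmul k \<delta>" if "k \<in> Ks" for k
 proof -
  have "d k \<le> \<delta>" using that fin by (simp add: \<delta>_def)
  hence "nmul k (d k) \<le> nmul k \<delta>" by (rule nmul_mono)
  hence "v (a 0) - v (a k) \<le> nmul k \<delta>" using d[of k] that by (simp add: Ks_def)
  thus ?thesis by (simp only: diff_le_eq add.commute)
 qed
 have "ge (v (poly f x)) (a k * hmon (nmul k \<delta>) 1)" for k
 proof (cases "k = 0")
  case True
  thus ?thesis using a0 by (simp add: hmon_one ge_iff)
 next
  case False
  thus ?thesis using le[of k] a0 by (auto simp: ge_hmon_iff Ks_def)
 qed
 moreover have "v (a k0) + nmul k0 \<delta> = v (poly f x)" using k0 d[of k0] a0 by (simp add: Ks_def)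
 ultimately have "good f x \<delta>" using fx k0(1) unfolding good_def a_def[symmetric] by (auto simp: Ks_def)
 thus ?thesis by blast
qed

text \<open>This is f (x + t^\<delta> X) / t^(v (f x)): by the choice of \<delta> it is integral and
  its residue polynomial is not constant.\<close>

definition nrm :: "('g, 's) hahn poly \<Rightarrow> ('g, 's) hahn \<Rightarrow> 'g \<Rightarrow> ('g, 's) hahn poly" where
 "nrm f x \<delta> = psmult (hmon (- v (poly f x)) 1) (pcompose (pcompose f [:x, 1:]) [:0, hmon \<delta> 1:])"

lemma coeff_nrm: "pcoeff (nrm f x \<delta>) k =
  hmon (- v (poly f x)) 1 * (pcoeff (pcompose f [:x, 1:]) k * hmon (nmul k \<delta>) 1)"
 by (simp add: nrm_def coeff_pcompose_scale hmon_power)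

lemma nrm_props:
 assumes "good f x \<delta>"
 shows "ge 0 (pcoeff (nrm f x \<delta>) k)" "\<exists>k>0. nf (pcoeff (nrm f x \<delta>) k) 0 \<noteq> zk"
proof -
 have "ge (- v (poly f x)) (hmon (- v (poly f x)) 1)" by (rule nf_hmon)
 from ge_mult[OF this, of "v (poly f x)"] show "ge 0 (pcoeff (nrm f x \<delta>) k)" using assms by (simp add: coeff_nrm good_def)
 obtain k where k: "k > 0" "pcoeff (pcompose f [:x, 1:]) k \<notin> N"
  "v (pcoeff (pcompose f [:x, 1:]) k) + nmul k \<delta> = v (poly f x)" using assms by (auto simp: good_def)
 hence "pcoeff (nrm f x \<delta>) k \<notin> N" "v (pcoeff (nrm f x \<delta>) k) = 0" unfolding coeff_nrm using v_mult hmon1 by simp_all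
 thus "\<exists>k>0. nf (pcoeff (nrm f x \<delta>) k) 0 \<noteq> zk" using k(1) v(2) by metis
qed

lemma nrm_shift: "pcoeff (pcompose (nrm f x \<delta>) [:u, 1:]) k =
  hmon (- v (poly f x)) 1 * (pcoeff (pcompose f [:x + hmon \<delta> 1 * u, 1:]) k * hmon (nmul k \<delta>) 1)"
proof -
 have "pcompose (pcompose (pcompose f [:x, 1:]) [:0, hmon \<delta> 1:]) [:u, 1:] =
   pcompose (pcompose f [:x + hmon \<delta> 1 * u, 1:]) [:0, hmon \<delta> 1:]"
  by (simp add: pcompose_assoc[symmetric] pcompose_pCons mult.commute)
 thus ?thesis by (simp add: nrm_def pcompose_smult coeff_pcompose_scale hmon_power)
qed

text \<open>Some Taylor coefficient of \<open>nrm f x \<delta>\<close> at \<open>u\<close> of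
  positive index \<open>k\<close> has valuation zero; if all had positive valuation, this would pass
  to the shift back by - u. Comparing the old and the new slope through this index gives the
  inequality, and it is strict if \<open>u\<close> is a root of the residue polynomial, because then
  the valuation of the value of \<open>f\<close> grows.\<close>

lemma good_step:
 assumes g: "good f x \<delta>" and u: "ge 0 u" and g': "good f (x + hmon \<delta> 1 * u) \<delta>'"
 shows "\<delta> \<le> \<delta>'" "nf (poly (nrm f x \<delta>) u) 0 = zk \<Longrightarrow> \<delta> < \<delta>'"
proof -
 let ?x = "x + hmon \<delta> 1 * u" and ?c = "\<lambda>k. pcoeff (pcompose (nrm f x \<delta>) [:u, 1:]) k"
 let ?a = "\<lambda>k. pcoeff (pcompose f [:?x, 1:]) k"
 have c0: "ge 0 (?c k)" for k
  using poly_shift_closed[of "{c. ge 0 c}" u] nrm_props(1)[OF g] ge_N[OF N0] ge_add ge0_mult[OF u] by simp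
 have "\<exists>k>0. nf (?c k) 0 \<noteq> zk"
 proof (rule ccontr)
  assume a: "\<not> (\<exists>k>0. nf (?c k) 0 \<noteq> zk)"
  let ?M = "{c. ge 0 c \<and> nf c 0 = zk}"
  have mu: "ge 0 (- u)" using ge0_mult[OF _ u, of "-1"] nf_hmon(1)[of 0 "- 1"] rhomD(1,5)[OF rhom_hmon]
   by (metis mult_minus1)
  have M: "c + d \<in> ?M" if "c \<in> ?M" "d \<in> ?M" for c d
  proof -
   have "rs (c + d) - (rs c + rs d) \<in> I" using that by (intro rs_add) auto
   moreover have "rs c + rs d \<in> I" using that rs_N by (intro pidealD(3)[OF I]) auto
   ultimately have "rs (c + d) \<in> I" using pidealD(11)[OF I] by blast
   thus ?thesis using that ge_add by (simp add: rs_N)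
  qed
  have Mm: "- u * c \<in> ?M" if "c \<in> ?M" for c
  proof -
   have "rs (- u * c) - rs (- u) * rs c \<in> I" using that by (intro rs_mult mu) auto
   moreover have "rs (- u) * rs c \<in> I" using that rs_N by (intro pidealD(4)[OF I]) auto
   ultimately have "rs (- u * c) \<in> I" using pidealD(11)[OF I] by blast
   thus ?thesis using that ge0_mult[OF mu, of c] rs_N[of "- u * c"] by simp
  qed
  have M0: "0 \<in> ?M" using N0 N_iff[of 0] ge_N by auto
  have "?c j \<in> ?M" if "j > 0" for j using a that c0 by blast
  hence "pcoeff (pcompose (pcompose (nrm f x \<delta>) [:u, 1:]) [:- u, 1:]) j \<in> ?M" if "j > 0" for j
   using poly_shift_closed'[of ?M "- u", OF M0 M Mm] that by blast
  thus False using nrm_props(2)[OF g] by (auto simp: pcompose_shift_back)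
 qed
 then obtain k where k: "k > 0" "nf (?c k) 0 \<noteq> zk" by blast
 have t: "hmon (- v (poly f x)) 1 \<notin> N" "v (hmon (- v (poly f x)) 1) = - v (poly f x)" by (rule hmon1)+
 have ak: "?a k \<notin> N" using not_zk_notin_N[OF k(2)] unfolding nrm_shift by (meson pidealD(4,5)[OF pideal_N])
 have "v (?c k) = 0" by (rule v_eq[OF c0 k(2)])
 hence vk: "v (?a k) + nmul k \<delta> = v (poly f x)" unfolding nrm_shift using v_mult ak t hmon1 by (simp add: add_eq_0_iff)
 have fx': "poly f ?x \<notin> N" using g' by (simp add: good_def)
 have vk': "v (poly f ?x) \<le> v (?a k) + nmul k \<delta>'" using g' ak ge_hmon_iff unfolding good_def by blast
 have c00: "?c 0 = hmon (- v (poly f x)) 1 * poly f ?x" unfolding nrm_shift unfolding coeff_shift_0 by (simp add: hmon_one)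
 have v0: "?c 0 \<notin> N" "v (?c 0) = v (poly f ?x) - v (poly f x)" unfolding c00 using v_mult[OF t(1) fx'] t by simp_all
 have "v (poly f x) \<le> v (poly f ?x)" using c0[of 0] v0 by (simp add: ge_iff)
 hence "v (?a k) + nmul k \<delta> \<le> v (?a k) + nmul k \<delta>'" unfolding vk using vk' by (rule order_trans)
 hence "nmul k \<delta> \<le> nmul k \<delta>'" by (simp only: add_le_cancel_left)
 thus "\<delta> \<le> \<delta>'" using nmul_le_iff[OF k(1)] by blast
 assume "nf (poly (nrm f x \<delta>) u) 0 = zk"
 hence "nf (?c 0) 0 = zk" by (simp add: coeff_shift_0)
 hence "v (?c 0) \<noteq> 0" using v(2)[OF v0(1)] by metis
 hence "v (poly f x) < v (poly f ?x)" using v0 c0[of 0] by (auto simp: ge_iff)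
 hence "v (?a k) + nmul k \<delta> < v (?a k) + nmul k \<delta>'" unfolding vk using vk' by (rule less_le_trans)
 hence "nmul k \<delta> < nmul k \<delta>'" by (simp only: add_less_cancel_left)
 thus "\<delta> < \<delta>'" using nmul_less_iff[OF k(1)] by blast
qed

text \<open>Spherical completeness. Below its radius each ball prescribes the normal form,
  consistently for different balls, and the glued function is the normal form of a common
  point.\<close>

lemma spherical:
 assumes "\<And>x \<delta> y \<epsilon>. (x, \<delta>) \<in> C \<Longrightarrow> (y, \<epsilon>) \<in> C \<Longrightarrow> \<delta> \<le> \<epsilon> \<Longrightarrow> ge \<delta> (y - x)"
 shows "\<exists>z. \<forall>(x, \<delta>)\<in>C. ge \<delta> (z - x)"
proof -
 have agree: "nf y \<beta> = nf x \<beta>" if "(x, \<delta>) \<in> C" "(y, \<epsilon>) \<in> C" "\<beta> < \<delta>" "\<beta> < \<epsilon>" for x y \<delta> \<epsilon> \<beta>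
  using assms[OF that(1,2)] assms[OF that(2,1)] that(3,4) unfolding ge_diff_iff by (cases "\<delta> \<le> \<epsilon>") auto
 define F where "F \<beta> = (if \<exists>x \<delta>. (x, \<delta>) \<in> C \<and> \<beta> < \<delta> then nf (fst (SOME p. p \<in> C \<and> \<beta> < snd p)) \<beta> else zk)" for \<beta>
 have F: "F \<beta> = nf x \<beta>" if "(x, \<delta>) \<in> C" "\<beta> < \<delta>" for x \<delta> \<beta>
 proof -
  define p where "p = (SOME p. p \<in> C \<and> \<beta> < snd p)"
  have "p \<in> C \<and> \<beta> < snd p" unfolding p_def by (rule someI[of _ "(x, \<delta>)"]) (use that in simp)
  hence "nf (fst p) \<beta> = nf x \<beta>" using agree[OF that(1), of "fst p" "snd p"] that(2) by simp
  thus ?thesis using that unfolding F_def p_def[symmetric] by auto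
 qed
 have "wf F" unfolding wf_def
 proof
  show "\<forall>g. F g \<in> K" by (simp add: F_def nf_K zk)
  show "wosupp {g. F g \<noteq> zk}"
  proof (rule wosupp_I)
   fix D assume D: "D \<subseteq> {g. F g \<noteq> zk}" "D \<noteq> {}"
   then obtain b where b: "b \<in> D" "F b \<noteq> zk" by auto
   then obtain x \<delta> where x: "(x, \<delta>) \<in> C" "b < \<delta>" by (auto simp: F_def split: if_splits)
   \<comment> \<open>Up to \<open>b\<close> the glued function agrees with a single normal form,
     which suffices to find a minimum of \<open>D\<close>.\<close>
   have "{g \<in> D. g \<le> b} \<subseteq> {g. nf x g \<noteq> zk}" using D(1) F[OF x(1)] x(2) by force
   hence "\<exists>m\<in>{g \<in> D. g \<le> b}. \<forall>y\<in>{g \<in> D. g \<le> b}. m \<le> y"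
    using nf(1)[of x] b(1) by (intro wosupp_min[of "{g. nf x g \<noteq> zk}"]) (auto simp: wf_def)
   then obtain m where m: "m \<in> D" "m \<le> b" "\<And>y. y \<in> D \<Longrightarrow> y \<le> b \<Longrightarrow> m \<le> y" by blast
   hence "\<forall>y\<in>D. m \<le> y" by (meson linear order_trans)
   thus "\<exists>m\<in>D. \<forall>x\<in>D. m \<le> x" using m(1) by blast
  qed
 qed
 thus ?thesis using F by (intro exI[of _ "TT F"]) (auto simp: ge_diff_iff nf_TT)
qed

text \<open>Take a maximal chain of approximations with increasing slopes and a point
  \<open>z\<close> common to its balls. If there were no root, one more Newton step from
  \<open>z\<close>, directed by a root of the residue polynomial, would give an approximation beyond
  the whole chain.\<close>

theorem acl_N:
 assumes div: "\<And>k (\<gamma> :: 'g). k > 0 \<Longrightarrow> \<exists>\<beta>. nmul k \<beta> = \<gamma>" and acl: "acl I"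
 shows "acl N" unfolding acl_def
proof (intro allI impI)
 fix f assume f: "\<exists>i>0. pcoeff f i \<notin> N"
 define R where "R = (\<lambda>(x, \<delta>) (y, \<epsilon>). \<delta> < \<epsilon> \<and> ge \<delta> (y - x :: ('g, 's) hahn))"
 define A where "A = {(x, \<delta>). good f x \<delta>}"
 obtain C where C: "pred_on.maxchain A R C" using pred_on.Hausdorff by blast
 have ch: "pred_on.chain A R C" using C by (rule pred_on.maxchain_imp_chain)
 have sph: "ge \<delta> (y - x)" if "(x, \<delta>) \<in> C" "(y, \<epsilon>) \<in> C" "\<delta> \<le> \<epsilon>" for x \<delta> y \<epsilon>
 proof -
  have "(x, \<delta>) = (y, \<epsilon>) \<or> R (x, \<delta>) (y, \<epsilon>) \<or> R (y, \<epsilon>) (x, \<delta>)" using pred_on.chain_total[OF ch that(1,2)] by auto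
  thus ?thesis using that(3) ge_N[OF N0] by (auto simp: R_def)
 qed
 have "\<exists>z. \<forall>(x, \<delta>)\<in>C. ge \<delta> (z - x)" using sph by (intro spherical) blast
 then obtain z where z: "\<And>x \<delta>. (x, \<delta>) \<in> C \<Longrightarrow> ge \<delta> (z - x)" by auto
 have up: "\<exists>u. ge 0 u \<and> y = x + hmon \<delta> 1 * u" if "ge \<delta> (y - x)" for x y \<delta>
 proof (intro exI conjI)
  show "ge 0 ((y - x) * hmon (- \<delta>) 1)" using ge_mult[OF that nf_hmon(1)[of "- \<delta>" 1]] by simp
  show "y = x + hmon \<delta> 1 * ((y - x) * hmon (- \<delta>) 1)"
  proof -
   have "hmon \<delta> 1 * hmon (- \<delta>) 1 = (1 :: ('g, 's) hahn)" by (rule hmon_inverse)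
   thus ?thesis by (simp add: mult.left_commute)
  qed
 qed
 have down: "ge \<delta> (hmon \<delta> 1 * u)" if "ge 0 u" for u \<delta> using ge_mult[OF nf_hmon(1)[of \<delta> 1] that] by simp
 have inA: "good f x \<delta>" if "(x, \<delta>) \<in> C" for x \<delta> using ch that by (auto simp: pred_on.chain_def A_def)
 show "\<exists>x. poly f x \<in> N"
 proof (rule ccontr)
  assume no: "\<not> ?thesis"
  obtain \<delta>z where gz: "good f z \<delta>z" using good_exists[OF div f] no by blast
  have le: "\<delta> \<le> \<delta>z" if "(x, \<delta>) \<in> C" for x \<delta> using up[OF z[OF that]] good_step(1)[OF inA[OF that]] gz by blast
  define G where "G = map_poly rs (nrm f z \<delta>z)"
  have cG: "pcoeff G k = rs (pcoeff (nrm f z \<delta>z) k)" for k by (simp add: G_def coeff_map_poly rs_zero)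
  obtain s where s: "poly G s \<in> I" using acl nrm_props(2)[OF gz] rs_N cG unfolding acl_def by metis
  define u where "u = hmon (0::'g) s"
  have u: "ge 0 u" by (simp add: u_def nf_hmon)
  have "rs (poly (nrm f z \<delta>z) u) - poly G s \<in> I"
   using rs_poly[of "nrm f z \<delta>z" s] nrm_props(1)[OF gz] by (simp add: u_def G_def)
  hence "rs (poly (nrm f z \<delta>z) u) \<in> I" using s pidealD(11)[OF I] by blast
  hence r0: "nf (poly (nrm f z \<delta>z) u) 0 = zk" by (simp add: rs_N)
  define y where "y = z + hmon \<delta>z 1 * u"
  obtain \<delta>y where gy: "good f y \<delta>y" using good_exists[OF div f] no by blast
  have lt: "\<delta>z < \<delta>y" using good_step(2)[OF gz u] gy r0 by (simp add: y_def)
  have "R (x, \<delta>) (y, \<delta>y)" if "(x, \<delta>) \<in> C" for x \<delta>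
  proof -
   have "ge \<delta> (hmon \<delta>z 1 * u)" using down[OF u, of \<delta>z] le[OF that] by (auto simp: ge_iff)
   hence "ge \<delta> ((z - x) + hmon \<delta>z 1 * u)" using z[OF that] ge_add by blast
   thus ?thesis using le[OF that] lt by (simp add: R_def y_def algebra_simps)
  qed
  hence "pred_on.chain A R (insert (y, \<delta>y) C)" using ch gy unfolding pred_on.chain_def by (auto simp: A_def)
  moreover have "(y, \<delta>y) \<notin> C" using le lt by force
  ultimately show False using C unfolding pred_on.maxchain_def by blast
 qed
qed

end

section \<open>The exponent group and the Hahn fields over an algebraically closed field\<close>

typedef 'a wo = "UNIV :: 'a set" by simp

definition the_wo :: "('a \<times> 'a) set" where
 "the_wo = (SOME r. Well_order r \<and> Field r = UNIV)"

lemma the_wo: "Well_order (the_wo :: ('a \<times> 'a) set)" "Field (the_wo :: ('a \<times> 'a) set) = UNIV"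
proof -
 have "Well_order (the_wo :: ('a \<times> 'a) set) \<and> Field (the_wo :: ('a \<times> 'a) set) = UNIV"
  unfolding the_wo_def by (rule someI_ex) (rule well_ordering)
 thus "Well_order (the_wo :: ('a \<times> 'a) set)" "Field (the_wo :: ('a \<times> 'a) set) = UNIV" by auto
qed

instantiation wo :: (type) linorder
begin

definition less_eq_wo :: "'a wo \<Rightarrow> 'a wo \<Rightarrow> bool" where
 "x \<le> y \<equiv> (Rep_wo x, Rep_wo y) \<in> the_wo"

definition less_wo :: "'a wo \<Rightarrow> 'a wo \<Rightarrow> bool" where
 "x < y \<equiv> x \<le> y \<and> \<not> y \<le> (x :: 'a wo)"

instance
proof
 have l: "Linear_order (the_wo :: ('a \<times> 'a) set)" using the_wo(1)[where 'a = 'a] by (simp add: well_order_on_def)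
 hence r: "refl (the_wo :: ('a \<times> 'a) set)" and t: "trans (the_wo :: ('a \<times> 'a) set)"
  and a: "antisym (the_wo :: ('a \<times> 'a) set)" and tot: "total (the_wo :: ('a \<times> 'a) set)"
  using the_wo(2)[where 'a = 'a] by (auto simp: order_on_defs)
 fix x y z :: "'a wo"
 show "x < y \<longleftrightarrow> x \<le> y \<and> \<not> y \<le> x" by (simp add: less_wo_def)
 show "x \<le> x" using r by (simp add: less_eq_wo_def refl_on_def)
 show "x \<le> y \<Longrightarrow> y \<le> z \<Longrightarrow> x \<le> z" using t unfolding less_eq_wo_def by (rule transD)
 show "x \<le> y \<Longrightarrow> y \<le> x \<Longrightarrow> x = y" using a by (metis antisymD less_eq_wo_def Rep_wo_inject)
 show "x \<le> y \<or> y \<le> x" using tot r unfolding less_eq_wo_def total_on_def refl_on_def by (metis UNIV_I)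
qed

end

text \<open>A divisible ordered group with arbitrarily many independent elements: finitely supported
  rational vectors, ordered lexicographically along a chosen well-order of the indices. The
  well-order lives on the copy \<open>'j wo\<close>, clear of any order that the index type may
  carry.\<close>

type_synonym 'j gam = "'j wo \<Rightarrow>\<^sub>0 rat"

definition gb :: "'j \<Rightarrow> 'j gam" where "gb j = psingle (Abs_wo j) 1"

lemma gb_pos: "0 < gb j"
proof -
 have "less_fun (\<lambda>_. 0) (\<lambda>k'. (1::rat) when Abs_wo j = k')"
  by (rule less_funI) (auto simp: when_def intro!: exI[of _ "Abs_wo j"])
 thus ?thesis unfolding gb_def less_poly_mapping.rep_eq by (simp add: zero_poly_mapping.rep_eq single.rep_eq)
qed

lemma lookup_nmul: "plk (nmul k x) i = of_nat k * plk (x :: 'j gam) i" by (induction k) (auto simp: lookup_add algebra_simps)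

lemma gam_div:
 assumes "k > 0"
 shows "\<exists>\<beta>. nmul k \<beta> = (\<gamma> :: 'j gam)"
proof
 show "nmul k (Poly_Mapping.map (\<lambda>r. r / of_nat k) \<gamma>) = \<gamma>"
  by (rule poly_mapping_eqI) (use assms in "auto simp: lookup_nmul Poly_Mapping.map.rep_eq when_def")
qed

lemma lookup_of_nat_times: "plk (of_nat n * z) m = of_nat n * plk (z :: ('v, int) mpol) m"
 by (induction n) (auto simp: lookup_add algebra_simps)

lemma mconst_of_int: "mconst c = (of_int c :: ('v, int) mpol)" using rhomD(10)[OF rhom_mconst[where 'c = int], of c] by simp

lemma zpol_induct:
 assumes "Q 1" "\<And>a. Q (mvar a)" "\<And>x y. Q x \<Longrightarrow> Q y \<Longrightarrow> Q (x - y)" "\<And>x y. Q x \<Longrightarrow> Q y \<Longrightarrow> Q (x * y)"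
 shows "Q (z :: ('v, int) mpol)"
proof -
 have 0: "Q 0" using assms(3)[of 1 1] assms(1) by simp
 have m: "Q (- x)" if "Q x" for x using assms(3)[OF 0 that] by simp
 have a: "Q (x + y)" if "Q x" "Q y" for x y using assms(3)[OF that(1) m[OF that(2)]] by simp
 have n: "Q (of_nat n)" for n by (induction n) (auto simp: 0 assms(1) a)
 have "Q (of_int i)" for i by (cases i rule: int_cases2) (auto simp: n m)
 thus ?thesis by (induction z rule: mpol_induct) (simp_all add: mconst_of_int assms(2,4) a)
qed

definition msub :: "('v \<Rightarrow> ('w, int) mpol) \<Rightarrow> ('v, int) mpol \<Rightarrow> ('w, int) mpol" where
 "msub g = meval of_int g"

lemma rhom_msub: "rhom (msub g)" unfolding msub_def by (rule rhom_meval[OF rhom_of_int])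

lemma msub_mvar [simp]: "msub g (mvar a) = g a" unfolding msub_def by (rule meval_mvar[OF rhom_of_int])

lemma zpol_hom_eqI:
 assumes "rhom f" "rhom g" "\<And>a. f (mvar a) = g (mvar a)"
 shows "f z = g (z :: ('v, int) mpol)" by (induction z rule: zpol_induct) (use assms in "auto simp: rhomD")

text \<open>Treats zero and positive characteristic uniformly, since 0 divides only 0.\<close>

definition char_of :: "('a, 'm) ring_scheme \<Rightarrow> nat \<Rightarrow> bool" where
 "char_of R q \<equiv> (\<forall>n::nat. [n] \<cdot>\<^bsub>R\<^esub> \<one>\<^bsub>R\<^esub> = \<zero>\<^bsub>R\<^esub> \<longleftrightarrow> q dvd n)"

locale acfield = field R for R (structure) +
 assumes acl_ker: "acl {z. mev z = \<zero>}"
begin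

definition ker :: "('a, int) mpol set" where "ker = {z. mev z = \<zero>}"

text \<open>A section of \<open>mev\<close> on the carrier that lifts zero to 0, so that lifting
  coefficients never enlarges a support.\<close>

definition tch :: "'a \<Rightarrow> ('a, int) mpol" where "tch a = (if a = \<zero> then 0 else mvar a)"

lemma ker: "pideal ker" unfolding ker_def by (rule pideal_phom[OF domain_axioms phom_mev])

lemma ker_diff: "x - y \<in> ker \<longleftrightarrow> mev x = mev y" unfolding ker_def using phomD(10)[OF is_cring phom_mev] by simp

lemma mev_tch: "a \<in> carrier R \<Longrightarrow> mev (tch a) = a" by (simp add: tch_def mev_var mev_zero)

lemma of_nat_ker: "of_nat n \<in> ker \<longleftrightarrow> [n] \<cdot> \<one> = \<zero>" unfolding ker_def using phomD(11)[OF is_cring phom_mev] by simp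

text \<open>Being the identity outside the carrier keeps the variables that stand for zero under
  \<open>mev\<close> among themselves, so that renaming variables by \<tau> induces \<tau>.\<close>

definition autos :: "('a \<Rightarrow> 'a) set" where "autos = {\<tau>. \<tau> \<in> ring_hom R R \<and> (\<forall>a. a \<notin> carrier R \<longrightarrow> \<tau> a = a)}"

definition vmap :: "('a \<Rightarrow> 'a) \<Rightarrow> ('a, int) mpol \<Rightarrow> ('a, int) mpol" where
 "vmap s = msub (\<lambda>a. mvar (s a))"

lemma rhom_vmap: "rhom (vmap \<tau>)" unfolding vmap_def by (rule rhom_msub)

lemma vmap_mvar [simp]: "vmap \<tau> (mvar a) = mvar (\<tau> a)" by (simp add: vmap_def)

lemma mev_vmap:
 assumes "\<tau> \<in> autos"
 shows "mev (vmap \<tau> z) = \<tau> (mev z)"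
proof -
 have h: "\<tau> \<in> ring_hom R R" "\<And>a. a \<notin> carrier R \<Longrightarrow> \<tau> a = a" using assms by (auto simp: autos_def)
 have z: "\<tau> \<zero> = \<zero>" using ring_hom_zero[OF h(1)] is_ring by simp
 note R = phomD[OF is_cring phom_mev] and S = rhomD[OF rhom_vmap]
 have c: "mev z \<in> carrier R" for z by simp
 show ?thesis
 proof (induction z rule: zpol_induct)
  case 1
  show ?case using ring_hom_one[OF h(1)] by (simp add: S mev_one)
 next
  case (2 a)
  show ?case using h ring_hom_closed[OF h(1)] z by (auto simp: mev_var)
 next
  case (3 x y)
  have "\<tau> (\<ominus> mev y) = \<ominus> \<tau> (mev y)" using ring_hom_cring.hom_a_inv[of R R \<tau> "mev y"] h(1) is_cring
   by (simp add: ring_hom_cring_def ring_hom_cring_axioms_def)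
  thus ?case using 3 ring_hom_add[OF h(1), of "mev x" "\<ominus> mev y"] by (simp add: S R a_minus_def)
 next
  case (4 x y)
  thus ?case using ring_hom_mult[OF h(1), of "mev x" "mev y"] by (simp add: S mev_mult)
 qed
qed

lemma vmap_ker: "\<tau> \<in> autos \<Longrightarrow> z \<in> ker \<Longrightarrow> vmap \<tau> z \<in> ker"
 using ring_hom_zero[of \<tau> R R] is_ring by (auto simp: ker_def mev_vmap autos_def)

lemma hahn_quot_N_eq: "hahn_quot mev ker (carrier R) tch \<zero> (e :: 'g::linordered_ab_group_add) (N_eq ker)"
 by (rule hahn_quot_eq) (auto simp: ker ker_diff mev_tch, simp add: tch_def)

lemma power_root:
 assumes a: "a \<in> carrier R" and n: "n > 0"
 shows "\<exists>b\<in>carrier R. b [^] (n::nat) = a"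
proof -
 let ?f = "pmonom 1 n - [:mvar a:] :: ('a, int) mpol poly"
 have "pcoeff ?f n = 1" using n by (cases n) auto
 hence "\<exists>i>0. pcoeff ?f i \<notin> {z. mev z = \<zero>}" using n by (intro exI[of _ n]) (simp add: mev_one)
 then obtain s where "mev (poly ?f s) = \<zero>" using acl_ker unfolding acl_def by blast
 hence "mev s [^] n = a" using a by (simp add: poly_monom phomD[OF is_cring phom_mev] mev_var)
 thus ?thesis by (intro bexI[of _ "mev s"]) auto
qed

text \<open>The congruence with the p-th power holds for variables and passes to differences and
  products by the binomial identity. The p-th roots demanded by \<open>T_root\<close> exist because
  the field is algebraically closed.\<close>

lemma frobenius_lift:
 assumes p: "Factorial_Ring.prime p" and pR: "[p] \<cdot> \<one> = \<zero>"
 shows "frobenius_lift p (msub (\<lambda>a. mvar a ^ p)) mev ker (carrier R) tch"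
proof -
 let ?\<phi> = "msub (\<lambda>a. mvar a ^ p) :: ('a, int) mpol \<Rightarrow> ('a, int) mpol"
 note \<phi> = rhomD[OF rhom_msub[of "\<lambda>a. mvar a ^ p"]]
 have p0: "p > 0" using p by (rule prime_gt_0_nat)
 have frob: "\<exists>w. ?\<phi> z = z ^ p + of_nat p * w" for z :: "('a, int) mpol"
 proof (induction z rule: zpol_induct)
  case 1
  show ?case by (rule exI[of _ 0]) (simp add: \<phi>)
 next
  case (2 a)
  show ?case by (rule exI[of _ 0]) simp
 next
  case (3 x y)
  then obtain v w where vw: "?\<phi> x = x ^ p + of_nat p * v" "?\<phi> y = y ^ p + of_nat p * w" by blast
  have "x ^ p = (x - y) ^ p + y ^ p + of_nat p * fresh p (x - y) y" using freshman_prime[OF p, of "x - y" y] by simp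
  hence "?\<phi> (x - y) = (x - y) ^ p + of_nat p * (fresh p (x - y) y + v - w)" by (simp add: \<phi> vw algebra_simps)
  thus ?case by blast
 next
  case (4 x y)
  then obtain v w where vw: "?\<phi> x = x ^ p + of_nat p * v" "?\<phi> y = y ^ p + of_nat p * w" by blast
  have "?\<phi> (x * y) = (x * y) ^ p + of_nat p * (x ^ p * w + v * y ^ p + of_nat p * v * w)"
   by (simp add: \<phi> vw power_mult_distrib algebra_simps)
  thus ?case by blast
 qed
 show ?thesis
 proof (rule frobenius_lift.intro)
  show "z = 0" if "of_nat p * z = 0" for z :: "('a, int) mpol"
  proof (rule poly_mapping_eqI)
   fix m
   have "of_nat p * plk z m = 0" using that lookup_of_nat_times[of p z m] by simp
   thus "plk z m = plk 0 m" using p0 by simp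
  qed
  show "?\<phi> (tch a) = tch a ^ p" for a using p0 by (simp add: tch_def \<phi> zero_power)
  show "\<exists>b\<in>carrier R. tch a - tch b ^ p \<in> ker" if a: "a \<in> carrier R" for a
  proof -
   obtain b where "b \<in> carrier R" "b [^] p = a" using power_root[OF a p0] by blast
   thus ?thesis using a by (intro bexI[of _ b]) (simp_all add: ker_diff mev_tch phomD[OF is_cring phom_mev])
  qed
  show "of_nat p \<in> ker" using pR by (simp add: of_nat_ker)
  fix Q :: "('a, int) mpol \<Rightarrow> bool" and z
  assume Q: "Q 1" "\<And>t. ?\<phi> t = t ^ p \<Longrightarrow> Q t" "\<And>x y. Q x \<Longrightarrow> Q y \<Longrightarrow> Q (x - y)" "\<And>x y. Q x \<Longrightarrow> Q y \<Longrightarrow> Q (x * y)"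
  show "Q z" by (rule zpol_induct[of Q, OF Q(1) _ Q(3,4)]) (simp add: Q(2))
 qed (auto simp: p rhom_msub ker ker_diff mev_tch frob)
qed

lemma char_prime:
 assumes "char_of R p" "p \<noteq> 0"
 shows "Factorial_Ring.prime p"
proof (rule prime_nat_iff[THEN iffD2], intro conjI allI impI)
 have z: "of_nat n \<in> ker \<longleftrightarrow> p dvd n" for n using assms(1) by (simp add: char_of_def of_nat_ker)
 have "p \<noteq> 1" using z[of 1] pidealD(2)[OF ker] by auto
 thus "1 < p" using assms(2) by simp
 fix m assume "m dvd p"
 then obtain k where k: "p = m * k" by blast
 hence "of_nat m * of_nat k \<in> ker" using z[of p] by simp
 hence "p dvd m \<or> p dvd k" using pidealD(6)[OF ker] z by blast
 thus "m = 1 \<or> m = p" using k assms(2) by (auto simp: dvd_def)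
qed

lemma of_int_ker:
 assumes "char_of R p"
 shows "of_int n \<in> ker \<longleftrightarrow> int p dvd n"
proof -
 have z: "of_nat n \<in> ker \<longleftrightarrow> p dvd n" for n using assms by (simp add: char_of_def of_nat_ker)
 show ?thesis by (cases n rule: int_cases2) (use pidealD(7)[OF ker] z in auto)
qed

text \<open>\<open>q\<close> is the wanted characteristic of the Hahn field. For
  \<open>q = p\<close>, zero included, the coefficients are reduced as they are; for
  \<open>q = 0\<close> and positive \<open>p\<close> the ideal \<open>N_mix\<close> lifts the
  characteristic to zero, with \<open>e\<close> as the valuation of \<open>p\<close>.\<close>

theorem hahn_field:
 fixes e :: "'j gam"
 assumes e: "0 < e" and p: "char_of R p" and q: "q = p \<or> q = 0"
 shows "\<exists>N. hahn_quot mev ker (carrier R) tch \<zero> e N \<and> pideal N \<and> acl N \<and>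
   (\<forall>n. of_int n \<in> N \<longleftrightarrow> int q dvd n) \<and> (\<forall>\<tau>\<in>autos. \<forall>c\<in>N. hmap (vmap \<tau>) c \<in> N)"
proof -
 have acl: "acl ker" using acl_ker by (simp add: ker_def)
 have go: "pideal N \<and> acl N" if "hahn_quot mev ker (carrier R) tch \<zero> e N" for N
 proof -
  interpret hahn_quot mev ker "carrier R" tch \<zero> e N by (rule that)
  show ?thesis using pideal_N acl_N[OF gam_div acl] by blast
 qed
 show ?thesis
 proof (cases "q = p")
  case True
  have "(of_int n :: ('j gam, ('a, int) mpol) hahn) \<in> N_eq ker \<longleftrightarrow> int q dvd n" for n
  proof -
   have "of_int n = hmon (0 :: 'j gam) (of_int n :: ('a, int) mpol)" using rhomD(10)[OF rhom_hmon] by metis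
   hence "(of_int n :: ('j gam, ('a, int) mpol) hahn) \<in> N_eq ker \<longleftrightarrow> of_int n \<in> ker"
    by (auto simp: N_eq_def pidealD(1)[OF ker])
   thus ?thesis using True of_int_ker[OF p] by simp
  qed
  moreover have "hmap (vmap \<tau>) c \<in> N_eq ker" if "\<tau> \<in> autos" "c \<in> N_eq ker"
   for \<tau> and c :: "('j gam, ('a, int) mpol) hahn" using that vmap_ker by (auto simp: N_eq_def hco_hmap rhomD[OF rhom_vmap])
  ultimately show ?thesis using hahn_quot_N_eq go by blast
 next
  case False
  hence q0: "q = 0" and p0: "p \<noteq> 0" using q by auto
  have pp: "Factorial_Ring.prime p" by (rule char_prime[OF p p0])
  interpret F: frobenius_lift p "msub (\<lambda>a. mvar a ^ p)" mev ker "carrier R" tch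
   by (rule frobenius_lift[OF pp]) (use p in "simp add: char_of_def")
  have hq: "hahn_quot mev ker (carrier R) tch \<zero> e (F.N_mix e)" by (rule F.hahn_quot_mix[OF e]) (auto simp: tch_def)
  have "of_int n \<in> F.N_mix e \<longleftrightarrow> int q dvd n" for n
   using F.N_mix_char[OF e, of n] q0 pidealD(1)[of "F.N_mix e"] go[OF hq] by auto
  moreover have "hmap (vmap \<tau>) c \<in> F.N_mix e" if "\<tau> \<in> autos" "c \<in> F.N_mix e" for \<tau> c
  proof (rule F.N_mix_hmap[OF rhom_vmap _ _ that(2) e])
   show "vmap \<tau> (msub (\<lambda>a. mvar a ^ p) z) = msub (\<lambda>a. mvar a ^ p) (vmap \<tau> z)" for z
    by (rule zpol_hom_eqI[OF rhom_comp[OF rhom_vmap rhom_msub] rhom_comp[OF rhom_msub rhom_vmap]])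
      (simp add: rhomD[OF rhom_vmap])
  qed (rule vmap_ker[OF that(1)])
  ultimately show ?thesis using hq go[OF hq] by blast
 qed
qed

end

section \<open>Partial isomorphisms of residue rings and their extension to algebraic
  elements\<close>

definition corr :: "'a::comm_ring_1 set \<Rightarrow> 'b::comm_ring_1 set \<Rightarrow> ('a \<times> 'b) set \<Rightarrow> bool" where
 "corr N M \<tau> \<equiv> (1, 1) \<in> \<tau> \<and> (\<forall>a b c d. (a, b) \<in> \<tau> \<longrightarrow> (c, d) \<in> \<tau> \<longrightarrow> (a - c, b - d) \<in> \<tau> \<and> (a * c, b * d) \<in> \<tau>) \<and>
   (\<forall>a b. (a, b) \<in> \<tau> \<longrightarrow> a \<in> N \<longleftrightarrow> b \<in> M)"

lemma corrD:
 assumes "corr N M \<tau>"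
 shows "(1, 1) \<in> \<tau>" "(0, 0) \<in> \<tau>" "(a, b) \<in> \<tau> \<Longrightarrow> (c, d) \<in> \<tau> \<Longrightarrow> (a - c, b - d) \<in> \<tau>"
  "(a, b) \<in> \<tau> \<Longrightarrow> (c, d) \<in> \<tau> \<Longrightarrow> (a + c, b + d) \<in> \<tau>"
  "(a, b) \<in> \<tau> \<Longrightarrow> (c, d) \<in> \<tau> \<Longrightarrow> (a * c, b * d) \<in> \<tau>"
  "(a, b) \<in> \<tau> \<Longrightarrow> (- a, - b) \<in> \<tau>" "(a, b) \<in> \<tau> \<Longrightarrow> (a ^ n, b ^ n) \<in> \<tau>"
  "(a, b) \<in> \<tau> \<Longrightarrow> a \<in> N \<longleftrightarrow> b \<in> M"
  "(\<And>i. i \<in> A \<Longrightarrow> (h i, k i) \<in> \<tau>) \<Longrightarrow> (sum h A, sum k A) \<in> \<tau>"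
proof -
 show 1: "(1, 1) \<in> \<tau>" and d: "(a, b) \<in> \<tau> \<Longrightarrow> (c, d) \<in> \<tau> \<Longrightarrow> (a - c, b - d) \<in> \<tau>"
  and m: "(a, b) \<in> \<tau> \<Longrightarrow> (c, d) \<in> \<tau> \<Longrightarrow> (a * c, b * d) \<in> \<tau>" for a b c d using assms by (auto simp: corr_def)
 show 0: "(0, 0) \<in> \<tau>" using d[OF 1 1] by simp
 show n: "(a, b) \<in> \<tau> \<Longrightarrow> (- a, - b) \<in> \<tau>" for a b using d[OF 0, of a b] by simp
 show p: "(a, b) \<in> \<tau> \<Longrightarrow> (c, d) \<in> \<tau> \<Longrightarrow> (a + c, b + d) \<in> \<tau>" for a b c d using d[of a b "- c" "- d"] n by simp
 show "(a, b) \<in> \<tau> \<Longrightarrow> (a ^ n, b ^ n) \<in> \<tau>" by (induction n) (auto simp: 1 m)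
 show "(a, b) \<in> \<tau> \<Longrightarrow> a \<in> N \<longleftrightarrow> b \<in> M" using assms unfolding corr_def by blast
 show "(\<And>i. i \<in> A \<Longrightarrow> (h i, k i) \<in> \<tau>) \<Longrightarrow> (sum h A, sum k A) \<in> \<tau>" by (induction A rule: infinite_finite_induct) (auto simp: 0 p)
qed

lemma corr_converse: "corr N M \<tau> \<Longrightarrow> corr M N (\<tau>\<inverse>)" unfolding corr_def by simp

text \<open>On residue classes a correspondence is an isomorphism between subrings of the two
  quotients. Keeping it as a relation between representatives spares all choices.\<close>

lemma corr_unique: "corr N M \<tau> \<Longrightarrow> 0 \<in> N \<Longrightarrow> (x, y) \<in> \<tau> \<Longrightarrow> (x, y') \<in> \<tau> \<Longrightarrow> y - y' \<in> M"
 using corrD(3)[of N M \<tau> x y x y'] corrD(8)[of N M \<tau> "x - x" "y - y'"] by auto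

lemma poly_in_ideal:
 assumes N: "pideal N" and "\<And>i. pcoeff f i \<in> N"
 shows "poly f a \<in> N" using assms(2)
proof (induction f)
 case (pCons c f)
 have "c \<in> N" "\<And>i. pcoeff f i \<in> N" using pCons.prems by (metis coeff_pCons_0, metis coeff_pCons_Suc)
 thus ?case using pCons.IH by (simp add: pidealD(3)[OF N] pidealD(4)[OF N])
qed (simp add: pidealD(1)[OF N])

lemma coeff_mult_in_ideal:
 assumes N: "pideal N" and "\<And>i. pcoeff f i \<in> N"
 shows "pcoeff (f * g) i \<in> N" unfolding coeff_mult by (intro pidealD(9)[OF N] pidealD(5)[OF N] assms)

definition prp :: "('a::comm_ring_1 \<times> 'b::comm_ring_1) set \<Rightarrow> 'a poly \<Rightarrow> 'b poly \<Rightarrow> bool" where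
 "prp \<tau> f g \<equiv> (\<forall>i. (pcoeff f i, pcoeff g i) \<in> \<tau>)"

definition below :: "nat \<Rightarrow> 'a::comm_ring_1 poly \<Rightarrow> 'b::comm_ring_1 poly \<Rightarrow> bool" where
 "below n f g \<equiv> (\<forall>i\<ge>n. pcoeff f i = 0 \<and> pcoeff g i = 0)"

context
 fixes N :: "'a::comm_ring_1 set" and M :: "'b::comm_ring_1 set" and \<tau> :: "('a \<times> 'b) set"
 assumes N: "pideal N" and M: "pideal M" and c: "corr N M \<tau>"
begin

lemma prp_diff: "prp \<tau> f g \<Longrightarrow> prp \<tau> f' g' \<Longrightarrow> prp \<tau> (f - f') (g - g')"
 and prp_add: "prp \<tau> f g \<Longrightarrow> prp \<tau> f' g' \<Longrightarrow> prp \<tau> (f + f') (g + g')"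
 and prp_mult: "prp \<tau> f g \<Longrightarrow> prp \<tau> f' g' \<Longrightarrow> prp \<tau> (f * f') (g * g')"
 and prp_smult: "(a, b) \<in> \<tau> \<Longrightarrow> prp \<tau> f g \<Longrightarrow> prp \<tau> (psmult a f) (psmult b g)"
 and prp_monom: "(a, b) \<in> \<tau> \<Longrightarrow> prp \<tau> (pmonom a n) (pmonom b n)" and prp_0: "prp \<tau> 0 0"
 and prp_cutoff: "prp \<tau> f g \<Longrightarrow> prp \<tau> (poly_cutoff n f) (poly_cutoff n g)"
 using corrD(2-6)[OF c] by (auto simp: prp_def coeff_mult coeff_poly_cutoff intro!: corrD(9)[OF c])

lemma prp_N: "prp \<tau> f g \<Longrightarrow> pcoeff f i \<in> N \<longleftrightarrow> pcoeff g i \<in> M" using corrD(8)[OF c] by (simp add: prp_def)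

lemma below_ex: "\<exists>d. below d f g"
 by (rule exI[of _ "Suc (max (pdegree f) (pdegree g))"]) (auto simp: below_def intro!: coeff_eq_0)

text \<open>Both polynomials are cut off above the last coefficient outside \<open>N\<close>. The
  removed coefficients lie in \<open>N\<close> and \<open>M\<close>, so values change only modulo
  these ideals.\<close>

lemma top_coeff:
 assumes fg: "prp \<tau> f g" and i: "pcoeff f i \<notin> N"
 shows "\<exists>n f' g'. prp \<tau> f' g' \<and> below (Suc n) f' g' \<and> pcoeff f' n \<notin> N \<and>
   (poly f' a \<in> N \<longleftrightarrow> poly f a \<in> N) \<and> (poly g' b \<in> M \<longleftrightarrow> poly g b \<in> M) \<and> pcoeff f n \<notin> N"
proof -
 let ?S = "{i. pcoeff f i \<notin> N}"
 have "?S \<subseteq> {..pdegree f}" using pidealD(1)[OF N] by (auto intro!: le_degree)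
 hence fin: "finite ?S" using finite_subset by blast
 define n where "n = Max ?S"
 have n: "pcoeff f n \<notin> N" using Max_in[OF fin] i by (auto simp: n_def)
 have up: "pcoeff f j \<in> N" if "j > n" for j using Max_ge[OF fin, of j] that by (auto simp: n_def)
 have "poly (f - poly_cutoff (Suc n) f) a \<in> N"
  by (rule poly_in_ideal[OF N]) (use up pidealD(1)[OF N] in "auto simp: coeff_poly_cutoff less_Suc_eq_le not_le")
 hence 1: "poly (poly_cutoff (Suc n) f) a \<in> N \<longleftrightarrow> poly f a \<in> N"
  using pidealD(11)[OF N, of "poly f a" "poly (poly_cutoff (Suc n) f) a"] by simp
 have "poly (g - poly_cutoff (Suc n) g) b \<in> M" by (rule poly_in_ideal[OF M])
    (use up prp_N[OF fg] pidealD(1)[OF M] in "auto simp: coeff_poly_cutoff less_Suc_eq_le not_le")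
 hence 2: "poly (poly_cutoff (Suc n) g) b \<in> M \<longleftrightarrow> poly g b \<in> M"
  using pidealD(11)[OF M, of "poly g b" "poly (poly_cutoff (Suc n) g) b"] by simp
 show ?thesis using 1 2 n prp_cutoff[OF fg]
  by (intro exI[of _ n] exI[of _ "poly_cutoff (Suc n) f"] exI[of _ "poly_cutoff (Suc n) g"])
    (auto simp: below_def coeff_poly_cutoff)
qed

text \<open>The domain of a correspondence need not contain inverses, so the two polynomials are
  divided in parallel after multiplication by powers of the leading coefficients, each step on one
  side being related to that on the other.\<close>

lemma pseudo_div:
 assumes fg0: "prp \<tau> f0 g0" "below (Suc n) f0 g0" and fg: "prp \<tau> f g" "below d f g"
 shows "\<exists>m q q' r r'. prp \<tau> q q' \<and> prp \<tau> r r' \<and> below n r r' \<and> (\<forall>i. i + n \<ge> d \<longrightarrow> pcoeff q i = 0) \<and>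
   psmult (pcoeff f0 n ^ m) f = q * f0 + r \<and> psmult (pcoeff g0 n ^ m) g = q' * g0 + r'" using fg
proof (induction d arbitrary: f g)
 case 0
 hence "below n f g" by (simp add: below_def)
 thus ?case using 0
  by (intro exI[of _ "0::nat"] exI[of _ "0 :: 'a poly"] exI[of _ "0 :: 'b poly"] exI[of _ f] exI[of _ g]) (simp add: prp_0)
next
 case (Suc d)
 show ?case
 proof (cases "Suc d \<le> n")
  case True
  hence "below n f g" using Suc.prems(2) by (auto simp: below_def)
  thus ?thesis using Suc.prems
   by (intro exI[of _ "0::nat"] exI[of _ "0 :: 'a poly"] exI[of _ "0 :: 'b poly"] exI[of _ f] exI[of _ g]) (simp add: prp_0)
 next
  case False
  hence dn: "n \<le> d" by simp
  let ?l = "pcoeff f0 n" and ?l' = "pcoeff g0 n"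
  let ?m = "pmonom (pcoeff f d) (d - n)" and ?m' = "pmonom (pcoeff g d) (d - n)"
  have ll: "(?l, ?l') \<in> \<tau>" using fg0(1) by (simp add: prp_def)
  have mm: "prp \<tau> ?m ?m'" using Suc.prems(1) by (intro prp_monom) (simp add: prp_def)
  have "prp \<tau> (psmult ?l f - ?m * f0) (psmult ?l' g - ?m' * g0)" by (intro prp_diff prp_smult prp_mult mm ll fg0 Suc.prems)
  moreover have "below d (psmult ?l f - ?m * f0) (psmult ?l' g - ?m' * g0)" unfolding below_def
  proof (intro allI impI)
   fix i assume i: "d \<le> i"
   show "pcoeff (psmult ?l f - ?m * f0) i = 0 \<and> pcoeff (psmult ?l' g - ?m' * g0) i = 0"
   proof (cases "i = d")
    case True
    thus ?thesis using dn by (simp add: coeff_monom_mult)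
   next
    case False
    hence "Suc d \<le> i" "Suc n \<le> i - (d - n)" using i dn by auto
    thus ?thesis using Suc.prems(2) fg0(2) dn i by (simp add: below_def coeff_monom_mult)
   qed
  qed
  ultimately obtain m q q' r r' where IH: "prp \<tau> q q'" "prp \<tau> r r'" "below n r r'"
   "\<And>i. i + n \<ge> d \<Longrightarrow> pcoeff q i = 0"
   "psmult (?l ^ m) (psmult ?l f - ?m * f0) = q * f0 + r"
   "psmult (?l' ^ m) (psmult ?l' g - ?m' * g0) = q' * g0 + r'" using Suc.IH by metis
  have "psmult (?l ^ Suc m) f = (q + psmult (?l ^ m) ?m) * f0 + r" using IH(5) by (simp add: smult_diff_right algebra_simps)
  moreover have "psmult (?l' ^ Suc m) g = (q' + psmult (?l' ^ m) ?m') * g0 + r'"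
   using IH(6) by (simp add: smult_diff_right algebra_simps)
  moreover have "prp \<tau> (q + psmult (?l ^ m) ?m) (q' + psmult (?l' ^ m) ?m')"
   by (intro prp_add prp_smult mm IH corrD(7)[OF c] ll)
  moreover have "pcoeff (q + psmult (?l ^ m) ?m) i = 0" if "i + n \<ge> Suc d" for i using that IH(4)[of i] dn by auto
  ultimately show ?thesis using IH(2,3) by blast
 qed
qed

text \<open>Let \<open>f0\<close> have least degree among the polynomials over the domain of \<tau>
  that vanish at \<open>a\<close>, and let \<open>b\<close> be a root of its partner
  \<open>g0\<close>. Then f(a) \<mapsto> g(b) is the wanted extension: that it preserves zero is
  division with remainder, that it reflects zero is the irreducibility of \<open>f0\<close> up to
  constants.\<close>

lemma ext_one:
 assumes acl: "acl M" and fg: "prp \<tau> f g" "pcoeff f i \<notin> N" "poly f a \<in> N"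
 shows "\<exists>\<tau>' b. corr N M \<tau>' \<and> \<tau> \<subseteq> \<tau>' \<and> (a, b) \<in> \<tau>'"
proof -
 define P where "P n \<equiv> (\<exists>f g. prp \<tau> f g \<and> below (Suc n) f g \<and> pcoeff f n \<notin> N \<and> poly f a \<in> N)" for n
 have "\<exists>n. P n" using top_coeff[OF fg(1,2), of a] fg(3) unfolding P_def by blast
 define n where "n = (LEAST n. P n)"
 have "P n" unfolding n_def using \<open>\<exists>n. P n\<close> by (rule LeastI_ex)
 then obtain f0 g0 where fg0: "prp \<tau> f0 g0" "below (Suc n) f0 g0" "pcoeff f0 n \<notin> N" "poly f0 a \<in> N" unfolding P_def by blast
 have min: "pcoeff r j \<in> N" if "prp \<tau> r r'" "\<forall>i\<ge>n. pcoeff r i = 0" "poly r a \<in> N" for r r' j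
 proof (rule ccontr)
  assume "pcoeff r j \<notin> N"
  from top_coeff[OF that(1) this, of a] that(3) obtain k f' g' where k: "prp \<tau> f' g'" "below (Suc k) f' g'"
   "pcoeff f' k \<notin> N" "poly f' a \<in> N" "pcoeff r k \<notin> N" by blast
  have "k < n" using that(2) k(5) pidealD(1)[OF N] by (metis not_le)
  moreover have "P k" using k unfolding P_def by blast
  ultimately show False using not_less_Least[of k P] unfolding n_def by blast
 qed
 let ?l = "pcoeff f0 n" and ?l' = "pcoeff g0 n"
 have l': "?l' \<notin> M" using prp_N fg0 by blast
 have n0: "n > 0"
 proof (rule ccontr)
  assume "\<not> n > 0"
  hence "f0 = [:?l:]" using fg0(2) by (intro poly_eqI) (auto simp: below_def coeff_pCons split: nat.splits)
  hence "poly f0 a = ?l" by (metis add.right_neutral mult_zero_right poly_0 poly_pCons)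
  thus False using fg0(3,4) by simp
 qed
 obtain b where b: "poly g0 b \<in> M" using acl n0 l' unfolding acl_def by blast
 have fwd: "poly g b \<in> M" if fg: "prp \<tau> f g" "poly f a \<in> N" for f g
 proof -
  obtain d where d: "below d f g" using below_ex by blast
  obtain m q q' r r' where r: "prp \<tau> r r'" "below n r r'"
   "psmult (?l ^ m) f = q * f0 + r" "psmult (?l' ^ m) g = q' * g0 + r'" using pseudo_div[OF fg0(1,2) fg(1) d] by blast
  have "poly r a = ?l ^ m * poly f a - poly q a * poly f0 a" using arg_cong[OF r(3), of "\<lambda>h. poly h a"] by simp
  hence "poly r a \<in> N" using fg(2) fg0(4) pidealD(4,8)[OF N] by simp
  hence "pcoeff r j \<in> N" for j using min[OF r(1)] r(2) by (simp add: below_def)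
  hence "poly r' b \<in> M" using prp_N[OF r(1)] by (intro poly_in_ideal[OF M]) blast
  moreover have "?l' ^ m * poly g b = poly q' b * poly g0 b + poly r' b" using arg_cong[OF r(4), of "\<lambda>h. poly h b"] by simp
  ultimately have "?l' ^ m * poly g b \<in> M" using b pidealD(3,4)[OF M] by simp
  thus ?thesis using l' pidealD(6,10)[OF M] by blast
 qed
 \<comment> \<open>If g(b) vanished but f(a) did not, the remainder would be a polynomial of smaller
   degree whose partner vanishes at \<open>b\<close>. The least such \<open>s\<close> divides
   \<open>f0\<close> up to constants, and \<open>a\<close> would be a root of \<open>s\<close> or of
   the cofactor, both of degree below \<open>n\<close>.\<close>
 have bwd: "poly f a \<in> N" if fg: "prp \<tau> f g" "poly g b \<in> M" for f g
 proof (rule ccontr)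
  assume fa: "poly f a \<notin> N"
  obtain d where d: "below d f g" using below_ex by blast
  obtain m q q' r r' where r: "prp \<tau> r r'" "below n r r'"
   "psmult (?l ^ m) f = q * f0 + r" "psmult (?l' ^ m) g = q' * g0 + r'" using pseudo_div[OF fg0(1,2) fg(1) d] by blast
  have "poly r' b = ?l' ^ m * poly g b - poly q' b * poly g0 b" using arg_cong[OF r(4), of "\<lambda>h. poly h b"] by simp
  hence r'b: "poly r' b \<in> M" using fg(2) b pidealD(4,8)[OF M] by simp
  have "\<exists>j. pcoeff r j \<notin> N"
  proof (rule ccontr)
   assume "\<not> ?thesis"
   hence "poly r a \<in> N" by (intro poly_in_ideal[OF N]) blast
   moreover have "?l ^ m * poly f a = poly q a * poly f0 a + poly r a" using arg_cong[OF r(3), of "\<lambda>h. poly h a"] by simp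
   ultimately have "?l ^ m * poly f a \<in> N" using fg0(4) pidealD(3,4)[OF N] by simp
   thus False using fa fg0(3) pidealD(6,10)[OF N] by blast
  qed
  then obtain j where j: "pcoeff r j \<notin> N" by blast
  define Q where "Q k \<equiv> (\<exists>s s'. prp \<tau> s s' \<and> below (Suc k) s s' \<and> pcoeff s k \<notin> N \<and> poly s' b \<in> M)" for k
  obtain k0 where k0: "Q k0" "k0 < n"
  proof -
   from top_coeff[OF r(1) j, of _ b] r'b obtain k s s' where k: "prp \<tau> s s'" "below (Suc k) s s'"
    "pcoeff s k \<notin> N" "poly s' b \<in> M" "pcoeff r k \<notin> N" by blast
   hence "k < n" using r(2) pidealD(1)[OF N] unfolding below_def by (metis not_le)
   thus thesis using that k unfolding Q_def by blast
  qed
  define m1 where "m1 = (LEAST k. Q k)"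
  have "Q m1" unfolding m1_def using k0(1) by (rule LeastI)
  have m1n: "m1 < n" using Least_le[of Q k0] k0 by (simp add: m1_def)
  obtain s s' where s: "prp \<tau> s s'" "below (Suc m1) s s'" "pcoeff s m1 \<notin> N" "poly s' b \<in> M"
   using \<open>Q m1\<close> unfolding Q_def by blast
  have smin: "pcoeff t j \<in> N" if "prp \<tau> t t'" "\<forall>i\<ge>m1. pcoeff t i = 0" "poly t' b \<in> M" for t t' j
  proof (rule ccontr)
   assume "pcoeff t j \<notin> N"
   from top_coeff[OF that(1) this, of _ b] that(3) obtain k f' g' where k: "prp \<tau> f' g'" "below (Suc k) f' g'"
    "pcoeff f' k \<notin> N" "poly g' b \<in> M" "pcoeff t k \<notin> N" by blast
   have "k < m1" using that(2) k(5) pidealD(1)[OF N] by (metis not_le)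
   moreover have "Q k" using k unfolding Q_def by blast
   ultimately show False using not_less_Least[of k Q] unfolding m1_def by blast
  qed
  have m10: "m1 > 0"
  proof (rule ccontr)
   assume "\<not> m1 > 0"
   hence "s' = [:pcoeff s' m1:]" using s(2) by (intro poly_eqI) (auto simp: below_def coeff_pCons split: nat.splits)
   hence "poly s' b = pcoeff s' m1" by (metis add.right_neutral mult_zero_right poly_0 poly_pCons)
   thus False using s prp_N[OF s(1), of m1] by simp
  qed
  let ?c = "pcoeff s m1"
  obtain k q q' t t' where t: "prp \<tau> q q'" "prp \<tau> t t'" "below m1 t t'" "\<And>i. i + m1 \<ge> Suc n \<Longrightarrow> pcoeff q i = 0"
   "psmult (?c ^ k) f0 = q * s + t" "psmult (pcoeff s' m1 ^ k) g0 = q' * s' + t'"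
   using pseudo_div[OF s(1,2) fg0(1,2)] by blast
  have "poly t' b = pcoeff s' m1 ^ k * poly g0 b - poly q' b * poly s' b" using arg_cong[OF t(6), of "\<lambda>h. poly h b"] by simp
  hence "poly t' b \<in> M" using s(4) b pidealD(4,8)[OF M] by simp
  hence tN: "pcoeff t j \<in> N" for j using smin[OF t(2)] t(3) by (simp add: below_def)
  hence ta: "poly t a \<in> N" by (rule poly_in_ideal[OF N])
  have "poly q a * poly s a = ?c ^ k * poly f0 a - poly t a" using arg_cong[OF t(5), of "\<lambda>h. poly h a"] by simp
  hence "poly q a * poly s a \<in> N" using fg0(4) ta pidealD(4,8)[OF N] by simp
  then consider "poly q a \<in> N" | "poly s a \<in> N" using pidealD(6)[OF N] by blast
  thus False
  proof cases
   case 1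
   have "\<forall>i\<ge>n. pcoeff q i = 0" using t(4) m10 by auto
   hence "pcoeff q j \<in> N" for j using min[OF t(1)] 1 by blast
   hence "pcoeff (q * s) n \<in> N" by (rule coeff_mult_in_ideal[OF N])
   hence "pcoeff (q * s + t) n \<in> N" using tN pidealD(3)[OF N] by simp
   hence "?c ^ k * ?l \<in> N" using t(5) by (metis coeff_smult)
   thus False using s(3) fg0(3) pidealD(6,10)[OF N] by blast
  next
   case 2
   have "\<forall>i\<ge>n. pcoeff s i = 0" using s(2) m1n by (auto simp: below_def)
   thus False using min[OF s(1) _ 2] s(3) by blast
  qed
 qed
 define \<tau>' where "\<tau>' = {(poly f a, poly g b) | f g. prp \<tau> f g}"
 have p1: "prp \<tau> 1 1" using prp_monom[OF corrD(1)[OF c], of 0] by (simp add: monom_0 pCons_one)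
 have "corr N M \<tau>'" unfolding corr_def
 proof (intro conjI allI impI)
  show "(1, 1) \<in> \<tau>'" using p1 unfolding \<tau>'_def by (intro CollectI exI[of _ 1]) simp
  fix x y z w
  assume "(x, y) \<in> \<tau>'"
  then obtain f g where 1: "x = poly f a" "y = poly g b" "prp \<tau> f g" by (auto simp: \<tau>'_def)
  show "x \<in> N \<longleftrightarrow> y \<in> M" using 1 fwd bwd by blast
  assume "(z, w) \<in> \<tau>'"
  then obtain h k where 2: "z = poly h a" "w = poly k b" "prp \<tau> h k" by (auto simp: \<tau>'_def)
  show "(x - z, y - w) \<in> \<tau>'" using prp_diff[OF 1(3) 2(3)] 1 2
   unfolding \<tau>'_def by (intro CollectI exI[of _ "f - h"] exI[of _ "g - k"]) simp
  show "(x * z, y * w) \<in> \<tau>'" using prp_mult[OF 1(3) 2(3)] 1 2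
   unfolding \<tau>'_def by (intro CollectI exI[of _ "f * h"] exI[of _ "g * k"]) simp
 qed
 moreover have "\<tau> \<subseteq> \<tau>'"
 proof clarify
  fix x y assume "(x, y) \<in> \<tau>"
  thus "(x, y) \<in> \<tau>'" using prp_monom[of x y 0]
   unfolding \<tau>'_def by (intro CollectI exI[of _ "[:x:]"] exI[of _ "[:y:]"]) (simp add: monom_0)
 qed
 moreover have "(a, b) \<in> \<tau>'" using prp_monom[OF corrD(1)[OF c], of 1] unfolding \<tau>'_def
  by (intro CollectI exI[of _ "pmonom 1 1"] exI[of _ "pmonom 1 1"]) (simp add: poly_monom)
 ultimately show ?thesis by blast
qed

end

lemma prp_converse: "prp (\<tau>\<inverse>) g f \<longleftrightarrow> prp \<tau> f g" by (simp add: prp_def)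

text \<open>A maximal correspondence above \<open>\<tau>0\<close> is closed under roots on both
  sides: a missing partner could be added by \<open>ext_one\<close>, applied to the converse
  relation for the second side.\<close>

theorem corr_extension:
 assumes N: "pideal N" and M: "pideal M" and aN: "acl N" and aM: "acl M" and c: "corr N M \<tau>0"
 shows "\<exists>\<tau>. \<tau>0 \<subseteq> \<tau> \<and> corr N M \<tau> \<and>
   (\<forall>f g i a. prp \<tau> f g \<longrightarrow> pcoeff f i \<notin> N \<longrightarrow> poly f a \<in> N \<longrightarrow> (\<exists>b. (a, b) \<in> \<tau>)) \<and>
   (\<forall>f g i b. prp \<tau> f g \<longrightarrow> pcoeff g i \<notin> M \<longrightarrow> poly g b \<in> M \<longrightarrow> (\<exists>a. (a, b) \<in> \<tau>))"
proof -
 let ?A = "Collect (\<lambda>S. \<tau>0 \<subseteq> S \<and> corr N M S)"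
 have "\<exists>M\<in>?A. \<forall>S\<in>?A. M \<subseteq> S \<longrightarrow> S = M"
 proof (rule subset_Zorn_nonempty)
  show "?A \<noteq> {}" using c by blast
  fix C assume C: "C \<noteq> {}" "subset.chain ?A C"
  hence CA: "\<And>\<tau>. \<tau> \<in> C \<Longrightarrow> \<tau>0 \<subseteq> \<tau> \<and> corr N M \<tau>" by (auto simp: subset.chain_def)
  have two: "\<exists>S\<in>C. p \<in> S \<and> q \<in> S" if pq: "p \<in> \<Union> C" "q \<in> \<Union> C" for p q
  proof -
   obtain S S' where "S \<in> C" "p \<in> S" "S' \<in> C" "q \<in> S'" using pq by blast
   moreover hence "S \<subseteq> S' \<or> S' \<subseteq> S" using C(2) by (auto simp: subset_chain_def)
   ultimately show ?thesis by blast
  qed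
  have "corr N M (\<Union> C)" unfolding corr_def
  proof (intro conjI allI impI)
   show "(1, 1) \<in> \<Union> C" using C(1) CA corrD(1) by blast
   fix x y z w
   assume xy: "(x, y) \<in> \<Union> C"
   thus "x \<in> N \<longleftrightarrow> y \<in> M" using CA corrD(8) by blast
   assume "(z, w) \<in> \<Union> C"
   with xy obtain S where "S \<in> C" "(x, y) \<in> S" "(z, w) \<in> S" using two by blast
   thus "(x - z, y - w) \<in> \<Union> C" "(x * z, y * w) \<in> \<Union> C" using CA corrD(3,5) by blast+
  qed
  thus "\<Union> C \<in> ?A" using C(1) CA by blast
 qed
 then obtain \<tau> where t: "\<tau>0 \<subseteq> \<tau>" "corr N M \<tau>" and max: "\<And>S. \<tau>0 \<subseteq> S \<Longrightarrow> corr N M S \<Longrightarrow> \<tau> \<subseteq> S \<Longrightarrow> S = \<tau>" by auto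
 have 1: "\<exists>b. (a, b) \<in> \<tau>" if h: "prp \<tau> f g" "pcoeff f i \<notin> N" "poly f a \<in> N" for f g i a
 proof -
  obtain \<tau>' b where "corr N M \<tau>'" "\<tau> \<subseteq> \<tau>'" "(a, b) \<in> \<tau>'" using ext_one[OF N M t(2) aM h] by blast
  thus ?thesis using max[of \<tau>'] t(1) by blast
 qed
 have 2: "\<exists>a. (a, b) \<in> \<tau>" if h: "prp \<tau> f g" "pcoeff g i \<notin> M" "poly g b \<in> M" for f g i b
 proof -
  have "prp (\<tau>\<inverse>) g f" using h(1) by (simp add: prp_converse)
  then obtain \<tau>' a where h': "corr M N \<tau>'" "\<tau>\<inverse> \<subseteq> \<tau>'" "(b, a) \<in> \<tau>'"
   using ext_one[OF M N corr_converse[OF t(2)] aN _ h(2,3)] by blast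
  have "corr N M (\<tau>'\<inverse>)" by (rule corr_converse[OF h'(1)])
  moreover have "\<tau> \<subseteq> \<tau>'\<inverse>" using h'(2) by auto
  ultimately have "\<tau>'\<inverse> = \<tau>" using max t(1) by blast
  thus ?thesis using h'(3) by auto
 qed
 show ?thesis using t 1 2 by (intro exI[of _ \<tau>]) blast
qed

section \<open>Continuous actions on discrete sets and the universal property of the free
  product\<close>

definition lconst :: "('h, 'm) top_group_scheme \<Rightarrow> ('h \<Rightarrow> 'x) \<Rightarrow> bool" where
 "lconst P f \<equiv> (\<forall>a. openin (topol P) {g \<in> carrier P. f g = a})"

abbreviation acts :: "('h, 'm) top_group_scheme \<Rightarrow> 'x set \<Rightarrow> ('h \<Rightarrow> 'x \<Rightarrow> 'x) \<Rightarrow> bool" where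
 "acts P W \<Phi> \<equiv> (\<forall>g\<in>carrier P. \<forall>w\<in>W. \<Phi> g w \<in> W) \<and> (\<forall>w\<in>W. \<Phi> \<one>\<^bsub>P\<^esub> w = w) \<and>
   (\<forall>g\<in>carrier P. \<forall>h\<in>carrier P. \<forall>w\<in>W. \<Phi> (g \<otimes>\<^bsub>P\<^esub> h) w = \<Phi> g (\<Phi> h w)) \<and> (\<forall>w\<in>W. lconst P (\<lambda>g. \<Phi> g w))"

lemma lconst_eq_closed:
 assumes P: "topspace (topol P) = carrier P" and "lconst P f" "lconst P f'"
 shows "closedin (topol P) {g \<in> carrier P. f g = f' g}"
proof -
 have "carrier P - {g \<in> carrier P. f g = f' g} =
   (\<Union>(a, b)\<in>{(a, b). a \<noteq> b}. {g \<in> carrier P. f g = a} \<inter> {g \<in> carrier P. f' g = b})" by auto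
 also have "openin (topol P) \<dots>" using assms(2,3) by (intro openin_Union) (auto simp: lconst_def)
 finally show ?thesis by (auto simp: closedin_def P)
qed

lemma lconst_comp2:
 assumes "lconst P f" "lconst P f'"
 shows "lconst P (\<lambda>g. F (f g) (f' g))" unfolding lconst_def
proof
 fix a
 have "{g \<in> carrier P. F (f g) (f' g) = a} =
   (\<Union>(b, c)\<in>{(b, c). F b c = a}. {g \<in> carrier P. f g = b} \<inter> {g \<in> carrier P. f' g = c})" by auto
 also have "openin (topol P) \<dots>" using assms by (intro openin_Union) (auto simp: lconst_def)
 finally show "openin (topol P) {g \<in> carrier P. F (f g) (f' g) = a}" .
qed

lemma lconst_comp: "lconst P f \<Longrightarrow> lconst P (\<lambda>g. F (f g))" using lconst_comp2[of P f f "\<lambda>x _. F x"] by simp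

lemma lconst_const: "topspace (topol P) = carrier P \<Longrightarrow> lconst P (\<lambda>_. c)"
 unfolding lconst_def by (metis (mono_tags, lifting) Collect_cong Collect_empty_eq Collect_mem_eq openin_empty openin_topspace)

lemma profinite_group_finite_discrete:
 assumes "group H" "finite (carrier H)" "topol H = discrete_topology (carrier H)"
 shows "profinite_group H"
proof -
 interpret group H by fact
 have "connected_component_of_set (discrete_topology (carrier H)) x = {x}" if "x \<in> carrier H" for x
  using that by (auto simp: connected_component_of_discrete_topology)
 thus ?thesis using assms unfolding profinite_group_def topological_group_def totally_disconnected_space_def
  by (auto simp: compact_space_discrete_topology Hausdorff_space_discrete_topology
    simp flip: prod_topology_discrete_topology)
qed

text \<open>Test groups have to live on \<open>'u\<close>; this is the copy of an abstract group
  along an injection, with the discrete topology.\<close>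

definition transport_group :: "('b \<Rightarrow> 'u) \<Rightarrow> 'b monoid \<Rightarrow> 'u top_group" where
 "transport_group \<iota> B = \<lparr>carrier = \<iota> ` carrier B,
   monoid.mult = (\<lambda>x y. \<iota> (inv_into (carrier B) \<iota> x \<otimes>\<^bsub>B\<^esub> inv_into (carrier B) \<iota> y)),
   monoid.one = \<iota> \<one>\<^bsub>B\<^esub>, topol = discrete_topology (\<iota> ` carrier B)\<rparr>"

lemma group_transport:
 assumes "group B" "inj_on \<iota> (carrier B)"
 shows "group (transport_group \<iota> B)"
proof -
 interpret group B by fact
 note [simp] = inv_into_f_f[OF assms(2)]
 show ?thesis
 proof (rule groupI)
  fix x assume "x \<in> carrier (transport_group \<iota> B)"
  then obtain b where b: "b \<in> carrier B" "x = \<iota> b" by (auto simp: transport_group_def)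
  thus "\<exists>y\<in>carrier (transport_group \<iota> B). y \<otimes>\<^bsub>transport_group \<iota> B\<^esub> x = \<one>\<^bsub>transport_group \<iota> B\<^esub>"
   by (intro bexI[of _ "\<iota> (inv\<^bsub>B\<^esub> b)"]) (auto simp: transport_group_def)
 qed (auto simp: transport_group_def m_assoc)
qed

locale ifp =
 fixes U :: "'u::infinite itself" and P :: "('h, 'm) top_group_scheme" (structure) and n :: nat and A :: "nat \<Rightarrow> 'h set"
 assumes ifp: "internal_free_product U P n A"
begin

lemma profinite: "profinite_group P" using ifp by (simp add: internal_free_product_def)

lemma group: "group P" using profinite by (simp add: profinite_group_def topological_group_def)

lemma topspace: "topspace (topol P) = carrier P" using profinite by (simp add: profinite_group_def topological_group_def)

lemma A: "i \<in> {1..n} \<Longrightarrow> subgroup (A i) P" "i \<in> {1..n} \<Longrightarrow> closedin (topol P) (A i)"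
 using ifp by (auto simp: internal_free_product_def)

lemma A_sub: "i \<in> {1..n} \<Longrightarrow> g \<in> A i \<Longrightarrow> g \<in> carrier P" using subgroup.mem_carrier[OF A(1)] by blast

text \<open>The form in which topological generation is applied: \<open>E\<close> will be the set of
  elements satisfying some identity, which then has to be checked on the \<open>A i\<close>
  only.\<close>

lemma density:
 assumes E: "E \<subseteq> carrier P" "\<one> \<in> E" "\<And>i g. i \<in> {1..n} \<Longrightarrow> g \<in> A i \<Longrightarrow> g \<in> E"
  "\<And>g h. g \<in> E \<Longrightarrow> h \<in> E \<Longrightarrow> g \<otimes> h \<in> E" "closedin (topol P) E"
 shows "E = carrier P"
proof -
 interpret group P by (rule group)
 have "x \<in> E" if "x \<in> generate P (\<Union>i\<in>{1..n}. A i)" for x using that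
 proof induction
  case (inv h)
  thus ?case using E(3) subgroup.m_inv_closed[OF A(1)] by blast
 qed (use E in auto)
 hence "topol P closure_of (generate P (\<Union>i\<in>{1..n}. A i)) \<subseteq> E" using E(5) by (intro closure_of_minimal) auto
 thus ?thesis using E(1) ifp by (auto simp: internal_free_product_def)
qed

definition "extends W act \<Phi> \<equiv> acts P W \<Phi> \<and> (\<forall>i\<in>{1..n}. \<forall>g\<in>A i. \<forall>w\<in>W. \<Phi> g w = act i g w)"

text \<open>Actions of the \<open>A i\<close> on a finite set are continuous homomorphisms into its
  symmetric group, which is finite and so has a copy on the infinite type \<open>'u\<close>; the
  universal property extends them to \<open>P\<close>.\<close>

lemma finite_level:
 assumes fin: "finite S" and act: "\<And>i g w. i \<in> {1..n} \<Longrightarrow> g \<in> A i \<Longrightarrow> w \<in> S \<Longrightarrow> act i g w \<in> S"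
  and act1: "\<And>i w. i \<in> {1..n} \<Longrightarrow> w \<in> S \<Longrightarrow> act i \<one> w = w"
  and actm: "\<And>i g h w. i \<in> {1..n} \<Longrightarrow> g \<in> A i \<Longrightarrow> h \<in> A i \<Longrightarrow> w \<in> S \<Longrightarrow> act i (g \<otimes> h) w = act i g (act i h w)"
  and acto: "\<And>i w. i \<in> {1..n} \<Longrightarrow> w \<in> S \<Longrightarrow> lconst (top_subgroup P (A i)) (\<lambda>g. act i g w)"
 shows "\<exists>\<Phi>. extends S act \<Phi>"
proof -
 let ?B = "BijGroup S"
 have finB: "finite (carrier ?B)"
 proof -
  have "Bij S \<subseteq> S \<rightarrow>\<^sub>E S" by (auto simp: Bij_def bij_betw_def PiE_def extensional_def)
  thus ?thesis using fin by (simp add: BijGroup_def finite_PiE finite_subset)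
 qed
 obtain \<iota> :: "(_ \<Rightarrow> _) \<Rightarrow> 'u" where inj: "inj_on \<iota> (carrier ?B)"
 proof -
  obtain T :: "'u set" where "finite T" "card T = card (carrier ?B)"
   using infinite_arbitrarily_large[OF infinite_UNIV] by blast
  then obtain f where "bij_betw f (carrier ?B) T" using finB by (metis finite_same_card_bij)
  thus thesis using that by (auto simp: bij_betw_def)
 qed
 let ?H = "transport_group \<iota> ?B"
 have grH: "group ?H" by (rule group_transport[OF group_BijGroup inj])
 have finH: "finite (carrier ?H)" using finB by (simp add: transport_group_def)
 have profH: "profinite_group ?H" by (rule profinite_group_finite_discrete[OF grH finH]) (simp add: transport_group_def)
 have cB: "carrier ?B = Bij S" by (simp add: BijGroup_def)
 define r where "r i g = restrict (act i g) S" for i g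
 interpret P: group P by (rule group)
 have inv: "inv g \<in> A i" if "i \<in> {1..n}" "g \<in> A i" for i g using subgroup.m_inv_closed[OF A(1)] that by blast
 have canc: "act i (inv g) (act i g w) = w" "act i g (act i (inv g) w) = w"
  if "i \<in> {1..n}" "g \<in> A i" "w \<in> S" for i g w
  using that inv[OF that(1,2)] actm[of i "inv g" g w] actm[of i g "inv g" w] act1 A_sub[OF that(1,2)] by auto
 have rB: "r i g \<in> Bij S" if "i \<in> {1..n}" "g \<in> A i" for i g
 proof -
  have "bij_betw (act i g) S S" by (rule bij_betw_byWitness[of _ "act i (inv g)"]) (use canc that inv act in auto)
  thus ?thesis unfolding r_def Bij_def by (auto simp: extensional_def bij_betw_cong[of S "restrict (act i g) S" "act i g"])
 qed
 define \<eta> where "\<eta> i g = \<iota> (r i g)" for i g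
 have inj_eq: "inv_into (Bij S) \<iota> (\<iota> b) = b" if "b \<in> Bij S" for b using inv_into_f_f[OF inj] that by (simp add: cB)
 have \<eta>: "\<eta> i \<in> cont_hom (top_subgroup P (A i)) ?H" if i: "i \<in> {1..n}" for i unfolding cont_hom_def
 proof (intro CollectI conjI)
  show "\<eta> i \<in> hom (top_subgroup P (A i)) ?H"
  proof (rule homI)
   fix g h assume "g \<in> carrier (top_subgroup P (A i))" "h \<in> carrier (top_subgroup P (A i))"
   hence gh: "g \<in> A i" "h \<in> A i" by (auto simp: top_subgroup_def)
   have "r i (g \<otimes> h) = compose S (r i g) (r i h)"
    unfolding r_def by (rule ext) (use actm[OF i gh] act[OF i gh(2)] in "auto simp: compose_def")
   thus "\<eta> i (g \<otimes>\<^bsub>top_subgroup P (A i)\<^esub> h) = \<eta> i g \<otimes>\<^bsub>?H\<^esub> \<eta> i h"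
    using rB[OF i] gh by (simp add: \<eta>_def transport_group_def top_subgroup_def cB inj_eq BijGroup_def)
  qed (use rB[OF i] in "auto simp: \<eta>_def transport_group_def top_subgroup_def cB")
  have t: "topspace (topol (top_subgroup P (A i))) = A i" using A_sub[OF i] topspace by (auto simp: top_subgroup_def)
  show "continuous_map (topol (top_subgroup P (A i))) (topol ?H) (\<eta> i)" unfolding continuous_map_def
  proof (intro conjI allI impI)
   show "\<eta> i \<in> topspace (topol (top_subgroup P (A i))) \<rightarrow> topspace (topol ?H)"
    using rB[OF i] unfolding t by (auto simp: \<eta>_def transport_group_def cB)
   fix V assume "openin (topol ?H) V"
   have o: "openin (topol (top_subgroup P (A i))) {g \<in> A i. r i g = b}" for b
   proof (cases "b \<in> extensional S")
    case True
    have "{g \<in> A i. r i g = b} = (\<Inter>w\<in>S. {g \<in> A i. act i g w = b w}) \<inter> A i"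
     using True by (auto simp: r_def extensional_def fun_eq_iff)
    moreover have "openin (topol (top_subgroup P (A i))) {g \<in> A i. act i g w = b w}" if "w \<in> S" for w
     using acto[OF i that] by (simp add: lconst_def top_subgroup_def)
    ultimately show ?thesis
     using openin_INT[of S "topol (top_subgroup P (A i))" "\<lambda>w. {g \<in> A i. act i g w = b w}"] fin t by simp
   next
    case False
    hence "{g \<in> A i. r i g = b} = {}" by (auto simp: r_def)
    thus ?thesis by (simp only: openin_empty)
   qed
   have "{x \<in> A i. \<eta> i x \<in> V} = (\<Union>b\<in>{b. \<iota> b \<in> V}. {g \<in> A i. r i g = b})" by (auto simp: \<eta>_def)
   thus "openin (topol (top_subgroup P (A i))) {x \<in> topspace (topol (top_subgroup P (A i))). \<eta> i x \<in> V}"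
    unfolding t using o by auto
  qed
 qed
 have "\<forall>H :: 'u top_group. profinite_group H \<longrightarrow>
    (\<forall>\<eta>. (\<forall>i \<in> {1..n}. \<eta> i \<in> cont_hom (top_subgroup P (A i)) H) \<longrightarrow>
     (\<exists>\<phi> \<in> cont_hom P H. (\<forall>i \<in> {1..n}. \<forall>x \<in> A i. \<phi> x = \<eta> i x)))" using ifp unfolding internal_free_product_def by blast
 hence "\<exists>\<phi> \<in> cont_hom P ?H. (\<forall>i \<in> {1..n}. \<forall>x \<in> A i. \<phi> x = \<eta> i x)" using profH \<eta> by blast
 then obtain \<phi> where \<phi>: "\<phi> \<in> hom P ?H" "continuous_map (topol P) (topol ?H) \<phi>"
  "\<And>i x. i \<in> {1..n} \<Longrightarrow> x \<in> A i \<Longrightarrow> \<phi> x = \<eta> i x" by (auto simp: cont_hom_def)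
 define \<Phi> where "\<Phi> g = inv_into (Bij S) \<iota> (\<phi> g)" for g
 have \<phi>B: "\<exists>b\<in>Bij S. \<phi> g = \<iota> b" if "g \<in> carrier P" for g
  using hom_in_carrier[OF \<phi>(1) that] by (auto simp: transport_group_def cB)
 have \<Phi>B: "\<Phi> g \<in> Bij S" "\<iota> (\<Phi> g) = \<phi> g" if "g \<in> carrier P" for g using \<phi>B[OF that] by (auto simp: \<Phi>_def inj_eq)
 have 1: "\<Phi> g w \<in> S" if "g \<in> carrier P" "w \<in> S" for g w using Bij_imp_funcset[OF \<Phi>B(1)[OF that(1)]] that(2) by auto
 have m: "\<Phi> (g \<otimes> h) = compose S (\<Phi> g) (\<Phi> h)" if "g \<in> carrier P" "h \<in> carrier P" for g h
 proof -
  have "\<phi> (g \<otimes> h) = \<iota> (compose S (\<Phi> g) (\<Phi> h))" using hom_mult[OF \<phi>(1) that] \<Phi>B(1)[OF that(1)] \<Phi>B(1)[OF that(2)]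
   by (simp add: transport_group_def cB \<Phi>_def BijGroup_def)
  thus ?thesis using compose_Bij[OF \<Phi>B(1)[OF that(1)] \<Phi>B(1)[OF that(2)]] by (simp add: \<Phi>_def inj_eq)
 qed
 have one: "\<Phi> \<one> w = w" if "w \<in> S" for w
 proof -
  have "\<phi> \<one> = \<one>\<^bsub>?H\<^esub>" by (rule hom_one[OF \<phi>(1) group grH])
  thus ?thesis using that id_Bij[of S] by (simp add: \<Phi>_def transport_group_def BijGroup_def inj_eq)
 qed
 have lc: "lconst P (\<lambda>g. \<Phi> g w)" if "w \<in> S" for w unfolding lconst_def
 proof
  fix a
  have "openin (topol P) {x \<in> topspace (topol P). \<phi> x \<in> \<iota> ` {b \<in> Bij S. b w = a}}"
   by (rule openin_continuous_map_preimage[OF \<phi>(2)]) (auto simp: transport_group_def cB)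
  moreover have "{x \<in> topspace (topol P). \<phi> x \<in> \<iota> ` {b \<in> Bij S. b w = a}} = {g \<in> carrier P. \<Phi> g w = a}"
  proof -
   have "\<phi> x \<in> \<iota> ` {b \<in> Bij S. b w = a} \<longleftrightarrow> \<Phi> x w = a" if "x \<in> carrier P" for x
   proof
    assume "\<phi> x \<in> \<iota> ` {b \<in> Bij S. b w = a}"
    thus "\<Phi> x w = a" by (auto simp: \<Phi>_def inj_eq)
   next
    assume "\<Phi> x w = a"
    thus "\<phi> x \<in> \<iota> ` {b \<in> Bij S. b w = a}" using \<Phi>B[OF that] by (intro image_eqI[of _ _ "\<Phi> x"]) auto
   qed
   thus ?thesis by (auto simp: topspace)
  qed
  ultimately show "openin (topol P) {g \<in> carrier P. \<Phi> g w = a}" by simp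
 qed
 have "\<Phi> g w = act i g w" if "i \<in> {1..n}" "g \<in> A i" "w \<in> S" for i g w
  using \<phi>(3)[OF that(1,2)] rB[OF that(1,2)] that(3) by (simp add: \<Phi>_def \<eta>_def inj_eq) (simp add: r_def)
 thus ?thesis using 1 m one lc by (intro exI[of _ \<Phi>]) (auto simp: compose_def extends_def)
qed

text \<open>Every point lies in a finite invariant set, on which \<open>P\<close> acts by
  \<open>finite_level\<close>. Two such actions agree on the overlap by \<open>density\<close>, so
  they glue to an action on \<open>W\<close>.\<close>

theorem extend_action:
 assumes act: "\<And>i g w. i \<in> {1..n} \<Longrightarrow> g \<in> A i \<Longrightarrow> w \<in> W \<Longrightarrow> act i g w \<in> W" and act1: "\<And>i w. i \<in> {1..n} \<Longrightarrow> w \<in> W \<Longrightarrow> act i \<one> w = w"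
  and actm: "\<And>i g h w. i \<in> {1..n} \<Longrightarrow> g \<in> A i \<Longrightarrow> h \<in> A i \<Longrightarrow> w \<in> W \<Longrightarrow> act i (g \<otimes> h) w = act i g (act i h w)"
  and acto: "\<And>i w. i \<in> {1..n} \<Longrightarrow> w \<in> W \<Longrightarrow> lconst (top_subgroup P (A i)) (\<lambda>g. act i g w)"
  and loc: "\<And>w. w \<in> W \<Longrightarrow> \<exists>S\<subseteq>W. finite S \<and> w \<in> S \<and> (\<forall>i\<in>{1..n}. \<forall>g\<in>A i. \<forall>x\<in>S. act i g x \<in> S)"
 shows "\<exists>\<Phi>. extends W act \<Phi>"
proof -
 interpret P: group P by (rule group)
 define good where "good S \<equiv> S \<subseteq> W \<and> finite S \<and> (\<forall>i\<in>{1..n}. \<forall>g\<in>A i. \<forall>x\<in>S. act i g x \<in> S)" for S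
 have "\<exists>\<Phi>. extends S act \<Phi>" if "good S" for S by (rule finite_level) (use that assms in "auto simp: good_def")
 then obtain \<Psi> where \<Psi>: "\<And>S. good S \<Longrightarrow> extends S act (\<Psi> S)" by metis
 have "\<exists>S. good S \<and> w \<in> S" if w: "w \<in> W" for w
 proof -
  obtain S where "S \<subseteq> W" "finite S" "w \<in> S" "\<forall>i\<in>{1..n}. \<forall>g\<in>A i. \<forall>x\<in>S. act i g x \<in> S" using loc[OF w] by (elim exE conjE)
  thus ?thesis unfolding good_def by (intro exI[of _ S]) simp
 qed
 hence "\<forall>w\<in>W. \<exists>S. good S \<and> w \<in> S" by simp
 from bchoice[OF this] obtain s where s': "\<forall>w\<in>W. good (s w) \<and> w \<in> s w" by (elim exE)
 hence s: "\<And>w. w \<in> W \<Longrightarrow> good (s w)" "\<And>w. w \<in> W \<Longrightarrow> w \<in> s w" by auto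
 have agree: "\<Psi> S g w = \<Psi> S' g w"
  if "good S" "good S'" "w \<in> S" "w \<in> S'" "g \<in> carrier P" for S S' w g
 proof -
  let ?T = "S \<inter> S'"
  let ?E = "{g \<in> carrier P. \<forall>w\<in>?T. \<Psi> S g w = \<Psi> S' g w}"
  note p = \<Psi>[OF that(1), unfolded extends_def] \<Psi>[OF that(2), unfolded extends_def]
  have "?E = carrier P"
  proof (rule density)
   show "\<one> \<in> ?E" using p by auto
   show "g \<in> ?E" if "i \<in> {1..n}" "g \<in> A i" for i g using p that A_sub by auto
   show "g \<otimes> h \<in> ?E" if "g \<in> ?E" "h \<in> ?E" for g h
   proof -
    have "\<Psi> S (g \<otimes> h) w = \<Psi> S' (g \<otimes> h) w" if w: "w \<in> ?T" for w
    proof -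
     have gh: "g \<in> carrier P" "h \<in> carrier P" using \<open>g \<in> ?E\<close> \<open>h \<in> ?E\<close> by auto
     have e: "\<Psi> S h w = \<Psi> S' h w" using w \<open>h \<in> ?E\<close> by blast
     have "\<Psi> S h w \<in> S" using w gh p(1) by blast
     moreover have "\<Psi> S' h w \<in> S'" using w gh p(2) by blast
     ultimately have "\<Psi> S h w \<in> ?T" using e by simp
     hence "\<Psi> S g (\<Psi> S h w) = \<Psi> S' g (\<Psi> S h w)" using \<open>g \<in> ?E\<close> by blast
     moreover have "\<Psi> S (g \<otimes> h) w = \<Psi> S g (\<Psi> S h w)" using w gh p(1) by blast
     moreover have "\<Psi> S' (g \<otimes> h) w = \<Psi> S' g (\<Psi> S' h w)" using w gh p(2) by blast
     ultimately show ?thesis using e by simp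
    qed
    thus ?thesis using that by auto
   qed
   have "closedin (topol P) (\<Inter>w\<in>?T. {g \<in> carrier P. \<Psi> S g w = \<Psi> S' g w})" if "?T \<noteq> {}"
    using that p by (intro closedin_Inter) (auto intro!: lconst_eq_closed topspace)
   moreover have "?E = (if ?T = {} then carrier P else (\<Inter>w\<in>?T. {g \<in> carrier P. \<Psi> S g w = \<Psi> S' g w}))" by auto
   ultimately show "closedin (topol P) ?E" using closedin_topspace[of "topol P"] topspace by (metis (no_types, lifting))
  qed auto
  thus ?thesis using that by blast
 qed
 define \<Phi> where "\<Phi> g w = \<Psi> (s w) g w" for g w
 have eq: "\<Phi> g w = \<Psi> S g w" if "good S" "w \<in> S" "g \<in> carrier P" for S g w
 proof -
  have "w \<in> W" using that by (auto simp: good_def)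
  thus ?thesis unfolding \<Phi>_def using agree[OF s(1) that(1) s(2) that(2,3)] by blast
 qed
 have "extends W act \<Phi>" unfolding extends_def
 proof (intro conjI ballI)
  fix g w assume gw: "g \<in> carrier P" "w \<in> W"
  have p: "extends (s w) act (\<Psi> (s w))" by (rule \<Psi>[OF s(1)[OF gw(2)]])
  have sW: "s w \<subseteq> W" using s(1)[OF gw(2)] by (simp add: good_def)
  show "\<Phi> g w \<in> W" using p gw s(2)[OF gw(2)] sW by (auto simp: extends_def \<Phi>_def)
  fix h assume h: "h \<in> carrier P"
  have "\<Psi> (s w) h w \<in> s w" using p h s(2)[OF gw(2)] by (auto simp: extends_def)
  thus "\<Phi> (g \<otimes> h) w = \<Phi> g (\<Phi> h w)" using p gw h s(2)[OF gw(2)] eq[OF s(1)[OF gw(2)] _ gw(1), of "\<Psi> (s w) h w"]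
   by (auto simp: extends_def \<Phi>_def)
 next
  fix w assume w: "w \<in> W"
  have p: "extends (s w) act (\<Psi> (s w))" by (rule \<Psi>[OF s(1)[OF w]])
  show "\<Phi> \<one> w = w" using p s(2)[OF w] by (simp add: extends_def \<Phi>_def)
  show "lconst P (\<lambda>g. \<Phi> g w)" using p s(2)[OF w] by (simp add: extends_def \<Phi>_def)
  fix i g assume "i \<in> {1..n}" "g \<in> A i"
  thus "\<Phi> g w = act i g w" using p s(2)[OF w] by (simp add: extends_def \<Phi>_def)
 qed
 thus ?thesis by blast
qed

end

section \<open>Passage between list polynomials over a carrier and typed polynomials\<close>

context ring
begin

lemma coeff_mem:
 assumes "set p \<subseteq> E" "\<zero> \<in> E"
 shows "coeff p i \<in> E" using assms coeff_length[of p i] by (cases "i < length p") (auto simp: coeff_nth)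

end

context cring
begin

text \<open>Lists begin with the leading coefficient, whence the exponent \<open>length p\<close>
  for the head. Coefficients become variables, to be read through \<open>mev\<close>.\<close>

primrec tp :: "'a list \<Rightarrow> ('a, int) mpol poly" where
 "tp [] = 0"
| "tp (a # p) = pmonom (mvar a) (length p) + tp p"

lemmas mevD = phomD[OF is_cring phom_mev]

lemma mev_mvar [simp]: "a \<in> carrier R \<Longrightarrow> mev (mvar a) = a" by (simp add: mev_var)

lemma tp_eval: "set p \<subseteq> carrier R \<Longrightarrow> mev (poly (tp p) z) = eval p (mev z)"
 by (induction p) (auto simp: mev_zero mev_add poly_monom mevD(5,8))

lemma coeff_tp_above: "i \<ge> length p \<Longrightarrow> pcoeff (tp p) i = 0" by (induction p) auto

lemma tp_coeff: "set p \<subseteq> carrier R \<Longrightarrow> mev (pcoeff (tp p) i) = coeff p i"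
proof (induction p)
 case (Cons a p)
 have "coeff p (length p) = \<zero>" by (rule coeff_length) simp
 thus ?case using Cons by (auto simp: mev_add mevD(3) coeff_tp_above)
qed (simp add: mev_zero)

text \<open>A typed polynomial is read modulo the kernel of \<open>mev\<close>; normalization
  removes leading coefficients that vanish there.\<close>

definition fp :: "('a, int) mpol poly \<Rightarrow> 'a list" where
 "fp F = normalize (map (\<lambda>i. mev (pcoeff F i)) (rev [0..<Suc (pdegree F)]))"

lemma eval_rev_upt:
 assumes "x \<in> carrier R" "\<And>i. f i \<in> carrier R"
 shows "eval (map f (rev [0..<n])) x = (\<Oplus>i\<in>{..<n}. f i \<otimes> x [^] i)"
proof (induction n)
 case (Suc n)
 have "eval (map f (rev [0..<Suc n])) x = f n \<otimes> x [^] n \<oplus> eval (map f (rev [0..<n])) x" by simp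
 also have "\<dots> = (\<Oplus>i\<in>{..<Suc n}. f i \<otimes> x [^] i)" unfolding Suc.IH lessThan_Suc by (subst finsum_insert) (use assms in auto)
 finally show ?case .
qed simp

lemma mev_sum: "finite A \<Longrightarrow> mev (sum f A) = (\<Oplus>a\<in>A. mev (f a))"
 by (induction A rule: finite_induct) (auto simp: mev_zero mev_add)

lemma fp_set: "set (map (\<lambda>i. mev (pcoeff F i)) (rev [0..<Suc (pdegree F)])) \<subseteq> carrier R" by auto

lemma fp_eval: "eval (fp F) (mev z) = mev (poly F z)"
proof -
 have "eval (fp F) (mev z) = eval (map (\<lambda>i. mev (pcoeff F i)) (rev [0..<Suc (pdegree F)])) (mev z)"
  unfolding fp_def by (rule eval_normalize[OF fp_set]) simp
 also have "\<dots> = (\<Oplus>i\<in>{..<Suc (pdegree F)}. mev (pcoeff F i) \<otimes> mev z [^] i)" by (rule eval_rev_upt) auto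
 also have "\<dots> = mev (\<Sum>i<Suc (pdegree F). pcoeff F i * z ^ i)" by (subst mev_sum) (auto simp: mevD(5,8))
 also have "(\<Sum>i<Suc (pdegree F). pcoeff F i * z ^ i) = poly F z" by (simp add: poly_altdef lessThan_Suc_atMost)
 finally show ?thesis .
qed

lemma fp_coeff: "coeff (fp F) i = mev (pcoeff F i)"
proof -
 let ?l = "map (\<lambda>i. mev (pcoeff F i)) (rev [0..<Suc (pdegree F)])"
 have c: "coeff (map f (rev [0..<n])) i = (if i < n then f i else \<zero>)" for f n
 proof (induction n)
  case (Suc n)
  have "coeff (map f (rev [0..<Suc n])) = coeff (f n # map f (rev [0..<n]))" by simp
  thus ?case using Suc by (auto simp: less_Suc_eq)
 qed simp
 have z: "mev (pcoeff F i) = \<zero>" if "\<not> i < Suc (pdegree F)" using that coeff_eq_0[of F i] mevD(3) by simp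
 have "coeff (fp F) i = coeff ?l i" unfolding fp_def using normalize_coeff[of ?l] by metis
 also have "\<dots> = mev (pcoeff F i)" unfolding c using z by (cases "i < Suc (pdegree F)") simp_all
 finally show ?thesis .
qed

lemma fp_carrier:
 assumes "subring K R" "\<And>i. mev (pcoeff F i) \<in> K"
 shows "fp F \<in> carrier (K[X])" unfolding univ_poly_carrier[symmetric] fp_def
 by (rule normalize_gives_polynomial) (use assms in auto)

lemma fp_nonzero: "mev (pcoeff F i) \<noteq> \<zero> \<Longrightarrow> fp F \<noteq> []" using fp_coeff[of F i] by auto

lemma fp_degree_ge:
 assumes "mev (pcoeff F i) \<noteq> \<zero>"
 shows "i \<le> length (fp F) - 1" using assms fp_coeff[of F i] coeff_degree[of "fp F" i] by (metis not_le)

lemma fp_degree_le: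
 assumes "\<And>i. i > n \<Longrightarrow> mev (pcoeff F i) = \<zero>"
 shows "length (fp F) - 1 \<le> n"
proof (rule ccontr)
 assume n: "\<not> ?thesis"
 hence ne: "fp F \<noteq> []" by auto
 have "polynomial (carrier R) (fp F)" unfolding fp_def by (rule normalize_gives_polynomial[OF fp_set])
 hence "hd (fp F) \<noteq> \<zero>" using ne by (simp add: polynomial_def)
 moreover have "hd (fp F) = coeff (fp F) (length (fp F) - 1)" using lead_coeff_simp[OF ne] by simp
 ultimately show False using assms n fp_coeff by simp
qed

end

lemma coeff1_mult: "pcoeff (f * g) 1 =
  pcoeff f 0 * pcoeff g 1 + pcoeff f 1 * pcoeff (g :: 'c::comm_ring_1 poly) 0" by (simp add: coeff_mult)

context algebraically_closed
begin

lemma acl_mev: "acl {z. mev z = \<zero>}" unfolding acl_def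
proof (intro allI impI)
 fix F :: "('a, int) mpol poly"
 assume "\<exists>i>0. pcoeff F i \<notin> {z. mev z = \<zero>}"
 then obtain i where i: "i > 0" "mev (pcoeff F i) \<noteq> \<zero>" by blast
 have c: "fp F \<in> carrier (poly_ring L)" by (rule fp_carrier[OF carrier_is_subring]) simp
 have "length (fp F) - 1 > 0" using fp_degree_ge[OF i(2)] i(1) by simp
 moreover have "size (roots (fp F)) = length (fp F) - 1" using roots_over_carrier[OF c] by (simp add: splitted_def)
 ultimately have "roots (fp F) \<noteq> {#}" by auto
 then obtain x where "x \<in># roots (fp F)" by blast
 hence "is_root (fp F) x" using roots_mem_iff_is_root[OF c] by blast
 hence "x \<in> carrier L" "eval (fp F) x = \<zero>" by (auto simp: is_root_def)
 hence "mev (poly F (mvar x)) = \<zero>" using fp_eval[of F "mvar x"] by simp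
 thus "\<exists>x. poly F x \<in> {z. mev z = \<zero>}" by blast
qed

end

sublocale algebraically_closed \<subseteq> acfield L by unfold_locales (rule acl_mev)

section \<open>Separable elements of an algebraic closure\<close>

locale aclos = algebraic_closure L K for L (structure) and K
begin

lemma K_sub: "K \<subseteq> carrier L" using subfieldE(3)[OF subfield_axioms] .

lemma subfieldK: "subfield K L" by (rule subfield_axioms)

lemma alg: "subfield E L \<Longrightarrow> K \<subseteq> E \<Longrightarrow> x \<in> carrier L \<Longrightarrow> (algebraic over E) x"
 using algebraic_mono[of K E x] algebraic_extension by blast

abbreviation "sext \<equiv> simple_extension"

lemma se_subfield: "subfield E L \<Longrightarrow> K \<subseteq> E \<Longrightarrow> x \<in> carrier L \<Longrightarrow> subfield (sext E x) L"
 using simple_extension_is_subfield[of E x] alg by blast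

lemma se_incl: "subfield E L \<Longrightarrow> x \<in> carrier L \<Longrightarrow> E \<subseteq> sext E x"
 using simple_extension_incl[OF subfieldE(3)] by blast

lemma se_mem: "subfield E L \<Longrightarrow> x \<in> carrier L \<Longrightarrow> x \<in> sext E x" using simple_extension_mem[OF subfieldE(1)] by blast

lemma se_least: "subfield F L \<Longrightarrow> E \<subseteq> F \<Longrightarrow> x \<in> F \<Longrightarrow> sext E x \<subseteq> F"
 using simple_extension_subring_incl[OF subfieldE(1)] by blast

lemma pow_closed_sub: "subfield E L \<Longrightarrow> x \<in> E \<Longrightarrow> x [^] (n::nat) \<in> E"
proof (induction n)
 case 0
 thus ?case using subringE(3)[OF subfieldE(1)] by simp
next
 case (Suc n)
 thus ?case using subringE(6)[OF subfieldE(1)[OF Suc.prems(1)]] by simp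
qed

text \<open>Makes any nontrivial algebraic relation, given as a typed polynomial with coefficients
  read through \<open>mev\<close>, a bound for the degree of the minimal polynomial.\<close>

lemma irr_degree_le:
 assumes E: "subfield E L" "K \<subseteq> E" and x: "x \<in> carrier L"
  and F: "\<And>i. mev (pcoeff F i) \<in> E" "\<And>i. i > n \<Longrightarrow> mev (pcoeff F i) = \<zero>"
  and i: "mev (pcoeff F i) \<noteq> \<zero>" and r: "mev (poly F (mvar x)) = \<zero>"
 shows "length (Irr E x) - 1 \<le> n"
proof -
 have c: "fp F \<in> carrier (E[X])" by (rule fp_carrier[OF subfieldE(1)[OF E(1)] F(1)])
 have "eval (fp F) x = \<zero>" using fp_eval[of F "mvar x"] r x by simp
 hence d: "Irr E x pdivides fp F" by (rule Irr_minimal[OF E(1) x alg[OF E x] c])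
 have "length (Irr E x) - 1 \<le> length (fp F) - 1"
  by (rule pdivides_imp_degree_le[OF subfieldE(1)[OF E(1)] IrrE(1)[OF E(1) x alg[OF E x]] c fp_nonzero[OF i] d])
 thus ?thesis using fp_degree_le[of n F] F(2) by simp
qed

lemma tp_pow_mult:
 assumes "f \<in> carrier (poly_ring L)" "g \<in> carrier (poly_ring L)"
 shows "mev (pcoeff (tp (f \<otimes>\<^bsub>poly_ring L\<^esub> g)) i) = mev (pcoeff (tp f * tp g) i)"
proof -
 have s: "set f \<subseteq> carrier L" "set g \<subseteq> carrier L" using assms polynomial_incl univ_poly_carrier by blast+
 have "f \<otimes>\<^bsub>poly_ring L\<^esub> g \<in> carrier (poly_ring L)"
  using assms ring.ring_simprules(5)[OF univ_poly_is_ring[OF carrier_is_subring]] by blast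
 hence sp: "set (f \<otimes>\<^bsub>poly_ring L\<^esub> g) \<subseteq> carrier L" using polynomial_incl univ_poly_carrier by blast
 have "coeff (poly_mult f g) i = (\<Oplus>k\<in>{..i}. coeff f k \<otimes> coeff g (i - k))" using poly_mult_coeff[OF s] by simp
 also have "\<dots> = mev (\<Sum>k\<le>i. pcoeff (tp f) k * pcoeff (tp g) (i - k))" by (subst mev_sum) (auto simp: mevD(5) tp_coeff s)
 finally show ?thesis using tp_coeff[OF sp, of i] by (simp add: coeff_mult univ_poly_mult)
qed

lemma double_root:
 assumes f: "f \<in> carrier (poly_ring L)" and y: "y \<in> carrier L" and m: "\<not> alg_mult f y \<le> 1"
 shows "\<exists>S. \<forall>i. mev (pcoeff (tp f) i) = mev (pcoeff ([:- mvar y, 1:] ^ 2 * S) i)"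
proof -
 let ?P = "poly_ring L"
 interpret UP: domain ?P by (rule univ_poly_is_domain[OF carrier_is_subring])
 let ?l = "[\<one>, \<ominus> y]"
 have l: "?l \<in> carrier ?P" using y by (simp add: univ_poly_carrier[symmetric] polynomial_def)
 have "(?l [^]\<^bsub>?P\<^esub> (2::nat)) pdivides f" using le_alg_mult_imp_pdivides[OF y f, of 2] m by simp
 then obtain s where s: "s \<in> carrier ?P" "f = (?l [^]\<^bsub>?P\<^esub> (2::nat)) \<otimes>\<^bsub>?P\<^esub> s" unfolding pdivides_def factor_def by auto
 have ll: "?l [^]\<^bsub>?P\<^esub> (2::nat) = ?l \<otimes>\<^bsub>?P\<^esub> ?l" using l by (simp add: numeral_2_eq_2)
 have tl: "mev (pcoeff (tp ?l) i) = mev (pcoeff [:- mvar y, 1:] i)" for i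
  using y by (auto simp: mevD(3,4,6,2) coeff_pCons split: nat.splits)
 have cong: "mev (pcoeff (f * g) i) = mev (pcoeff (f' * g) i)"
  if "\<And>i. mev (pcoeff f i) = mev (pcoeff f' i)" for f f' g i unfolding coeff_mult by (simp add: mev_sum mevD(5) that)
 have "mev (pcoeff (tp f) i) = mev (pcoeff ([:- mvar y, 1:] ^ 2 * tp s) i)" for i
 proof -
  have "mev (pcoeff (tp f) i) = mev (pcoeff (tp (?l \<otimes>\<^bsub>?P\<^esub> ?l) * tp s) i)"
   unfolding s(2) ll by (rule tp_pow_mult) (use l s in auto)
  also have "\<dots> = mev (pcoeff (tp ?l * tp ?l * tp s) i)" by (rule cong) (rule tp_pow_mult[OF l l])
  also have "\<dots> = mev (pcoeff (([:- mvar y, 1:] * [:- mvar y, 1:]) * tp s) i)"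
  proof (rule cong)
   fix i
   have "mev (pcoeff (tp ?l * tp ?l) i) = mev (pcoeff ([:- mvar y, 1:] * tp ?l) i)" by (rule cong) (rule tl)
   also have "\<dots> = mev (pcoeff (tp ?l * [:- mvar y, 1:]) i)" by (simp only: mult.commute)
   also have "\<dots> = mev (pcoeff ([:- mvar y, 1:] * [:- mvar y, 1:]) i)" by (rule cong) (rule tl)
   finally show "mev (pcoeff (tp ?l * tp ?l) i) = mev (pcoeff ([:- mvar y, 1:] * [:- mvar y, 1:]) i)" .
  qed
  finally show ?thesis by (simp only: power2_eq_square)
 qed
 thus ?thesis by blast
qed

end

definition dpoly :: "'c::comm_ring_1 poly \<Rightarrow> 'c poly" where
 "dpoly f = (\<Sum>i\<le>pdegree f. pmonom (of_nat i * pcoeff f i) (i - 1))"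

lemma coeff_dpoly: "pcoeff (dpoly f) j = of_nat (Suc j) * pcoeff f (Suc j)"
proof -
 have "pcoeff (dpoly f) j =
   (\<Sum>i\<le>pdegree f. if i = Suc j then of_nat i * pcoeff f i else 0)" unfolding dpoly_def coeff_sum
 proof (rule sum.cong)
  fix i
  show "pcoeff (pmonom (of_nat i * pcoeff f i) (i - 1)) j =
    (if i = Suc j then of_nat i * pcoeff f i else 0)" by (cases i) auto
 qed simp
 also have "\<dots> = of_nat (Suc j) * pcoeff f (Suc j)" by (subst sum.delta) (auto simp: coeff_eq_0)
 finally show ?thesis .
qed

lemma coeff1_power: "pcoeff ([:y, 1:] ^ i) 1 = of_nat i * (y::'c::comm_ring_1) ^ (i - 1)"
proof (induction i)
 case (Suc i)
 have "pcoeff ([:y, 1:] ^ i) 0 = y ^ i" by (induction i) (simp_all add: coeff_mult)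
 moreover have "pcoeff [:y, 1:] 1 = 1" "pcoeff [:y, 1:] 0 = y" by simp_all
 ultimately have "pcoeff ([:y, 1:] ^ Suc i) 1 = y * (of_nat i * y ^ (i - 1)) + 1 * y ^ i"
  using Suc by (simp only: power_Suc coeff1_mult)
 thus ?case by (cases i) (simp_all add: algebra_simps)
qed simp

text \<open>The derivative at \<open>y\<close> is the linear coefficient of the Taylor expansion at
  \<open>y\<close>, a form in which it visibly vanishes at a double root.\<close>

lemma poly_dpoly: "poly (dpoly f) y = pcoeff (pcompose f [:y, 1:]) 1"
proof -
 have "pcompose f [:y, 1:] = (\<Sum>i\<le>pdegree f. pcompose (pmonom (pcoeff f i) i) [:y, 1:])"
  unfolding pcompose_sum[symmetric] by (simp add: poly_as_sum_of_monoms)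
 also have "\<dots> = (\<Sum>i\<le>pdegree f. psmult (pcoeff f i) ([:y, 1:] ^ i))"
  by (rule sum.cong) (auto simp: pcompose_altdef smult_conv_map_poly map_poly_monom poly_monom)
 finally have *: "pcompose f [:y, 1:] = (\<Sum>i\<le>pdegree f. psmult (pcoeff f i) ([:y, 1:] ^ i))" .
 show ?thesis unfolding * dpoly_def poly_sum coeff_sum
  by (rule sum.cong) (auto simp: poly_monom coeff1_power simp del: One_nat_def)
qed

lemma dpoly_double_root: "poly (dpoly ([:- y, 1:] ^ 2 * S)) (y::'c::comm_ring_1) = 0"
proof -
 have "pcompose [:- y, 1:] [:y, 1:] = [:0, 1:]" by (simp add: pcompose_pCons)
 hence "pcompose ([:- y, 1:] ^ 2 * S) [:y, 1:] = [:0, 1:] ^ 2 * pcompose S [:y, 1:]"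
  by (simp only: pcompose_mult power2_eq_square)
 thus ?thesis unfolding poly_dpoly by (simp add: power2_eq_square coeff_pCons)
qed

text \<open>The exponent \<open>r\<close> is the characteristic exponent of the field: \<open>1\<close> in characteristic \<open>0\<close>.\<close>

locale char_exp = aclos +
 fixes r :: nat
 assumes r_pos: "r > 0" and r_add: "\<And>x y. mev ((x + y) ^ r) = mev (x ^ r + y ^ r)"
  and r_inj: "\<And>x y. mev (x ^ r) = mev (y ^ r) \<Longrightarrow> mev x = mev y"
  and r_char: "\<And>i c. mev (of_nat i * c) = \<zero> \<Longrightarrow> mev c = \<zero> \<or> i = 0 \<or> (1 < r \<and> r dvd i)"
begin

abbreviation "dg E x \<equiv> length (Irr E x) - 1"

lemma r_zero: "mev (x ^ r) = \<zero> \<Longrightarrow> mev x = \<zero>" using r_inj[of x 0] r_pos by (simp add: power_0_left mev_zero)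

lemma r_inj_carrier: "x \<in> carrier L \<Longrightarrow> y \<in> carrier L \<Longrightarrow> x [^] r = y [^] r \<Longrightarrow> x = y"
 using r_inj[of "mvar x" "mvar y"] by (simp add: mevD(8))

lemma r_sum: "finite A \<Longrightarrow> mev ((\<Sum>a\<in>A. f a) ^ r) = mev (\<Sum>a\<in>A. f a ^ r)"
proof (induction A rule: finite_induct)
 case empty
 thus ?case using r_pos by (simp add: power_0_left)
next
 case (insert a A)
 thus ?case using r_add[of "f a" "sum f A"] by (simp add: mev_add)
qed

lemma Irr_props:
 assumes "subfield E L" "K \<subseteq> E" "x \<in> carrier L"
 shows "Irr E x \<in> carrier (E[X])" "Irr E x \<in> carrier (poly_ring L)" "Irr E x \<noteq> []" "dg E x > 0"
  "eval (Irr E x) x = \<zero>" "set (Irr E x) \<subseteq> E" "coeff (Irr E x) (dg E x) = \<one>" "coeff (Irr E x) i \<in> E"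
proof -
 note I = IrrE[OF assms(1,3) alg[OF assms]]
 show c: "Irr E x \<in> carrier (E[X])" by (rule I(1))
 show c': "Irr E x \<in> carrier (poly_ring L)" using carrier_polynomial_shell[OF subfieldE(1)[OF assms(1)] c] .
 show d: "dg E x > 0" using pirreducible_degree[OF assms(1) c I(2)] by simp
 thus ne: "Irr E x \<noteq> []" by auto
 show "eval (Irr E x) x = \<zero>" by (rule I(4))
 show s: "set (Irr E x) \<subseteq> E" using c univ_poly_carrier polynomial_incl by blast
 show "coeff (Irr E x) (dg E x) = \<one>" using lead_coeff_simp[OF ne] I(3) by simp
 show "coeff (Irr E x) i \<in> E" by (rule coeff_mem[OF s subringE(2)[OF subfieldE(1)[OF assms(1)]]])
qed

lemma Irr_same_root:
 assumes "x \<in> carrier L" "y \<in> carrier L" "eval (Irr K x) y = \<zero>"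
 shows "Irr K y = Irr K x"
proof -
 note I = IrrE[OF subfieldK assms(1) alg[OF subfieldK subset_refl assms(1)]]
 show ?thesis unfolding Irr_def[of K y]
  by (rule the1_equality[OF minimal_polynomial_is_unique[OF subfieldK assms(2) alg[OF subfieldK subset_refl assms(2)]]])
   (use I assms(3) in auto)
qed

text \<open>The derivative of the minimal polynomial vanishes at a multiple root \<open>y\<close>.
  It has smaller degree, while \<open>y\<close> has the same minimal polynomial as \<open>x\<close>,
  so the derivative is zero. Hence only exponents divisible by \<open>r\<close> occur besides 0, and
  the leading coefficient forces \<open>1 < r\<close>.\<close>

lemma not_separable:
 assumes x: "x \<in> carrier L" and ns: "\<not> separable_over L K x"
 shows "1 < r" and "i \<noteq> 0 \<Longrightarrow> coeff (Irr K x) i \<noteq> \<zero> \<Longrightarrow> r dvd i"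
proof -
 note I = Irr_props[OF subfieldK subset_refl x]
 let ?f = "tp (Irr K x)"
 have sf: "set (Irr K x) \<subseteq> carrier L" using I(6) K_sub by blast
 obtain y where y: "y \<in> carrier L" "\<not> alg_mult (Irr K x) y \<le> 1"
  using ns alg[OF subfieldK subset_refl x] unfolding separable_over_def by (auto simp: over_def)
 obtain S where S: "\<And>i. mev (pcoeff ?f i) = mev (pcoeff ([:- mvar y, 1:] ^ 2 * S) i)" using double_root[OF I(2) y] by blast
 let ?h = "[:- mvar y, 1:] ^ 2 * S"
 have "alg_mult (Irr K x) y > 0" using y by simp
 hence root: "eval (Irr K x) y = \<zero>" using alg_mult_gt_zero_iff_is_root[OF I(2)] by (simp add: is_root_def)
 hence same: "Irr K y = Irr K x" by (rule Irr_same_root[OF x y(1)])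
 have cd: "mev (pcoeff (dpoly ?f) i) = mev (pcoeff (dpoly ?h) i)" for i unfolding coeff_dpoly using S by (simp add: mevD(5))
 have cong: "mev (poly F z) = mev (poly G z)"
  if "\<And>i. mev (pcoeff F i) = mev (pcoeff G i)" for F G z
 proof -
  let ?n = "max (pdegree F) (pdegree G)"
  have "poly F z = (\<Sum>i\<le>?n. pcoeff F i * z ^ i)" "poly G z = (\<Sum>i\<le>?n. pcoeff G i * z ^ i)"
   unfolding poly_altdef by (rule sum.mono_neutral_left; simp add: coeff_eq_0)+
  thus ?thesis by (simp add: mev_sum mevD(5) that)
 qed
 have r0: "mev (poly (dpoly ?f) (mvar y)) = \<zero>" using cong[OF cd] dpoly_double_root[of "mvar y" S] by (simp add: mev_zero)
 have z: "mev (pcoeff (dpoly ?f) i) = \<zero>" for i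
 proof (rule ccontr)
  assume i: "mev (pcoeff (dpoly ?f) i) \<noteq> \<zero>"
  have "dg K y \<le> dg K x - 1"
  proof (rule irr_degree_le[OF subfieldK subset_refl y(1) _ _ i r0])
   show "mev (pcoeff (dpoly ?f) j) \<in> K" for j
   proof -
    have "mev (of_nat n * c) \<in> K" if "mev c \<in> K" for n c
     by (induction n) (use that subringE(2,7)[OF subfieldE(1)[OF subfieldK]] in "auto simp: mev_zero algebra_simps mev_add")
    thus ?thesis unfolding coeff_dpoly using tp_coeff[OF sf] I(8) by (simp del: of_nat_Suc)
   qed
   show "mev (pcoeff (dpoly ?f) j) = \<zero>" if "dg K x - 1 < j" for j
    unfolding coeff_dpoly using that by (simp add: coeff_tp_above mev_zero)
  qed
  thus False using I(4) same by simp
 qed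
 have main: "1 < r \<and> r dvd i" if "i \<noteq> 0" "coeff (Irr K x) i \<noteq> \<zero>" for i
 proof -
  obtain j where j: "i = Suc j" using \<open>i \<noteq> 0\<close> by (cases i) auto
  have "mev (of_nat i * pcoeff ?f i) = \<zero>" using z[of j] unfolding coeff_dpoly j .
  thus ?thesis using r_char[of i] that tp_coeff[OF sf] by metis
 qed
 show "1 < r" using main[of "dg K x"] I(4,7) by simp
 show "i \<noteq> 0 \<Longrightarrow> coeff (Irr K x) i \<noteq> \<zero> \<Longrightarrow> r dvd i" using main by blast
qed

lemma not_separable_root:
 assumes x: "x \<in> carrier L" and ns: "\<not> separable_over L K x"
 defines "n \<equiv> dg K x div r"
 shows "mev (\<Sum>j\<le>n. mvar (coeff (Irr K x) (j * r)) * (mvar x ^ j) ^ r) = \<zero>"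
  "coeff (Irr K x) (n * r) = \<one>" "n < dg K x"
proof -
 note I = Irr_props[OF subfieldK subset_refl x]
 note ns' = not_separable[OF x ns]
 let ?f = "tp (Irr K x)"
 let ?d = "dg K x"
 have sf: "set (Irr K x) \<subseteq> carrier L" using I(6) K_sub by blast
 have "r dvd ?d" using ns'(2)[of ?d] I(4,7) by simp
 hence d: "n * r = ?d" unfolding n_def by simp
 thus "coeff (Irr K x) (n * r) = \<one>" using I(7) by simp
 show "n < ?d" unfolding n_def using I(4) ns'(1) by simp
 have cK: "coeff (Irr K x) i \<in> carrier L" for i using I(8) K_sub by blast
 have "\<zero> = mev (poly ?f (mvar x))" using tp_eval[OF sf] I(5) x by simp
 also have "poly ?f (mvar x) = (\<Sum>i\<le>?d. pcoeff ?f i * mvar x ^ i)" unfolding poly_altdef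
 proof (rule sum.mono_neutral_left)
  have "pdegree ?f \<le> ?d" by (rule degree_le) (auto simp: coeff_tp_above)
  thus "{..pdegree ?f} \<subseteq> {..?d}" by auto
 qed (auto simp: coeff_eq_0)
 also have "mev (\<Sum>i\<le>?d. pcoeff ?f i * mvar x ^ i) = mev (\<Sum>i\<le>?d. mvar (coeff (Irr K x) i) * mvar x ^ i)"
  by (simp add: mev_sum mevD(5) tp_coeff[OF sf] cK)
 also have "\<dots> = mev (\<Sum>i\<in>(\<lambda>j. j * r) ` {..n}. mvar (coeff (Irr K x) i) * mvar x ^ i)"
 proof -
  let ?A = "(\<lambda>j. j * r) ` {..n}"
  have A: "?A \<subseteq> {..?d}" using d by (metis (no_types, lifting) atMost_iff image_subsetI mult_le_mono1)
  have z: "\<forall>i\<in>{..?d} - ?A. mev (mvar (coeff (Irr K x) i) * mvar x ^ i) = \<zero>"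
   proof
    fix i assume i: "i \<in> {..?d} - ?A"
    have "\<not> r dvd i"
    proof
     assume "r dvd i"
     then obtain j where j: "i = j * r" by (metis dvd_div_mult_self)
     hence "j * r \<le> n * r" using i d by simp
     hence "j \<le> n" using r_pos by simp
     thus False using i j by blast
    qed
    hence "i \<noteq> 0" by (metis dvd_0_right)
    hence "coeff (Irr K x) i = \<zero>" using ns'(2)[of i] \<open>\<not> r dvd i\<close> by blast
    thus "mev (mvar (coeff (Irr K x) i) * mvar x ^ i) = \<zero>" by (simp add: mevD(5))
   qed
  have "(\<Oplus>i\<in>{..?d}. mev (mvar (coeff (Irr K x) i) * mvar x ^ i)) = (\<Oplus>i\<in>?A. mev (mvar (coeff (Irr K x) i) * mvar x ^ i))"
   by (rule add.finprod_mono_neutral_cong_right) (use A z in auto)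
  thus ?thesis by (simp add: mev_sum)
 qed
 also have "(\<Sum>i\<in>(\<lambda>j. j * r) ` {..n}. mvar (coeff (Irr K x) i) * mvar x ^ i) =
   (\<Sum>j\<le>n. mvar (coeff (Irr K x) (j * r)) * (mvar x ^ j) ^ r)"
  by (subst sum.reindex) (use r_pos in "auto simp: inj_on_def power_mult")
 finally show "mev (\<Sum>j\<le>n. mvar (coeff (Irr K x) (j * r)) * (mvar x ^ j) ^ r) = \<zero>" by simp
qed

lemma irr_degree_le_sum:
 assumes E: "subfield E L" "K \<subseteq> E" and x: "x \<in> carrier L" and c: "\<And>j. c j \<in> E" "c i \<noteq> \<zero>" "i \<le> n"
  and r: "mev (\<Sum>j\<le>n. mvar (c j) * mvar x ^ j) = \<zero>"
 shows "dg E x \<le> n"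
proof -
 let ?F = "\<Sum>j\<le>n. pmonom (mvar (c j)) j"
 have cL: "c j \<in> carrier L" for j using c(1) subfieldE(3)[OF E(1)] by blast
 have cf: "pcoeff ?F j = (if j \<le> n then mvar (c j) else 0)" for j by (auto simp: coeff_sum sum.delta')
 have z: "\<zero> \<in> E" using subringE(2)[OF subfieldE(1)[OF E(1)]] .
 show ?thesis
 proof (rule irr_degree_le[OF E x])
  show "mev (pcoeff ?F j) \<in> E" for j using c(1) cL z by (auto simp: cf mev_zero)
  show "mev (pcoeff ?F j) = \<zero>" if "n < j" for j using that by (simp add: cf mev_zero)
  show "mev (pcoeff ?F i) \<noteq> \<zero>" using c cL by (simp add: cf)
  show "mev (poly ?F (mvar x)) = \<zero>" using r by (simp add: poly_sum poly_monom)
 qed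
qed

text \<open>The minimal polynomial of \<open>x\<close> is a polynomial in X^r, so x^r satisfies a
  relation of degree \<open>dg K x div r\<close>.\<close>

lemma deg_power_less:
 assumes x: "x \<in> carrier L" and ns: "\<not> separable_over L K x"
 shows "dg K (x [^] r) < dg K x"
proof -
 note N = not_separable_root[OF x ns] and I = Irr_props[OF subfieldK subset_refl x]
 have "mev (\<Sum>j\<le>dg K x div r. mvar (coeff (Irr K x) (j * r)) * mvar (x [^] r) ^ j) = \<zero>" using N(1) I(8) K_sub x
  by (simp add: mev_sum mevD(5,8) subset_iff nat_pow_pow mult.commute)
 hence "dg K (x [^] r) \<le> dg K x div r"
  using irr_degree_le_sum[OF subfieldK subset_refl, of "x [^] r" "\<lambda>j. coeff (Irr K x) (j * r)" "dg K x div r" "dg K x div r"]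
   N(2) I(8) x by simp
 thus ?thesis using N(3) by simp
qed

text \<open>Otherwise the minimal polynomial, being a polynomial in X^r, would be the r-th power of
  the polynomial formed with the r-th roots of its coefficients; the latter has smaller degree and
  also vanishes at \<open>x\<close>.\<close>

lemma separable_of_perfect:
 assumes perf: "\<And>x. x \<in> K \<Longrightarrow> \<exists>y\<in>K. y [^] r = x" and x: "x \<in> carrier L"
 shows "separable_over L K x"
proof (rule ccontr)
 assume ns: "\<not> ?thesis"
 note N = not_separable_root[OF x ns] and I = Irr_props[OF subfieldK subset_refl x]
 have "\<forall>i. \<exists>y. y \<in> K \<and> y [^] r = coeff (Irr K x) i" using perf I(8) by blast
 from choice[OF this] obtain b where "\<forall>i. b i \<in> K \<and> b i [^] r = coeff (Irr K x) i" by (elim exE)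
 hence b: "b i \<in> K" "b i \<in> carrier L" "b i [^] r = coeff (Irr K x) i" for i using K_sub by auto
 let ?n = "dg K x div r"
 have "mev ((\<Sum>j\<le>?n. mvar (b (j * r)) * mvar x ^ j) ^ r) = mev (\<Sum>j\<le>?n. mvar (b (j * r)) ^ r * (mvar x ^ j) ^ r)"
  by (subst r_sum) (simp_all add: power_mult_distrib)
 also have "\<dots> = mev (\<Sum>j\<le>?n. mvar (coeff (Irr K x) (j * r)) * (mvar x ^ j) ^ r)"
  using I(8) K_sub b by (simp add: mev_sum mevD(5,8) subset_iff)
 finally have "mev ((\<Sum>j\<le>?n. mvar (b (j * r)) * mvar x ^ j) ^ r) = \<zero>" using N(1) by simp
 hence r0: "mev (\<Sum>j\<le>?n. mvar (b (j * r)) * mvar x ^ j) = \<zero>" by (rule r_zero)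
 have "b (?n * r) \<noteq> \<zero>"
 proof
  assume "b (?n * r) = \<zero>"
  hence "coeff (Irr K x) (?n * r) = \<zero>" using b(3)[of "?n * r"] r_pos nat_pow_zero[of r] by simp
  thus False using N(2) by simp
 qed
 hence "dg K x \<le> ?n" using irr_degree_le_sum[OF subfieldK subset_refl x, of "\<lambda>j. b (j * r)" ?n ?n] b(1) r0 by simp
 thus False using N(3) by simp
qed

text \<open>Since E(y) = E(y^r), the powers of y^r below the degree of \<open>y\<close> are
  independent over \<open>E\<close>. Write z = \<Sum> h_i y^i; then z^r = \<Sum> h_i^r (y^r)^i lies
  in \<open>E\<close>, and comparing constant terms gives z^r = h_0^r, so z = h_0.\<close>

lemma root_in_base:
 assumes E: "subfield E L" "K \<subseteq> E" and y: "y \<in> carrier L" "y \<in> sext E (y [^] r)"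
  and z: "z \<in> sext E y" "z [^] r \<in> E"
 shows "z \<in> E"
proof -
 note I = Irr_props[OF E y(1)]
 let ?d = "dg E y"
 have yr: "y [^] r \<in> carrier L" using y by simp
 have "sext E (y [^] r) \<subseteq> sext E y"
  by (rule se_least[OF se_subfield[OF E y(1)] se_incl[OF E(1) y(1)]])
   (rule pow_closed_sub[OF se_subfield[OF E y(1)] se_mem[OF E(1) y(1)]])
 moreover have "sext E y \<subseteq> sext E (y [^] r)"
  by (rule se_least[OF se_subfield[OF E yr] se_incl[OF E(1) yr] y(2)])
 ultimately have same: "sext E y = sext E (y [^] r)" by blast
 have "?d = dg E (y [^] r)" using dimension_is_inj[OF E(1) dimension_simple_extension[OF E(1) y(1) alg[OF E y(1)]]]
   dimension_simple_extension[OF E(1) yr alg[OF E yr]] same by simp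
 obtain h where h: "h \<in> carrier (E[X])" "length h \<le> ?d" "z = eval h y"
  using z(1)[folded Span_exp_base[OF E(1) y(1) alg[OF E y(1)]], unfolded Span_eq_eval_img[OF E(1) y(1)]] by blast
 have hE: "set h \<subseteq> E" using h(1) univ_poly_carrier polynomial_incl by blast
 hence hL: "set h \<subseteq> carrier L" using subfieldE(3)[OF E(1)] by blast
 let ?H = "\<lambda>i. pcoeff (tp h) i"
 have HE: "mev (?H i) \<in> E" for i unfolding tp_coeff[OF hL] by (rule coeff_mem[OF hE subringE(2)[OF subfieldE(1)[OF E(1)]]])
 have zL: "z \<in> carrier L" using z(1) subfieldE(3)[OF se_subfield[OF E y(1)]] by blast
 have zs: "z = mev (\<Sum>i<?d. ?H i * mvar y ^ i)"
 proof -
  have "poly (tp h) (mvar y) = (\<Sum>i<?d. ?H i * mvar y ^ i)" unfolding poly_altdef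
  proof (rule sum.mono_neutral_cong)
   show "\<And>i. i \<in> {..pdegree (tp h)} - {..<?d} \<Longrightarrow> ?H i * mvar y ^ i = 0" using h(2) by (auto simp: coeff_tp_above)
  qed (auto simp: coeff_eq_0)
  thus ?thesis using h(3) tp_eval[OF hL, of "mvar y"] y by simp
 qed
 let ?c = "\<lambda>i. mev (?H i) [^] r \<ominus> (if i = 0 then z [^] r else \<zero>)"
 have cE: "?c i \<in> E" for i using pow_closed_sub[OF E(1) HE] z(2) subringE(2,5,7)[OF subfieldE(1)[OF E(1)]]
  by (auto simp: a_minus_def)
 have cL: "?c i \<in> carrier L" for i using cE subfieldE(3)[OF E(1)] by blast
 have rt: "mev (\<Sum>j\<le>?d - 1. mvar (?c j) * mvar (y [^] r) ^ j) = \<zero>"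
 proof -
  have 1: "mev (mvar (?c j) * mvar (y [^] r) ^ j) =
    mev ((?H j * mvar y ^ j) ^ r - (if j = 0 then mvar z ^ r else 0))" for j using cL[of j] y zL
   by (auto simp: m_comm mevD(5,7,8) mev_zero nat_pow_distrib nat_pow_pow mult.commute a_minus_def)
  have "mev (\<Sum>j\<le>?d - 1. mvar (?c j) * mvar (y [^] r) ^ j) =
    mev (\<Sum>j\<le>?d - 1. (?H j * mvar y ^ j) ^ r - (if j = 0 then mvar z ^ r else 0))" by (simp add: mev_sum 1)
  also have "(\<Sum>j\<le>?d - 1. (?H j * mvar y ^ j) ^ r - (if j = 0 then mvar z ^ r else 0)) =
    (\<Sum>j\<le>?d - 1. (?H j * mvar y ^ j) ^ r) - mvar z ^ r" by (simp add: sum_subtractf)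
  also have "(\<Sum>j\<le>?d - 1. (?H j * mvar y ^ j) ^ r) = (\<Sum>j<?d. (?H j * mvar y ^ j) ^ r)" by (rule sum.cong) (use I(4) in auto)
  also have "mev ((\<Sum>j<?d. (?H j * mvar y ^ j) ^ r) - mvar z ^ r) =
    mev (\<Sum>j<?d. (?H j * mvar y ^ j) ^ r) \<ominus> z [^] r" using zL by (simp add: mevD(7,8))
  also have "mev (\<Sum>j<?d. (?H j * mvar y ^ j) ^ r) = z [^] r"
   using r_sum[of "{..<?d}" "\<lambda>j. ?H j * mvar y ^ j"] zs by (simp add: mevD(8))
  finally show ?thesis using zL by (simp add: r_neg a_minus_def)
 qed
 have "?c 0 = \<zero>"
 proof (rule ccontr)
  assume "?c 0 \<noteq> \<zero>"
  hence "dg E (y [^] r) \<le> ?d - 1" using irr_degree_le_sum[OF E yr, of ?c 0 "?d - 1"] cE rt by simp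
  thus False using \<open>?d = dg E (y [^] r)\<close> I(4) by simp
 qed
 hence "mev (?H 0) [^] r = z [^] r" using zL by simp
 hence "mev (?H 0) = z" using r_inj_carrier[of "mev (?H 0)" z] zL by simp
 thus ?thesis using HE[of 0] by simp
qed

text \<open>This is \<open>root_in_base\<close> over the field K(z^r), to which the hypothesis on
  \<open>y\<close> passes.\<close>

lemma good_simple_extension:
 assumes y: "y \<in> carrier L" "y \<in> sext K (y [^] r)" and z: "z \<in> sext K y"
 shows "z \<in> sext K (z [^] r)"
proof -
 have zL: "z \<in> carrier L" using z subfieldE(3)[OF se_subfield[OF subfieldK subset_refl y(1)]] by blast
 let ?E = "sext K (z [^] r)"
 have zr: "z [^] r \<in> carrier L" using zL by simp
 have E: "subfield ?E L" "K \<subseteq> ?E" using se_subfield[OF subfieldK subset_refl zr] se_incl[OF subfieldK zr] by auto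
 have m: "sext K u \<subseteq> sext ?E u" if u: "u \<in> carrier L" for u
  using se_least[OF se_subfield[OF E u] _ se_mem[OF E(1) u]] se_incl[OF E(1) u] E(2) by blast
 show ?thesis by (rule root_in_base[OF E y(1)]) (use m y z se_mem[OF subfieldK zr] in auto)
qed

text \<open>The criterion K(x) = K(x^r) turns separability into membership in simple extensions. If
  it holds, the degree cannot drop as in \<open>deg_power_less\<close>. Conversely, over K(x^r) the
  only root of X^r - x^r is \<open>x\<close>, so the minimal polynomial of a separable
  \<open>x\<close> has this one simple root and is linear.\<close>

lemma separable_iff:
 assumes x: "x \<in> carrier L"
 shows "separable_over L K x \<longleftrightarrow> x \<in> sext K (x [^] r)"
proof
 have xr: "x [^] r \<in> carrier L" using x by simp
 assume good: "x \<in> sext K (x [^] r)"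
 have "sext K (x [^] r) = sext K x"
  using se_least[OF se_subfield[OF subfieldK subset_refl xr] se_incl[OF subfieldK xr] good]
   se_least[OF se_subfield[OF subfieldK subset_refl x] se_incl[OF subfieldK x]
    pow_closed_sub[OF se_subfield[OF subfieldK subset_refl x] se_mem[OF subfieldK x]]] by blast
 hence "dg K (x [^] r) = dg K x"
  using dimension_is_inj[OF subfieldK dimension_simple_extension[OF subfieldK x alg[OF subfieldK subset_refl x]]]
   dimension_simple_extension[OF subfieldK xr alg[OF subfieldK subset_refl xr]] by simp
 thus "separable_over L K x" using deg_power_less[OF x] by force
next
 assume sep: "separable_over L K x"
 have xr: "x [^] r \<in> carrier L" using x by simp
 let ?E = "sext K (x [^] r)"
 have E: "subfield ?E L" "K \<subseteq> ?E" using se_subfield[OF subfieldK subset_refl xr] se_incl[OF subfieldK xr] by auto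
 note I = Irr_props[OF E x] and IK = Irr_props[OF subfieldK subset_refl x]
 have IKE: "Irr K x \<in> carrier (?E[X])" using IK(1,6) E(2) unfolding univ_poly_carrier[symmetric] polynomial_def by blast
 have "Irr ?E x pdivides Irr K x" by (rule Irr_minimal[OF E(1) x alg[OF E x] IKE IK(5)])
 hence incl: "roots (Irr ?E x) \<subseteq># roots (Irr K x)" by (rule pdivides_imp_roots_incl[OF I(2) IK(2,3)])
 have only: "y = x" if y: "y \<in># roots (Irr ?E x)" for y
 proof -
  have yr: "y \<in> carrier L" "eval (Irr ?E x) y = \<zero>" using y roots_mem_iff_is_root[OF I(2)] by (auto simp: is_root_def)
  let ?F = "pmonom 1 r - [:mvar (x [^] r):]"
  have one: "\<one> \<in> ?E" "\<zero> \<in> ?E" using subringE(2,3)[OF subfieldE(1)[OF E(1)]] by auto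
  have xrE: "\<ominus> (x [^] r) \<in> ?E" using subringE(5)[OF subfieldE(1)[OF E(1)] se_mem[OF subfieldK xr]] .
  have FE: "mev (pcoeff ?F i) \<in> ?E" for i using one xrE r_pos xr by (cases i) (auto simp: mevD(2,3,6,7) mev_zero a_minus_def)
  have "eval (fp ?F) x = \<zero>" using fp_eval[of ?F "mvar x"] x by (simp add: poly_monom mevD(7,8) a_minus_def r_neg)
  hence "Irr ?E x pdivides fp ?F" by (rule Irr_minimal[OF E(1) x alg[OF E x] fp_carrier[OF subfieldE(1)[OF E(1)] FE]])
  hence "eval (fp ?F) y = \<zero>" by (rule pdivides_imp_root_sharing[OF I(2) _ yr(1,2)])
  hence "y [^] r \<ominus> x [^] r = \<zero>" using fp_eval[of ?F "mvar y"] yr(1) x by (simp add: poly_monom mevD(7,8))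
  thus ?thesis using r_inj_carrier[OF yr(1) x] yr(1) x by simp
 qed
 have "count (roots (Irr ?E x)) x \<le> 1"
 proof -
  have "alg_mult (Irr K x) x \<le> 1" using sep x unfolding separable_over_def by blast
  thus ?thesis using mset_subset_eq_count[OF incl, of x] alg_mult_eq_count_roots[OF IK(2)] by simp
 qed
 moreover have "roots (Irr ?E x) = replicate_mset (count (roots (Irr ?E x)) x) x"
  by (rule multiset_eqI) (metis count_replicate_mset only not_in_iff)
 ultimately have "size (roots (Irr ?E x)) \<le> 1" by (metis size_replicate_mset)
 moreover have "size (roots (Irr ?E x)) = dg ?E x" using roots_over_carrier[OF I(2)] by (simp add: splitted_def)
 ultimately have "dg ?E x \<le> 1" by simp
 hence d1: "dg ?E x = 1" using I(4) by simp
 have "x \<in> sext ?E x" by (rule se_mem[OF E(1) x])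
 then obtain h where h: "h \<in> carrier (?E[X])" "length h \<le> 1" "x = eval h x"
  unfolding Span_exp_base[OF E(1) x alg[OF E x], symmetric] d1 Span_eq_eval_img[OF E(1) x] by blast
 have hE: "set h \<subseteq> ?E" using h(1) univ_poly_carrier polynomial_incl by blast
 show "x \<in> ?E"
 proof (cases h)
  case Nil
  hence "x = \<zero>" using h(3) by simp
  thus ?thesis by simp
 next
  case (Cons c h')
  hence "h = [c]" using h(2) by simp
  moreover have "c \<in> ?E" using hE Cons by simp
  hence "c \<in> carrier L" using subfieldE(3)[OF E(1)] by blast
  ultimately have "x = c" using h(3) by simp
  thus ?thesis using \<open>c \<in> ?E\<close> by simp
 qed
qed

lemma separable_simple_extension:
 assumes "y \<in> carrier L" "separable_over L K y" "z \<in> sext K y"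
 shows "separable_over L K z"
proof -
 have "z \<in> carrier L" using assms subfieldE(3)[OF se_subfield[OF subfieldK subset_refl assms(1)]] by blast
 thus ?thesis using good_simple_extension[OF assms(1) _ assms(3)] separable_iff assms(1,2) by simp
qed

text \<open>As long as the element is inseparable, raising it to the power \<open>r\<close> lowers
  its degree.\<close>

lemma separable_power:
 assumes "x \<in> carrier L"
 shows "\<exists>n. separable_over L K (x [^] (r ^ n))" using assms
proof (induction "dg K x" arbitrary: x rule: less_induct)
 case less
 show ?case
 proof (cases "separable_over L K x")
  case True
  hence "separable_over L K (x [^] (r ^ 0))" using less.prems by simp
  thus ?thesis by blast
 next
  case False
  obtain n where "separable_over L K ((x [^] r) [^] (r ^ n))"
   using less.hyps[OF deg_power_less[OF less.prems False]] less.prems by auto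
  hence "separable_over L K (x [^] (r ^ Suc n))" using less.prems by (simp add: nat_pow_pow)
  thus ?thesis by blast
 qed
qed

end

section \<open>The absolute Galois group acting on the algebraic closure\<close>

context char_exp
begin

definition sepc :: "'a set" where
 "sepc = {x \<in> carrier L. separable_over L K x}"

text \<open>Together with \<open>sepc\<close> and \<open>galtop\<close> this restates the absolute
  Galois group for an arbitrary algebraic closure \<open>L\<close> of a subfield \<open>K\<close>;
  the given definitions are instances.\<close>

definition gal :: "('a \<Rightarrow> 'a) set" where
 "gal = {\<tau> \<in> extensional sepc. \<tau> \<in> ring_iso (L\<lparr>carrier := sepc\<rparr>) (L\<lparr>carrier := sepc\<rparr>) \<and> (\<forall>x\<in>K. \<tau> x = x)}"

definition galtop :: "('a \<Rightarrow> 'a) topology" where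
 "galtop = topology_generated_by
   {{\<tau> \<in> gal. \<forall>x \<in> E. \<tau> x = \<rho> x} | \<rho> E.
    \<rho> \<in> gal \<and> subfield E (L\<lparr>carrier := sepc\<rparr>) \<and> K \<subseteq> E \<and>
    ring.finite_dimension (L\<lparr>carrier := sepc\<rparr>) K E}"

lemma rn_add: "x \<in> carrier L \<Longrightarrow> y \<in> carrier L \<Longrightarrow> (x \<oplus> y) [^] (r ^ n) = x [^] (r ^ n) \<oplus> y [^] (r ^ n)"
proof (induction n)
 case (Suc n)
 have r1: "(u \<oplus> v) [^] r = u [^] r \<oplus> v [^] r" if "u \<in> carrier L" "v \<in> carrier L" for u v
  using r_add[of "mvar u" "mvar v"] that by (simp add: mevD(4,8))
 have "z [^] (r ^ Suc n) = (z [^] (r ^ n)) [^] r" if "z \<in> carrier L" for z using that by (simp add: nat_pow_pow mult.commute)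
 thus ?case using Suc by (simp add: r1)
qed simp

lemma rn_inj: "x \<in> carrier L \<Longrightarrow> y \<in> carrier L \<Longrightarrow> x [^] (r ^ n) = y [^] (r ^ n) \<Longrightarrow> x = y"
proof (induction n arbitrary: x y)
 case (Suc n)
 have "z [^] (r ^ Suc n) = (z [^] r) [^] (r ^ n)" if "z \<in> carrier L" for z using that by (simp add: nat_pow_pow)
 hence "x [^] r = y [^] r" using Suc by simp
 thus ?case using r_inj_carrier Suc.prems by blast
qed simp

lemma sepc_carrier: "x \<in> sepc \<Longrightarrow> x \<in> carrier L" by (simp add: sepc_def)

lemma sepc_se: "x \<in> sepc \<Longrightarrow> z \<in> sext K x \<Longrightarrow> z \<in> sepc" unfolding sepc_def
 using separable_simple_extension[of x z] subfieldE(3)[OF se_subfield[OF subfieldK subset_refl, of x]] by blast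

lemma sepc_pow: "x \<in> sepc \<Longrightarrow> x [^] (n::nat) \<in> sepc" by (rule sepc_se[of x])
  (simp_all add: sepc_carrier pow_closed_sub se_mem subfieldK se_subfield)

lemma sepc_base: "x \<in> K \<Longrightarrow> x \<in> sepc"
 using se_incl[OF subfieldK, of \<zero>] K_sub separable_iff[of x] se_incl[OF subfieldK, of "x [^] r"]
 by (auto simp: sepc_def subset_iff)

text \<open>The element \<open>z\<close> of K(x, y) is brought down from K(z^r)(x)(y) to K(z^r)(x)
  and then to K(z^r) by two uses of \<open>root_in_base\<close>, which is the criterion for
  separability.\<close>

lemma sepc_two:
 assumes x: "x \<in> sepc" and y: "y \<in> sepc" and z: "z \<in> sext (sext K x) y"
 shows "z \<in> sepc"
proof -
 have xL: "x \<in> carrier L" and yL: "y \<in> carrier L" using x y sepc_carrier by auto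
 have good: "x \<in> sext K (x [^] r)" "y \<in> sext K (y [^] r)"
  using x y separable_iff by (auto simp: sepc_def)
 note F = se_subfield[OF subfieldK subset_refl xL] se_incl[OF subfieldK xL]
 have zL: "z \<in> carrier L" using z subfieldE(3)[OF se_subfield[OF F yL]] by blast
 have zr: "z [^] r \<in> carrier L" using zL by simp
 let ?E = "sext K (z [^] r)"
 note E = se_subfield[OF subfieldK subset_refl zr] se_incl[OF subfieldK zr]
 let ?E1 = "sext ?E x"
 have E1: "subfield ?E1 L" "K \<subseteq> ?E1" using se_subfield[OF E xL] se_incl[OF E(1) xL] E(2) by auto
 have m: "sext K u \<subseteq> sext M u"
  if "subfield M L" "K \<subseteq> M" "u \<in> carrier L" for M u
  using se_least[OF se_subfield[OF that] _ se_mem[OF that(1,3)]] se_incl[OF that(1,3)] that(2) by blast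
 have zrE: "z [^] r \<in> ?E" by (rule se_mem[OF subfieldK zr])
 have yr: "y [^] r \<in> carrier L" and xr: "x [^] r \<in> carrier L" using xL yL by auto
 have "z \<in> ?E1"
 proof (rule root_in_base[OF E1 yL])
  show "y \<in> sext ?E1 (y [^] r)" using m[OF E1 yr] good(2) by blast
  have "sext (sext K x) y \<subseteq> sext ?E1 y"
   by (rule se_least[OF se_subfield[OF E1 yL] _ se_mem[OF E1(1) yL]]) (use m[OF E xL] se_incl[OF E1(1) yL] in blast)
  thus "z \<in> sext ?E1 y" using z by blast
  show "z [^] r \<in> ?E1" using zrE se_incl[OF E(1) xL] by blast
 qed
 hence "z \<in> ?E" by (rule root_in_base[OF E xL _ _ zrE, rotated]) (use m[OF E xr] good(1) in blast)
 thus ?thesis using separable_iff[OF zL] zL by (simp add: sepc_def)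
qed

lemma sepc_subring: "subring sepc L"
proof (rule subringI)
 have *: "x \<in> sext (sext K x) y" "y \<in> sext (sext K x) y"
  "subring (sext (sext K x) y) L" if "x \<in> sepc" "y \<in> sepc" for x y
 proof -
  have xL: "x \<in> carrier L" and yL: "y \<in> carrier L" using that sepc_carrier by auto
  note F = se_subfield[OF subfieldK subset_refl xL] se_incl[OF subfieldK xL]
  show "x \<in> sext (sext K x) y" "y \<in> sext (sext K x) y"
   using se_incl[OF F(1) yL] se_mem[OF subfieldK xL] se_mem[OF F(1) yL] by auto
  show "subring (sext (sext K x) y) L" by (rule subfieldE(1)[OF se_subfield[OF F yL]])
 qed
 show "\<one> \<in> sepc" using sepc_base subringE(3)[OF subfieldE(1)[OF subfieldK]] by blast
 fix x assume x: "x \<in> sepc"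
 show "\<ominus> x \<in> sepc" using sepc_two[OF x x] subringE(5)[OF *(3)[OF x x] *(1)[OF x x]] by blast
 fix y assume y: "y \<in> sepc"
 show "x \<otimes> y \<in> sepc" using sepc_two[OF x y] subringE(6)[OF *(3)[OF x y] *(1)[OF x y] *(2)[OF x y]] by blast
 show "x \<oplus> y \<in> sepc" using sepc_two[OF x y] subringE(7)[OF *(3)[OF x y] *(1)[OF x y] *(2)[OF x y]] by blast
qed (auto simp: sepc_carrier)

lemma galD:
 assumes "\<tau> \<in> gal"
 shows "x \<in> sepc \<Longrightarrow> \<tau> x \<in> sepc" "x \<in> sepc \<Longrightarrow> \<tau> x \<in> carrier L" "x \<in> sepc \<Longrightarrow> y \<in> sepc \<Longrightarrow> \<tau> (x \<otimes> y) = \<tau> x \<otimes> \<tau> y"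
  "x \<in> sepc \<Longrightarrow> y \<in> sepc \<Longrightarrow> \<tau> (x \<oplus> y) = \<tau> x \<oplus> \<tau> y" "\<tau> \<one> = \<one>" "bij_betw \<tau> sepc sepc"
  "x \<in> K \<Longrightarrow> \<tau> x = x" "\<tau> \<in> extensional sepc"
 using assms ring_iso_memE[of \<tau> "L\<lparr>carrier := sepc\<rparr>" "L\<lparr>carrier := sepc\<rparr>"] sepc_carrier by (auto simp: gal_def)

lemma gal_pow: "\<tau> \<in> gal \<Longrightarrow> x \<in> sepc \<Longrightarrow> \<tau> (x [^] (n::nat)) = \<tau> x [^] n" by (induction n) (simp_all add: galD sepc_pow)

text \<open>The unique prolongation of \<tau> to the algebraic closure: some power x^(r^n) is
  separable, and the image of \<open>x\<close> is the only r^n-th root of the image of this power.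
  Outside the carrier it is the identity, as \<open>autos\<close> requires.\<close>

definition ext :: "('a \<Rightarrow> 'a) \<Rightarrow> 'a \<Rightarrow> 'a" where
 "ext \<tau> x = (if x \<in> carrier L then
   (THE y. y \<in> carrier L \<and> (\<forall>n. x [^] (r ^ n) \<in> sepc \<longrightarrow> y [^] (r ^ n) = \<tau> (x [^] (r ^ n)))) else x)"

lemma ext_unique:
 assumes t: "\<tau> \<in> gal" and x: "x \<in> carrier L" "y \<in> carrier L" "x [^] (r ^ n) \<in> sepc" "y [^] (r ^ n) = \<tau> (x [^] (r ^ n))"
  and m: "x [^] (r ^ m) \<in> sepc"
 shows "y [^] (r ^ m) = \<tau> (x [^] (r ^ m))"
proof (rule rn_inj[of _ _ n])
 have "(y [^] (r ^ m)) [^] (r ^ n) = \<tau> (x [^] (r ^ n)) [^] (r ^ m)"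
  using x by (simp flip: x(4) add: nat_pow_pow mult.commute)
 also have "\<dots> = \<tau> ((x [^] (r ^ n)) [^] (r ^ m))" using gal_pow[OF t x(3)] by simp
 also have "(x [^] (r ^ n)) [^] (r ^ m) = (x [^] (r ^ m)) [^] (r ^ n)" using x by (simp add: nat_pow_pow mult.commute)
 finally show "(y [^] (r ^ m)) [^] (r ^ n) = \<tau> (x [^] (r ^ m)) [^] (r ^ n)" using gal_pow[OF t m] by simp
qed (use x galD(2)[OF t m] in auto)

lemma sepc_ex: "x \<in> carrier L \<Longrightarrow> \<exists>n. x [^] (r ^ n) \<in> sepc" using separable_power[of x] by (auto simp: sepc_def)

lemma ext_props:
 assumes t: "\<tau> \<in> gal" and x: "x \<in> carrier L"
 shows "ext \<tau> x \<in> carrier L" "x [^] (r ^ n) \<in> sepc \<Longrightarrow> ext \<tau> x [^] (r ^ n) = \<tau> (x [^] (r ^ n))"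
proof -
 let ?P = "\<lambda>y. y \<in> carrier L \<and> (\<forall>n. x [^] (r ^ n) \<in> sepc \<longrightarrow> y [^] (r ^ n) = \<tau> (x [^] (r ^ n)))"
 obtain m where m: "x [^] (r ^ m) \<in> sepc" using sepc_ex[OF x] by blast
 have "r ^ m > 0" using r_pos by simp
 then obtain y where y: "y \<in> carrier L" "y [^] (r ^ m) = \<tau> (x [^] (r ^ m))" using power_root[OF galD(2)[OF t m]] by blast
 have "?P y" using y ext_unique[OF t x y(1) m y(2)] by blast
 moreover have "z = y" if "?P z" for z using that y m rn_inj[of z y m] by simp
 ultimately have "?P (THE y. ?P y)" by (rule theI)
 thus "ext \<tau> x \<in> carrier L" "x [^] (r ^ n) \<in> sepc \<Longrightarrow> ext \<tau> x [^] (r ^ n) = \<tau> (x [^] (r ^ n))"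
  using x by (simp_all add: ext_def)
qed

lemma ext_eqI:
 assumes t: "\<tau> \<in> gal" and x: "x \<in> carrier L" "y \<in> carrier L" "x [^] (r ^ n) \<in> sepc" "y [^] (r ^ n) = \<tau> (x [^] (r ^ n))"
 shows "ext \<tau> x = y" using rn_inj[OF ext_props(1)[OF t x(1)] x(2), of n] ext_props(2)[OF t x(1,3)] x(4) by simp

lemma sepc_pow_mono: "x \<in> carrier L \<Longrightarrow> x [^] (r ^ m) \<in> sepc \<Longrightarrow> x [^] (r ^ (m + k)) \<in> sepc"
 using sepc_pow[of "x [^] (r ^ m)" "r ^ k"] by (simp add: nat_pow_pow power_add)

lemma ext_autos: 
 assumes t: "\<tau> \<in> gal"
 shows "ext \<tau> \<in> autos"
proof -
 have ex3: "\<exists>n. x [^] (r ^ n) \<in> sepc \<and> y [^] (r ^ n) \<in> sepc" if xy: "x \<in> carrier L" "y \<in> carrier L" for x y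
 proof -
  obtain m k where mk: "x [^] (r ^ m) \<in> sepc" "y [^] (r ^ k) \<in> sepc" using sepc_ex xy by meson
  hence "x [^] (r ^ (m + k)) \<in> sepc \<and> y [^] (r ^ (m + k)) \<in> sepc" using sepc_pow_mono xy by (metis add.commute)
  thus ?thesis by blast
 qed
 have "ext \<tau> \<in> ring_hom L L"
 proof (rule ring_hom_memI)
  fix x y assume xy: "x \<in> carrier L" "y \<in> carrier L"
  obtain n where n: "x [^] (r ^ n) \<in> sepc" "y [^] (r ^ n) \<in> sepc" using ex3[OF xy] by blast
  note e = ext_props[OF t xy(1)] ext_props[OF t xy(2)]
  show "ext \<tau> (x \<otimes> y) = ext \<tau> x \<otimes> ext \<tau> y" by (rule ext_eqI[OF t, of _ _ n])
    (use xy e n subringE(6)[OF sepc_subring n] galD(3)[OF t n] in "simp_all add: nat_pow_distrib")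
  show "ext \<tau> (x \<oplus> y) = ext \<tau> x \<oplus> ext \<tau> y" by (rule ext_eqI[OF t, of _ _ n])
    (use xy e n subringE(7)[OF sepc_subring n] galD(4)[OF t n] in "simp_all add: rn_add")
 next
  show "ext \<tau> \<one> = \<one>" by (rule ext_eqI[OF t, of _ _ 0]) (use galD(5)[OF t] subringE(3)[OF sepc_subring] in auto)
 qed (rule ext_props(1)[OF t])
 thus ?thesis by (simp add: autos_def ext_def)
qed

lemma ext_sepc: "\<tau> \<in> gal \<Longrightarrow> x \<in> sepc \<Longrightarrow> ext \<tau> x = \<tau> x" by (rule ext_eqI[of _ _ _ 0]) (auto simp: sepc_carrier galD)

lemma ext_faithful:
 assumes "\<tau> \<in> gal" "\<rho> \<in> gal" "ext \<tau> = ext \<rho>"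
 shows "\<tau> = \<rho>"
proof (rule extensionalityI[OF galD(8)[OF assms(1)] galD(8)[OF assms(2)]])
 fix x assume "x \<in> sepc"
 thus "\<tau> x = \<rho> x" using ext_sepc[OF assms(1)] ext_sepc[OF assms(2)] assms(3) by metis
qed

lemma ext_one:
 assumes "(\<lambda>x\<in>sepc. x) \<in> gal"
 shows "ext (\<lambda>x\<in>sepc. x) x = x"
proof (cases "x \<in> carrier L")
 case True
 then obtain n where "x [^] (r ^ n) \<in> sepc" using sepc_ex by blast
 thus ?thesis using ext_eqI[OF assms True True] by simp
qed (simp add: ext_def)

lemma ext_compose:
 assumes t: "\<tau> \<in> gal" "\<rho> \<in> gal" "compose sepc \<tau> \<rho> \<in> gal"
 shows "ext (compose sepc \<tau> \<rho>) x = ext \<tau> (ext \<rho> x)"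
proof (cases "x \<in> carrier L")
 case True
 then obtain n where n: "x [^] (r ^ n) \<in> sepc" using sepc_ex by blast
 have "ext \<rho> x [^] (r ^ n) \<in> sepc" using ext_props(2)[OF t(2) True n] galD(1)[OF t(2) n] by simp
 hence "ext \<tau> (ext \<rho> x) [^] (r ^ n) = \<tau> (\<rho> (x [^] (r ^ n)))"
  using ext_props(2)[OF t(1) ext_props(1)[OF t(2) True]] ext_props(2)[OF t(2) True n] by simp
 thus ?thesis by (intro ext_eqI[OF t(3) True _ n]) (use n ext_props(1) t True in "auto simp: compose_def")
qed (simp add: ext_def)

text \<open>Prescribing the image of \<open>x\<close> is a condition on the restriction of \<tau> to
  K(x^(r^n)) for suitable n, a finite extension of \<open>K\<close> inside the separable
  closure.\<close>

lemma openin_ext: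
 assumes x: "x \<in> carrier L"
 shows "openin galtop {\<tau> \<in> gal. ext \<tau> x = y}"
proof -
 obtain n where n: "x [^] (r ^ n) \<in> sepc" using sepc_ex[OF x] by blast
 let ?s = "x [^] (r ^ n)" let ?E = "sext K ?s"
 have s: "?s \<in> carrier L" using x by simp
 have sub: "?E \<subseteq> sepc" using sepc_se[OF n] by blast
 let ?M = "L\<lparr>carrier := sepc\<rparr>"
 have M: "ring ?M" by (rule subring_is_ring[OF sepc_subring])
 have sf: "subfield F ?M" if "subfield F L" "F \<subseteq> sepc" for F
  using ring.subfield_iff(1)[OF M, of F] subfield_iff(2)[OF that(1)] that(2) by simp
 have E: "subfield ?E ?M" by (rule sf[OF se_subfield[OF subfieldK subset_refl s] sub])
 have K: "subfield K ?M" by (rule sf[OF subfieldK]) (use sepc_base in blast)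
 have span: "?E = Span K (exp_base ?s (dg K ?s))" using Span_exp_base[OF subfieldK s alg[OF subfieldK subset_refl s]] by simp
 have "set (exp_base ?s (dg K ?s)) \<subseteq> sepc" using sepc_pow[OF n] by (auto simp: exp_base_def)
 hence fin: "ring.finite_dimension ?M K ?E" using ring.Span_finite_dimension[OF M K, of "exp_base ?s (dg K ?s)"]
  unfolding Span_consistent[OF sepc_subring] span by simp
 have b: "openin galtop {\<tau> \<in> gal. \<forall>x\<in>?E. \<tau> x = \<rho> x}" if "\<rho> \<in> gal" for \<rho> unfolding galtop_def
  by (rule topology_generated_by_Basis) (use that E fin se_incl[OF subfieldK s] in blast)
 have "{\<tau> \<in> gal. ext \<tau> x = y} = \<Union>((\<lambda>\<rho>. {\<tau> \<in> gal. \<forall>x\<in>?E. \<tau> x = \<rho> x}) ` {\<rho> \<in> gal. ext \<rho> x = y})"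
 proof (rule equalityI; rule subsetI)
  fix \<tau> assume "\<tau> \<in> \<Union>((\<lambda>\<rho>. {\<tau> \<in> gal. \<forall>x\<in>?E. \<tau> x = \<rho> x}) ` {\<rho> \<in> gal. ext \<rho> x = y})"
  then obtain \<rho> where \<rho>: "\<rho> \<in> gal" "ext \<rho> x = y" "\<tau> \<in> gal" "\<forall>x\<in>?E. \<tau> x = \<rho> x" by blast
  hence "\<tau> ?s = \<rho> ?s" using se_mem[OF subfieldK s] by blast
  hence "ext \<tau> x = y" using ext_eqI[OF \<rho>(3) x ext_props(1)[OF \<rho>(1) x] n] ext_props(2)[OF \<rho>(1) x n] \<rho>(2) by simp
  thus "\<tau> \<in> {\<tau> \<in> gal. ext \<tau> x = y}" using \<rho>(3) by blast
 qed blast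
 also have "openin galtop \<dots>" by (rule openin_Union) (use b in blast)
 finally show ?thesis .
qed

end

lemma ring_characteristic_char_of:
 assumes "field R"
 shows "char_of R (ring_characteristic R)"
proof -
 interpret field R by (rule assms)
 let ?Z = "\<lambda>m::nat. [m] \<cdot>\<^bsub>R\<^esub> \<one>\<^bsub>R\<^esub> = \<zero>\<^bsub>R\<^esub>"
 show ?thesis
 proof (cases "\<exists>m>0. ?Z m")
  case False
  have nz: "\<not> ?Z m" if "m > 0" for m using False that by blast
  have "?Z m \<longleftrightarrow> m = 0" for m using nz[of m] by (cases "m = 0") simp_all
  moreover have "ring_characteristic R = 0" unfolding ring_characteristic_def by (rule if_not_P[OF False])
  ultimately show ?thesis unfolding char_of_def by simp
 next
  case True
  define p where "p = (LEAST m. m > 0 \<and> ?Z m)"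
  have p: "p > 0" "?Z p" using LeastI_ex[OF True] unfolding p_def by auto
  have small: "m = 0" if "m < p" "?Z m" for m using not_less_Least[of m "\<lambda>m. m > 0 \<and> ?Z m"] that unfolding p_def by (meson gr0I)
  have rc: "ring_characteristic R = p" unfolding ring_characteristic_def p_def by (rule if_P[OF True])
  have "?Z m \<longleftrightarrow> p dvd m" for m
  proof -
   have zk: "?Z (k * p)" for k
    using p(2) add.nat_pow_pow[OF one_closed, of k p] add.nat_pow_one[of k] by (simp add: mult.commute)
   have "[m] \<cdot>\<^bsub>R\<^esub> \<one>\<^bsub>R\<^esub> = [(m div p * p)] \<cdot>\<^bsub>R\<^esub> \<one>\<^bsub>R\<^esub> \<oplus>\<^bsub>R\<^esub> [(m mod p)] \<cdot>\<^bsub>R\<^esub> \<one>\<^bsub>R\<^esub>"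
    using add.nat_pow_mult[OF one_closed, of "m div p * p" "m mod p"] by simp
   hence "?Z m \<longleftrightarrow> ?Z (m mod p)" using zk by simp
   also have "\<dots> \<longleftrightarrow> m mod p = 0" using small[of "m mod p"] p(1) by auto
   finally show ?thesis by (simp add: dvd_eq_mod_eq_0)
  qed
  thus ?thesis unfolding char_of_def rc by blast
 qed
qed

lemma char_of_hom:
 assumes "field R" "field S" "h \<in> ring_hom R S" "char_of R p"
 shows "char_of S p"
proof -
 interpret R: field R by fact
 interpret S: field S by fact
 interpret h: ring_hom_ring R S h using ring_hom_ringI2[OF R.is_ring S.is_ring assms(3)] .
 have "h ([n] \<cdot>\<^bsub>R\<^esub> \<one>\<^bsub>R\<^esub>) = [n] \<cdot>\<^bsub>S\<^esub> \<one>\<^bsub>S\<^esub>" for n :: nat by (induction n) simp_all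
 moreover have "inj_on h (carrier R)" by (rule non_trivial_field_hom_is_inj[OF assms(3,1,2)])
 ultimately have "[n] \<cdot>\<^bsub>S\<^esub> \<one>\<^bsub>S\<^esub> = \<zero>\<^bsub>S\<^esub> \<longleftrightarrow> [n] \<cdot>\<^bsub>R\<^esub> \<one>\<^bsub>R\<^esub> = \<zero>\<^bsub>R\<^esub>" for n :: nat
  using inj_onD[of h "carrier R" "[n] \<cdot>\<^bsub>R\<^esub> \<one>\<^bsub>R\<^esub>" "\<zero>\<^bsub>R\<^esub>" for n :: nat] by (metis R.add.nat_pow_closed R.one_closed R.zero_closed h.hom_zero)
 thus ?thesis using assms(4) by (simp add: char_of_def)
qed

lemma char_expI:
 fixes L (structure)
 assumes "algebraic_closure L K" "char_of L p"
 shows "char_exp L K (if p = 0 then 1 else p)"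
proof -
 interpret aclos L K using assms(1) by (simp add: aclos_def)
 let ?r = "if p = 0 then 1 else p"
 have z: "mev (of_nat n) = \<zero> \<longleftrightarrow> p dvd n" for n using assms(2) of_nat_ker[of n] by (simp add: char_of_def ker_def)
 have add: "mev ((x + y) ^ ?r) = mev (x ^ ?r + y ^ ?r)" for x y
 proof (cases "p = 0")
  case False
  have "(x + y) ^ p = x ^ p + y ^ p + of_nat p * fresh p x y" by (rule freshman_prime[OF char_prime[OF assms(2) False]])
  thus ?thesis using False z[of p] by (simp add: mev_add mev_mult)
 qed simp
 show ?thesis
 proof unfold_locales
  show "mev ((x + y) ^ ?r) = mev (x ^ ?r + y ^ ?r)" for x y by (rule add)
  fix x y assume e: "mev (x ^ ?r) = mev (y ^ ?r)"
  have "mev x [^] ?r = mev ((x - y) + y) [^] ?r" by simp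
  also have "\<dots> = mev ((x - y) ^ ?r) \<oplus> mev (y ^ ?r)"
   using add[of "x - y" y] by (simp only: mevD(8)[symmetric] mev_add[symmetric])
  finally have "mev (x ^ ?r) = mev ((x - y) ^ ?r) \<oplus> mev (y ^ ?r)" by (simp only: mevD(8)[symmetric])
  hence "mev ((x - y) ^ ?r) = \<zero>" using e by (metis l_zero add.r_cancel mev_closed zero_closed)
  hence "mev (x - y) = \<zero>" using pidealD(10)[OF ker, of "x - y" ?r] by (simp add: ker_def)
  thus "mev x = mev y" using mevD(10) by blast
 next
  fix i c assume "mev (of_nat i * c) = \<zero>"
  hence "mev c = \<zero> \<or> p dvd i" using pidealD(6)[OF ker, of "of_nat i" c] z by (auto simp: ker_def)
  moreover have "1 < p" if "p \<noteq> 0" using prime_gt_1_nat[OF char_prime[OF assms(2) that]] .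
  ultimately show "mev c = \<zero> \<or> i = 0 \<or> 1 < ?r \<and> ?r dvd i" by auto
 qed auto
qed

text \<open>The properties of the given Galois groups on which the construction rests. They act on
  the whole algebraic closure, because the Hahn construction asks for an algebraically closed
  residue field. The clauses on unit and product presuppose membership in the carrier, which is
  later supplied by an isomorphic profinite group.\<close>

theorem galois_extension:
 fixes K :: "('k, 'm) ring_scheme"
 assumes K: "field K"
 defines "L \<equiv> field.alg_closure K" and "p \<equiv> ring_characteristic K" and "Gal \<equiv> absolute_galois_group K"
 shows "acfield L" "char_of L p" "\<exists>ext. (\<forall>\<tau>\<in>carrier Gal. ext \<tau> \<in> acfield.autos L) \<and>
   (\<one>\<^bsub>Gal\<^esub> \<in> carrier Gal \<longrightarrow> (\<forall>x. ext \<one>\<^bsub>Gal\<^esub> x = x)) \<and>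
   (\<forall>\<tau>\<in>carrier Gal. \<forall>\<rho>\<in>carrier Gal. \<tau> \<otimes>\<^bsub>Gal\<^esub> \<rho> \<in> carrier Gal \<longrightarrow> (\<forall>x. ext (\<tau> \<otimes>\<^bsub>Gal\<^esub> \<rho>) x = ext \<tau> (ext \<rho> x))) \<and>
   inj_on ext (carrier Gal) \<and> (\<forall>x\<in>carrier L. \<forall>y. openin (topol Gal) {\<tau> \<in> carrier Gal. ext \<tau> x = y})"
proof -
 interpret K: field K by (rule K)
 have ac: "algebraic_closure L (base_field K)" using K.alg_closureE(1) by (simp add: L_def base_field_def)
 interpret aclos L "base_field K" using ac by (simp add: aclos_def)
 show c: "char_of L p" unfolding p_def by (rule char_of_hom[OF K field_axioms _ ring_characteristic_char_of[OF K]])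
   (use K.alg_closureE(2) in "simp add: L_def")
 interpret char_exp L "base_field K" "if p = 0 then 1 else p" by (rule char_expI[OF ac c])
 show "acfield L" by (rule acfield_axioms)
 have S: "carrier (sep_closure K) = sepc" unfolding sepc_def by (simp add: sep_closure_def L_def)
 have SL: "sep_closure K = L\<lparr>carrier := sepc\<rparr>" unfolding sepc_def by (simp add: sep_closure_def L_def)
 have G: "carrier Gal = gal" unfolding Gal_def absolute_galois_group_def absolute_galois_carrier_def gal_def S SL by simp
 hence G': "absolute_galois_carrier K = gal" by (simp add: Gal_def absolute_galois_group_def)
 have T: "topol Gal = galtop" unfolding Gal_def absolute_galois_group_def krull_topology_def galtop_def G' SL by simp
 have ops: "\<one>\<^bsub>Gal\<^esub> = (\<lambda>x\<in>sepc. x)" "\<tau> \<otimes>\<^bsub>Gal\<^esub> \<rho> = compose sepc \<tau> \<rho>" for \<tau> \<rho>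
  unfolding Gal_def absolute_galois_group_def S by simp_all
 show "\<exists>ext. (\<forall>\<tau>\<in>carrier Gal. ext \<tau> \<in> acfield.autos L) \<and>
   (\<one>\<^bsub>Gal\<^esub> \<in> carrier Gal \<longrightarrow> (\<forall>x. ext \<one>\<^bsub>Gal\<^esub> x = x)) \<and>
   (\<forall>\<tau>\<in>carrier Gal. \<forall>\<rho>\<in>carrier Gal. \<tau> \<otimes>\<^bsub>Gal\<^esub> \<rho> \<in> carrier Gal \<longrightarrow> (\<forall>x. ext (\<tau> \<otimes>\<^bsub>Gal\<^esub> \<rho>) x = ext \<tau> (ext \<rho> x))) \<and>
   inj_on ext (carrier Gal) \<and> (\<forall>x\<in>carrier L. \<forall>y. openin (topol Gal) {\<tau> \<in> carrier Gal. ext \<tau> x = y})" unfolding G T ops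
  by (rule exI[of _ ext]) (use ext_autos ext_one ext_compose ext_faithful openin_ext in "auto simp: inj_on_def")
qed

section \<open>A profinite group acting on its clopen subsets\<close>

lemma lconst_finite_range:
 assumes c: "compact_space (topol M)" and t: "topspace (topol M) = carrier M" and l: "lconst M f"
 shows "finite (f ` carrier M)"
proof -
 let ?U = "(\<lambda>a. {g \<in> carrier M. f g = a}) ` (f ` carrier M)"
 have "\<exists>F. finite F \<and> F \<subseteq> ?U \<and> topspace (topol M) \<subseteq> \<Union>F"
 proof (rule compactinD[OF c[unfolded compact_space_def]])
  show "openin (topol M) u" if u: "u \<in> ?U" for u
  proof -
   obtain a where "u = {g \<in> carrier M. f g = a}" using u by blast
   thus ?thesis using l unfolding lconst_def by simp
  qed
  show "topspace (topol M) \<subseteq> \<Union>?U" unfolding t by blast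
 qed
 then obtain F where F: "finite F" "F \<subseteq> ?U" "carrier M \<subseteq> \<Union>F" unfolding t by blast
 then obtain B where B: "finite B" "B \<subseteq> f ` carrier M" "F = (\<lambda>a. {g \<in> carrier M. f g = a}) ` B"
  by (meson finite_subset_image)
 hence "f ` carrier M \<subseteq> B" using F(3) by auto
 thus ?thesis using B(1) finite_subset by blast
qed

text \<open>In a compact Hausdorff space components are quasi-components, and points in different
  quasi-components are separated by clopen sets.\<close>

lemma clopen_separation:
 assumes P: "compact_space T" "Hausdorff_space T" "totally_disconnected_space T"
  and xy: "x \<in> topspace T" "y \<in> topspace T" "x \<noteq> y"
 shows "\<exists>U. openin T U \<and> closedin T U \<and> x \<in> U \<and> y \<notin> U"
proof -
 have "connected_component_of_set T x = {x}" using P(3) xy(1) by (simp add: totally_disconnected_space_def)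
 hence "\<not> quasi_component_of T x y"
  using quasi_eq_connected_component_of[of T x] P(1,2) xy(3) by (metis mem_Collect_eq singletonD)
 thus ?thesis using xy unfolding quasi_component_of by blast
qed

text \<open>Sets that are not clopen are fixed, which makes this an action on the full type
  \<open>'h set\<close>, the index set of the independent elements.\<close>

definition ltr :: "('h, 'm) top_group_scheme \<Rightarrow> 'h \<Rightarrow> 'h set \<Rightarrow> 'h set" where
 "ltr P g U = (if openin (topol P) U \<and> closedin (topol P) U then (\<lambda>h. g \<otimes>\<^bsub>P\<^esub> h) ` U else U)"

locale profin =
 fixes P :: "('h, 'm) top_group_scheme" (structure)
 assumes prof: "profinite_group P"
begin

lemma tg: "topological_group P" using prof by (simp add: profinite_group_def)

lemma is_group: "group P" using tg by (simp add: topological_group_def)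

lemma tsp: "topspace (topol P) = carrier P" using tg by (simp add: topological_group_def)

lemma compact: "compact_space (topol P)" using prof by (simp add: profinite_group_def)

lemma cont_mult: "continuous_map (prod_topology (topol P) (topol P)) (topol P) (\<lambda>(x, y). x \<otimes> y)"
 using tg by (simp add: topological_group_def)

lemma cont_left: "g \<in> carrier P \<Longrightarrow> continuous_map (topol P) (topol P) (\<lambda>h. g \<otimes> h)"
 using continuous_map_compose[OF _ cont_mult, of "topol P" "\<lambda>h. (g, h)"] by (simp add: o_def continuous_map_pairwise tsp)

lemma translate_vimage:
 assumes g: "g \<in> carrier P" and U: "U \<subseteq> carrier P"
 shows "(\<lambda>h. g \<otimes> h) ` U = {h \<in> carrier P. inv g \<otimes> h \<in> U}"
proof -
 interpret group P by (rule is_group)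
 show ?thesis
 proof (intro equalityI subsetI)
  fix h assume "h \<in> {h \<in> carrier P. inv g \<otimes> h \<in> U}"
  hence "h = g \<otimes> (inv g \<otimes> h)" "inv g \<otimes> h \<in> U" using g by (auto simp: m_assoc[symmetric])
  thus "h \<in> (\<lambda>h. g \<otimes> h) ` U" by blast
 qed (use g U in "auto simp: m_assoc[symmetric] subset_iff")
qed

lemma clopen_translate:
 assumes g: "g \<in> carrier P" and U: "openin (topol P) U" "closedin (topol P) U"
 shows "openin (topol P) ((\<lambda>h. g \<otimes> h) ` U)" "closedin (topol P) ((\<lambda>h. g \<otimes> h) ` U)"
proof -
 interpret group P by (rule is_group)
 have s: "U \<subseteq> carrier P" using openin_subset[OF U(1)] tsp by simp
 have i: "inv g \<in> carrier P" using g by simp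
 show "openin (topol P) ((\<lambda>h. g \<otimes> h) ` U)"
  unfolding translate_vimage[OF g s] using openin_continuous_map_preimage[OF cont_left[OF i] U(1)] by (simp add: tsp)
 show "closedin (topol P) ((\<lambda>h. g \<otimes> h) ` U)"
  unfolding translate_vimage[OF g s] using closedin_continuous_map_preimage[OF cont_left[OF i] U(2)] by (simp add: tsp)
qed

lemma ltr_one: "ltr P \<one> U = U"
proof -
 interpret group P by (rule is_group)
 have "(\<lambda>h. \<one> \<otimes> h) ` U = U" if "U \<subseteq> carrier P"
 proof -
  have "(\<lambda>h. \<one> \<otimes> h) ` U = (\<lambda>h. h) ` U" by (rule image_cong) (use that in auto)
  thus ?thesis by simp
 qed
 thus ?thesis using openin_subset[of "topol P" U] by (simp add: ltr_def tsp)
qed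

lemma ltr_mult:
 assumes g: "g \<in> carrier P" "h \<in> carrier P"
 shows "ltr P (g \<otimes> h) U = ltr P g (ltr P h U)"
proof (cases "openin (topol P) U \<and> closedin (topol P) U")
 case True
 interpret group P by (rule is_group)
 have "U \<subseteq> carrier P" using openin_subset[of "topol P" U] True tsp by simp
 hence "(\<lambda>k. (g \<otimes> h) \<otimes> k) ` U = (\<lambda>k. g \<otimes> k) ` ((\<lambda>k. h \<otimes> k) ` U)"
  unfolding image_image using g by (intro image_cong) (auto simp: m_assoc)
 thus ?thesis using True clopen_translate[OF g(2), of U] by (simp add: ltr_def)
next
 case False
 hence "ltr P k U = U" for k unfolding ltr_def by (rule if_not_P)
 thus ?thesis by simp
qed

text \<open>The complement is the projection of a closed set along a compact factor.\<close>

lemma open_translate_sub: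
 assumes U: "closedin (topol P) U" and V: "openin (topol P) V"
 shows "openin (topol P) {g \<in> carrier P. \<forall>h\<in>U. g \<otimes> h \<in> V}"
proof -
 let ?T = "topol P"
 let ?C = "{z \<in> topspace (prod_topology ?T ?T). (\<lambda>(x, y). x \<otimes> y) z \<in> topspace ?T - V} \<inter> (topspace ?T \<times> U)"
 have "closedin (prod_topology ?T ?T) ?C"
  by (intro closedin_Int closedin_continuous_map_preimage[OF cont_mult] closedin_diff closedin_topspace V)
   (simp add: closedin_prod_Times_iff U)
 hence "closedin ?T (fst ` ?C)" using closed_map_fst[OF compact] by (auto simp: closed_map_def)
 moreover have "{g \<in> carrier P. \<forall>h\<in>U. g \<otimes> h \<in> V} = topspace ?T - fst ` ?C"
 proof -
  interpret group P by (rule is_group)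
  have "U \<subseteq> carrier P" using closedin_subset[OF U] tsp by simp
  thus ?thesis by (force simp: tsp image_def)
 qed
 ultimately show ?thesis by auto
qed

text \<open>For clopen sets, g U = V says that \<open>g\<close> maps \<open>U\<close> into
  \<open>V\<close> and the complement of \<open>U\<close> into that of \<open>V\<close>; both
  conditions on \<open>g\<close> are open.\<close>

lemma ltr_lconst: "lconst P (\<lambda>g. ltr P g U)"
proof (cases "openin (topol P) U \<and> closedin (topol P) U")
 case False
 hence "(\<lambda>g. ltr P g U) = (\<lambda>g. U)" by (auto simp: ltr_def)
 thus ?thesis using lconst_const[OF tsp] by simp
next
 case True
 interpret group P by (rule is_group)
 let ?T = "topol P"
 have U: "openin ?T U" "closedin ?T U" "U \<subseteq> carrier P" using True openin_subset[of ?T U] tsp by auto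
 show ?thesis unfolding lconst_def
 proof
  fix V
  show "openin ?T {g \<in> carrier P. ltr P g U = V}"
  proof (cases "openin ?T V \<and> closedin ?T V")
   case False
   hence "{g \<in> carrier P. ltr P g U = V} = {}" using clopen_translate U by (auto simp: ltr_def)
   thus ?thesis by (metis openin_empty)
  next
   case Vt: True
   let ?c = "\<lambda>A. carrier P - A"
   have c: "openin ?T (?c V)" "closedin ?T (?c U)"
    using Vt U tsp by (metis openin_diff openin_topspace, metis closedin_diff closedin_topspace)
   have Vs: "V \<subseteq> carrier P" using openin_subset[of ?T V] Vt tsp by simp
   have "{g \<in> carrier P. ltr P g U = V} =
     {g \<in> carrier P. \<forall>h\<in>U. g \<otimes> h \<in> V} \<inter> {g \<in> carrier P. \<forall>h\<in>?c U. g \<otimes> h \<in> ?c V}"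
   proof (intro equalityI subsetI)
    fix g assume "g \<in> {g \<in> carrier P. ltr P g U = V}"
    hence g: "g \<in> carrier P" "(\<lambda>h. g \<otimes> h) ` U = V" using True by (auto simp: ltr_def)
    have "g \<otimes> h \<notin> V" if h: "h \<in> carrier P" "h \<notin> U" for h
    proof
     assume "g \<otimes> h \<in> V"
     then obtain u where "u \<in> U" "g \<otimes> h = g \<otimes> u" using g(2) by auto
     thus False using h g(1) U(3) by (metis l_cancel subsetD)
    qed
    thus "g \<in> {g \<in> carrier P. \<forall>h\<in>U. g \<otimes> h \<in> V} \<inter> {g \<in> carrier P. \<forall>h\<in>?c U. g \<otimes> h \<in> ?c V}" using g by auto
   next
    fix g assume g: "g \<in> {g \<in> carrier P. \<forall>h\<in>U. g \<otimes> h \<in> V} \<inter> {g \<in> carrier P. \<forall>h\<in>?c U. g \<otimes> h \<in> ?c V}"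
    have "v \<in> (\<lambda>h. g \<otimes> h) ` U" if v: "v \<in> V" for v
    proof -
     have v': "v \<in> carrier P" using v Vs by blast
     have e: "g \<otimes> (inv g \<otimes> v) = v" using g v' by (auto simp: m_assoc[symmetric])
     have "inv g \<otimes> v \<in> U"
     proof (rule ccontr)
      assume "inv g \<otimes> v \<notin> U"
      hence "g \<otimes> (inv g \<otimes> v) \<in> ?c V" using g v' by auto
      thus False using e v by simp
     qed
     thus ?thesis using e by (metis imageI)
    qed
    hence "(\<lambda>h. g \<otimes> h) ` U = V" using g by blast
    thus "g \<in> {g \<in> carrier P. ltr P g U = V}" using g True by (auto simp: ltr_def)
   qed
   also have "openin ?T \<dots>" by (intro openin_Int open_translate_sub) (use U c Vt in auto)
   finally show ?thesis .
  qed
 qed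
qed

text \<open>A clopen neighbourhood of the unit that misses h^(-1) g has different translates by
  \<open>g\<close> and \<open>h\<close>.\<close>

lemma ltr_faithful:
 assumes gh: "g \<in> carrier P" "h \<in> carrier P" "\<And>U. ltr P g U = ltr P h U"
 shows "g = h"
proof (rule ccontr)
 interpret group P by (rule is_group)
 assume "g \<noteq> h"
 hence "\<one> \<noteq> inv h \<otimes> g" using gh(1,2) by (metis inv_closed inv_inv inv_unique' inv_equality r_inv inv_comm)
 then obtain U where U: "openin (topol P) U" "closedin (topol P) U" "\<one> \<in> U" "inv h \<otimes> g \<notin> U"
  using clopen_separation[of "topol P" \<one> "inv h \<otimes> g"] prof gh(1,2) by (auto simp: profinite_group_def tsp)
 have s: "U \<subseteq> carrier P" using openin_subset[OF U(1)] tsp by simp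
 have "g \<otimes> \<one> \<in> ltr P g U" using U by (auto simp: ltr_def)
 hence "g \<in> ltr P h U" using gh by simp
 hence "g \<in> {k \<in> carrier P. inv h \<otimes> k \<in> U}" using U translate_vimage[OF gh(2) s] by (simp add: ltr_def)
 thus False using U by simp
qed

end

section \<open>Galois theory of a compact group acting on a field\<close>

context cring
begin

definition hrel :: "('a \<Rightarrow> 'a) \<Rightarrow> (('a, int) mpol \<times> ('a, int) mpol) set" where
 "hrel \<phi> = {(a, b). \<phi> (mev a) = mev b}"

lemma ring_hom_neg:
 assumes "\<phi> \<in> ring_hom R R" "x \<in> carrier R"
 shows "\<phi> (\<ominus> x) = \<ominus> \<phi> x"
proof -
 interpret h: ring_hom_cring R R \<phi> using assms(1) is_cring by (simp add: ring_hom_cring_def ring_hom_cring_axioms_def)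
 show ?thesis using assms(2) by simp
qed

lemma ring_hom_0: "\<phi> \<in> ring_hom R R \<Longrightarrow> \<phi> \<zero> = \<zero>" using ring_hom_zero[of \<phi> R R] ring_axioms by simp

end

context field
begin

lemma hom_inj_on:
 assumes "\<phi> \<in> ring_hom R R"
 shows "inj_on \<phi> (carrier R)" by (rule non_trivial_field_hom_is_inj[OF assms field_axioms field_axioms])

lemma corr_hrel:
 assumes "\<phi> \<in> ring_hom R R"
 shows "corr {z. mev z = \<zero>} {z. mev z = \<zero>} (hrel \<phi>)" unfolding corr_def hrel_def
 using ring_hom_one[OF assms] ring_hom_add[OF assms] ring_hom_mult[OF assms]
  ring_hom_neg[OF assms] ring_hom_0[OF assms] inj_onD[OF hom_inj_on[OF assms]]
 by (auto simp: mev_one mevD(5,7) a_minus_def ring_hom_closed[OF assms])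

lemma pideal_ker: "pideal {z. mev z = \<zero>}" by (rule pideal_phom[OF domain_axioms phom_mev])

lemma hrel_mvar: "x \<in> carrier R \<Longrightarrow> \<phi> x \<in> carrier R \<Longrightarrow> (mvar x, mvar (\<phi> x)) \<in> hrel \<phi>" by (simp add: hrel_def)

end

lemma prp_prod:
 assumes "pideal N" "pideal M" "corr N M \<tau>" "finite A" "\<And>a. a \<in> A \<Longrightarrow> prp \<tau> (f a) (g a)"
 shows "prp \<tau> (prod f A) (prod g A)" using assms(4,5)
proof (induction A rule: finite_induct)
 case empty
 show ?case using corrD(1,2)[OF assms(3)] by (simp add: prp_def)
next
 case (insert a A)
 thus ?case using prp_mult[OF assms(1-3), of "f a" "g a" "prod f A" "prod g A"] by simp
qed

lemma prp_sum:
 assumes "corr N M \<tau>" "\<And>a. a \<in> A \<Longrightarrow> prp \<tau> (f a) (g a)"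
 shows "prp \<tau> (sum f A) (sum g A)"
 unfolding prp_def coeff_sum using assms(2) by (intro allI corrD(9)[OF assms(1)]) (simp add: prp_def)

lemma prp_root: "corr N M \<tau> \<Longrightarrow> (a, b) \<in> \<tau> \<Longrightarrow> prp \<tau> [:- a, 1:] [:- b, 1:]"
 using corrD(1,2,6)[of N M \<tau>] by (auto simp: prp_def coeff_pCons split: nat.splits)

lemma corr_poly:
 assumes "corr N M \<tau>" "prp \<tau> f g" "(a, b) \<in> \<tau>"
 shows "(poly f a, poly g b) \<in> \<tau>"
proof -
 let ?n = "max (pdegree f) (pdegree g)"
 have "poly f a = (\<Sum>i\<le>?n. pcoeff f i * a ^ i)" "poly g b = (\<Sum>i\<le>?n. pcoeff g i * b ^ i)"
  unfolding poly_altdef by (rule sum.mono_neutral_left; simp add: coeff_eq_0)+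
 thus ?thesis
  using assms(2,3) by (auto simp: prp_def intro!: corrD(9)[OF assms(1)] corrD(5)[OF assms(1)] corrD(7)[OF assms(1)])
qed

text \<open>A homomorphism fixing the invariants of \<open>H\<close> agrees with an element of \<open>H\<close> on any finite set:
 the image of \<open>a\<close> is a root of the polynomial with the orbit of \<open>a\<close> as roots, and Lagrange interpolation
 on this orbit shows that the invariants of the stabilizer of \<open>a\<close> are polynomials in \<open>a\<close>.\<close>

lemma (in field) finite_agree:
 fixes M (structure) and act :: "'h \<Rightarrow> 'a \<Rightarrow> 'a"
 assumes M: "group M" and F: "finite F" "F \<subseteq> carrier R" and H: "subgroup H M" and hom: "\<And>g. g \<in> H \<Longrightarrow> act g \<in> ring_hom R R"
  and one: "\<And>a. a \<in> carrier R \<Longrightarrow> act \<one>\<^bsub>M\<^esub> a = a"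
  and mult: "\<And>g h a. g \<in> H \<Longrightarrow> h \<in> H \<Longrightarrow> a \<in> carrier R \<Longrightarrow> act (g \<otimes>\<^bsub>M\<^esub> h) a = act g (act h a)"
  and fin: "\<And>a. a \<in> carrier R \<Longrightarrow> finite ((\<lambda>g. act g a) ` H)"
  and s: "\<rho> \<in> ring_hom R R" "\<And>b. b \<in> carrier R \<Longrightarrow> (\<And>h. h \<in> H \<Longrightarrow> act h b = b) \<Longrightarrow> \<rho> b = b"
 shows "\<exists>h\<in>H. \<forall>a\<in>F. act h a = \<rho> a" using F H hom mult fin s
proof (induction F arbitrary: H \<rho> rule: finite_induct)
 case empty
 thus ?case using subgroup.one_closed[OF empty.prems(2)] by auto
next
 case (insert a F)
 interpret M: group M by (rule M)
 note H = insert.prems(2) and hom = insert.prems(3) and mult = insert.prems(4) and fin = insert.prems(5)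
  and rho = insert.prems(6) and fixed = insert.prems(7)
 have a: "a \<in> carrier R" and F: "F \<subseteq> carrier R" using insert.prems(1) by auto
 have oneH: "\<one>\<^bsub>M\<^esub> \<in> H" and invH: "\<And>h. h \<in> H \<Longrightarrow> inv\<^bsub>M\<^esub> h \<in> H"
  and multH: "\<And>h g. h \<in> H \<Longrightarrow> g \<in> H \<Longrightarrow> h \<otimes>\<^bsub>M\<^esub> g \<in> H" and Hc: "\<And>h. h \<in> H \<Longrightarrow> h \<in> carrier M"
  using subgroup.one_closed[OF H] subgroup.m_inv_closed[OF H] subgroup.m_closed[OF H] subgroup.mem_carrier[OF H] by auto
 have cl: "act h x \<in> carrier R" if "h \<in> H" "x \<in> carrier R" for h x using ring_hom_closed[OF hom[OF that(1)] that(2)] .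
 have invact: "act (inv\<^bsub>M\<^esub> h) (act h x) = x" "act h (act (inv\<^bsub>M\<^esub> h) x) = x" if "h \<in> H" "x \<in> carrier R" for h x
  using mult[OF invH[OF that(1)] that] mult[OF that(1) invH[OF that(1)] that(2)] one[OF that(2)] Hc[OF that(1)] by simp_all
 define Q where "Q = (\<lambda>g. act g a) ` H"
 have finQ: "finite Q" unfolding Q_def by (rule fin[OF a])
 have aQ: "a \<in> Q" unfolding Q_def using one[OF a] oneH by force
 have Qc: "x \<in> carrier R" if "x \<in> Q" for x using that cl a by (auto simp: Q_def)
 have Qact: "act h x \<in> Q" if "h \<in> H" "x \<in> Q" for h x
 proof -
  obtain g where g: "g \<in> H" "x = act g a" using \<open>x \<in> Q\<close> by (auto simp: Q_def)
  hence "act h x = act (h \<otimes>\<^bsub>M\<^esub> g) a" using mult[OF that(1) g(1) a] by simp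
  thus ?thesis unfolding Q_def using multH[OF that(1) g(1)] by blast
 qed
 have Qbij: "bij_betw (act h) Q Q" if "h \<in> H" for h
  by (rule bij_betwI[of _ _ _ "act (inv\<^bsub>M\<^esub> h)"]) (use that Qact invH invact Qc in auto)
 let ?N = "{z. mev z = \<zero>}"
 note N = pideal_ker and ch = corr_hrel[OF hom] and cr = corr_hrel[OF rho]
 have coeff_fixed: "prp (hrel \<rho>) f f" if f: "\<And>h. h \<in> H \<Longrightarrow> prp (hrel (act h)) f f" for f unfolding prp_def hrel_def
 proof (intro allI)
  fix i
  have "\<rho> (mev (pcoeff f i)) = mev (pcoeff f i)" by (rule fixed) (use f in "auto simp: prp_def hrel_def")
  thus "(pcoeff f i, pcoeff f i) \<in> {(a, b). \<rho> (mev a) = mev b}" by simp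
 qed
 let ?r = "\<lambda>x. [:- mvar x, 1:] :: ('a, int) mpol poly"
 have pr: "prp (hrel (act h)) (\<Prod>x\<in>A. ?r x) (\<Prod>x\<in>A. ?r (act h x))" if "h \<in> H" "A \<subseteq> Q" for h A
  by (rule prp_prod[OF N N ch[OF that(1)] finite_subset[OF that(2) finQ]])
   (use that cl Qc in "auto intro!: prp_root[OF ch[OF that(1)]] hrel_mvar")
 have "\<exists>h1\<in>H. \<rho> a = act h1 a"
 proof -
  let ?p = "\<Prod>x\<in>Q. ?r x"
  have "prp (hrel (act h)) ?p ?p" if "h \<in> H" for h
   using pr[OF that subset_refl] prod.reindex_bij_betw[OF Qbij[OF that], of ?r] by simp
  hence c: "prp (hrel \<rho>) ?p ?p" by (rule coeff_fixed)
  have ra: "\<rho> a \<in> carrier R" using ring_hom_closed[OF rho a] .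
  have "(poly ?p (mvar a), poly ?p (mvar (\<rho> a))) \<in> hrel \<rho>" by (rule corr_poly[OF cr c hrel_mvar[where \<phi>=\<rho>, OF a ra]])
  moreover have "poly ?p (mvar a) = 0" unfolding poly_prod by (rule prod_zero[OF finQ], rule bexI[OF _ aQ]) simp
  ultimately have "mev (poly ?p (mvar (\<rho> a))) = \<zero>" using ring_hom_0[OF rho] by (auto simp: hrel_def mev_zero)
  hence "(\<Prod>x\<in>Q. mvar (\<rho> a) - mvar x) \<in> ?N" by (simp add: poly_prod)
  from iffD1[OF pidealD(13)[OF N finQ] this]
  obtain x where x: "x \<in> Q" "mev (mvar (\<rho> a) - mvar x) = \<zero>" by blast
  hence "\<rho> a = x" using mevD(10)[of "mvar (\<rho> a)" "mvar x"] ra Qc[OF x(1)] by simp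
  thus ?thesis using \<open>x \<in> Q\<close> by (auto simp: Q_def)
 qed
 then obtain h1 where h1: "h1 \<in> H" "\<rho> a = act h1 a" by blast
 \<comment> \<open>After composition with the inverse of \<open>h1\<close> the homomorphism fixes
   \<open>a\<close>; the induction hypothesis is applied to the stabilizer of \<open>a\<close> and
   the remaining points.\<close>
 define H' where "H' = {h \<in> H. act h a = a}"
 define \<rho>' where "\<rho>' = (\<lambda>x. act (inv\<^bsub>M\<^esub> h1) (\<rho> x))"
 have rho': "\<rho>' \<in> ring_hom R R" unfolding \<rho>'_def using ring_hom_trans[OF rho hom[OF invH[OF h1(1)]]] by (simp add: o_def)
 have r'a: "\<rho>' a = a" unfolding \<rho>'_def h1(2) by (rule invact[OF h1(1) a])
 have sub': "subgroup H' M"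
 proof (rule M.subgroupI)
  show "H' \<noteq> {}" using oneH one[OF a] by (auto simp: H'_def)
  fix h assume h: "h \<in> H'"
  hence "act (inv\<^bsub>M\<^esub> h) a = a" using invact(1)[of h a] a by (simp add: H'_def)
  thus "inv\<^bsub>M\<^esub> h \<in> H'" using h invH by (simp add: H'_def)
  fix g assume "g \<in> H'"
  thus "h \<otimes>\<^bsub>M\<^esub> g \<in> H'" using h mult[of h g a] a multH by (simp add: H'_def)
 qed (use Hc in "auto simp: H'_def")
 have fixed': "\<rho>' b = b" if b: "b \<in> carrier R" and bf: "\<And>h. h \<in> H' \<Longrightarrow> act h b = b" for b
 proof -
  have "\<exists>f. \<forall>h\<in>H. f (act h a) = act h b"
  proof -
   have "act h b = act g b" if hg: "h \<in> H" "g \<in> H" "act h a = act g a" for h g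
   proof -
    have "act (inv\<^bsub>M\<^esub> g \<otimes>\<^bsub>M\<^esub> h) a = a" using hg mult[OF invH hg(1) a] invact(1) a by simp
    hence "act (inv\<^bsub>M\<^esub> g \<otimes>\<^bsub>M\<^esub> h) b = b" using bf multH invH hg by (simp add: H'_def)
    hence "act (inv\<^bsub>M\<^esub> g) (act h b) = b" using mult[OF invH hg(1) b] hg by simp
    thus ?thesis using invact(2)[of g "act h b"] hg cl b by metis
   qed
   hence "\<forall>h\<in>H. act (SOME g. g \<in> H \<and> act g a = act h a) b = act h b" by (metis (mono_tags, lifting) someI_ex)
   thus ?thesis by (intro exI[of _ "\<lambda>x. act (SOME g. g \<in> H \<and> act g a = x) b"])
  qed
  then obtain f where f: "\<And>h. h \<in> H \<Longrightarrow> f (act h a) = act h b" by blast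
  have fc: "f x \<in> carrier R" if "x \<in> Q" for x using that f cl b by (auto simp: Q_def)
  have fa: "f a = b" using f[OF oneH] one a b by simp
  have fact: "f (act h x) = act h (f x)" if hx: "h \<in> H" "x \<in> Q" for h x
  proof -
   obtain g where g: "g \<in> H" "x = act g a" using hx by (auto simp: Q_def)
   have "f (act h x) = f (act (h \<otimes>\<^bsub>M\<^esub> g) a)" using g mult[OF hx(1) g(1) a] by simp
   also have "\<dots> = act h (act g b)" using f[OF multH[OF hx(1) g(1)]] mult[OF hx(1) g(1) b] by simp
   finally show ?thesis using f[OF g(1)] g(2) by simp
  qed
  \<comment> \<open>The denominator of the Lagrange basis polynomial at \<open>x\<close>. It is
    never inverted: the interpolation identity \<open>main\<close> is used once for \<open>f\<close>
    and once for the constant \<one>, and the value at \<open>a\<close> is cancelled at the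
    end.\<close>
  define D where "D x = (\<Prod>y\<in>Q - {x}. mvar x - mvar y :: ('a, int) mpol)" for x
  have Dnz: "mev (D x) \<noteq> \<zero>" if x: "x \<in> Q" for x
  proof
   assume "mev (D x) = \<zero>"
   hence "(\<Prod>y\<in>Q - {x}. mvar x - mvar y) \<in> ?N" by (simp add: D_def)
   from iffD1[OF pidealD(13)[OF N finite_Diff[OF finQ]] this]
   obtain y where y: "y \<in> Q - {x}" "mev (mvar x - mvar y) = \<zero>" by blast
   hence "x = y" using mevD(10)[of "mvar x" "mvar y"] x Qc[of x] Qc[of y] by simp
   thus False using y(1) by simp
  qed
  have Qminus: "bij_betw (act h) (Q - {x}) (Q - {act h x})" if hx: "h \<in> H" "x \<in> Q" for h x
   using bij_betw_DiffI[OF Qbij[OF hx(1)], of "{x}" "{act h x}"] hx Qact by (simp add: bij_betw_def)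
  have main: "\<rho> (k a \<otimes> mev (D a)) = act h1 (k a \<otimes> mev (D a))"
   if kc: "\<And>x. x \<in> Q \<Longrightarrow> k x \<in> carrier R" and kact: "\<And>h x. h \<in> H \<Longrightarrow> x \<in> Q \<Longrightarrow> k (act h x) = act h (k x)" for k
  proof -
   let ?g = "\<Sum>x\<in>Q. psmult (mvar (k x)) (\<Prod>y\<in>Q - {x}. ?r y)"
   have g: "prp (hrel (act h)) ?g ?g" if h: "h \<in> H" for h
   proof -
    have "prp (hrel (act h)) ?g (\<Sum>x\<in>Q. psmult (mvar (k (act h x))) (\<Prod>y\<in>Q - {x}. ?r (act h y)))"
    proof (rule prp_sum[OF ch[OF h]], rule prp_smult[OF N N ch[OF h]])
     fix x assume x: "x \<in> Q"
     show "(mvar (k x), mvar (k (act h x))) \<in> hrel (act h)"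
      unfolding kact[OF h x] by (rule hrel_mvar[where \<phi>="act h", OF kc[OF x] cl[OF h kc[OF x]]])
     show "prp (hrel (act h)) (\<Prod>y\<in>Q - {x}. ?r y) (\<Prod>y\<in>Q - {x}. ?r (act h y))" by (rule pr[OF h]) blast
    qed
    also have "(\<Sum>x\<in>Q. psmult (mvar (k (act h x))) (\<Prod>y\<in>Q - {x}. ?r (act h y))) =
      (\<Sum>x\<in>Q. psmult (mvar (k (act h x))) (\<Prod>y\<in>Q - {act h x}. ?r y))"
     by (rule sum.cong) (use prod.reindex_bij_betw[OF Qminus[OF h], of _ ?r] in simp_all)
    also have "\<dots> = ?g" using sum.reindex_bij_betw[OF Qbij[OF h], of "\<lambda>x. psmult (mvar (k x)) (\<Prod>y\<in>Q - {x}. ?r y)"] by simp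
    finally show ?thesis .
   qed
   have "poly ?g (mvar a) = (\<Sum>x\<in>{a}. mvar (k x) * (\<Prod>y\<in>Q - {x}. mvar a - mvar y))" unfolding poly_sum poly_smult poly_prod
   proof (rule sum.mono_neutral_cong_right[OF finQ])
    show "\<forall>x\<in>Q - {a}. mvar (k x) * (\<Prod>y\<in>Q - {x}. poly (?r y) (mvar a)) = 0"
    proof
     fix x assume "x \<in> Q - {a}"
     hence "a \<in> Q - {x}" using aQ by blast
     hence "(\<Prod>y\<in>Q - {x}. poly (?r y) (mvar a)) = 0" using finQ by (intro prod_zero) auto
     thus "mvar (k x) * (\<Prod>y\<in>Q - {x}. poly (?r y) (mvar a)) = 0" by simp
    qed
   qed (use aQ in simp_all)
   hence ga: "mev (poly ?g (mvar a)) = k a \<otimes> mev (D a)" using kc[OF aQ] by (simp add: D_def mevD(5))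
   have "\<rho> (mev (poly ?g (mvar a))) = mev (poly ?g (mvar (\<rho> a)))"
    using corr_poly[OF cr coeff_fixed[OF g] hrel_mvar[where \<phi>=\<rho>, OF a ring_hom_closed[OF rho a]]] by (simp add: hrel_def)
   moreover have "act h1 (mev (poly ?g (mvar a))) = mev (poly ?g (mvar (act h1 a)))"
    using corr_poly[OF ch[OF h1(1)] g[OF h1(1)] hrel_mvar[where \<phi>="act h1", OF a cl[OF h1(1) a]]] by (simp add: hrel_def)
   ultimately show ?thesis using ga h1(2) by simp
  qed
  have D: "mev (D a) \<in> carrier R" by simp
  have c: "\<rho> (mev (D a)) = act h1 (mev (D a))" using main[of "\<lambda>_. \<one>"] ring_hom_one[OF hom] by simp
  have "\<rho> b \<otimes> \<rho> (mev (D a)) = act h1 b \<otimes> \<rho> (mev (D a))"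
   using main[OF fc fact] fa ring_hom_mult[OF rho b D] ring_hom_mult[OF hom[OF h1(1)] b D] c by simp
  moreover have "\<rho> (mev (D a)) \<noteq> \<zero>"
   using inj_onD[OF hom_inj_on[OF rho], of "mev (D a)" \<zero>] ring_hom_0[OF rho] Dnz[OF aQ] by auto
  ultimately have "\<rho> b = act h1 b" using m_rcancel ring_hom_closed[OF rho] b cl[OF h1(1)] D by metis
  thus ?thesis unfolding \<rho>'_def using invact(1)[OF h1(1) b] by simp
 qed
 have "\<exists>h\<in>H'. \<forall>x\<in>F. act h x = \<rho>' x"
 proof (rule insert.IH[OF F sub' _ _ _ rho' fixed'])
  show "finite ((\<lambda>g. act g x) ` H')" if "x \<in> carrier R" for x by (rule finite_subset[OF _ fin[OF that]]) (auto simp: H'_def)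
 qed (auto simp: H'_def hom mult)
 then obtain h2 where h2: "h2 \<in> H" "act h2 a = a" "\<And>x. x \<in> F \<Longrightarrow> act h2 x = \<rho>' x" by (auto simp: H'_def)
 have "act (h1 \<otimes>\<^bsub>M\<^esub> h2) x = \<rho> x" if x: "x \<in> insert a F" for x
 proof -
  have xc: "x \<in> carrier R" using x a F by auto
  have "act h2 x = \<rho>' x" using x h2(2,3) r'a by auto
  hence "act (h1 \<otimes>\<^bsub>M\<^esub> h2) x = act h1 (act (inv\<^bsub>M\<^esub> h1) (\<rho> x))" using mult[OF h1(1) h2(1) xc] by (simp add: \<rho>'_def)
  thus ?thesis using invact(2)[OF h1(1) ring_hom_closed[OF rho xc]] by simp
 qed
 thus ?case using multH[OF h1(1) h2(1)] by blast
qed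

locale gact = field R for R (structure) +
 fixes M :: "('h, 'n) top_group_scheme" and act :: "'h \<Rightarrow> 'a \<Rightarrow> 'a"
 assumes M: "group M" and M_top: "topspace (topol M) = carrier M" and M_compact: "compact_space (topol M)"
  and act_hom: "\<And>g. g \<in> carrier M \<Longrightarrow> act g \<in> ring_hom R R" and act_one: "\<And>a. a \<in> carrier R \<Longrightarrow> act \<one>\<^bsub>M\<^esub> a = a"
  and act_mult: "\<And>g h a. g \<in> carrier M \<Longrightarrow> h \<in> carrier M \<Longrightarrow> a \<in> carrier R \<Longrightarrow> act (g \<otimes>\<^bsub>M\<^esub> h) a = act g (act h a)"
  and act_lconst: "\<And>a. a \<in> carrier R \<Longrightarrow> lconst M (\<lambda>g. act g a)"
begin

text \<open>Each condition \<open>act h a = \<rho> a\<close> is closed in \<open>h\<close>, any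
  finitely many of them are solvable in \<open>H\<close> by \<open>finite_agree\<close>, and
  \<open>H\<close> is compact.\<close>

lemma agree:
 assumes H: "subgroup H M" "closedin (topol M) H"
  and s: "\<rho> \<in> ring_hom R R" "\<And>b. b \<in> carrier R \<Longrightarrow> (\<And>h. h \<in> H \<Longrightarrow> act h b = b) \<Longrightarrow> \<rho> b = b"
 shows "\<exists>h\<in>H. \<forall>a\<in>carrier R. act h a = \<rho> a"
proof -
 have Hc: "H \<subseteq> carrier M" using subgroup.subset[OF H(1)] .
 have fa: "\<exists>h\<in>H. \<forall>a\<in>F. act h a = \<rho> a" if F: "finite F" "F \<subseteq> carrier R" for F
 proof (rule finite_agree[OF M F H(1) _ _ _ _ s])
  show "finite ((\<lambda>g. act g a) ` H)" if "a \<in> carrier R" for a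
   by (rule finite_subset[OF image_mono[OF Hc] lconst_finite_range[OF M_compact M_top act_lconst[OF that]]])
 qed (use act_hom act_one act_mult Hc in "auto simp: subset_iff")
 let ?C = "\<lambda>a. {h \<in> carrier M. act h a = \<rho> a}"
 have closed: "closedin (topol M) (?C a)" if "a \<in> carrier R" for a
  by (rule lconst_eq_closed[OF M_top act_lconst[OF that] lconst_const[OF M_top]])
 have "compactin (topol M) H" by (rule closedin_compact_space[OF M_compact H(2)])
 hence "H \<inter> \<Inter>(?C ` carrier R) \<noteq> {}"
 proof (rule compactin_fip[THEN iffD1, THEN conjunct2, rule_format], intro conjI ballI allI impI)
  fix C assume "C \<in> ?C ` carrier R"
  thus "closedin (topol M) C" using closed by blast
 next
  fix FF assume "finite FF \<and> FF \<subseteq> ?C ` carrier R"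
  then obtain F where F: "finite F" "F \<subseteq> carrier R" "FF = ?C ` F" by (meson finite_subset_image)
  thus "H \<inter> \<Inter>FF \<noteq> {}" using fa[OF F(1,2)] Hc by auto
 qed
 thus ?thesis by blast
qed

text \<open>Otherwise \<open>act g\<close> fixes all invariants of \<open>H\<close>, thus coincides
  with an element of \<open>H\<close> by \<open>agree\<close>, against faithfulness.\<close>

lemma separation:
 assumes faithful: "\<And>g h. g \<in> carrier M \<Longrightarrow> h \<in> carrier M \<Longrightarrow> (\<And>a. a \<in> carrier R \<Longrightarrow> act g a = act h a) \<Longrightarrow> g = h"
  and H: "subgroup H M" "closedin (topol M) H" and g: "g \<in> carrier M" "g \<notin> H"
 shows "\<exists>b\<in>carrier R. (\<forall>h\<in>H. act h b = b) \<and> act g b \<noteq> b"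
proof (rule ccontr)
 assume "\<not> ?thesis"
 then obtain h where "h \<in> H" "\<forall>a\<in>carrier R. act h a = act g a" using agree[OF H act_hom[OF g(1)]] by blast
 thus False using faithful[of h g] g subgroup.mem_carrier[OF H(1)] by blast
qed

end

section \<open>Independent elements of the Hahn field permuted by one factor\<close>

lemma gb_inj: "gb i = gb j \<Longrightarrow> i = j"
 unfolding gb_def by (metis Abs_wo_inject UNIV_I lookup_single_eq lookup_single_not_eq zero_neq_one)

lemma lookup_gb: "plk (gb i) (Abs_wo j) = (if i = j then 1 else 0)"
 unfolding gb_def by (simp add: lookup_single when_def Abs_wo_inject)

lemma coeffs_mult:
 assumes "0 \<in> S" "\<And>x y. x \<in> S \<Longrightarrow> y \<in> S \<Longrightarrow> x + y \<in> S" "\<And>m n. plk x m * plk y n \<in> S"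
 shows "plk (x * y :: ('v, 'c::comm_ring_1) mpol) k \<in> S"
proof -
 have sumS: "sum f A \<in> S" if "\<And>a. a \<in> A \<Longrightarrow> f a \<in> S" for f and A :: "'v multiset set"
  using that by (induction A rule: infinite_finite_induct) (auto simp: assms)
 have "x * y = (\<Sum>m\<in>pkeys x. \<Sum>n\<in>pkeys y. psingle (m + n) (plk x m * plk y n))"
  by (subst mpol_sum_single[of x], subst mpol_sum_single[of y]) (simp add: sum_product mult_single)
 hence "plk (x * y) k = (\<Sum>m\<in>pkeys x. \<Sum>n\<in>pkeys y. plk (psingle (m + n) (plk x m * plk y n)) k)" by (simp add: lookup_sum)
 also have "\<dots> \<in> S" by (intro sumS) (auto simp: lookup_single when_def assms)
 finally show ?thesis .
qed

lemma plk_mconst_mult: "plk (mconst c * z) m = c * plk (z :: ('v, 'c::comm_ring_1) mpol) m"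
proof -
 have "mconst c * z = (\<Sum>n\<in>pkeys z. psingle n (c * plk z n))"
  by (subst mpol_sum_single[of z]) (simp add: sum_distrib_left mconst_def mult_single)
 thus ?thesis by (simp add: lookup_sum lookup_single when_def in_keys_iff)
qed

lemma degree_prod_root_le: "pdegree (\<Prod>x\<in>A. [:- f x, 1:] :: 'c::comm_ring_1 poly) \<le> card A"
proof (induction A rule: infinite_finite_induct)
 case (insert x A)
 have "pdegree (\<Prod>x\<in>insert x A. [:- f x, 1:]) \<le> pdegree [:- f x, 1:] + pdegree (\<Prod>x\<in>A. [:- f x, 1:])"
  unfolding prod.insert[OF insert.hyps] by (rule degree_mult_le)
 thus ?case using insert by simp
qed auto

text \<open>The exponents have three kinds of generators: \<open>Inl None\<close> is reserved for
  the residue characteristic, \<open>Inl (Some p)\<close> for the weights with which separating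
  functions are combined, and \<open>Inr (x, k)\<close> for the free variables attached to an
  orbit.\<close>

type_synonym ('x, 'a) hser = "((('x \<times> 'x) option + ('x \<times> nat)) gam, ('a, int) mpol) hahn"

text \<open>One factor: \<open>M\<close> acts faithfully on the algebraically closed field
  \<open>R\<close>, through the coefficients on series, and by \<alpha> on the index set
  \<open>'x\<close>. The aim is an independent family of series indexed by \<open>'x\<close> on
  which the last two actions match.\<close>

locale factor = gact R M act + acfield R + hahn_quot mev ker "carrier R" tch \<zero> "gb (Inl None)" N
 for R (structure) and M :: "('h, 'n) top_group_scheme" and act :: "'h \<Rightarrow> 'a \<Rightarrow> 'a" and N :: "('x, 'a) hser set" +
 fixes \<alpha> :: "'h \<Rightarrow> 'x \<Rightarrow> 'x" and q :: nat
 assumes act_autos: "\<And>g. g \<in> carrier M \<Longrightarrow> act g \<in> autos"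
  and faithful: "\<And>g h. g \<in> carrier M \<Longrightarrow> h \<in> carrier M \<Longrightarrow> (\<And>a. a \<in> carrier R \<Longrightarrow> act g a = act h a) \<Longrightarrow> g = h"
  and \<alpha>_one: "\<And>x. \<alpha> \<one>\<^bsub>M\<^esub> x = x" and \<alpha>_mult: "\<And>g h x. g \<in> carrier M \<Longrightarrow> h \<in> carrier M \<Longrightarrow> \<alpha> (g \<otimes>\<^bsub>M\<^esub> h) x = \<alpha> g (\<alpha> h x)"
  and \<alpha>_lconst: "\<And>x. lconst M (\<lambda>g. \<alpha> g x)" and N_hmap: "\<And>\<tau> c. \<tau> \<in> autos \<Longrightarrow> c \<in> N \<Longrightarrow> hmap (vmap \<tau>) c \<in> N"
  and N_char: "\<And>n. of_int n \<in> N \<longleftrightarrow> int q dvd n"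
begin

definition orb :: "'x \<Rightarrow> 'x set" where "orb x = (\<lambda>g. \<alpha> g x) ` carrier M"

lemma oneM: "\<one>\<^bsub>M\<^esub> \<in> carrier M" using M by (simp add: group.is_monoid)

lemma invM: "g \<in> carrier M \<Longrightarrow> inv\<^bsub>M\<^esub> g \<in> carrier M" using M by simp

lemma multM: "g \<in> carrier M \<Longrightarrow> h \<in> carrier M \<Longrightarrow> g \<otimes>\<^bsub>M\<^esub> h \<in> carrier M" using M by (simp add: group.is_monoid monoid.m_closed)

lemma \<alpha>_inv:
 assumes g: "g \<in> carrier M"
 shows "\<alpha> (inv\<^bsub>M\<^esub> g) (\<alpha> g x) = x" "\<alpha> g (\<alpha> (inv\<^bsub>M\<^esub> g) x) = x"
 using \<alpha>_mult[OF invM[OF g] g, of x] \<alpha>_mult[OF g invM[OF g], of x] group.l_inv[OF M g] group.r_inv[OF M g] \<alpha>_one[of x]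
 by auto

lemma finite_orb: "finite (orb x)" unfolding orb_def by (rule lconst_finite_range[OF M_compact M_top \<alpha>_lconst])

lemma self_orb: "x \<in> orb x" unfolding orb_def using oneM \<alpha>_one by (metis image_eqI)

lemma orb_act:
 assumes g: "g \<in> carrier M" and z: "z \<in> orb x"
 shows "\<alpha> g z \<in> orb x"
proof -
 obtain h where h: "h \<in> carrier M" "z = \<alpha> h x" using z unfolding orb_def by blast
 hence "\<alpha> g z = \<alpha> (g \<otimes>\<^bsub>M\<^esub> h) x" using \<alpha>_mult[OF g h(1)] by simp
 thus ?thesis unfolding orb_def using multM[OF g h(1)] by blast
qed

lemma orb_sym:
 assumes "z \<in> orb x"
 shows "x \<in> orb z"
proof -
 obtain h where h: "h \<in> carrier M" "z = \<alpha> h x" using assms unfolding orb_def by blast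
 hence "x = \<alpha> (inv\<^bsub>M\<^esub> h) z" using \<alpha>_inv(1)[OF h(1)] by simp
 thus ?thesis unfolding orb_def using invM[OF h(1)] by blast
qed

lemma orb_sub: "z \<in> orb x \<Longrightarrow> orb z \<subseteq> orb x"
proof
 fix w assume z: "z \<in> orb x" and "w \<in> orb z"
 then obtain g where "g \<in> carrier M" "w = \<alpha> g z" by (auto simp: orb_def)
 thus "w \<in> orb x" using orb_act z by simp
qed

lemma orb_eq: "z \<in> orb x \<Longrightarrow> orb z = orb x" using orb_sub[of z x] orb_sub[OF orb_sym, of z x] by blast

definition rep :: "'x \<Rightarrow> 'x" where "rep x = (SOME z. z \<in> orb x)"

lemma rep: "rep x \<in> orb x" unfolding rep_def using self_orb by (rule someI)

lemma rep_eq: "z \<in> orb x \<Longrightarrow> rep z = rep x" unfolding rep_def by (simp add: orb_eq)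

definition equiv_sep :: "'x \<Rightarrow> 'x \<Rightarrow> ('x \<Rightarrow> 'a) \<Rightarrow> bool" where
 "equiv_sep z z' f \<equiv> (\<forall>x\<in>orb z. f x \<in> carrier R \<and> (\<forall>g\<in>carrier M. f (\<alpha> g x) = act g (f x))) \<and> f z \<noteq> f z'"

text \<open>Let z' = m z. Then \<open>m\<close> lies outside the stabilizer of \<open>z\<close>, and
  \<open>separation\<close> gives an element \<open>b\<close> invariant under the stabilizer and
  moved by \<open>m\<close>. The map g z \<mapsto> g b is well defined, equivariant, and separates z
  from z'.\<close>

lemma equiv_sep_ex:
 assumes z: "z' \<in> orb z" "z \<noteq> z'"
 shows "\<exists>f. equiv_sep z z' f"
proof -
 let ?H = "{g \<in> carrier M. \<alpha> g z = z}"
 have H: "subgroup ?H M"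
 proof (rule group.subgroupI[OF M])
  show "?H \<noteq> {}" using oneM \<alpha>_one by blast
  fix g assume g: "g \<in> ?H"
  thus "inv\<^bsub>M\<^esub> g \<in> ?H" using invM \<alpha>_inv(1)[of g z] by simp
  fix h assume "h \<in> ?H"
  thus "g \<otimes>\<^bsub>M\<^esub> h \<in> ?H" using g multM \<alpha>_mult by simp
 qed auto
 have cl: "closedin (topol M) ?H" by (rule lconst_eq_closed[OF M_top \<alpha>_lconst lconst_const[OF M_top]])
 obtain m where m: "m \<in> carrier M" "z' = \<alpha> m z" using z(1) by (auto simp: orb_def)
 hence "m \<notin> ?H" using z(2) by auto
 then obtain b where b: "b \<in> carrier R" "\<And>h. h \<in> ?H \<Longrightarrow> act h b = b" "act m b \<noteq> b"
  using separation[OF faithful H cl m(1)] by blast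
 define f where "f x = act (SOME g. g \<in> carrier M \<and> \<alpha> g z = x) b" for x
 have f: "f (\<alpha> g z) = act g b" if g: "g \<in> carrier M" for g
 proof -
  let ?g = "SOME h. h \<in> carrier M \<and> \<alpha> h z = \<alpha> g z"
  have g': "?g \<in> carrier M \<and> \<alpha> ?g z = \<alpha> g z" by (rule someI[of _ g]) (use g in simp)
  hence "inv\<^bsub>M\<^esub> g \<otimes>\<^bsub>M\<^esub> ?g \<in> ?H" using g invM multM \<alpha>_mult[OF invM] \<alpha>_inv(1) by simp
  hence "act (inv\<^bsub>M\<^esub> g \<otimes>\<^bsub>M\<^esub> ?g) b = b" by (rule b(2))
  hence "act g (act (inv\<^bsub>M\<^esub> g \<otimes>\<^bsub>M\<^esub> ?g) b) = act g b" by simp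
  hence "act (g \<otimes>\<^bsub>M\<^esub> (inv\<^bsub>M\<^esub> g \<otimes>\<^bsub>M\<^esub> ?g)) b = act g b" using act_mult[OF g multM[OF invM[OF g]] b(1)] g' by simp
  moreover have "g \<otimes>\<^bsub>M\<^esub> (inv\<^bsub>M\<^esub> g \<otimes>\<^bsub>M\<^esub> ?g) = ?g"
   using group.inv_solve_left'[OF M] g g' invM multM by (simp add: monoid.m_assoc[OF group.is_monoid[OF M], symmetric] group.r_inv[OF M] monoid.l_one[OF group.is_monoid[OF M]])
  ultimately show ?thesis by (simp add: f_def)
 qed
 have "equiv_sep z z' f" unfolding equiv_sep_def
 proof (intro conjI ballI)
  fix x assume "x \<in> orb z"
  then obtain g where g: "g \<in> carrier M" "x = \<alpha> g z" by (auto simp: orb_def)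
  show "f x \<in> carrier R" using f g ring_hom_closed[OF act_hom b(1)] by simp
  fix h assume h: "h \<in> carrier M"
  have "f (\<alpha> h x) = f (\<alpha> (h \<otimes>\<^bsub>M\<^esub> g) z)" using g \<alpha>_mult[OF h g(1)] by simp
  thus "f (\<alpha> h x) = act h (f x)" using f[OF multM[OF h g(1)]] f[OF g(1)] act_mult[OF h g(1) b(1)] g(2) by simp
 next
  show "f z \<noteq> f z'" using f[OF oneM] f[OF m(1)] m(2) b act_one by (simp add: \<alpha>_one)
 qed
 thus ?thesis by blast
qed

definition sepf :: "'x \<times> 'x \<Rightarrow> 'x \<Rightarrow> 'a" where "sepf p = (SOME f. equiv_sep (fst p) (snd p) f)"

definition pairs :: "'x \<Rightarrow> ('x \<times> 'x) set" where "pairs x = {(z, z') \<in> orb x \<times> orb x. z \<noteq> z'}"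

lemma finite_pairs: "finite (pairs x)"
 unfolding pairs_def by (rule finite_subset[OF _ finite_cartesian_product[OF finite_orb finite_orb]]) auto

lemma pairs_eq: "z \<in> orb x \<Longrightarrow> pairs z = pairs x" by (simp add: pairs_def orb_eq)

lemma sepf:
 assumes "p \<in> pairs x" "z \<in> orb x"
 shows "sepf p z \<in> carrier R" "g \<in> carrier M \<Longrightarrow> sepf p (\<alpha> g z) = act g (sepf p z)" "sepf p (fst p) \<noteq> sepf p (snd p)"
proof -
 have p: "snd p \<in> orb (fst p)" "fst p \<noteq> snd p" "orb (fst p) = orb x"
  using assms(1) orb_eq[of "fst p" x] by (auto simp: pairs_def)
 have "equiv_sep (fst p) (snd p) (sepf p)" unfolding sepf_def using equiv_sep_ex[OF p(1,2)] by (rule someI_ex)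
 thus "sepf p z \<in> carrier R" "g \<in> carrier M \<Longrightarrow> sepf p (\<alpha> g z) = act g (sepf p z)" "sepf p (fst p) \<noteq> sepf p (snd p)"
  using assms(2) p(3) by (auto simp: equiv_sep_def)
qed

definition hact :: "'h \<Rightarrow> ('x, 'a) hser \<Rightarrow> ('x, 'a) hser" where "hact g = hmap (vmap (act g))"

lemma rhom_hact: "rhom (hact g)" unfolding hact_def by (rule rhom_hmap[OF rhom_vmap])

lemma hact_hmon: "hact g (hmon \<gamma> z) = hmon \<gamma> (vmap (act g) z)"
 unfolding hact_def by (rule hmap_hmon) (rule rhomD[OF rhom_vmap])

lemma hact_N: "g \<in> carrier M \<Longrightarrow> c \<in> N \<Longrightarrow> hact g c \<in> N" unfolding hact_def by (rule N_hmap[OF act_autos])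

text \<open>The separating functions of all pairs of the orbit are combined with different monomials
  as weights. The result is still equivariant and separates all points of the orbit at once.\<close>

definition aa :: "'x \<Rightarrow> ('x, 'a) hser" where
 "aa x = (\<Sum>p\<in>pairs x. hmon (gb (Inl (Some p))) (mvar (sepf p x)))"

lemma hact_aa:
 assumes g: "g \<in> carrier M"
 shows "hact g (aa x) = aa (\<alpha> g x)"
proof -
 have o: "\<alpha> g x \<in> orb x" using orb_act[OF g self_orb] .
 show ?thesis unfolding aa_def pairs_eq[OF o] rhomD(8)[OF rhom_hact]
  by (rule sum.cong) (simp_all add: hact_hmon sepf(2)[OF _ self_orb g])
qed

lemma aa_diff:
 assumes x': "x' \<in> orb x" "x \<noteq> x'"
 shows "aa x - aa x' \<notin> N"
proof
 assume n: "aa x - aa x' \<in> N"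
 let ?b = "\<lambda>p. gb (Inl (Some p)) :: (('x \<times> 'x) option + ('x \<times> nat)) gam"
 let ?S = "{p \<in> pairs x. sepf p x \<noteq> sepf p x'}"
 have xp: "(x, x') \<in> pairs x" using x' self_orb by (auto simp: pairs_def)
 hence "(x, x') \<in> ?S" using sepf(3)[OF xp self_orb] by simp
 hence S: "?b ` ?S \<noteq> {}" "finite (?b ` ?S)" using finite_pairs by auto
 \<comment> \<open>The least weight at which the two series differ. By \<open>N_lead\<close> the
   difference there would lie in the kernel.\<close>
 define \<gamma> where "\<gamma> = Min (?b ` ?S)"
 have "\<gamma> \<in> ?b ` ?S" unfolding \<gamma>_def by (rule Min_in[OF S(2,1)])
 then obtain p0 where p0: "p0 \<in> ?S" "\<gamma> = ?b p0" by blast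
 have co: "hco (aa x - aa x') g = (\<Sum>p\<in>pairs x. if g = ?b p then mvar (sepf p x) - mvar (sepf p x') else 0)" for g
  unfolding aa_def pairs_eq[OF x'(1)] hco_simps hco_sum sum_subtractf[symmetric] by (rule sum.cong) auto
 have "hco (aa x - aa x') g = 0" if g: "g < \<gamma>" for g unfolding co
 proof (rule sum.neutral, intro ballI)
  fix p assume p: "p \<in> pairs x"
  have "g \<noteq> ?b p" if "sepf p x \<noteq> sepf p x'"
  proof
   assume "g = ?b p"
   hence "\<gamma> \<le> g" unfolding \<gamma>_def using p that by (intro Min_le[OF S(2)]) auto
   thus False using g by simp
  qed
  thus "(if g = ?b p then mvar (sepf p x) - mvar (sepf p x') else 0 :: ('a, int) mpol) = 0"
   by (cases "sepf p x = sepf p x'") simp_all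
 qed
 hence "hco (aa x - aa x') \<gamma> \<in> ker" by (rule N_lead[OF n])
 moreover have "hco (aa x - aa x') \<gamma> = (\<Sum>p\<in>pairs x. if p0 = p then mvar (sepf p x) - mvar (sepf p x') else 0)"
  unfolding co p0(2) by (rule sum.cong) (auto dest: gb_inj)
 ultimately have "mvar (sepf p0 x) - mvar (sepf p0 x') \<in> ker" using finite_pairs p0(1) by simp
 hence "sepf p0 x = sepf p0 x'"
  using ker_diff sepf(1)[of p0 x x] sepf(1)[of p0 x x'] p0(1) self_orb x'(1) by (simp add: mev_var)
 thus False using p0(1) by simp
qed

text \<open>The coefficientwise action fixes the free variables of an orbit, so these cannot be
  permuted themselves. They are multiplied by the Vandermonde matrix of the elements
  \<open>aa x\<close>, which are distinct modulo \<open>N\<close>: equivariance is inherited from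
  \<open>aa\<close>, independence from the variables.\<close>

definition yy :: "'x \<Rightarrow> ('x, 'a) hser" where
 "yy x = (\<Sum>k<card (orb x). aa x ^ k * hmon (gb (Inr (rep x, k))) 1)"

lemma hact_yy:
 assumes g: "g \<in> carrier M"
 shows "hact g (yy x) = yy (\<alpha> g x)"
proof -
 have o: "\<alpha> g x \<in> orb x" using orb_act[OF g self_orb] .
 show ?thesis unfolding yy_def orb_eq[OF o] rep_eq[OF o] rhomD(8)[OF rhom_hact]
  by (rule sum.cong) (simp_all add: rhomD[OF rhom_hact] hact_aa[OF g] hact_hmon rhomD[OF rhom_vmap])
qed

text \<open>The series without variables of kind \<open>Inr\<close>: the ring of coefficients over
  which these variables are to be independent.\<close>

definition low :: "('x, 'a) hser set" where
 "low = {c. \<forall>g. hco c g \<noteq> 0 \<longrightarrow> (\<forall>j. plk g (Abs_wo (Inr j)) = 0)}"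

lemma low_closed: "0 \<in> low" "1 \<in> low" "c \<in> low \<Longrightarrow> d \<in> low \<Longrightarrow> c + d \<in> low" "c \<in> low \<Longrightarrow> d \<in> low \<Longrightarrow> c - d \<in> low"
 "c \<in> low \<Longrightarrow> d \<in> low \<Longrightarrow> c * d \<in> low" "hmon (gb (Inl i)) s \<in> low"
proof -
 show "0 \<in> low" "1 \<in> low" by (auto simp: low_def)
 show "c \<in> low \<Longrightarrow> d \<in> low \<Longrightarrow> c + d \<in> low" by (auto simp: low_def) (metis add.right_neutral)
 show "c \<in> low \<Longrightarrow> d \<in> low \<Longrightarrow> c - d \<in> low" by (auto simp: low_def) (metis diff_0_right)
 show "hmon (gb (Inl i)) s \<in> low" by (simp add: low_def lookup_gb)
 assume cd: "c \<in> low" "d \<in> low"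
 show "c * d \<in> low" unfolding low_def
 proof (intro CollectI allI impI)
  fix g j assume "hco (c * d) g \<noteq> 0"
  then obtain a where "hco c a \<noteq> 0" "hco d (g - a) \<noteq> 0" using hco_times_nonzero by blast
  hence "plk a (Abs_wo (Inr j)) = 0" "plk (g - a) (Abs_wo (Inr j)) = 0" using cd unfolding low_def by blast+
  thus "plk g (Abs_wo (Inr j)) = 0" by (simp add: lookup_minus)
 qed
qed

lemma low_aa: "aa x \<in> low"
proof -
 have "sum f A \<in> low" if "\<And>a. a \<in> A \<Longrightarrow> f a \<in> low" for f and A :: "('x \<times> 'x) set"
  using that by (induction A rule: infinite_finite_induct) (auto simp: low_closed)
 thus ?thesis unfolding aa_def by (simp add: low_closed(6))
qed

definition wt :: "('x \<times> nat) multiset \<Rightarrow> (('x \<times> 'x) option + ('x \<times> nat)) gam" where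
 "wt m = (\<Sum>i\<in>#m. gb (Inr i))"

lemma plk_wt: "plk (wt m) (Abs_wo (Inr j)) = of_nat (count m j)"
 unfolding wt_def by (induction m) (auto simp: lookup_add lookup_gb)

lemma prod_hmon_wt: "(\<Prod>i\<in>#m. hmon (gb (Inr i)) (1 :: ('a, int) mpol)) = hmon (wt m) 1"
 unfolding wt_def by (induction m) (auto simp: hmon_mult hmon_one)

text \<open>The set \<open>?D\<close> consists of the exponents whose \<open>Inr\<close> part is
  that of the monomial \<open>m\<close>. It is invariant under translation by the generator
  \<open>Inl None\<close>, so \<open>N_restr\<close> isolates a single term of the sum, and the
  monomial in this term is invertible.\<close>

lemma low_coeff_extract:
 assumes Q: "\<And>m. plk Q m \<in> low" and n: "meval (\<lambda>x. x) (\<lambda>i. hmon (gb (Inr i)) 1) Q \<in> N"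
 shows "plk Q m \<in> N"
proof (cases "m \<in> pkeys Q")
 case False
 thus ?thesis using N0 by (simp add: in_keys_iff)
next
 case True
 let ?D = "{g. \<forall>j. plk g (Abs_wo (Inr j)) = of_nat (count m j)}"
 let ?E = "meval (\<lambda>x. x) (\<lambda>i. hmon (gb (Inr i)) 1) Q"
 have E: "?E = (\<Sum>m\<in>pkeys Q. plk Q m * hmon (wt m) 1)" unfolding meval_def prod_hmon_wt by simp
 have tm: "hco (plk Q m' * hmon (wt m') 1) g = hco (plk Q m') (g - wt m')" for m' g
  using hco_hmon_times[of "wt m'" 1 "plk Q m'" g] by (simp add: mult.commute)
 have z: "hco (plk Q m' * hmon (wt m') 1) g = 0" if "(g \<in> ?D) \<longleftrightarrow> m' \<noteq> m" for m' g
 proof (rule ccontr)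
  assume "hco (plk Q m' * hmon (wt m') 1) g \<noteq> 0"
  hence "plk (g - wt m') (Abs_wo (Inr j)) = 0" for j using Q[of m'] unfolding tm low_def by blast
  hence g: "plk g (Abs_wo (Inr j)) = of_nat (count m' j)" for j by (simp add: lookup_minus plk_wt)
  show False
  proof (cases "m' = m")
   case True
   thus False using that g by simp
  next
   case False
   hence "\<forall>j. count m j = count m' j" using that g by auto
   thus False using False by (metis multiset_eqI)
  qed
 qed
 have "hrestr ?D ?E = plk Q m * hmon (wt m) 1"
 proof (rule hahn_eqI)
  fix g
  show "hco (hrestr ?D ?E) g = hco (plk Q m * hmon (wt m) 1) g"
  proof (cases "g \<in> ?D")
   case False
   thus ?thesis using z[of g m] unfolding hco_hrestr if_not_P[OF False] by simp
  next
   case gD: True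
   have "hco ?E g = (\<Sum>m'\<in>{m}. hco (plk Q m' * hmon (wt m') 1) g)"
    unfolding E hco_sum by (rule sum.mono_neutral_right) (use True z gD in auto)
   thus ?thesis unfolding hco_hrestr if_P[OF gD] by simp
  qed
 qed
 moreover have "hrestr ?D ?E \<in> N" by (rule N_restr[OF n]) (simp add: lookup_add lookup_gb)
 ultimately have "hmon (- wt m) 1 * (plk Q m * hmon (wt m) 1) \<in> N" by (simp add: N_mult)
 thus ?thesis using hmon_inverse[of "wt m", where 'b = "('a, int) mpol"] by (simp add: mult.left_commute mult.commute[of "hmon (- wt m) 1"])
qed

definition Lg :: "'x \<Rightarrow> ('x, 'a) hser poly" where
 "Lg x = (\<Prod>z\<in>orb x - {x}. [:- aa z, 1:])"

text \<open>The linear form behind \<open>yy x\<close>, before monomials are substituted for its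
  variables.\<close>

definition YY :: "'x \<Rightarrow> ('x \<times> nat, ('x, 'a) hser) mpol" where
 "YY x = (\<Sum>k<card (orb x). mconst (aa x ^ k) * mvar (rep x, k))"

lemma low_YY: "plk (meval of_int YY (P :: ('x, int) mpol)) m \<in> low"
proof -
 note r = rhomD[OF rhom_meval[OF rhom_of_int, of YY]]
 have pw: "aa x ^ k \<in> low" for x k by (induction k) (auto simp: low_closed low_aa)
 have sm: "sum f A \<in> low" if "\<And>a. a \<in> A \<Longrightarrow> f a \<in> low" for f and A :: "nat set"
  using that by (induction A rule: infinite_finite_induct) (auto simp: low_closed)
 show ?thesis
 proof (induction P arbitrary: m rule: zpol_induct)
  case 1
  thus ?case by (simp add: r lookup_one when_def low_closed)
 next
  case (2 x)
  have "plk (YY x) m \<in> low"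
   unfolding YY_def lookup_sum by (intro sm) (simp add: plk_mconst_mult mvar_def lookup_single when_def low_closed pw)
  thus ?case by (simp add: meval_mvar[OF rhom_of_int])
 next
  case (3 x y)
  thus ?case by (simp add: r lookup_minus low_closed)
 next
  case (4 x y)
  thus ?case unfolding r(3) by (intro coeffs_mult) (auto simp: low_closed)
 qed
qed

lemma eval_YY: "meval (\<lambda>x. x) (\<lambda>i. hmon (gb (Inr i)) 1) (meval of_int YY P) = meval of_int yy (P :: ('x, int) mpol)"
proof (rule zpol_hom_eqI[where f = "\<lambda>P. meval (\<lambda>x. x) (\<lambda>i. hmon (gb (Inr i)) 1) (meval of_int YY P)"])
 show "rhom (\<lambda>P. meval (\<lambda>x. x) (\<lambda>i. hmon (gb (Inr i)) 1) (meval of_int YY P))"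
  by (rule rhom_comp[OF rhom_meval[OF rhom_id] rhom_meval[OF rhom_of_int]])
 show "rhom (meval of_int yy)" by (rule rhom_meval[OF rhom_of_int])
 fix x
 note r = rhomD[OF rhom_meval[OF rhom_id, of "\<lambda>i. hmon (gb (Inr i)) (1 :: ('a, int) mpol)"]]
 show "meval (\<lambda>x. x) (\<lambda>i. hmon (gb (Inr i)) 1) (meval of_int YY (mvar x)) = meval of_int yy (mvar x)"
  unfolding meval_mvar[OF rhom_of_int] YY_def yy_def by (simp add: r meval_mvar[OF rhom_id] meval_mconst[OF rhom_id])
qed

text \<open>Comparing coefficients by \<open>low_coeff_extract\<close> turns a relation between the
  \<open>yy\<close> into one between the formal \<open>YY\<close>. The substitution \<Theta> takes
  \<open>YY x\<close> to a nonzero multiple of the variable \<open>x\<close>, so each coefficient of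
  \<open>P\<close>, times a nonzero factor, vanishes in the Hahn field.\<close>

lemma independent:
 fixes P :: "('x, int) mpol"
 shows "meval of_int yy P \<in> N \<longleftrightarrow> (\<forall>m. int q dvd plk P m)"
proof
 assume d: "\<forall>m. int q dvd plk P m"
 show "meval of_int yy P \<in> N"
  unfolding meval_def by (rule pidealD(9)[OF pideal_N], rule pidealD(5)[OF pideal_N]) (use d N_char in simp)
next
 assume n: "meval of_int yy P \<in> N"
 have lowN: "plk (meval of_int YY P) m \<in> N" for m by (rule low_coeff_extract[OF low_YY]) (simp add: eval_YY n)
 \<comment> \<open>The inverse Vandermonde matrix up to scaling: its entries are the coefficients of
   the Lagrange numerators \<open>Lg x\<close>, and the scaling factor is the value of
   \<open>Lg x\<close> at \<open>aa x\<close>.\<close>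
 define \<Theta> :: "('x \<times> nat, ('x, 'a) hser) mpol \<Rightarrow> ('x, ('x, 'a) hser) mpol" where
  "\<Theta> = meval mconst (\<lambda>(z, k). \<Sum>x\<in>orb z. mconst (pcoeff (Lg x) k) * mvar x)"
 note rT = rhomD[OF rhom_meval[OF rhom_mconst], of "\<lambda>(z, k). \<Sum>x\<in>orb z. mconst (pcoeff (Lg x) k) * mvar x", folded \<Theta>_def]
 note rc = rhomD[OF rhom_mconst]
 have TN: "plk (\<Theta> Q) m \<in> N" if "\<And>m. plk Q m \<in> N" for Q m unfolding \<Theta>_def meval_def lookup_sum
  by (rule pidealD(9)[OF pideal_N]) (simp add: plk_mconst_mult pidealD(5)[OF pideal_N] that)
 let ?\<Delta> = "\<lambda>x. poly (Lg x) (aa x)"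
 have Delta: "?\<Delta> x \<notin> N" for x
 proof
  assume "?\<Delta> x \<in> N"
  hence "(\<Prod>z\<in>orb x - {x}. aa x - aa z) \<in> N" by (simp add: Lg_def poly_prod)
  from iffD1[OF pidealD(13)[OF pideal_N finite_Diff[OF finite_orb]] this]
  obtain z where "z \<in> orb x - {x}" "aa x - aa z \<in> N" by blast
  thus False using aa_diff[of z x] by auto
 qed
 have TV: "\<Theta> (mvar (z, k)) = (\<Sum>x\<in>orb z. mconst (pcoeff (Lg x) k) * mvar x)" and TC: "\<Theta> (mconst c) = mconst c" for z k c
  unfolding \<Theta>_def by (simp_all add: meval_mvar[OF rhom_mconst] meval_mconst[OF rhom_mconst])
 have TY: "\<Theta> (YY x) = mconst (?\<Delta> x) * mvar x" for x
 proof -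
  have o: "orb (rep x) = orb x" by (rule orb_eq[OF rep])
  have "\<Theta> (YY x) = (\<Sum>k<card (orb x). \<Sum>z\<in>orb x. mconst (aa x ^ k * pcoeff (Lg z) k) * mvar z)"
   unfolding YY_def by (simp add: rT TV TC o sum_distrib_left rc mult.assoc)
  also have "\<dots> = (\<Sum>z\<in>orb x. mconst (\<Sum>k<card (orb x). aa x ^ k * pcoeff (Lg z) k) * mvar z)"
   by (subst sum.swap) (simp add: rc sum_distrib_right)
  also have "\<dots> = (\<Sum>z\<in>orb x. mconst (poly (Lg z) (aa x)) * mvar z)"
  proof (rule sum.cong)
   fix z assume z: "z \<in> orb x"
   have "card (orb z - {z}) < card (orb x)"
    unfolding orb_eq[OF z] by (rule psubset_card_mono[OF finite_orb]) (use z in blast)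
   hence "pdegree (Lg z) < card (orb x)" unfolding Lg_def using degree_prod_root_le le_less_trans by blast
   hence "poly (Lg z) (aa x) = (\<Sum>k<card (orb x). pcoeff (Lg z) k * aa x ^ k)"
    unfolding poly_altdef by (intro sum.mono_neutral_left) (auto simp: coeff_eq_0)
   thus "mconst (\<Sum>k<card (orb x). aa x ^ k * pcoeff (Lg z) k) * mvar z = mconst (poly (Lg z) (aa x)) * mvar z"
    by (simp add: mult.commute)
  qed simp
  also have "\<dots> = (\<Sum>z\<in>{x}. mconst (poly (Lg z) (aa x)) * mvar z)"
  proof (rule sum.mono_neutral_right[OF finite_orb])
   have "poly (Lg z) (aa x) = 0" if "z \<in> orb x - {x}" for z
   proof -
    have "x \<in> orb z - {z}" using that orb_sym by auto
    thus ?thesis unfolding Lg_def poly_prod by (intro prod_zero[OF finite_Diff[OF finite_orb]] bexI[of _ x]) auto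
   qed
   thus "\<forall>z\<in>orb x - {x}. mconst (poly (Lg z) (aa x)) * mvar z = (0 :: ('x, ('x, 'a) hser) mpol)" by (simp add: rc)
  qed (use self_orb in simp)
  finally show ?thesis by simp
 qed
 have "\<Theta> (meval of_int YY P) = meval of_int (\<lambda>x. mconst (?\<Delta> x) * mvar x) P"
 proof (rule zpol_hom_eqI[where f = "\<lambda>P. \<Theta> (meval of_int YY P)"])
  show "rhom (\<lambda>P. \<Theta> (meval of_int YY P))"
   unfolding \<Theta>_def by (rule rhom_comp[OF rhom_meval[OF rhom_mconst] rhom_meval[OF rhom_of_int]])
  show "rhom (meval of_int (\<lambda>x. mconst (?\<Delta> x) * mvar x))" by (rule rhom_meval[OF rhom_of_int])
 qed (simp add: meval_mvar[OF rhom_of_int] TY)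
 also have "\<dots> = (\<Sum>m\<in>pkeys P. psingle m (of_int (plk P m) * (\<Prod>x\<in>#m. ?\<Delta> x)))"
 proof -
  have pr: "(\<Prod>x\<in>#m. mconst (?\<Delta> x) * mvar x) = psingle m (\<Prod>x\<in>#m. ?\<Delta> x)" for m
  proof (induction m)
   case (add x m)
   thus ?case by (simp add: mconst_def mvar_def mult_single add.commute)
  qed (simp add: single_one flip: zero_multiset_def)
  have "(of_int i :: ('x, ('x, 'a) hser) mpol) = mconst (of_int i)" for i by (simp add: rc)
  hence "(of_int i :: ('x, ('x, 'a) hser) mpol) * psingle m d = psingle m (of_int i * d)" for i m d
   by (metis (no_types, lifting) add_0 mconst_def mult_single zero_multiset_def)
  thus ?thesis unfolding meval_def pr by simp
 qed
 finally have T: "\<Theta> (meval of_int YY P) = (\<Sum>m\<in>pkeys P. psingle m (of_int (plk P m) * (\<Prod>x\<in>#m. ?\<Delta> x)))" .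
 show "\<forall>m. int q dvd plk P m"
 proof
  fix m
  have "plk (\<Theta> (meval of_int YY P)) m = of_int (plk P m) * (\<Prod>x\<in>#m. ?\<Delta> x)"
   unfolding T lookup_sum lookup_single by (auto simp: when_def in_keys_iff)
  hence "of_int (plk P m) * (\<Prod>x\<in>#m. ?\<Delta> x) \<in> N" using TN[OF lowN] by metis
  moreover have "(\<Prod>x\<in>#m. ?\<Delta> x) \<notin> N" by (induction m) (use Delta pidealD(2)[OF pideal_N] pidealD(6)[OF pideal_N] in auto)
  ultimately have "of_int (plk P m) \<in> N" using pidealD(6)[OF pideal_N] by blast
  thus "int q dvd plk P m" using N_char by simp
 qed
qed

text \<open>Lifted coefficients are 0 or single variables, so renaming variables takes normal forms
  to normal forms. Questions about \<open>hact\<close> modulo \<open>N\<close> thus reduce to the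
  action on \<open>R\<close>.\<close>

lemma nf_hact:
 assumes g: "g \<in> carrier M"
 shows "nf (hact g c) \<beta> = act g (nf c \<beta>)"
proof -
 have z: "act g \<zero> = \<zero>" by (rule ring_hom_0[OF act_hom[OF g]])
 have inj: "act g a = \<zero> \<longleftrightarrow> a = \<zero>" if "a \<in> carrier R" for a
  using inj_onD[OF hom_inj_on[OF act_hom[OF g]], of a \<zero>] z that by auto
 note w = nf(1)[of c]
 have wf: "wf (\<lambda>\<beta>. act g (nf c \<beta>))" using w ring_hom_closed[OF act_hom[OF g]] z
  unfolding wf_def by (auto intro: wosupp_subset[of "{\<beta>. nf c \<beta> \<noteq> \<zero>}"])
 have "hact g c - hact g (TT (nf c)) \<in> N" using hact_N[OF g nf(2)[of c]] by (simp add: rhomD[OF rhom_hact])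
 moreover have "hact g (TT (nf c)) = TT (\<lambda>\<beta>. act g (nf c \<beta>))"
 proof (rule hahn_eqI)
  fix \<beta>
  have "nf c \<beta> \<in> carrier R" using w unfolding wf_def by auto
  thus "hco (hact g (TT (nf c))) \<beta> = hco (TT (\<lambda>\<beta>. act g (nf c \<beta>))) \<beta>"
   unfolding hact_def hco_hmap[where \<phi> = "vmap (act g)", OF rhomD(4)[OF rhom_vmap]] hco_TT[OF w] hco_TT[OF wf]
   using inj[of "nf c \<beta>"] by (simp add: tch_def rhomD(4)[OF rhom_vmap])
 qed
 ultimately have "nf (hact g c) = nf (TT (\<lambda>\<beta>. act g (nf c \<beta>)))" using nf_eq_iff by metis
 thus ?thesis using nf_TT[OF wf] by simp
qed

end

section \<open>Extending the actions of the factors to an action of the free product on algebraic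
  elements\<close>

lemma corr_mod:
 assumes N: "pideal N" and h: "rhom h"
 shows "corr {z. h z \<in> N} N {(z, c). c - h z \<in> N}" unfolding corr_def
proof (intro conjI allI impI)
 note r = rhomD[OF h]
 show "(1, 1) \<in> {(z, c). c - h z \<in> N}" using pidealD(1)[OF N] by (simp add: r)
 fix a b c d assume "(a, b) \<in> {(z, c). c - h z \<in> N}" "(c, d) \<in> {(z, c). c - h z \<in> N}"
 hence 1: "b - h a \<in> N" "d - h c \<in> N" by auto
 have e: "b - d - h (a - c) = (b - h a) - (d - h c)" "b * d - h (a * c) = b * (d - h c) + (b - h a) * h c"
  by (simp_all add: r algebra_simps)
 have "b - d - h (a - c) \<in> N" unfolding e(1) by (rule pidealD(8)[OF N 1])
 moreover have "b * d - h (a * c) \<in> N" unfolding e(2) by (rule pidealD(3)[OF N pidealD(4)[OF N 1(2)] pidealD(5)[OF N 1(1)]])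
 ultimately show "(a - c, b - d) \<in> {(z, c). c - h z \<in> N}" "(a * c, b * d) \<in> {(z, c). c - h z \<in> N}" by auto
next
 fix a b assume "(a, b) \<in> {(z, c). c - h z \<in> N}"
 thus "(a \<in> {z. h z \<in> N}) = (b \<in> N)" using pidealD(11)[OF N, of b "h a"] by auto
qed

lemma poly_cong_mod:
 assumes N: "pideal N" and "a - b \<in> N" "poly f b \<in> N"
 shows "poly f a \<in> N"
proof -
 note c = corr_mod[OF N rhom_id]
 have "(poly f b, poly f a) \<in> {(z, c). c - z \<in> N}"
  by (rule corr_poly[OF c]) (use assms(2) pidealD(1)[OF N] in "simp_all add: prp_def")
 thus ?thesis using corrD(8)[OF c] assms(3) by blast
qed

text \<open>Division by X - a lowers the degree and, as \<open>N\<close> is prime, any other root is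
  congruent to \<open>a\<close> or is a root of the quotient.\<close>

lemma finite_roots:
 assumes N: "pideal N" and f: "pcoeff f j \<notin> N"
 shows "\<exists>B. finite B \<and> (\<forall>d. poly f d \<in> N \<longrightarrow> (\<exists>b\<in>B. d - b \<in> N))" using f
proof (induction "pdegree f" arbitrary: f j rule: less_induct)
 case less
 show ?case
 proof (cases "\<exists>a. poly f a \<in> N")
  case False
  thus ?thesis by (intro exI[of _ "{}"]) auto
 next
  case True
  then obtain a where a: "poly f a \<in> N" by blast
  let ?g = "synthetic_div f a"
  have f: "f = [:- a, 1:] * ?g + [:poly f a:]" using synthetic_div_correct'[of a f] by simp
  have "\<exists>k. pcoeff ?g k \<notin> N"
  proof (rule ccontr)
   assume "\<nexists>k. pcoeff ?g k \<notin> N"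
   hence "pcoeff ([:- a, 1:] * ?g) j \<in> N" using coeff_mult_in_ideal[OF N, of ?g "[:- a, 1:]" j] by (simp add: mult.commute)
   moreover have "pcoeff [:poly f a:] j \<in> N" using a pidealD(1)[OF N] by (cases j) auto
   moreover have "pcoeff f j = pcoeff ([:- a, 1:] * ?g) j + pcoeff [:poly f a:] j" by (subst f) (rule coeff_add)
   ultimately have "pcoeff f j \<in> N" using pidealD(3)[OF N] by metis
   thus False using less.prems by blast
  qed
  then obtain k where k: "pcoeff ?g k \<notin> N" by blast
  have "pdegree f \<noteq> 0"
  proof
   assume "pdegree f = 0"
   then obtain c where "f = [:c:]" by (rule degree_eq_zeroE)
   thus False using a less.prems pidealD(1)[OF N] by (cases j) auto
  qed
  hence "pdegree ?g < pdegree f" by (simp add: degree_synthetic_div)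
  then obtain B where B: "finite B" "\<And>d. poly ?g d \<in> N \<Longrightarrow> \<exists>b\<in>B. d - b \<in> N" using less.hyps k by blast
  have "\<exists>b\<in>insert a B. d - b \<in> N" if d: "poly f d \<in> N" for d
  proof -
   have "poly f d = (d - a) * poly ?g d + poly f a" by (subst f) (simp add: algebra_simps)
   hence "(d - a) * poly ?g d \<in> N" using pidealD(8)[OF N d a] by simp
   hence "d - a \<in> N \<or> poly ?g d \<in> N" using pidealD(6)[OF N] by blast
   thus ?thesis using B(2) by blast
  qed
  thus ?thesis using B(1) by blast
 qed
qed

lemma poly_choose:
 assumes "\<And>j. \<exists>c. Q j c" "\<And>j. j > n \<Longrightarrow> Q j 0"
 shows "\<exists>g :: 'c::comm_ring_1 poly. \<forall>j. Q j (pcoeff g j)"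
proof -
 have "\<forall>j. \<exists>c. Q j c" using assms(1) by blast
 from choice[OF this] obtain c where c: "\<forall>j. Q j (c j)" by (elim exE)
 have "pcoeff (\<Sum>j\<le>n. pmonom (c j) j) j = (if j \<le> n then c j else 0)" for j by (auto simp: coeff_sum)
 thus ?thesis using c assms(2) by (intro exI[of _ "\<Sum>j\<le>n. pmonom (c j) j"]) auto
qed

text \<open>All \<open>A i\<close> on one quotient field. An element \<open>g\<close> of
  \<open>A i\<close> acts by the relation \<open>mv i g\<close>, which need not be total but by
  \<open>mv_root\<close> reaches everything algebraic over its domain; on the elements
  \<open>y x\<close> it follows an action \<alpha> of the whole group \<open>P\<close>.\<close>

locale corr_action = ifp U P n A
 for U :: "'u::infinite itself" and P :: "('h, 'm) top_group_scheme" (structure) and n :: nat and A :: "nat \<Rightarrow> 'h set" +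
 fixes N :: "'c::comm_ring_1 set" and mv :: "nat \<Rightarrow> 'h \<Rightarrow> ('c \<times> 'c) set" and y :: "'x \<Rightarrow> 'c" and \<alpha> :: "'h \<Rightarrow> 'x \<Rightarrow> 'x"
 assumes N: "pideal N" and aclN: "acl N" and mv_corr: "\<And>i g. i \<in> {1..n} \<Longrightarrow> g \<in> A i \<Longrightarrow> corr N N (mv i g)"
  and mv_root: "\<And>i g f f' j a. i \<in> {1..n} \<Longrightarrow> g \<in> A i \<Longrightarrow> prp (mv i g) f f' \<Longrightarrow> pcoeff f j \<notin> N \<Longrightarrow>
   poly f a \<in> N \<Longrightarrow> \<exists>b. (a, b) \<in> mv i g" and mv_N: "\<And>i g c. i \<in> {1..n} \<Longrightarrow> g \<in> A i \<Longrightarrow> c \<in> N \<Longrightarrow> (0, c) \<in> mv i g \<and> (c, 0) \<in> mv i g"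
  and mv_mult: "\<And>i g h a b c. i \<in> {1..n} \<Longrightarrow> g \<in> A i \<Longrightarrow> h \<in> A i \<Longrightarrow> (a, b) \<in> mv i h \<Longrightarrow> (b, c) \<in> mv i g \<Longrightarrow>
   (a, c) \<in> mv i (g \<otimes> h)" and mv_one: "\<And>i a b. i \<in> {1..n} \<Longrightarrow> (a, b) \<in> mv i \<one> \<Longrightarrow> b - a \<in> N"
  and mv_closed: "\<And>i a b. i \<in> {1..n} \<Longrightarrow> closedin (topol P) {g \<in> A i. (a, b) \<in> mv i g}"
  and mv_y: "\<And>i g x. i \<in> {1..n} \<Longrightarrow> g \<in> A i \<Longrightarrow> (y x, y (\<alpha> g x)) \<in> mv i g" and \<alpha>_one: "\<And>x. \<alpha> \<one> x = x"
  and \<alpha>_mult: "\<And>g h x. g \<in> carrier P \<Longrightarrow> h \<in> carrier P \<Longrightarrow> \<alpha> (g \<otimes> h) x = \<alpha> g (\<alpha> h x)" and \<alpha>_lconst: "\<And>x. lconst P (\<lambda>g. \<alpha> g x)"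
begin

text \<open>Modulo \<open>N\<close> this is the relative algebraic closure of the field generated by
  the \<open>y x\<close>. The rule \<open>root\<close> with linear polynomials also yields inverses
  and closure under congruence.\<close>

inductive_set Alg :: "'c set" where
 y: "y x \<in> Alg"
| one: "1 \<in> Alg"
| diff: "a \<in> Alg \<Longrightarrow> b \<in> Alg \<Longrightarrow> a - b \<in> Alg"
| mult: "a \<in> Alg \<Longrightarrow> b \<in> Alg \<Longrightarrow> a * b \<in> Alg"
| root: "(\<And>j. pcoeff f j \<in> Alg) \<Longrightarrow> pcoeff f k \<notin> N \<Longrightarrow> poly f d \<in> N \<Longrightarrow> d \<in> Alg"

lemma Alg_zero: "0 \<in> Alg" using diff[OF one one] by simp

lemma Alg_add: "a \<in> Alg \<Longrightarrow> b \<in> Alg \<Longrightarrow> a + b \<in> Alg" using diff[of a "0 - b"] diff[OF Alg_zero, of b] by simp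

lemma Alg_cong:
 assumes "c \<in> Alg" "d - c \<in> N"
 shows "d \<in> Alg"
proof (rule root[of "[:- c, 1:]" 1])
 show "pcoeff [:- c, 1:] j \<in> Alg" for j
  using diff[OF Alg_zero assms(1)] one Alg_zero by (auto simp: coeff_pCons split: nat.splits)
qed (use pidealD(2)[OF N] assms(2) in auto)

lemma mv_cong:
 assumes i: "i \<in> {1..n}" "g \<in> A i" and "(a, b) \<in> mv i g" "a' - a \<in> N" "b' - b \<in> N"
 shows "(a', b') \<in> mv i g"
proof -
 note c = mv_corr[OF i]
 have "(a' - a, 0) \<in> mv i g" "(0, b' - b) \<in> mv i g" using mv_N[OF i] assms by auto
 hence "(a' - a + 0, 0 + (b' - b)) \<in> mv i g" by (rule corrD(4)[OF c])
 thus ?thesis using corrD(4)[OF c _ assms(3), of "a' - a" "b' - b"] by simp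
qed

lemma mv_unique: "i \<in> {1..n} \<Longrightarrow> g \<in> A i \<Longrightarrow> (a, b) \<in> mv i g \<Longrightarrow> (a, b') \<in> mv i g \<Longrightarrow> b - b' \<in> N"
 by (rule corr_unique[OF mv_corr pidealD(1)[OF N]])

definition stable :: "'c set \<Rightarrow> bool" where
 "stable S \<equiv> finite S \<and> (\<forall>s\<in>S. \<forall>i\<in>{1..n}. \<forall>g\<in>A i. \<exists>s'\<in>S. (s, s') \<in> mv i g)"

lemma stableD: "stable S \<Longrightarrow> s \<in> S \<Longrightarrow> i \<in> {1..n} \<Longrightarrow> g \<in> A i \<Longrightarrow> \<exists>s'\<in>S. (s, s') \<in> mv i g" unfolding stable_def by blast

lemma stable_op:
 assumes S: "stable S" "stable T"
  and op: "\<And>i g s s' t t'. i \<in> {1..n} \<Longrightarrow> g \<in> A i \<Longrightarrow> (s, s') \<in> mv i g \<Longrightarrow> (t, t') \<in> mv i g \<Longrightarrow> (F s t, F s' t') \<in> mv i g"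
 shows "stable ((\<lambda>(s, t). F s t) ` (S \<times> T))" unfolding stable_def
proof (intro conjI ballI)
 show "finite ((\<lambda>(s, t). F s t) ` (S \<times> T))" using S by (simp add: stable_def)
 fix u i g assume u: "u \<in> (\<lambda>(s, t). F s t) ` (S \<times> T)" and i: "i \<in> {1..n}" "g \<in> A i"
 then obtain s t where st: "s \<in> S" "t \<in> T" "u = F s t" by auto
 obtain s' where s': "s' \<in> S" "(s, s') \<in> mv i g" using stableD[OF S(1) st(1) i] by blast
 obtain t' where t': "t' \<in> T" "(t, t') \<in> mv i g" using stableD[OF S(2) st(2) i] by blast
 show "\<exists>s'\<in>(\<lambda>(s, t). F s t) ` (S \<times> T). (u, s') \<in> mv i g"
  using op[OF i s'(2) t'(2)] s'(1) t'(1) st(3) by (intro bexI[of _ "F s' t'"]) auto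
qed

text \<open>Only finitely many polynomials have coefficients in \<open>S\<close> and degree at most
  that of \<open>f\<close>; each nonzero one has finitely many roots modulo \<open>N\<close>, and
  \<open>mv i g\<close> takes a root of one to a root of another.\<close>

lemma stable_roots:
 assumes S: "stable S" "0 \<in> S" and f: "\<And>j. pcoeff f j \<in> S" "pcoeff f k \<notin> N" "poly f d \<in> N"
 shows "\<exists>T. stable T \<and> d \<in> T"
proof -
 define m where "m = pdegree f"
 define good where "good h \<equiv> (\<forall>j. pcoeff h j \<in> S) \<and> (\<forall>j>m. pcoeff h j = 0) \<and> (\<exists>k. pcoeff h k \<notin> N)" for h
 have "finite {h. good h}"
 proof -
  have "inj_on (\<lambda>h. map (pcoeff h) [0..<Suc m]) {h. good h}"
  proof (rule inj_onI)
   fix h h' :: "'c poly"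
   assume hh: "h \<in> {h. good h}" "h' \<in> {h. good h}"
    "map (pcoeff h) [0..<Suc m] = map (pcoeff h') [0..<Suc m]"
   have "pcoeff h j = pcoeff h' j" for j
   proof (cases "j \<le> m")
    case True
    thus ?thesis using hh(3) by (auto simp: map_eq_conv simp del: upt_Suc)
   next
    case False
    thus ?thesis using hh(1,2) by (simp add: good_def)
   qed
   thus "h = h'" by (simp add: poly_eq_iff)
  qed
  moreover have "(\<lambda>h. map (pcoeff h) [0..<Suc m]) ` {h. good h} \<subseteq> {xs. set xs \<subseteq> S \<and> length xs = Suc m}"
   by (auto simp: good_def simp del: upt_Suc)
  moreover have "finite {xs. set xs \<subseteq> S \<and> length xs = Suc m}"
   using S(1) by (intro finite_lists_length_eq) (simp add: stable_def)
  ultimately show ?thesis by (meson finite_imageD finite_subset)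
 qed
 have "\<forall>h\<in>{h. good h}. \<exists>B. finite B \<and> (\<forall>d. poly h d \<in> N \<longrightarrow> (\<exists>b\<in>B. d - b \<in> N))"
  using finite_roots[OF N] by (auto simp: good_def)
 from bchoice[OF this] obtain B where
  B: "\<forall>h\<in>{h. good h}. finite (B h) \<and> (\<forall>d. poly h d \<in> N \<longrightarrow> (\<exists>b\<in>B h. d - b \<in> N))" by (elim exE)
 define T where "T = insert d (\<Union>h\<in>{h. good h}. B h)"
 \<comment> \<open>The sets \<open>B h\<close> may contain elements that are not roots of any such
   polynomial; these are discarded.\<close>
 define T' where "T' = {t \<in> T. \<exists>h. good h \<and> poly h t \<in> N}"
 have rootT: "\<exists>t\<in>T'. b - t \<in> N" if h: "good h" "poly h b \<in> N" for h b
 proof -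
  obtain t where t: "t \<in> B h" "b - t \<in> N" using B h by blast
  have "t - b \<in> N" using t(2) pidealD(12)[OF N] by blast
  from poly_cong_mod[OF N this h(2)] have "poly h t \<in> N" .
  thus ?thesis using t h(1) unfolding T'_def T_def by blast
 qed
 have goodf: "good f" using f(1,2) by (auto simp: good_def m_def coeff_eq_0)
 have "stable T'" unfolding stable_def
 proof (intro conjI ballI)
  have "finite T" using \<open>finite {h. good h}\<close> B by (simp add: T_def)
  thus "finite T'" by (simp add: T'_def)
  fix t i g assume t: "t \<in> T'" and i: "i \<in> {1..n}" "g \<in> A i"
  obtain h where h: "good h" "poly h t \<in> N" using t by (auto simp: T'_def)
  note c = mv_corr[OF i]
  obtain k' where k': "pcoeff h k' \<notin> N" using h(1) by (auto simp: good_def)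
  have "\<exists>h'. \<forall>j. pcoeff h' j \<in> S \<and> (pcoeff h j, pcoeff h' j) \<in> mv i g \<and> (j > m \<longrightarrow> pcoeff h' j = 0)"
  proof (rule poly_choose[of "\<lambda>j c. c \<in> S \<and> (pcoeff h j, c) \<in> mv i g \<and> (j > m \<longrightarrow> c = 0)" m])
   show 0: "0 \<in> S \<and> (pcoeff h j, 0) \<in> mv i g \<and> (j > m \<longrightarrow> 0 = (0::'c))" if "j > m" for j
    using that h(1) S(2) corrD(2)[OF c] by (simp add: good_def)
   show "\<exists>c. c \<in> S \<and> (pcoeff h j, c) \<in> mv i g \<and> (j > m \<longrightarrow> c = 0)" for j
   proof (cases "j > m")
    case True
    thus ?thesis using 0 by blast
   next
    case False
    thus ?thesis using stableD[OF S(1) _ i, of "pcoeff h j"] h(1) by (auto simp: good_def)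
   qed
  qed
  then obtain h' where h': "\<And>j. pcoeff h' j \<in> S" "prp (mv i g) h h'" "\<And>j. j > m \<Longrightarrow> pcoeff h' j = 0" unfolding prp_def by blast
  obtain b where b: "(t, b) \<in> mv i g" using mv_root[OF i h'(2) k' h(2)] by blast
  have "poly h' b \<in> N" using corr_poly[OF c h'(2) b] corrD(8)[OF c] h(2) by blast
  moreover have "good h'" using h'(1,3) k' prp_N[OF N N c h'(2), of k'] by (auto simp: good_def)
  ultimately obtain t' where t': "t' \<in> T'" "b - t' \<in> N" using rootT by blast
  have "(t, t') \<in> mv i g" by (rule mv_cong[OF i b]) (use t'(2) pidealD(1,12)[OF N] in auto)
  thus "\<exists>s'\<in>T'. (t, s') \<in> mv i g" using t'(1) by blast
 qed
 moreover have "d \<in> T'" using goodf f(3) by (auto simp: T'_def T_def)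
 ultimately show ?thesis by blast
qed

lemma stable_Un: "stable S \<Longrightarrow> stable T \<Longrightarrow> stable (S \<union> T)" unfolding stable_def by blast

lemma stable_singleton: "(\<And>i g. i \<in> {1..n} \<Longrightarrow> g \<in> A i \<Longrightarrow> (c, c) \<in> mv i g) \<Longrightarrow> stable {c}" by (simp add: stable_def)

lemma stable_UN: "finite J \<Longrightarrow> (\<And>j. j \<in> J \<Longrightarrow> stable (S j)) \<Longrightarrow> stable (\<Union>j\<in>J. S j)"
 by (induction J rule: finite_induct) (auto simp: stable_Un, simp add: stable_def)

text \<open>Finiteness of orbits, as \<open>extend_action\<close> requires. For the
  \<open>y x\<close> it comes from the compactness of \<open>P\<close>, and it is inherited along
  all rules that generate \<open>Alg\<close>.\<close>

lemma Alg_stable: "c \<in> Alg \<Longrightarrow> \<exists>S. stable S \<and> c \<in> S"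
proof (induction rule: Alg.induct)
 case (y x)
 have cm: "compact_space (topol P)" using profinite by (simp add: profinite_group_def)
 let ?O = "(\<lambda>g. \<alpha> g x) ` carrier P"
 interpret P: group P by (rule group)
 have "stable (y ` ?O)" unfolding stable_def
 proof (intro conjI ballI)
  show "finite (y ` ?O)" using lconst_finite_range[OF cm topspace \<alpha>_lconst] by blast
  fix s i g assume s: "s \<in> y ` ?O" and i: "i \<in> {1..n}" "g \<in> A i"
  then obtain h where h: "h \<in> carrier P" "s = y (\<alpha> h x)" by blast
  have g: "g \<in> carrier P" using A_sub i by blast
  have "\<alpha> g (\<alpha> h x) = \<alpha> (g \<otimes> h) x" using \<alpha>_mult[OF g h(1)] by simp
  hence "y (\<alpha> g (\<alpha> h x)) \<in> y ` ?O" using P.m_closed[OF g h(1)] by auto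
  thus "\<exists>s'\<in>y ` ?O. (s, s') \<in> mv i g" using mv_y[OF i, of "\<alpha> h x"] h(2) by blast
 qed
 moreover have "y x \<in> y ` ?O" using \<alpha>_one[of x] P.one_closed by (metis image_eqI)
 ultimately show ?case by blast
next
 case one
 have "stable {1}" by (rule stable_singleton) (rule corrD(1)[OF mv_corr])
 thus ?case by blast
next
 case (diff a b)
 then obtain S T where ST: "stable S" "a \<in> S" "stable T" "b \<in> T" by blast
 have "stable ((\<lambda>(s, t). s - t) ` (S \<times> T))" by (rule stable_op[OF ST(1,3)]) (rule corrD(3)[OF mv_corr])
 thus ?case using ST by blast
next
 case (mult a b)
 then obtain S T where ST: "stable S" "a \<in> S" "stable T" "b \<in> T" by blast
 have "stable ((\<lambda>(s, t). s * t) ` (S \<times> T))" by (rule stable_op[OF ST(1,3)]) (rule corrD(5)[OF mv_corr])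
 thus ?case using ST by blast
next
 case (root f k d)
 have "\<forall>j. \<exists>S. stable S \<and> pcoeff f j \<in> S" using root.IH by blast
 from choice[OF this] obtain S where S: "\<forall>j. stable (S j) \<and> pcoeff f j \<in> S j" by (elim exE)
 let ?S = "(\<Union>j\<in>{..pdegree f}. S j) \<union> {0}"
 have "stable {0}" by (rule stable_singleton) (rule corrD(2)[OF mv_corr])
 hence st: "stable ?S" using S by (intro stable_Un stable_UN) auto
 have "pcoeff f j \<in> ?S" for j using S by (cases "j \<le> pdegree f") (auto simp: coeff_eq_0)
 thus ?case using stable_roots[OF st _ _ root.hyps(2,3)] by simp
qed

lemma Alg_mv:
 assumes "c \<in> Alg" and i: "i \<in> {1..n}" "g \<in> A i"
 shows "\<exists>c'\<in>Alg. (c, c') \<in> mv i g" using assms(1)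
proof (induction rule: Alg.induct)
 case (y x)
 thus ?case using mv_y[OF i] Alg.y by blast
next
 case one
 thus ?case using corrD(1)[OF mv_corr[OF i]] Alg.one by blast
next
 case (diff a b)
 thus ?case using corrD(3)[OF mv_corr[OF i]] Alg.diff by blast
next
 case (mult a b)
 thus ?case using corrD(5)[OF mv_corr[OF i]] Alg.mult by blast
next
 case (root f k d)
 note c = mv_corr[OF i]
 have "\<exists>h. \<forall>j. pcoeff h j \<in> Alg \<and> (pcoeff f j, pcoeff h j) \<in> mv i g"
  by (rule poly_choose[of "\<lambda>j c. c \<in> Alg \<and> (pcoeff f j, c) \<in> mv i g" "pdegree f"])
   (use root.IH Alg_zero corrD(2)[OF c] in "auto simp: coeff_eq_0")
 then obtain h where h: "\<And>j. pcoeff h j \<in> Alg" "prp (mv i g) f h" unfolding prp_def by blast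
 obtain b where b: "(d, b) \<in> mv i g" using mv_root[OF i h(2) root.hyps(2,3)] by blast
 have "poly h b \<in> N" using corr_poly[OF c h(2) b] corrD(8)[OF c] root.hyps(3) by blast
 hence "b \<in> Alg" using Alg.root[OF h(1)] prp_N[OF N N c h(2), of k] root.hyps(2) by blast
 thus ?case using b by blast
qed

text \<open>A representative of the residue class, the same for congruent elements because the
  choice depends on the class only. The set \<open>W\<close> of representatives serves as the
  quotient of \<open>Alg\<close> by \<open>N\<close>.\<close>

definition can :: "'c \<Rightarrow> 'c" where "can c = (SOME d. d - c \<in> N)"

lemma can: "can c - c \<in> N" unfolding can_def by (rule someI[of _ c]) (simp add: pidealD(1)[OF N])

lemma can_eq_iff: "can c = can d \<longleftrightarrow> c - d \<in> N"
proof
 assume "can c = can d"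
 hence "(can d - d) - (can c - c) = c - d" by simp
 thus "c - d \<in> N" using pidealD(8)[OF N can[of d] can[of c]] by simp
next
 assume cd: "c - d \<in> N"
 have "e - c \<in> N \<longleftrightarrow> e - d \<in> N" for e using pidealD(11)[OF N, of "e - d" "e - c"] cd by (simp add: algebra_simps)
 thus "can c = can d" by (simp add: can_def)
qed

lemma can_can: "can (can c) = can c" using can can_eq_iff by blast

definition W :: "'c set" where "W = can ` Alg"

lemma WD: "w \<in> W \<Longrightarrow> w \<in> Alg" "w \<in> W \<Longrightarrow> can w = w" unfolding W_def using Alg_cong can can_can by auto

lemma WI: "c \<in> Alg \<Longrightarrow> can c \<in> W" by (simp add: W_def)

definition acti :: "nat \<Rightarrow> 'h \<Rightarrow> 'c \<Rightarrow> 'c" where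
 "acti i g w = can (SOME c. (w, c) \<in> mv i g)"

lemma acti_eq:
 assumes i: "i \<in> {1..n}" "g \<in> A i" and c: "(w, c) \<in> mv i g"
 shows "acti i g w = can c" unfolding acti_def can_eq_iff by (rule mv_unique[OF i _ c]) (rule someI[of _ c], rule c)

lemma acti_mv:
 assumes w: "w \<in> W" and i: "i \<in> {1..n}" "g \<in> A i"
 shows "acti i g w \<in> W" "(w, acti i g w) \<in> mv i g"
proof -
 obtain c where c: "c \<in> Alg" "(w, c) \<in> mv i g" using Alg_mv[OF WD(1)[OF w] i] by blast
 thus "acti i g w \<in> W" using acti_eq[OF i c(2)] WI by simp
 show "(w, acti i g w) \<in> mv i g" unfolding acti_eq[OF i c(2)] by (rule mv_cong[OF i c(2)]) (use can pidealD(1)[OF N] in auto)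
qed

lemma acti_iff:
 assumes w: "w \<in> W" and i: "i \<in> {1..n}" "g \<in> A i" and v: "can v = v"
 shows "acti i g w = v \<longleftrightarrow> (w, v) \<in> mv i g" using acti_eq[OF i, of w v] acti_mv(2)[OF w i] v by auto

lemma acti_stable:
 assumes w: "w \<in> W"
 shows "\<exists>S\<subseteq>W. finite S \<and> w \<in> S \<and> (\<forall>i\<in>{1..n}. \<forall>g\<in>A i. \<forall>x\<in>S. acti i g x \<in> S)"
proof -
 obtain S where S: "stable S" "w \<in> S" using Alg_stable[OF WD(1)[OF w]] by blast
 let ?S = "(can ` S) \<inter> W"
 have "acti i g x \<in> ?S" if i: "i \<in> {1..n}" "g \<in> A i" and x: "x \<in> ?S" for i g x
 proof -
  obtain s where s: "s \<in> S" "x = can s" using x by blast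
  obtain s' where s': "s' \<in> S" "(s, s') \<in> mv i g" using stableD[OF S(1) s(1) i] by blast
  have "(x, s') \<in> mv i g" unfolding s(2) by (rule mv_cong[OF i s'(2)]) (use can pidealD(1)[OF N] in auto)
  hence "acti i g x = can s'" by (rule acti_eq[OF i])
  thus ?thesis using s'(1) acti_mv(1)[OF _ i, of x] x by auto
 qed
 moreover have "finite ?S" using S(1) by (simp add: stable_def)
 moreover have "w \<in> ?S" using S(2) w WD(2)[OF w] by (metis IntI image_eqI)
 ultimately show ?thesis by (intro exI[of _ ?S]) auto
qed

text \<open>The fibres are closed and the orbit is finite, so each fibre is the complement of a
  finite union of closed sets.\<close>

lemma acti_lconst:
 assumes w: "w \<in> W" and i: "i \<in> {1..n}"
 shows "lconst (top_subgroup P (A i)) (\<lambda>g. acti i g w)"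
proof -
 obtain S where S: "finite S" "S \<subseteq> W" "w \<in> S" "\<And>g x. g \<in> A i \<Longrightarrow> x \<in> S \<Longrightarrow> acti i g x \<in> S" using acti_stable[OF w] i by blast
 have cl: "closedin (subtopology (topol P) (A i)) {g \<in> A i. acti i g w = v}" if "v \<in> W" for v
 proof -
  have "{g \<in> A i. acti i g w = v} = {g \<in> A i. (w, v) \<in> mv i g}" using acti_iff[OF w i _ WD(2)[OF that]] by blast
  thus ?thesis using mv_closed[OF i, of w v] by (intro closedin_subset_topspace) auto
 qed
 show ?thesis unfolding lconst_def
 proof
  fix v
  have top: "topspace (subtopology (topol P) (A i)) = A i" using A_sub[OF i] by (auto simp: topspace)
  have "{g \<in> A i. acti i g w = v} = A i - (\<Union>u\<in>S - {v}. {g \<in> A i. acti i g w = u})" using S(3,4) by auto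
  moreover have "closedin (subtopology (topol P) (A i)) (\<Union>u\<in>S - {v}. {g \<in> A i. acti i g w = u})"
   by (intro closedin_Union) (use S(1,2) cl in auto)
  hence "openin (subtopology (topol P) (A i)) (topspace (subtopology (topol P) (A i)) - (\<Union>u\<in>S - {v}. {g \<in> A i. acti i g w = u}))"
   by (rule openin_diff[OF openin_topspace])
  ultimately have "openin (subtopology (topol P) (A i)) {g \<in> A i. acti i g w = v}" unfolding top by simp
  thus "openin (topol (top_subgroup P (A i))) {g \<in> carrier (top_subgroup P (A i)). acti i g w = v}"
   by (simp add: top_subgroup_def)
 qed
qed

definition "W_action \<Phi> \<equiv> acts P W \<Phi> \<and>
   (\<forall>g\<in>carrier P. \<forall>v\<in>W. \<forall>w\<in>W. \<Phi> g (can (v + w)) = can (\<Phi> g v + \<Phi> g w) \<and> \<Phi> g (can (v * w)) = can (\<Phi> g v * \<Phi> g w)) \<and>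
   (\<forall>g\<in>carrier P. \<forall>x. \<Phi> g (can (y x)) = can (y (\<alpha> g x))) \<and> (\<forall>g\<in>carrier P. \<Phi> g (can 1) = can 1)"

theorem action_ex: "\<exists>\<Phi>. W_action \<Phi>"
proof -
 interpret P: group P by (rule group)
 have "\<exists>\<Phi>. extends W acti \<Phi>"
 proof (rule extend_action)
  fix i w assume i: "i \<in> {1..n}" and w: "w \<in> W"
  have o: "\<one> \<in> A i" by (rule subgroup.one_closed[OF A(1)[OF i]])
  have "can (acti i \<one> w) = can w" unfolding can_eq_iff by (rule mv_one[OF i acti_mv(2)[OF w i o]])
  thus "acti i \<one> w = w" using WD(2)[OF w] WD(2)[OF acti_mv(1)[OF w i o]] by simp
  fix g h assume gh: "g \<in> A i" "h \<in> A i"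
  note m = acti_mv[OF w i gh(2)]
  have "acti i (g \<otimes> h) w = can (acti i g (acti i h w))"
   by (rule acti_eq[OF i subgroup.m_closed[OF A(1)[OF i] gh] mv_mult[OF i gh m(2) acti_mv(2)[OF m(1) i gh(1)]]])
  thus "acti i (g \<otimes> h) w = acti i g (acti i h w)" using WD(2)[OF acti_mv(1)[OF m(1) i gh(1)]] by simp
 qed (use acti_mv acti_lconst acti_stable in auto)
 then obtain \<Phi> where "extends W acti \<Phi>" by (elim exE)
 hence P1: "\<And>g w. g \<in> carrier P \<Longrightarrow> w \<in> W \<Longrightarrow> \<Phi> g w \<in> W" and P2: "\<And>w. w \<in> W \<Longrightarrow> \<Phi> \<one> w = w"
  and P3: "\<And>g h w. g \<in> carrier P \<Longrightarrow> h \<in> carrier P \<Longrightarrow> w \<in> W \<Longrightarrow> \<Phi> (g \<otimes> h) w = \<Phi> g (\<Phi> h w)"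
  and P4: "\<And>i g w. i \<in> {1..n} \<Longrightarrow> g \<in> A i \<Longrightarrow> w \<in> W \<Longrightarrow> \<Phi> g w = acti i g w"
  and P5: "\<And>w. w \<in> W \<Longrightarrow> lconst P (\<lambda>g. \<Phi> g w)" unfolding extends_def by blast+
 have canop: "can (v + w) \<in> W" "can (v * w) \<in> W" if "v \<in> W" "w \<in> W" for v w using that Alg_add Alg.mult WD(1) WI by auto
 \<comment> \<open>The universal property yields an action on a set only. Compatibility with a ring
   operation holds for elements of the \<open>A i\<close> and extends to \<open>P\<close> by
   \<open>density\<close>.\<close>
 have op: "\<Phi> g (can (F v w)) = can (F (\<Phi> g v) (\<Phi> g w))"
  if F: "\<And>v w. v \<in> W \<Longrightarrow> w \<in> W \<Longrightarrow> can (F v w) \<in> W"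
   "\<And>i g v v' w w'. i \<in> {1..n} \<Longrightarrow> g \<in> A i \<Longrightarrow> (v, v') \<in> mv i g \<Longrightarrow> (w, w') \<in> mv i g \<Longrightarrow> (F v w, F v' w') \<in> mv i g"
   and vw: "g \<in> carrier P" "v \<in> W" "w \<in> W" for F g v w
 proof -
  let ?E = "{g \<in> carrier P. \<forall>p\<in>W \<times> W. \<Phi> g (can (F (fst p) (snd p))) = can (F (\<Phi> g (fst p)) (\<Phi> g (snd p)))}"
  have "?E = carrier P"
  proof (rule density)
   have w0: "can 1 \<in> W" by (rule WI[OF Alg.one])
   have "?E = (\<Inter>p\<in>W \<times> W. {g \<in> carrier P. \<Phi> g (can (F (fst p) (snd p))) = can (F (\<Phi> g (fst p)) (\<Phi> g (snd p)))})"
    using w0 by fastforce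
   moreover have "closedin (topol P) \<dots>"
    by (intro closedin_Inter) (use w0 in "auto intro!: lconst_eq_closed[OF topspace] P5 F(1) lconst_comp2[OF P5 P5]")
   ultimately show "closedin (topol P) ?E" by simp
   show "\<one> \<in> ?E" using P2 F(1) by auto
   fix i g assume i: "i \<in> {1..n}" "g \<in> A i"
   have "\<Phi> g (can (F v w)) = can (F (\<Phi> g v) (\<Phi> g w))" if v: "v \<in> W" "w \<in> W" for v w
   proof -
    have "(F v w, F (\<Phi> g v) (\<Phi> g w)) \<in> mv i g"
     using F(2)[OF i acti_mv(2)[OF v(1) i] acti_mv(2)[OF v(2) i]] P4[OF i] v by simp
    hence "(can (F v w), F (\<Phi> g v) (\<Phi> g w)) \<in> mv i g" by (rule mv_cong[OF i]) (use can pidealD(1)[OF N] in auto)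
    thus ?thesis using acti_eq[OF i] P4[OF i F(1)[OF v]] by simp
   qed
   thus "g \<in> ?E" using A_sub[OF i] by auto
  next
   fix g h assume "g \<in> ?E" "h \<in> ?E"
   thus "g \<otimes> h \<in> ?E" using P3 F(1) P1 by auto
  qed auto
  thus ?thesis using vw by auto
 qed
 have yv: "\<Phi> g (can (y x)) = can (y (\<alpha> g x))" if "g \<in> carrier P" for g x
 proof -
  have yW: "can (y x) \<in> W" for x by (rule WI[OF Alg.y])
  let ?E = "{g \<in> carrier P. \<forall>x. \<Phi> g (can (y x)) = can (y (\<alpha> g x))}"
  have "?E = carrier P"
  proof (rule density)
   have "?E = (\<Inter>x. {g \<in> carrier P. \<Phi> g (can (y x)) = can (y (\<alpha> g x))})" by auto
   moreover have "closedin (topol P) \<dots>"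
    by (intro closedin_Inter) (auto intro!: lconst_eq_closed[OF topspace] P5 yW lconst_comp[OF \<alpha>_lconst])
   ultimately show "closedin (topol P) ?E" by simp
   show "\<one> \<in> ?E" using P2 yW \<alpha>_one by auto
   fix i g assume i: "i \<in> {1..n}" "g \<in> A i"
   have "\<Phi> g (can (y x)) = can (y (\<alpha> g x))" for x
   proof -
    have "(can (y x), y (\<alpha> g x)) \<in> mv i g" by (rule mv_cong[OF i mv_y[OF i]]) (use can pidealD(1)[OF N] in auto)
    thus ?thesis using acti_eq[OF i] P4[OF i yW] by simp
   qed
   thus "g \<in> ?E" using A_sub[OF i] by auto
  next
   fix g h assume "g \<in> ?E" "h \<in> ?E"
   thus "g \<otimes> h \<in> ?E" using P3 yW \<alpha>_mult by auto
  qed auto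
  thus ?thesis using that by auto
 qed
 have one: "\<Phi> g (can 1) = can 1" if g: "g \<in> carrier P" for g
  using op[of "\<lambda>_ _. 1" g "can 1" "can 1"] WI[OF Alg.one] corrD(1)[OF mv_corr] g by simp
 show ?thesis by (rule exI[of _ \<Phi>])
   (use P1 P2 P3 P5 op[of "(+)"] op[of "(*)"] canop corrD(4,5)[OF mv_corr] yv one in "auto simp: W_action_def")
qed

end

section \<open>Comparing the factors through their independent elements\<close>

context factor
begin

lemma hact_N_iff: "g \<in> carrier M \<Longrightarrow> hact g c \<in> N \<longleftrightarrow> c \<in> N"
proof -
 assume g: "g \<in> carrier M"
 have "nf c \<beta> = \<zero>" if "act g (nf c \<beta>) = \<zero>" for \<beta>
 proof -
  have c: "nf c \<beta> \<in> carrier R" using nf(1)[of c] unfolding wf_def by auto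
  have "act g (nf c \<beta>) = act g \<zero>" using that ring_hom_0[OF act_hom[OF g]] by simp
  thus ?thesis using inj_onD[OF hom_inj_on[OF act_hom[OF g]]] c by blast
 qed
 hence "c \<in> N" if "hact g c \<in> N" using that nf_hact[OF g, of c] unfolding N_iff by simp
 thus ?thesis using hact_N[OF g] by blast
qed

lemma nf_closed: "nf c \<beta> \<in> carrier R" using nf(1)[of c] unfolding wf_def by auto

lemma hact_mult: "g \<in> carrier M \<Longrightarrow> h \<in> carrier M \<Longrightarrow> hact (g \<otimes>\<^bsub>M\<^esub> h) c - hact g (hact h c) \<in> N"
 unfolding nf_eq_iff[symmetric] by (rule ext) (simp add: nf_hact multM act_mult nf_closed)

lemma hact_one: "hact \<one>\<^bsub>M\<^esub> c - c \<in> N" unfolding nf_eq_iff[symmetric] by (rule ext) (simp add: nf_hact oneM act_one nf_closed)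

lemma closed_hact: "closedin (topol M) {g \<in> carrier M. d - hact g c \<in> N}"
proof -
 have "{g \<in> carrier M. d - hact g c \<in> N} = (\<Inter>\<beta>. {g \<in> carrier M. act g (nf c \<beta>) = nf d \<beta>})"
  unfolding nf_eq_iff[symmetric] by (auto simp: fun_eq_iff nf_hact)
 also have "closedin (topol M) \<dots>"
  by (intro closedin_Inter) (auto intro!: lconst_eq_closed[OF M_top] act_lconst nf_closed lconst_const[OF M_top])
 finally show ?thesis .
qed

end

lemma corr_relcomp:
 assumes "corr N M \<sigma>" "corr M K \<tau>"
 shows "corr N K (\<sigma> O \<tau>)" unfolding corr_def
proof (intro conjI allI impI)
 show "(1, 1) \<in> \<sigma> O \<tau>" using corrD(1)[OF assms(1)] corrD(1)[OF assms(2)] by blast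
 fix a c assume "(a, c) \<in> \<sigma> O \<tau>"
 then obtain b where b: "(a, b) \<in> \<sigma>" "(b, c) \<in> \<tau>" by blast
 thus "(a \<in> N) = (c \<in> K)" using corrD(8)[OF assms(1)] corrD(8)[OF assms(2)] by blast
 fix a' c' assume "(a', c') \<in> \<sigma> O \<tau>"
 then obtain b' where b': "(a', b') \<in> \<sigma>" "(b', c') \<in> \<tau>" by blast
 show "(a - a', c - c') \<in> \<sigma> O \<tau>" by (rule relcompI[OF corrD(3)[OF assms(1) b(1) b'(1)] corrD(3)[OF assms(2) b(2) b'(2)]])
 show "(a * a', c * c') \<in> \<sigma> O \<tau>" by (rule relcompI[OF corrD(5)[OF assms(1) b(1) b'(1)] corrD(5)[OF assms(2) b(2) b'(2)]])
qed

lemma prp_relcomp: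
 assumes "corr N M \<sigma>" "corr M K \<tau>" "prp (\<sigma> O \<tau>) f g"
 shows "\<exists>h. prp \<sigma> f h \<and> prp \<tau> h g"
proof -
 have "\<exists>h. \<forall>j. (pcoeff f j, pcoeff h j) \<in> \<sigma> \<and> (pcoeff h j, pcoeff g j) \<in> \<tau>"
  by (rule poly_choose[of _ "max (pdegree f) (pdegree g)"])
   (use assms(3) corrD(2)[OF assms(1)] corrD(2)[OF assms(2)] in "auto simp: prp_def coeff_eq_0")
 thus ?thesis by (auto simp: prp_def)
qed

locale amalgam = ifp U P n A
 for U :: "'u::infinite itself" and P :: "('h, 'm) top_group_scheme" (structure) and n :: nat and A :: "nat \<Rightarrow> 'h set" +
 fixes R :: "nat \<Rightarrow> ('a, 'r) ring_scheme" and act :: "nat \<Rightarrow> 'h \<Rightarrow> 'a \<Rightarrow> 'a" and N :: "nat \<Rightarrow> ('h set, 'a) hser set" and q :: nat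
 assumes n: "n \<ge> 1" and fac: "\<And>i. i \<in> {1..n} \<Longrightarrow> factor (R i) (top_subgroup P (A i)) (act i) (N i) (ltr P) q"
  and aclN: "\<And>i. i \<in> {1..n} \<Longrightarrow> acl (N i)"
begin

abbreviation Y :: "nat \<Rightarrow> 'h set \<Rightarrow> ('h set, 'a) hser" where
 "Y i \<equiv> factor.yy (R i) (top_subgroup P (A i)) (act i) (ltr P)"

abbreviation H :: "nat \<Rightarrow> 'h \<Rightarrow> ('h set, 'a) hser \<Rightarrow> ('h set, 'a) hser" where
 "H i \<equiv> factor.hact (act i)"

lemma one_in: "1 \<in> {1..n}" using n by simp

lemma top_subgroup_simps:
 "carrier (top_subgroup P B) = B" "\<one>\<^bsub>top_subgroup P B\<^esub> = \<one>" "x \<otimes>\<^bsub>top_subgroup P B\<^esub> y = x \<otimes> y"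
 "topol (top_subgroup P B) = subtopology (topol P) B" by (simp_all add: top_subgroup_def)

lemma facts:
 assumes i: "i \<in> {1..n}"
 shows "pideal (N i)" "rhom (H i g)" "g \<in> A i \<Longrightarrow> H i g c \<in> N i \<longleftrightarrow> c \<in> N i"
  "g \<in> A i \<Longrightarrow> h \<in> A i \<Longrightarrow> H i (g \<otimes> h) c - H i g (H i h c) \<in> N i" "H i \<one> c - c \<in> N i"
  "closedin (topol P) {g \<in> A i. d - H i g c \<in> N i}" "g \<in> A i \<Longrightarrow> H i g (Y i x) = Y i (ltr P g x)"
  "meval of_int (Y i) z \<in> N i \<longleftrightarrow> (\<forall>m. int q dvd plk z m)"
proof -
 interpret F: factor "R i" "top_subgroup P (A i)" "act i" "N i" "ltr P" q by (rule fac[OF i])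
 note s = top_subgroup_simps
 show "pideal (N i)" by (rule F.pideal_N)
 show "rhom (H i g)" by (rule F.rhom_hact)
 show "g \<in> A i \<Longrightarrow> H i g c \<in> N i \<longleftrightarrow> c \<in> N i" using F.hact_N_iff[of g c] by (simp add: s)
 show "g \<in> A i \<Longrightarrow> h \<in> A i \<Longrightarrow> H i (g \<otimes> h) c - H i g (H i h c) \<in> N i" using F.hact_mult[of g h c] by (simp add: s)
 show "H i \<one> c - c \<in> N i" using F.hact_one[of c] by (simp add: s)
 show "g \<in> A i \<Longrightarrow> H i g (Y i x) = Y i (ltr P g x)" using F.hact_yy[of g x] by (simp add: s)
 show "meval of_int (Y i) z \<in> N i \<longleftrightarrow> (\<forall>m. int q dvd plk z m)" by (rule F.independent)
 have "closedin (subtopology (topol P) (A i)) {g \<in> A i. d - H i g c \<in> N i}" using F.closed_hact[of d c] by (simp add: s)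
 thus "closedin (topol P) {g \<in> A i. d - H i g c \<in> N i}" using closedin_trans_full A(2)[OF i] by blast
qed

definition \<tau>0 :: "nat \<Rightarrow> (('h set, 'a) hser \<times> ('h set, 'a) hser) set" where
 "\<tau>0 i = {(meval of_int (Y 1) z, meval of_int (Y i) z) | z. True}"

text \<open>By \<open>independent\<close> both families satisfy exactly the same integral relations,
  those with all coefficients divisible by \<open>q\<close>.\<close>

lemma corr_\<tau>0: "i \<in> {1..n} \<Longrightarrow> corr (N 1) (N i) (\<tau>0 i)"
proof -
 assume i: "i \<in> {1..n}"
 note r = rhomD[OF rhom_meval[OF rhom_of_int]]
 show ?thesis unfolding corr_def
 proof (intro conjI allI impI)
  show "(1, 1) \<in> \<tau>0 i" unfolding \<tau>0_def by (auto simp: r intro!: exI[of _ 1])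
  fix a b c d assume "(a, b) \<in> \<tau>0 i" "(c, d) \<in> \<tau>0 i"
  then obtain z w where zw: "a = meval of_int (Y 1) z" "b = meval of_int (Y i) z"
   "c = meval of_int (Y 1) w" "d = meval of_int (Y i) w" unfolding \<tau>0_def by auto
  show "(a - c, b - d) \<in> \<tau>0 i" unfolding \<tau>0_def zw r(6)[symmetric] by blast
  show "(a * c, b * d) \<in> \<tau>0 i" unfolding \<tau>0_def zw r(3)[symmetric] by blast
 next
  fix a b assume "(a, b) \<in> \<tau>0 i"
  thus "(a \<in> N 1) = (b \<in> N i)" unfolding \<tau>0_def using facts(8)[OF i] facts(8)[OF one_in] by auto
 qed
qed

definition is_\<tau> :: "nat \<Rightarrow> (('h set, 'a) hser \<times> ('h set, 'a) hser) set \<Rightarrow> bool" where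
 "is_\<tau> i t \<equiv> \<tau>0 i \<subseteq> t \<and> corr (N 1) (N i) t \<and>
   (\<forall>f g j a. prp t f g \<longrightarrow> pcoeff f j \<notin> N 1 \<longrightarrow> poly f a \<in> N 1 \<longrightarrow> (\<exists>b. (a, b) \<in> t)) \<and>
   (\<forall>f g j b. prp t f g \<longrightarrow> pcoeff g j \<notin> N i \<longrightarrow> poly g b \<in> N i \<longrightarrow> (\<exists>a. (a, b) \<in> t))"

definition \<tau> :: "nat \<Rightarrow> (('h set, 'a) hser \<times> ('h set, 'a) hser) set" where "\<tau> i = (SOME t. is_\<tau> i t)"

lemma is_\<tau>: "i \<in> {1..n} \<Longrightarrow> is_\<tau> i (\<tau> i)" unfolding \<tau>_def is_\<tau>_def
 by (rule someI_ex) (rule corr_extension[OF facts(1)[OF one_in] facts(1) aclN[OF one_in] aclN corr_\<tau>0])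

lemma \<tau>:
 assumes i: "i \<in> {1..n}"
 shows "corr (N 1) (N i) (\<tau> i)" "(Y 1 x, Y i x) \<in> \<tau> i"
  "prp (\<tau> i) f g \<Longrightarrow> pcoeff f j \<notin> N 1 \<Longrightarrow> poly f a \<in> N 1 \<Longrightarrow> \<exists>b. (a, b) \<in> \<tau> i"
  "prp (\<tau> i) f g \<Longrightarrow> pcoeff g j \<notin> N i \<Longrightarrow> poly g b \<in> N i \<Longrightarrow> \<exists>a. (a, b) \<in> \<tau> i"
proof -
 have "(Y 1 x, Y i x) \<in> \<tau>0 i" unfolding \<tau>0_def by (intro CollectI exI[of _ "mvar x"]) (simp add: meval_mvar[OF rhom_of_int])
 thus "(Y 1 x, Y i x) \<in> \<tau> i" using is_\<tau>[OF i] unfolding is_\<tau>_def by blast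
qed (use is_\<tau>[OF i] in "unfold is_\<tau>_def, blast+")

lemma \<tau>_N: "i \<in> {1..n} \<Longrightarrow> c \<in> N 1 \<Longrightarrow> \<exists>b\<in>N i. (c, b) \<in> \<tau> i"
proof -
 assume i: "i \<in> {1..n}" and c: "c \<in> N 1"
 note cr = \<tau>(1)[OF i]
 have "prp (\<tau> i) [:0, 1:] [:0, 1:]" using corrD(1,2)[OF cr] by (auto simp: prp_def coeff_pCons split: nat.splits)
 moreover have "pcoeff [:0, 1:] (1::nat) \<notin> N 1" using pidealD(2)[OF facts(1)[OF one_in]] by simp
 ultimately obtain b where "(c, b) \<in> \<tau> i" using \<tau>(3)[OF i, of "[:0, 1:]" "[:0, 1:]" 1 c] c by auto
 thus ?thesis using corrD(8)[OF cr] c by blast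
qed

text \<open>The action of \<open>g\<close> on the quotient by \<open>N i\<close>, pulled back along
  \<tau> i to the quotient by \<open>N 1\<close>, where all factors meet.\<close>

definition mv :: "nat \<Rightarrow> 'h \<Rightarrow> (('h set, 'a) hser \<times> ('h set, 'a) hser) set" where
 "mv i g = {(c, c'). \<exists>d d'. (c, d) \<in> \<tau> i \<and> (c', d') \<in> \<tau> i \<and> d' - H i g d \<in> N i}"

lemma mvI: "(c, d) \<in> \<tau> i \<Longrightarrow> (c', d') \<in> \<tau> i \<Longrightarrow> d' - H i g d \<in> N i \<Longrightarrow> (c, c') \<in> mv i g" unfolding mv_def by blast

context
 fixes i :: nat
 assumes i: "i \<in> {1..n}"
begin

lemma mv_iff:
 assumes g: "g \<in> A i" and "(c, d) \<in> \<tau> i" "(c', d') \<in> \<tau> i"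
 shows "(c, c') \<in> mv i g \<longleftrightarrow> d' - H i g d \<in> N i"
proof
 note N = facts(1)[OF i] and u = corr_unique[OF \<tau>(1)[OF i] pidealD(1)[OF facts(1)[OF one_in]]]
 assume "(c, c') \<in> mv i g"
 then obtain e e' where e: "(c, e) \<in> \<tau> i" "(c', e') \<in> \<tau> i" "e' - H i g e \<in> N i" unfolding mv_def by blast
 have 1: "d' - e' \<in> N i" "H i g (e - d) \<in> N i" using u[OF assms(3) e(2)] facts(3)[OF i g] u[OF e(1) assms(2)] by auto
 have "(d' - e') + (e' - H i g e) + H i g (e - d) \<in> N i" by (rule pidealD(3)[OF N pidealD(3)[OF N 1(1) e(3)] 1(2)])
 thus "d' - H i g d \<in> N i" by (simp add: rhomD(6)[OF facts(2)[OF i]])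
qed (rule mvI[OF assms(2,3)])

lemma mv_K: "g \<in> A i \<Longrightarrow> corr (N i) (N i) {(c, d). d - H i g c \<in> N i}"
 using corr_mod[OF facts(1)[OF i] facts(2)[OF i], of g] facts(3)[OF i] by simp

lemma mv_relcomp: "mv i g = \<tau> i O {(c, d). d - H i g c \<in> N i} O (\<tau> i)\<inverse>" unfolding mv_def by auto

lemma mv_corr: "g \<in> A i \<Longrightarrow> corr (N 1) (N 1) (mv i g)"
 unfolding mv_relcomp by (rule corr_relcomp[OF \<tau>(1)[OF i] corr_relcomp[OF mv_K corr_converse[OF \<tau>(1)[OF i]]]])

text \<open>The polynomial is carried to the factor \<open>i\<close>, moved by \<open>g\<close>, and
  carried back. A root takes the same way, which uses that \<tau> i is closed under roots on both
  sides.\<close>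

lemma mv_root:
 assumes g: "g \<in> A i" and f: "prp (mv i g) f f'" "pcoeff f j \<notin> N 1" "poly f a \<in> N 1"
 shows "\<exists>b. (a, b) \<in> mv i g"
proof -
 note cr = \<tau>(1)[OF i] and ck = mv_K[OF g] and N = facts(1)[OF i]
 note cc = corr_converse[OF cr]
 obtain D where D: "prp (\<tau> i) f D" "prp ({(c, d). d - H i g c \<in> N i} O (\<tau> i)\<inverse>) D f'"
  using prp_relcomp[OF cr corr_relcomp[OF ck cc] f(1)[unfolded mv_relcomp]] by blast
 obtain D' where D': "prp {(c, d). d - H i g c \<in> N i} D D'" "prp ((\<tau> i)\<inverse>) D' f'" using prp_relcomp[OF ck cc D(2)] by blast
 have p: "prp (\<tau> i) f D" "prp (\<tau> i) f' D'" "prp {(c, d). d - H i g c \<in> N i} D D'" using D(1) D' by (auto simp: prp_converse)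
 obtain d where d: "(a, d) \<in> \<tau> i" using \<tau>(3)[OF i p(1) f(2,3)] by blast
 have "poly D d \<in> N i" using corr_poly[OF cr p(1) d] corrD(8)[OF cr] f(3) by blast
 moreover have "(poly D d, poly D' (H i g d)) \<in> {(c, d). d - H i g c \<in> N i}"
  by (rule corr_poly[OF ck p(3)]) (simp add: pidealD(1)[OF N])
 ultimately have pD': "poly D' (H i g d) \<in> N i" using corrD(8)[OF ck] by blast
 have "pcoeff D' j \<notin> N i" using f(2) prp_N[OF facts(1)[OF one_in] N cr p(1)] prp_N[OF N N ck p(3)] by blast
 then obtain a' where a': "(a', H i g d) \<in> \<tau> i" using \<tau>(4)[OF i p(2) _ pD'] by blast
 have "(a, a') \<in> mv i g" by (rule mvI[OF d a']) (simp add: pidealD(1)[OF N])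
 thus ?thesis by blast
qed

lemma mv_N:
 assumes g: "g \<in> A i" and c: "c \<in> N 1"
 shows "(0, c) \<in> mv i g \<and> (c, 0) \<in> mv i g"
proof -
 obtain b where b: "b \<in> N i" "(c, b) \<in> \<tau> i" using \<tau>_N[OF i c] by blast
 have z: "(0, 0) \<in> \<tau> i" by (rule corrD(2)[OF \<tau>(1)[OF i]])
 have "(0, c) \<in> mv i g" by (rule mvI[OF z b(2)]) (simp add: rhomD[OF facts(2)[OF i]] b(1))
 moreover have "(c, 0) \<in> mv i g" by (rule mvI[OF b(2) z]) (use b(1) facts(3)[OF i g] pidealD(7)[OF facts(1)[OF i]] in simp)
 ultimately show ?thesis ..
qed

lemma mv_mult:
 assumes g: "g \<in> A i" "h \<in> A i" and ab: "(a, b) \<in> mv i h" "(b, c) \<in> mv i g"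
 shows "(a, c) \<in> mv i (g \<otimes> h)"
proof -
 note N = facts(1)[OF i] and r = rhomD[OF facts(2)[OF i]]
 obtain d d' where d: "(a, d) \<in> \<tau> i" "(b, d') \<in> \<tau> i" "d' - H i h d \<in> N i" using ab(1) unfolding mv_def by blast
 obtain e' where e': "(c, e') \<in> \<tau> i" using ab(2) unfolding mv_def by blast
 have e: "e' - H i g d' \<in> N i" using mv_iff[OF g(1) d(2) e'] ab(2) by blast
 have 1: "H i g (d' - H i h d) \<in> N i" using facts(3)[OF i g(1)] d(3) by simp
 have "(e' - H i g d') + H i g (d' - H i h d) - (H i (g \<otimes> h) d - H i g (H i h d)) \<in> N i"
  by (rule pidealD(8)[OF N pidealD(3)[OF N e 1] facts(4)[OF i g]])
 thus ?thesis by (intro mvI[OF d(1) e']) (simp add: r)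
qed

lemma mv_one: "(a, b) \<in> mv i \<one> \<Longrightarrow> b - a \<in> N 1"
proof -
 note N = facts(1)[OF i]
 assume "(a, b) \<in> mv i \<one>"
 then obtain d d' where d: "(a, d) \<in> \<tau> i" "(b, d') \<in> \<tau> i" "d' - H i \<one> d \<in> N i" unfolding mv_def by blast
 have "(d' - H i \<one> d) + (H i \<one> d - d) \<in> N i" by (rule pidealD(3)[OF N d(3) facts(5)[OF i]])
 thus ?thesis using corrD(8)[OF \<tau>(1)[OF i] corrD(3)[OF \<tau>(1)[OF i] d(2,1)]] by simp
qed

lemma mv_closed: "closedin (topol P) {g \<in> A i. (a, b) \<in> mv i g}"
proof (cases "\<exists>d d'. (a, d) \<in> \<tau> i \<and> (b, d') \<in> \<tau> i")
 case True
 then obtain d d' where d: "(a, d) \<in> \<tau> i" "(b, d') \<in> \<tau> i" by blast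
 have "{g \<in> A i. (a, b) \<in> mv i g} = {g \<in> A i. d' - H i g d \<in> N i}" using mv_iff[OF _ d] by blast
 thus ?thesis using facts(6)[OF i] by simp
next
 case False
 hence "{g \<in> A i. (a, b) \<in> mv i g} = {}" unfolding mv_def by blast
 thus ?thesis by (metis closedin_empty)
qed

lemma mv_y: "g \<in> A i \<Longrightarrow> (Y 1 x, Y 1 (ltr P g x)) \<in> mv i g"
 by (rule mvI[OF \<tau>(2)[OF i] \<tau>(2)[OF i]]) (simp add: facts(7)[OF i] pidealD(1)[OF facts(1)[OF i]])

end

lemma profin: "profin P" using profinite by (simp add: profin_def)

theorem corr_action: "corr_action U P n A (N 1) mv (Y 1) (ltr P)"
proof -
 interpret profin P by (rule profin)
 show ?thesis
 proof (unfold_locales)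
  fix i g f f' j a assume i: "i \<in> {1..n}" and g: "g \<in> A i"
  show "corr (N 1) (N 1) (mv i g)" by (rule mv_corr[OF i g])
  show "(Y 1 x, Y 1 (ltr P g x)) \<in> mv i g" for x by (rule mv_y[OF i g])
  show "(0, c) \<in> mv i g \<and> (c, 0) \<in> mv i g" if "c \<in> N 1" for c by (rule mv_N[OF i g that])
  show "(a, c) \<in> mv i (g \<otimes> h)" if "h \<in> A i" "(a, b) \<in> mv i h" "(b, c) \<in> mv i g" for h a b c by (rule mv_mult[OF i g that])
  assume "prp (mv i g) f f'" "pcoeff f j \<notin> N 1" "poly f a \<in> N 1"
  thus "\<exists>b. (a, b) \<in> mv i g" by (rule mv_root[OF i g])
 next
  show "b - a \<in> N 1" if "i \<in> {1..n}" "(a, b) \<in> mv i \<one>" for i a b by (rule mv_one[OF that])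
  show "closedin (topol P) {g \<in> A i. (a, b) \<in> mv i g}" if "i \<in> {1..n}" for i a b by (rule mv_closed[OF that])
 qed (rule facts(1)[OF one_in] aclN[OF one_in] ltr_one ltr_mult ltr_lconst; assumption?)+
qed

lemma Y_inj:
 assumes "Y 1 x - Y 1 z \<in> N 1"
 shows "x = z"
proof (rule ccontr)
 assume ne: "x \<noteq> z"
 have "meval of_int (Y 1) (mvar x - mvar z) \<in> N 1"
  using assms by (simp add: rhomD[OF rhom_meval[OF rhom_of_int]] meval_mvar[OF rhom_of_int])
 hence "int q dvd plk (mvar x - mvar z) {#x#}" using facts(8)[OF one_in] by blast
 hence q1: "q = 1" using ne by (simp add: mvar_def lookup_minus lookup_single when_def)
 have "meval of_int (Y 1) 1 \<in> N 1" unfolding facts(8)[OF one_in] q1 by simp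
 thus False using pidealD(2)[OF facts(1)[OF one_in]] by (simp add: rhomD[OF rhom_meval[OF rhom_of_int]])
qed

end

section \<open>The field of algebraic elements and the action of the free product on it\<close>

locale waction = corr_action U P n A N mv y \<alpha>
 for U :: "'u::infinite itself" and P :: "('h, 'm) top_group_scheme" (structure) and n :: nat and A :: "nat \<Rightarrow> 'h set"
  and N :: "'c::comm_ring_1 set" and mv :: "nat \<Rightarrow> 'h \<Rightarrow> ('c \<times> 'c) set" and y :: "'x \<Rightarrow> 'c" and \<alpha> :: "'h \<Rightarrow> 'x \<Rightarrow> 'x" +
 fixes \<Phi> :: "'h \<Rightarrow> 'c \<Rightarrow> 'c" and \<kappa> :: "'c \<Rightarrow> 'z" and q :: nat
 assumes \<Phi>: "W_action \<Phi>" and \<kappa>: "inj_on \<kappa> W" and y_inj: "y x - y z \<in> N \<Longrightarrow> x = z"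
  and \<alpha>_faithful: "g \<in> carrier P \<Longrightarrow> h \<in> carrier P \<Longrightarrow> (\<And>x. \<alpha> g x = \<alpha> h x) \<Longrightarrow> g = h" and N_char: "of_int m \<in> N \<longleftrightarrow> int q dvd m"
begin

lemma \<Phi>_W: "g \<in> carrier P \<Longrightarrow> w \<in> W \<Longrightarrow> \<Phi> g w \<in> W" and \<Phi>_one: "w \<in> W \<Longrightarrow> \<Phi> \<one> w = w"
  and \<Phi>_mult: "g \<in> carrier P \<Longrightarrow> h \<in> carrier P \<Longrightarrow> w \<in> W \<Longrightarrow> \<Phi> (g \<otimes> h) w = \<Phi> g (\<Phi> h w)"
  and \<Phi>_lconst: "w \<in> W \<Longrightarrow> lconst P (\<lambda>g. \<Phi> g w)"
  and \<Phi>_hom: "g \<in> carrier P \<Longrightarrow> v \<in> W \<Longrightarrow> w \<in> W \<Longrightarrow> \<Phi> g (can (v + w)) = can (\<Phi> g v + \<Phi> g w)"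
   "g \<in> carrier P \<Longrightarrow> v \<in> W \<Longrightarrow> w \<in> W \<Longrightarrow> \<Phi> g (can (v * w)) = can (\<Phi> g v * \<Phi> g w)"
  and \<Phi>_y: "g \<in> carrier P \<Longrightarrow> \<Phi> g (can (y x)) = can (y (\<alpha> g x))" and \<Phi>_1: "g \<in> carrier P \<Longrightarrow> \<Phi> g (can 1) = can 1"
 using \<Phi> unfolding W_action_def by blast+

text \<open>The class of \<open>c\<close> as an element of the type \<open>'z\<close> on which the
  field is to be built; \<open>lf\<close> returns its canonical representative.\<close>

definition hh :: "'c \<Rightarrow> 'z" where "hh c = \<kappa> (can c)"

definition lf :: "'z \<Rightarrow> 'c" where "lf = inv_into W \<kappa>"

definition wr :: "'z ring" where
 "wr = \<lparr>carrier = \<kappa> ` W, monoid.mult = \<lambda>a b. hh (lf a * lf b), monoid.one = hh 1, ring.zero = hh 0, ring.add = \<lambda>a b. hh (lf a + lf b)\<rparr>"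

lemma hh_eq: "c \<in> Alg \<Longrightarrow> d \<in> Alg \<Longrightarrow> hh c = hh d \<longleftrightarrow> c - d \<in> N"
 unfolding hh_def using inj_on_eq_iff[OF \<kappa> WI WI, of c d] can_eq_iff by simp

lemma lf_hh: "c \<in> Alg \<Longrightarrow> lf (hh c) = can c" unfolding lf_def hh_def by (rule inv_into_f_f[OF \<kappa> WI])

lemma can_Alg: "c \<in> Alg \<Longrightarrow> can c \<in> Alg" using WD(1)[OF WI] .

lemma wr_carrier: "a \<in> carrier wr \<longleftrightarrow> (\<exists>c\<in>Alg. a = hh c)" unfolding wr_def hh_def W_def by auto

lemma hh_carrier: "c \<in> Alg \<Longrightarrow> hh c \<in> carrier wr" using wr_carrier by blast

lemma wr_ops:
 assumes "a \<in> Alg" "b \<in> Alg"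
 shows "hh a \<otimes>\<^bsub>wr\<^esub> hh b = hh (a * b)" "hh a \<oplus>\<^bsub>wr\<^esub> hh b = hh (a + b)"
proof -
 have N1: "can a - a \<in> N" "can b - b \<in> N" by (rule can)+
 have e: "can a * can b - a * b = can a * (can b - b) + (can a - a) * b"
  "can a + can b - (a + b) = (can a - a) + (can b - b)" by (simp_all add: algebra_simps)
 have "can a * can b - a * b \<in> N" unfolding e by (rule pidealD(3)[OF N pidealD(4)[OF N N1(2)] pidealD(5)[OF N N1(1)]])
 moreover have "can a + can b - (a + b) \<in> N" unfolding e by (rule pidealD(3)[OF N N1])
 ultimately show "hh a \<otimes>\<^bsub>wr\<^esub> hh b = hh (a * b)" "hh a \<oplus>\<^bsub>wr\<^esub> hh b = hh (a + b)"
  using assms hh_eq can_Alg by (simp_all add: wr_def lf_hh Alg.mult Alg_add)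
qed

lemma wr_consts: "\<one>\<^bsub>wr\<^esub> = hh 1" "\<zero>\<^bsub>wr\<^esub> = hh 0" by (simp_all add: wr_def)

lemma Alg_uminus: "c \<in> Alg \<Longrightarrow> - c \<in> Alg" using Alg.diff[OF Alg_zero] by simp

lemma cring_wr: "cring wr"
proof (rule cringI)
 note s = wr_consts wr_ops Alg.mult Alg_add Alg.one Alg_zero hh_carrier Alg_uminus
 show "abelian_group wr"
 proof (rule abelian_groupI)
  fix a b c assume "a \<in> carrier wr" "b \<in> carrier wr" "c \<in> carrier wr"
  then obtain a' b' c' where "a' \<in> Alg" "b' \<in> Alg" "c' \<in> Alg" "a = hh a'" "b = hh b'" "c = hh c'" using wr_carrier by metis
  thus "a \<oplus>\<^bsub>wr\<^esub> b \<oplus>\<^bsub>wr\<^esub> c = a \<oplus>\<^bsub>wr\<^esub> (b \<oplus>\<^bsub>wr\<^esub> c)" by (simp add: s add.assoc)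
 next
  fix a b assume "a \<in> carrier wr" "b \<in> carrier wr"
  then obtain a' b' where "a' \<in> Alg" "b' \<in> Alg" "a = hh a'" "b = hh b'" using wr_carrier by metis
  thus "a \<oplus>\<^bsub>wr\<^esub> b \<in> carrier wr" "a \<oplus>\<^bsub>wr\<^esub> b = b \<oplus>\<^bsub>wr\<^esub> a" by (simp_all add: s add.commute)
 next
  fix a assume "a \<in> carrier wr"
  then obtain a' where a: "a' \<in> Alg" "a = hh a'" using wr_carrier by metis
  thus "\<zero>\<^bsub>wr\<^esub> \<oplus>\<^bsub>wr\<^esub> a = a" by (simp add: s)
  show "\<exists>b\<in>carrier wr. b \<oplus>\<^bsub>wr\<^esub> a = \<zero>\<^bsub>wr\<^esub>" by (rule bexI[of _ "hh (- a')"]) (use a in "simp_all add: s")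
 qed (simp add: s)
 show "comm_monoid wr"
 proof (rule comm_monoidI)
  fix a b c assume "a \<in> carrier wr" "b \<in> carrier wr" "c \<in> carrier wr"
  then obtain a' b' c' where "a' \<in> Alg" "b' \<in> Alg" "c' \<in> Alg" "a = hh a'" "b = hh b'" "c = hh c'" using wr_carrier by metis
  thus "a \<otimes>\<^bsub>wr\<^esub> b \<otimes>\<^bsub>wr\<^esub> c = a \<otimes>\<^bsub>wr\<^esub> (b \<otimes>\<^bsub>wr\<^esub> c)" by (simp add: s mult.assoc)
 next
  fix a b assume "a \<in> carrier wr" "b \<in> carrier wr"
  then obtain a' b' where "a' \<in> Alg" "b' \<in> Alg" "a = hh a'" "b = hh b'" using wr_carrier by metis
  thus "a \<otimes>\<^bsub>wr\<^esub> b \<in> carrier wr" "a \<otimes>\<^bsub>wr\<^esub> b = b \<otimes>\<^bsub>wr\<^esub> a" by (simp_all add: s mult.commute)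
 next
  fix a assume "a \<in> carrier wr"
  then obtain a' where a: "a' \<in> Alg" "a = hh a'" using wr_carrier by metis
  thus "\<one>\<^bsub>wr\<^esub> \<otimes>\<^bsub>wr\<^esub> a = a" by (simp add: s)
 qed (simp add: s)
 fix a b c assume "a \<in> carrier wr" "b \<in> carrier wr" "c \<in> carrier wr"
 then obtain a' b' c' where "a' \<in> Alg" "b' \<in> Alg" "c' \<in> Alg" "a = hh a'" "b = hh b'" "c = hh c'" using wr_carrier by metis
 thus "(a \<oplus>\<^bsub>wr\<^esub> b) \<otimes>\<^bsub>wr\<^esub> c = a \<otimes>\<^bsub>wr\<^esub> c \<oplus>\<^bsub>wr\<^esub> b \<otimes>\<^bsub>wr\<^esub> c" by (simp add: s distrib_right)
qed

lemma field_wr: "field wr"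
proof (rule cring.cring_fieldI2[OF cring_wr])
 show "\<zero>\<^bsub>wr\<^esub> \<noteq> \<one>\<^bsub>wr\<^esub>" using hh_eq[OF Alg_zero Alg.one] pidealD(2)[OF N] pidealD(7)[OF N, of 1] by (simp add: wr_consts)
 fix a assume "a \<in> carrier wr" and a0: "a \<noteq> \<zero>\<^bsub>wr\<^esub>"
 then obtain c where c: "c \<in> Alg" "a = hh c" using wr_carrier by blast
 have cN: "c \<notin> N" using a0 hh_eq[OF c(1) Alg_zero] c(2) by (auto simp: wr_consts)
 \<comment> \<open>The inverse of \<open>c\<close> is found as a root of c X - 1, and thus stays in
   \<open>Alg\<close>.\<close>
 let ?f = "[:- 1, c:]"
 have f1: "pcoeff ?f 1 \<notin> N" using cN by simp
 then obtain v where v: "poly ?f v \<in> N" using aclN unfolding acl_def by (metis zero_less_one)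
 have "v \<in> Alg"
  by (rule Alg.root[OF _ f1 v]) (use c(1) Alg.one Alg_zero Alg_uminus in "auto simp: coeff_pCons split: nat.splits")
 moreover have "hh (c * v) = hh 1" using v hh_eq[OF Alg.mult[OF c(1) \<open>v \<in> Alg\<close>] Alg.one] by (simp add: algebra_simps)
 ultimately show "\<exists>b\<in>carrier wr. a \<otimes>\<^bsub>wr\<^esub> b = \<one>\<^bsub>wr\<^esub>"
  by (intro bexI[of _ "hh v"]) (simp_all add: c wr_ops wr_consts hh_carrier)
qed

sublocale wr: field wr by (rule field_wr)

definition lft :: "('z, int) mpol \<Rightarrow> 'c" where
 "lft = meval of_int (\<lambda>a. if a \<in> carrier wr then lf a else 0)"

lemma rhom_lft: "rhom lft" unfolding lft_def by (rule rhom_meval[OF rhom_of_int])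

lemma lft_mvar: "lft (mvar a) = (if a \<in> carrier wr then lf a else 0)" unfolding lft_def by (rule meval_mvar[OF rhom_of_int])

lemma lft_mev: "lft z \<in> Alg \<and> wr.mev z = hh (lft z)"
proof (induction z rule: zpol_induct)
 case 1
 thus ?case by (simp add: rhomD[OF rhom_lft] Alg.one wr.mev_one wr_consts)
next
 case (2 a)
 show ?case
 proof (cases "a \<in> carrier wr")
  case True
  then obtain c where c: "c \<in> Alg" "a = hh c" using wr_carrier by blast
  have "hh (can c) = hh c" using hh_eq[OF can_Alg c(1)] c(1) can by blast
  thus ?thesis using True c by (simp add: lft_mvar wr.mev_var lf_hh can_Alg)
 next
  case False
  thus ?thesis by (simp add: lft_mvar wr.mev_var Alg_zero wr_consts)
 qed
next
 case (3 x y)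
 have neg: "\<ominus>\<^bsub>wr\<^esub> hh c = hh (- c)" if "c \<in> Alg" for c
  by (rule wr.minus_equality) (use that in "simp_all add: wr_ops Alg_uminus wr_consts hh_carrier")
 show ?case using 3 by (simp add: rhomD[OF rhom_lft] Alg.diff wr.mevD(7) a_minus_def neg wr_ops Alg_uminus)
next
 case (4 x y)
 thus ?case by (simp add: rhomD[OF rhom_lft] Alg.mult wr.mev_mult wr_ops)
qed

lemma mev_zero_iff: "wr.mev z = \<zero>\<^bsub>wr\<^esub> \<longleftrightarrow> lft z \<in> N" using lft_mev[of z] hh_eq[of "lft z" 0] Alg_zero by (simp add: wr_consts)

text \<open>The coefficients are lifted to \<open>'c\<close> by \<open>lft\<close>; the residue ring
  modulo \<open>N\<close> has a root, and this root belongs to \<open>Alg\<close> by the rule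
  \<open>root\<close>.\<close>

lemma acfield_wr: "acfield wr"
proof (rule acfield.intro[OF field_wr], unfold_locales)
 show "acl {z. wr.mev z = \<zero>\<^bsub>wr\<^esub>}" unfolding acl_def
 proof (intro allI impI)
  fix F :: "('z, int) mpol poly"
  assume "\<exists>i>0. pcoeff F i \<notin> {z. wr.mev z = \<zero>\<^bsub>wr\<^esub>}"
  then obtain i where i: "i > 0" "lft (pcoeff F i) \<notin> N" using mev_zero_iff by auto
  let ?F = "map_poly lft F"
  have cf: "pcoeff ?F j = lft (pcoeff F j)" for j by (rule coeff_map_poly) (rule rhomD[OF rhom_lft])
  obtain d where d: "poly ?F d \<in> N" using aclN i cf unfolding acl_def by metis
  have dA: "d \<in> Alg" by (rule Alg.root[OF _ _ d, of i]) (use lft_mev i cf in auto)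
  let ?K = "{z. lft z \<in> N}"
  let ?R = "{(z, c). c - lft z \<in> N}"
  note cr = corr_mod[OF N rhom_lft]
  have "d - lf (hh d) \<in> N" using lf_hh[OF dA] can pidealD(12)[OF N] by metis
  hence "(mvar (hh d), d) \<in> ?R" using hh_carrier[OF dA] by (simp add: lft_mvar)
  hence "(poly F (mvar (hh d)), poly ?F d) \<in> ?R" by (rule corr_poly[OF cr, rotated]) (simp add: prp_def cf pidealD(1)[OF N])
  hence "lft (poly F (mvar (hh d))) \<in> N" using corrD(8)[OF cr] d by blast
  thus "\<exists>x. poly F x \<in> {z. wr.mev z = \<zero>\<^bsub>wr\<^esub>}" using mev_zero_iff by blast
 qed
qed

definition actw :: "'h \<Rightarrow> 'z \<Rightarrow> 'z" where "actw g a = \<kappa> (\<Phi> g (lf a))"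

lemma actw_hh: "c \<in> Alg \<Longrightarrow> actw g (hh c) = \<kappa> (\<Phi> g (can c))" by (simp add: actw_def lf_hh)

lemma kappa_hh: "w \<in> W \<Longrightarrow> \<kappa> w = hh w" using WD(2) by (simp add: hh_def)

lemma gact_wr: "gact wr P actw"
proof (rule gact.intro[OF field_wr], rule gact_axioms.intro)
 show "group P" by (rule group)
 show "topspace (topol P) = carrier P" by (rule topspace)
 show "compact_space (topol P)" using profinite by (simp add: profinite_group_def)
next
 fix g assume g: "g \<in> carrier P"
 show "actw g \<in> ring_hom wr wr"
 proof (rule ring_hom_memI)
  fix a assume "a \<in> carrier wr"
  then obtain c where c: "c \<in> Alg" "a = hh c" using wr_carrier by blast
  thus "actw g a \<in> carrier wr" using \<Phi>_W[OF g WI] by (simp add: actw_hh kappa_hh WD(1) hh_carrier)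
  fix b assume "b \<in> carrier wr"
  then obtain d where d: "d \<in> Alg" "b = hh d" using wr_carrier by blast
  have canop: "can (c + d) = can (can c + can d)" "can (c * d) = can (can c * can d)"
  proof -
   have 1: "c - can c \<in> N" "d - can d \<in> N" using can pidealD(12)[OF N] by blast+
   have e: "c * d - can c * can d = c * (d - can d) + (c - can c) * can d"
    "c + d - (can c + can d) = (c - can c) + (d - can d)" by (simp_all add: algebra_simps)
   show "can (c + d) = can (can c + can d)" unfolding can_eq_iff e by (rule pidealD(3)[OF N 1])
   show "can (c * d) = can (can c * can d)" unfolding can_eq_iff e
    by (rule pidealD(3)[OF N pidealD(4)[OF N 1(2)] pidealD(5)[OF N 1(1)]])
  qed
  have W: "\<Phi> g (can c) \<in> W" "\<Phi> g (can d) \<in> W" using \<Phi>_W[OF g WI] c d by auto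
  show "actw g (a \<otimes>\<^bsub>wr\<^esub> b) = actw g a \<otimes>\<^bsub>wr\<^esub> actw g b" using W \<Phi>_hom(2)[OF g WI[OF c(1)] WI[OF d(1)]] c d
   by (simp add: wr_ops actw_hh Alg.mult canop kappa_hh[OF W(1)] kappa_hh[OF W(2)] WD(1)) (simp add: hh_def)
  show "actw g (a \<oplus>\<^bsub>wr\<^esub> b) = actw g a \<oplus>\<^bsub>wr\<^esub> actw g b" using W \<Phi>_hom(1)[OF g WI[OF c(1)] WI[OF d(1)]] c d
   by (simp add: wr_ops actw_hh Alg_add canop kappa_hh[OF W(1)] kappa_hh[OF W(2)] WD(1)) (simp add: hh_def)
 next
  show "actw g \<one>\<^bsub>wr\<^esub> = \<one>\<^bsub>wr\<^esub>" using \<Phi>_1[OF g] by (simp add: wr_consts actw_hh Alg.one) (simp add: hh_def)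
 qed
next
 fix a assume "a \<in> carrier wr"
 then obtain c where c: "c \<in> Alg" "a = hh c" using wr_carrier by blast
 show "actw \<one> a = a" using \<Phi>_one[OF WI[OF c(1)]] c by (simp add: actw_hh) (simp add: hh_def)
 show "lconst P (\<lambda>g. actw g a)" using lconst_comp[OF \<Phi>_lconst[OF WI[OF c(1)]], of \<kappa>] c by (simp add: actw_hh)
 fix g h assume g: "g \<in> carrier P" "h \<in> carrier P"
 show "actw (g \<otimes> h) a = actw g (actw h a)" using \<Phi>_mult[OF g WI[OF c(1)]] \<Phi>_W[OF g(2) WI[OF c(1)]] c
  by (simp add: actw_hh kappa_hh WD)
qed

lemma actw_faithful:
 assumes g: "g \<in> carrier P" "h \<in> carrier P" and e: "\<And>a. a \<in> carrier wr \<Longrightarrow> actw g a = actw h a"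
 shows "g = h"
proof (rule \<alpha>_faithful[OF g])
 fix x
 have "\<kappa> (can (y (\<alpha> g x))) = \<kappa> (can (y (\<alpha> h x)))" using e[OF hh_carrier[OF Alg.y]] \<Phi>_y g by (simp add: actw_hh Alg.y)
 hence "hh (y (\<alpha> g x)) = hh (y (\<alpha> h x))" by (simp add: hh_def)
 thus "\<alpha> g x = \<alpha> h x" using hh_eq[OF Alg.y Alg.y] y_inj by blast
qed

lemma char_wr: "char_of wr q" unfolding char_of_def
proof
 fix m :: nat
 have "[m] \<cdot>\<^bsub>wr\<^esub> \<one>\<^bsub>wr\<^esub> = wr.mev (of_nat m)" using phomD(11)[OF wr.is_cring wr.phom_mev] by simp
 thus "([m] \<cdot>\<^bsub>wr\<^esub> \<one>\<^bsub>wr\<^esub> = \<zero>\<^bsub>wr\<^esub>) = (q dvd m)"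
  using mev_zero_iff[of "of_nat m"] N_char[of "int m"] by (simp add: rhomD[OF rhom_lft])
qed

end

section \<open>Counting: an injection of the field into the prescribed type\<close>

datatype 'x tm = Vc 'x | Oc | Dc "'x tm" "'x tm" | Tc "'x tm" "'x tm" | Rc "'x tm list" nat

text \<open>A prefix code: each constructor has its own tag, and the number of arguments of
  \<open>Rc\<close> is recorded, so that concatenated codes can be taken apart.\<close>

primrec enc :: "'x tm \<Rightarrow> ('x + nat) list" where
 "enc (Vc x) = [Inr 0, Inl x]"
| "enc Oc = [Inr 1]"
| "enc (Dc s t) = Inr 2 # enc s @ enc t"
| "enc (Tc s t) = Inr 3 # enc s @ enc t"
| "enc (Rc ts k) = Inr 4 # Inr k # Inr (length ts) # concat (map enc ts)"

lemma enc_prefix: "enc t @ u = enc s @ v \<Longrightarrow> t = s \<and> u = v"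
proof (induction t arbitrary: s u v)
 case (Vc x)
 thus ?case by (cases s) auto
next
 case Oc
 thus ?case by (cases s) auto
next
 case (Dc t1 t2)
 show ?case
 proof (cases s)
  case (Dc s1 s2)
  hence "enc t1 @ (enc t2 @ u) = enc s1 @ (enc s2 @ v)" using Dc.prems by simp
  hence "t1 = s1" "enc t2 @ u = enc s2 @ v" using Dc.IH(1) by blast+
  thus ?thesis using Dc.IH(2) \<open>s = Dc s1 s2\<close> by blast
 qed (use Dc.prems in auto)
next
 case (Tc t1 t2)
 show ?case
 proof (cases s)
  case (Tc s1 s2)
  hence "enc t1 @ (enc t2 @ u) = enc s1 @ (enc s2 @ v)" using Tc.prems by simp
  hence "t1 = s1" "enc t2 @ u = enc s2 @ v" using Tc.IH(1) by blast+
  thus ?thesis using Tc.IH(2) \<open>s = Tc s1 s2\<close> by blast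
 qed (use Tc.prems in auto)
next
 case (Rc ts k)
 have lists: "length ts = length ss \<Longrightarrow> concat (map enc ts) @ u = concat (map enc ss) @ v \<Longrightarrow> ts = ss \<and> u = v" for ss using Rc.IH
 proof (induction ts arbitrary: ss)
  case (Cons a ts)
  then obtain b ss' where ss: "ss = b # ss'" by (cases ss) auto
  have "enc a @ (concat (map enc ts) @ u) = enc b @ (concat (map enc ss') @ v)" using Cons.prems(2) ss by simp
  hence "a = b" "concat (map enc ts) @ u = concat (map enc ss') @ v" using Cons.prems(3)[of a] by auto
  moreover have "ts = ss' \<and> u = v" by (rule Cons.IH) (use Cons.prems ss calculation in auto)
  ultimately show ?case using ss by simp
 qed simp
 show ?case using Rc.prems lists by (cases s) auto
qed

lemma inj_enc: "inj enc" by (rule injI) (use enc_prefix[of _ "[]" _ "[]"] in simp)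

text \<open>Entries become subsets of \<open>'h + nat\<close>, and a list becomes a set of pairs of
  a point and a position. The mark \<open>Inr 0\<close>, present in every entry, makes the length
  recognizable. Pairs fit into \<open>'k + 'h + nat\<close> because an infinite set has the
  cardinality of its square.\<close>

lemma inj_list_to_set: "\<exists>f :: ('h set + nat) list \<Rightarrow> ('k + 'h + nat) set. inj f"
proof -
 define ent :: "'h set + nat \<Rightarrow> ('h + nat) set" where
  "ent a = (case a of Inl S \<Rightarrow> insert (Inr 0) (Inl ` S) | Inr m \<Rightarrow> {Inr 0, Inr (Suc m)})" for a
 have ent: "ent a = ent b \<Longrightarrow> a = b" for a b
 proof -
  assume e: "ent a = ent b"
  have l: "S = {h. Inl h \<in> ent (Inl S)}" "{m. Inr (Suc m) \<in> ent (Inl S)} = {}"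
   "{m. Inr (Suc m) \<in> ent (Inr k)} = {k}" for S k by (auto simp: ent_def)
  show "a = b" by (cases a; cases b) (use e l in "metis, metis insert_not_empty, metis insert_not_empty, metis the_elem_eq")
 qed
 define F :: "('h set + nat) list \<Rightarrow> (('h + nat) \<times> nat) set" where
  "F xs = {(z, i). i < length xs \<and> z \<in> ent (xs ! i)}" for xs
 have "inj F"
 proof (rule injI)
  fix xs ys assume e: "F xs = F ys"
  have "(Inr 0, i) \<in> F xs \<longleftrightarrow> i < length xs" for xs i by (auto simp: F_def ent_def split: sum.splits)
  hence "i < length xs \<longleftrightarrow> i < length ys" for i using e by metis
  hence len: "length xs = length ys" by (meson linorder_neqE_nat less_irrefl)
  show "xs = ys"
  proof (rule nth_equalityI[OF len])
   fix i assume i: "i < length xs"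
   have "ent (xs ! i) = {z. (z, i) \<in> F xs}" "ent (ys ! i) = {z. (z, i) \<in> F ys}" using i len by (auto simp: F_def)
   thus "xs ! i = ys ! i" using e ent by simp
  qed
 qed
 moreover have "\<exists>g :: ('h + nat) \<times> nat \<Rightarrow> 'k + 'h + nat. inj g"
 proof -
  let ?B = "UNIV :: ('k + 'h + nat) set"
  have "infinite ?B" by (simp add: infinite_UNIV_char_0)
  hence "|?B \<times> ?B| =o |?B|" by (rule card_of_Times_same_infinite)
  hence "|?B \<times> ?B| \<le>o |?B|" by (rule ordIso_imp_ordLeq)
  hence "\<exists>f. inj_on f (?B \<times> ?B) \<and> f ` (?B \<times> ?B) \<subseteq> ?B" unfolding card_of_ordLeq .
  then obtain f :: "('k + 'h + nat) \<times> ('k + 'h + nat) \<Rightarrow> 'k + 'h + nat" where f: "inj_on f (?B \<times> ?B)" by (elim exE conjE)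
  have "inj (\<lambda>p. f (Inr (fst p), Inr (Inr (snd p))))"
  proof (rule injI)
   fix p p' :: "('h + nat) \<times> nat"
   assume "f (Inr (fst p), Inr (Inr (snd p))) = f (Inr (fst p'), Inr (Inr (snd p')))"
   from inj_onD[OF f this] show "p = p'" by (simp add: prod_eq_iff)
  qed
  thus ?thesis by (rule exI[where x = "\<lambda>p. f (Inr (fst p), Inr (Inr (snd p)))"])
 qed
 then obtain g :: "('h + nat) \<times> nat \<Rightarrow> 'k + 'h + nat" where "inj g" by blast
 ultimately have "inj (\<lambda>xs. g ` F xs)" by (auto simp: inj_def inj_image_eq_iff)
 thus ?thesis by blast
qed

context corr_action
begin

text \<open>One enumeration of root representatives is fixed for each coefficient list, so that a
  root is named by the list and an index.\<close>

definition rt :: "'c list \<Rightarrow> nat \<Rightarrow> 'c" where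
 "rt cs = (SOME e. \<forall>d. poly (Poly cs) d \<in> N \<longrightarrow> (\<exists>k. d - e k \<in> N))"

lemma rt:
 assumes "pcoeff (Poly cs) j \<notin> N" "poly (Poly cs) d \<in> N"
 shows "\<exists>k. d - rt cs k \<in> N"
proof -
 obtain B where B: "finite B" "\<And>d. poly (Poly cs) d \<in> N \<Longrightarrow> \<exists>b\<in>B. d - b \<in> N" using finite_roots[OF N assms(1)] by blast
 obtain xs where xs: "set xs = B" using finite_list[OF B(1)] by blast
 have "\<forall>d. poly (Poly cs) d \<in> N \<longrightarrow> (\<exists>k. d - xs ! k \<in> N)" using B(2) xs by (metis in_set_conv_nth)
 hence "\<forall>d. poly (Poly cs) d \<in> N \<longrightarrow> (\<exists>k. d - rt cs k \<in> N)" unfolding rt_def by (rule someI[of "\<lambda>e. \<forall>d. poly (Poly cs) d \<in> N \<longrightarrow> (\<exists>k. d - e k \<in> N)"])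
 thus ?thesis using assms(2) by blast
qed

text \<open>Each rule generating \<open>Alg\<close> has its constructor, so terms name all elements
  of \<open>Alg\<close> up to congruence, and counting terms bounds the size of the field.\<close>

primrec val :: "'x tm \<Rightarrow> 'c" where
 "val (Vc x) = y x"
| "val Oc = 1"
| "val (Dc s t) = val s - val t"
| "val (Tc s t) = val s * val t"
| "val (Rc ts k) = rt (map val ts) k"

lemma Alg_val: "c \<in> Alg \<Longrightarrow> \<exists>t. c - val t \<in> N"
proof (induction rule: Alg.induct)
 case (y x)
 show ?case by (rule exI[of _ "Vc x"]) (simp add: pidealD(1)[OF N])
next
 case one
 show ?case by (rule exI[of _ Oc]) (simp add: pidealD(1)[OF N])
next
 case (diff a b)
 then obtain s t where st: "a - val s \<in> N" "b - val t \<in> N" by blast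
 have "a - b - val (Dc s t) = (a - val s) - (b - val t)" by (simp add: algebra_simps)
 thus ?case using pidealD(8)[OF N st] by metis
next
 case (mult a b)
 then obtain s t where st: "a - val s \<in> N" "b - val t \<in> N" by blast
 have "a * b - val (Tc s t) = a * (b - val t) + (a - val s) * val t" by (simp add: algebra_simps)
 thus ?case using pidealD(3)[OF N pidealD(4)[OF N st(2)] pidealD(5)[OF N st(1)]] by metis
next
 case (root f k d)
 have "\<forall>j. \<exists>t. pcoeff f j - val t \<in> N" using root.IH by blast
 from choice[OF this] obtain t where t: "\<forall>j. pcoeff f j - val (t j) \<in> N" by (elim exE)
 let ?ts = "map t [0..<Suc (pdegree f)]"
 let ?g = "Poly (map val ?ts)"
 have cg: "pcoeff f j - pcoeff ?g j \<in> N" for j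
 proof (cases "j \<le> pdegree f")
  case True
  hence "pcoeff ?g j = val (t j)" by (simp add: nth_default_def del: upt_Suc)
  thus ?thesis using t by simp
 next
  case False
  thus ?thesis using pidealD(1)[OF N] by (simp add: nth_default_def coeff_eq_0 del: upt_Suc)
 qed
 hence "poly (f - ?g) d \<in> N" by (intro poly_in_ideal[OF N]) simp
 hence "poly ?g d \<in> N" using pidealD(11)[OF N, of "poly f d" "poly ?g d"] root.hyps(3) by simp
 moreover have "pcoeff ?g k \<notin> N" using pidealD(11)[OF N cg] root.hyps(2) by blast
 ultimately obtain m where "d - rt (map val ?ts) m \<in> N" using rt by blast
 hence "d - val (Rc ?ts m) \<in> N" by (simp only: val.simps)
 thus ?case by blast
qed

lemma W_inj_tm: "\<exists>\<kappa> :: 'c \<Rightarrow> 'x tm. inj_on \<kappa> W"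
proof -
 have "\<forall>w\<in>W. \<exists>t. can (val t) = w" using Alg_val WD can_eq_iff by metis
 from bchoice[OF this] obtain \<kappa> where "\<forall>w\<in>W. can (val (\<kappa> w)) = w" by (elim exE)
 hence "inj_on \<kappa> W" by (metis inj_onI)
 thus ?thesis by blast
qed

end

lemma (in corr_action) W_inj:
 fixes f :: "'x \<Rightarrow> 'h set"
 assumes "inj f"
 shows "\<exists>\<kappa> :: 'c \<Rightarrow> ('k + 'h + nat) set. inj_on \<kappa> W"
proof -
 obtain \<kappa> :: "'c \<Rightarrow> 'x tm" where k: "inj_on \<kappa> W" using W_inj_tm by blast
 obtain g :: "('h set + nat) list \<Rightarrow> ('k + 'h + nat) set" where g: "inj g" using inj_list_to_set by blast
 have m: "inj (map (map_sum f (id :: nat \<Rightarrow> nat)))" using assms by (simp add: inj_mapI sum.inj_map)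
 have "inj (\<lambda>t. g (map (map_sum f id) (enc t)))" using inj_compose[OF g inj_compose[OF m inj_enc]] by (simp add: o_def)
 hence "inj_on (\<lambda>w. g (map (map_sum f id) (enc (\<kappa> w)))) W"
  using comp_inj_on[OF k, of "\<lambda>t. g (map (map_sum f id) (enc t))"] by (simp add: o_def inj_on_subset)
 thus ?thesis by blast
qed

section \<open>The absolute Galois group of a fixed field\<close>

lemma (in cring) ring_hom_nat_pow:
 assumes "\<phi> \<in> ring_hom R R" "x \<in> carrier R"
 shows "\<phi> (x [^] (n::nat)) = \<phi> x [^] n"
 using ring_hom_one[OF assms(1)] ring_hom_mult[OF assms(1) _ assms(2)] assms(2) by (induction n) simp_all

context char_exp
begin

lemma topspace_galtop: "topspace galtop = gal"
proof
 show "topspace galtop \<subseteq> gal" unfolding galtop_def topology_generated_by_topspace by blast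
 show "gal \<subseteq> topspace galtop"
 proof
  fix \<tau> assume "\<tau> \<in> gal"
  hence "\<tau> \<in> {\<rho> \<in> gal. ext \<rho> \<zero> = ext \<tau> \<zero>}" by simp
  thus "\<tau> \<in> topspace galtop" using openin_subset[OF openin_ext[OF zero_closed, of "ext \<tau> \<zero>"]] by blast
 qed
qed

lemma Hausdorff_galtop: "Hausdorff_space galtop" unfolding Hausdorff_space_def topspace_galtop
proof (intro allI impI, elim conjE)
 fix \<tau> \<rho> assume t: "\<tau> \<in> gal" "\<rho> \<in> gal" "\<tau> \<noteq> \<rho>"
 have "ext \<tau> \<noteq> ext \<rho>" using ext_faithful[OF t(1,2)] t(3) by blast
 then obtain x where x: "ext \<tau> x \<noteq> ext \<rho> x" by blast
 have xL: "x \<in> carrier L" using x by (rule contrapos_np) (simp add: ext_def)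
 show "\<exists>U V. openin galtop U \<and> openin galtop V \<and> \<tau> \<in> U \<and> \<rho> \<in> V \<and> disjnt U V"
  by (rule exI[of _ "{\<upsilon> \<in> gal. ext \<upsilon> x = ext \<tau> x}"], rule exI[of _ "{\<upsilon> \<in> gal. ext \<upsilon> x = ext \<rho> x}"])
   (use openin_ext[OF xL] t x in "auto simp: disjnt_def")
qed

lemma hom_combine:
 assumes f: "f \<in> ring_hom L L" "g \<in> ring_hom L L" "\<And>k. k \<in> K \<Longrightarrow> f k = k" "\<And>k. k \<in> K \<Longrightarrow> g k = k"
  and e: "\<And>u. u \<in> set Us \<Longrightarrow> f u = g u" and Us: "set Us \<subseteq> carrier L" "set Ks \<subseteq> K"
 shows "f (combine Ks Us) = g (combine Ks Us)" using e Us
proof (induction Ks Us rule: combine.induct)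
 case (1 k Ks u Us)
 hence k: "k \<in> K" "k \<in> carrier L" "u \<in> carrier L" "set Ks \<subseteq> carrier L" "set Us \<subseteq> carrier L" using K_sub by auto
 hence c: "combine Ks Us \<in> carrier L" by simp
 have h: "h (combine (k # Ks) (u # Us)) = h k \<otimes> h u \<oplus> h (combine Ks Us)" if "h \<in> ring_hom L L" for h
  using ring_hom_add[OF that _ c, of "k \<otimes> u"] ring_hom_mult[OF that k(2,3)] k by simp
 have "f u = g u" using 1(2)[of u] by simp
 thus ?case unfolding h[OF f(1)] h[OF f(2)] f(3)[OF k(1)] f(4)[OF k(1)] using 1 by simp
qed (use ring_hom_0[OF f(1)] ring_hom_0[OF f(2)] in simp_all)

text \<open>A faithful action of a profinite group \<open>P\<close> with open stabilizers identifies \<open>P\<close> with the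
 absolute Galois group of the fixed field: by compactness every automorphism comes from \<open>P\<close>.\<close>

lemma galois_group_of_action:
 fixes P :: "('h, 'n) top_group_scheme"
 assumes P: "profinite_group P" and act: "gact L P act" and fixed: "\<And>x. x \<in> carrier L \<Longrightarrow> (\<forall>g\<in>carrier P. act g x = x) \<longleftrightarrow> x \<in> K"
  and faithful: "\<And>g h. g \<in> carrier P \<Longrightarrow> h \<in> carrier P \<Longrightarrow> (\<And>a. a \<in> carrier L \<Longrightarrow> act g a = act h a) \<Longrightarrow> g = h"
 shows "sepc = carrier L"
  "\<exists>\<Psi>. bij_betw \<Psi> (carrier P) gal \<and> homeomorphic_map (topol P) galtop \<Psi> \<and>
   (\<forall>g\<in>carrier P. \<forall>h\<in>carrier P. \<Psi> (g \<otimes>\<^bsub>P\<^esub> h) = compose (carrier L) (\<Psi> g) (\<Psi> h))"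
proof -
 interpret G: gact L P act by (rule act)
 interpret GP: group P by (rule G.M)
 have fixK: "act g x = x" if "g \<in> carrier P" "x \<in> K" for g x using fixed[of x] that K_sub by blast
 have cl: "act g x \<in> carrier L" if "g \<in> carrier P" "x \<in> carrier L" for g x
  by (rule ring_hom_closed[OF G.act_hom[OF that(1)] that(2)])
 \<comment> \<open>The fixed field is perfect: r-th roots are unique, so that of a fixed element is
   fixed. Hence every element of \<open>L\<close> is separable.\<close>
 have perf: "\<exists>y\<in>K. y [^] r = x" if x: "x \<in> K" for x
 proof -
  obtain y where y: "y \<in> carrier L" "y [^] r = x" using power_root[of x r] x K_sub r_pos by blast
  have "act g y = y" if g: "g \<in> carrier P" for g
  proof -
   have "act g y [^] r = x" using ring_hom_nat_pow[OF G.act_hom[OF g] y(1), of r] y(2) fixK[OF g x] by simp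
   thus ?thesis using r_inj_carrier[OF cl[OF g y(1)] y(1)] y(2) by simp
  qed
  thus ?thesis using fixed[OF y(1)] y(2) by blast
 qed
 show S: "sepc = carrier L" using separable_of_perfect[OF perf] by (auto simp: sepc_def)
 have LS: "L\<lparr>carrier := sepc\<rparr> = L" unfolding S by simp
 have galD': "\<tau> \<in> ring_hom L L" if "\<tau> \<in> gal" for \<tau> using that unfolding gal_def LS by (auto simp: ring_iso_def)
 define \<Psi> where "\<Psi> g = restrict (act g) (carrier L)" for g
 have inv: "act (inv\<^bsub>P\<^esub> g) (act g x) = x" "act g (act (inv\<^bsub>P\<^esub> g) x) = x" if "g \<in> carrier P" "x \<in> carrier L" for g x
  using G.act_mult[of "inv\<^bsub>P\<^esub> g" g x] G.act_mult[of g "inv\<^bsub>P\<^esub> g" x] that G.act_one by simp_all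
 have gal: "\<Psi> g \<in> gal" if g: "g \<in> carrier P" for g
 proof -
  have "bij_betw (act g) (carrier L) (carrier L)" by (rule bij_betwI[of _ _ _ "act (inv\<^bsub>P\<^esub> g)"]) (use g cl inv in auto)
  hence b: "bij_betw (\<Psi> g) (carrier L) (carrier L)" unfolding \<Psi>_def by (simp add: bij_betw_restrict_eq)
  have h: "\<Psi> g \<in> ring_hom L L" by (rule ring_hom_memI)
    (use ring_hom_closed[OF G.act_hom[OF g]] ring_hom_mult[OF G.act_hom[OF g]] ring_hom_add[OF G.act_hom[OF g]]
     ring_hom_one[OF G.act_hom[OF g]] in "auto simp: \<Psi>_def")
  show ?thesis unfolding gal_def LS ring_iso_def using b h fixK[OF g] K_sub by (auto simp: \<Psi>_def S)
 qed
 have inj: "inj_on \<Psi> (carrier P)"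
 proof (rule inj_onI)
  fix g h assume gh: "g \<in> carrier P" "h \<in> carrier P" "\<Psi> g = \<Psi> h"
  show "g = h" by (rule faithful[OF gh(1,2)]) (use gh(3) in "metis \<Psi>_def restrict_apply'")
 qed
 have surj: "\<tau> \<in> \<Psi> ` carrier P" if t: "\<tau> \<in> gal" for \<tau>
 proof -
  have "\<exists>g\<in>carrier P. \<forall>a\<in>carrier L. act g a = \<tau> a"
  proof (rule G.agree[OF GP.subgroup_self _ galD'[OF t]])
   show "closedin (topol P) (carrier P)" using closedin_topspace[of "topol P"] G.M_top by simp
   fix b assume "b \<in> carrier L" "\<And>h. h \<in> carrier P \<Longrightarrow> act h b = b"
   hence "b \<in> K" using fixed by blast
   thus "\<tau> b = b" using galD(7)[OF t] by simp
  qed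
  then obtain g where g: "g \<in> carrier P" "\<And>a. a \<in> carrier L \<Longrightarrow> act g a = \<tau> a" by blast
  have "\<tau> = \<Psi> g" by (rule extensionalityI[of _ "carrier L"]) (use galD(8)[OF t] g(2) in "auto simp: S \<Psi>_def")
  thus ?thesis using g(1) by blast
 qed
 have img: "\<Psi> ` carrier P = gal" using gal surj by blast
 have cont: "continuous_map (topol P) galtop \<Psi>" unfolding galtop_def
 proof (rule continuous_on_generated_topo)
  show "\<Psi> ` topspace (topol P) \<subseteq> \<Union>{{\<tau> \<in> gal. \<forall>x \<in> E. \<tau> x = \<rho> x} | \<rho> E.
    \<rho> \<in> gal \<and> subfield E (L\<lparr>carrier := sepc\<rparr>) \<and> K \<subseteq> E \<and> ring.finite_dimension (L\<lparr>carrier := sepc\<rparr>) K E}"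
   using img topspace_galtop unfolding galtop_def topology_generated_by_topspace G.M_top by blast
  fix B assume "B \<in> {{\<tau> \<in> gal. \<forall>x \<in> E. \<tau> x = \<rho> x} | \<rho> E.
    \<rho> \<in> gal \<and> subfield E (L\<lparr>carrier := sepc\<rparr>) \<and> K \<subseteq> E \<and> ring.finite_dimension (L\<lparr>carrier := sepc\<rparr>) K E}"
  then obtain \<rho> E where B: "B = {\<tau> \<in> gal. \<forall>x \<in> E. \<tau> x = \<rho> x}" and r: "\<rho> \<in> gal" and E: "subfield E L" "K \<subseteq> E"
   "finite_dimension K E" unfolding LS by blast
  obtain d where "dimension d K E" using E(3) by auto
  then obtain Us where Us: "set Us \<subseteq> carrier L" "Span K Us = E" using exists_base[OF subfieldK] by blast
  have sp: "E = {combine Ks Us | Ks. set Ks \<subseteq> K}" using Span_eq_combine_set[OF subfieldK Us(1)] Us(2) by simp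
  have UE: "set Us \<subseteq> E" using Span_base_incl[OF subfieldK Us(1)] Us(2) by simp
  have "\<Psi> -` B \<inter> topspace (topol P) = {g \<in> carrier P. \<forall>x\<in>E. act g x = \<rho> x}"
   unfolding B G.M_top using gal subfieldE(3)[OF E(1)] by (auto simp: \<Psi>_def subset_iff)
  \<comment> \<open>Homomorphisms that fix \<open>K\<close> and agree on a spanning list of
    \<open>E\<close> agree on \<open>E\<close>, which leaves finitely many open conditions.\<close>
  also have "\<dots> = {g \<in> carrier P. \<forall>u\<in>set Us. act g u = \<rho> u}"
  proof (intro equalityI subsetI)
   fix g assume g: "g \<in> {g \<in> carrier P. \<forall>u\<in>set Us. act g u = \<rho> u}"
   have "act g x = \<rho> x" if xE: "x \<in> E" for x
   proof -
    obtain Ks where Ks: "x = combine Ks Us" "set Ks \<subseteq> K" using xE sp by blast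
    show ?thesis unfolding Ks(1)
     by (rule hom_combine[OF G.act_hom galD'[OF r] fixK galD(7)[OF r] _ Us(1) Ks(2)]) (use g in auto)
   qed
   thus "g \<in> {g \<in> carrier P. \<forall>x\<in>E. act g x = \<rho> x}" using g by blast
  qed (use UE in blast)
  also have "openin (topol P) \<dots>" using Us(1)
  proof (induction Us)
   case Nil
   thus ?case using openin_topspace[of "topol P"] G.M_top by simp
  next
   case (Cons u Us)
   have eq: "{g \<in> carrier P. \<forall>u\<in>set (u # Us). act g u = \<rho> u} =
     {g \<in> carrier P. act g u = \<rho> u} \<inter> {g \<in> carrier P. \<forall>u\<in>set Us. act g u = \<rho> u}" by auto
   have o1: "openin (topol P) {g \<in> carrier P. act g u = \<rho> u}"
    using G.act_lconst[of u] Cons.prems unfolding lconst_def by simp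
   have o2: "openin (topol P) {g \<in> carrier P. \<forall>u\<in>set Us. act g u = \<rho> u}" using Cons by simp
   show ?case unfolding eq by (rule openin_Int[OF o1 o2])
  qed
  finally show "openin (topol P) (\<Psi> -` B \<inter> topspace (topol P))" .
 qed
 have homeo: "homeomorphic_map (topol P) galtop \<Psi>"
  by (rule continuous_imp_homeomorphic_map[OF cont G.M_compact Hausdorff_galtop])
   (use img inj G.M_top topspace_galtop in auto)
 have mult: "\<Psi> (g \<otimes>\<^bsub>P\<^esub> h) = compose (carrier L) (\<Psi> g) (\<Psi> h)" if "g \<in> carrier P" "h \<in> carrier P" for g h
  by (rule ext) (use that G.act_mult cl in "auto simp: \<Psi>_def compose_def")
 show "\<exists>\<Psi>. bij_betw \<Psi> (carrier P) gal \<and> homeomorphic_map (topol P) galtop \<Psi> \<and>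
   (\<forall>g\<in>carrier P. \<forall>h\<in>carrier P. \<Psi> (g \<otimes>\<^bsub>P\<^esub> h) = compose (carrier L) (\<Psi> g) (\<Psi> h))"
  by (rule exI[of _ \<Psi>]) (use inj img homeo mult in "auto simp: bij_betw_def")
qed

end

lemma coeff_prod_monic: "finite B \<Longrightarrow> pcoeff (\<Prod>x\<in>B. [:- f x, 1:] :: 'c::comm_ring_1 poly) (card B) = 1"
proof (induction B rule: finite_induct)
 case (insert x B)
 have "pcoeff (\<Prod>x\<in>B. [:- f x, 1:] :: 'c poly) (Suc (card B)) = 0"
  using degree_prod_root_le[of f B] by (intro coeff_eq_0) simp
 thus ?case using insert by simp
qed simp

locale galois_action = gact S P act + acfield S
 for S :: "'z ring" (structure) and P :: "('h, 'n) top_group_scheme" and act :: "'h \<Rightarrow> 'z \<Rightarrow> 'z" +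
 assumes prof: "profinite_group P"
  and faithful: "\<And>g h. g \<in> carrier P \<Longrightarrow> h \<in> carrier P \<Longrightarrow> (\<And>a. a \<in> carrier S \<Longrightarrow> act g a = act h a) \<Longrightarrow> g = h"
begin

definition fixf :: "'z set" where "fixf = {a \<in> carrier S. \<forall>g\<in>carrier P. act g a = a}"

lemma fixf_carrier: "x \<in> fixf \<Longrightarrow> x \<in> carrier S" by (simp add: fixf_def)

lemma subfield_fixf: "subfield fixf S"
proof (rule subfieldI')
 show "subring fixf S"
 proof (rule subringI)
  show "\<one> \<in> fixf" using ring_hom_one[OF act_hom] by (simp add: fixf_def)
  show "\<ominus> x \<in> fixf" if "x \<in> fixf" for x using that ring_hom_neg[OF act_hom] by (simp add: fixf_def)
  show "x \<otimes> y \<in> fixf" if "x \<in> fixf" "y \<in> fixf" for x y using that ring_hom_mult[OF act_hom] by (simp add: fixf_def)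
  show "x \<oplus> y \<in> fixf" if "x \<in> fixf" "y \<in> fixf" for x y using that ring_hom_add[OF act_hom] by (simp add: fixf_def)
 qed (auto simp: fixf_def)
 fix k assume k: "k \<in> fixf - {\<zero>}"
 hence u: "k \<in> Units S" "k \<in> carrier S" using fixf_carrier field_Units by auto
 have "act g (inv k) = inv k" if g: "g \<in> carrier P" for g
 proof -
  have c: "act g (inv k) \<in> carrier S" using ring_hom_closed[OF act_hom[OF g]] u by simp
  have "act g (k \<otimes> inv k) = k \<otimes> act g (inv k)"
   using ring_hom_mult[OF act_hom[OF g], of k "inv k"] u k g by (simp add: fixf_def)
  hence "k \<otimes> act g (inv k) = \<one>" using u ring_hom_one[OF act_hom[OF g]] by simp
  thus ?thesis using comm_inv_char[OF u(2) c] by simp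
 qed
 thus "inv k \<in> fixf" using u by (simp add: fixf_def)
qed

definition F :: "'z ring" where "F = S\<lparr>carrier := fixf\<rparr>"

lemma field_F: "field F" unfolding F_def by (rule subfield_iff(2)[OF subfield_fixf])

lemma F_simps: "carrier F = fixf" "x \<oplus>\<^bsub>F\<^esub> y = x \<oplus> y" "x \<otimes>\<^bsub>F\<^esub> y = x \<otimes> y" "\<one>\<^bsub>F\<^esub> = \<one>" "\<zero>\<^bsub>F\<^esub> = \<zero>" by (simp_all add: F_def)

lemma ring_characteristic_F:
 assumes "char_of S q"
 shows "ring_characteristic F = q"
proof -
 have "(\<lambda>x. x) \<in> ring_hom F S" by (rule ring_hom_memI) (auto simp: F_simps fixf_carrier)
 hence "char_of S (ring_characteristic F)"
  by (rule char_of_hom[OF field_F field_axioms _ ring_characteristic_char_of[OF field_F]])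
 hence "ring_characteristic F dvd m \<longleftrightarrow> q dvd m" for m using assms by (simp add: char_of_def)
 thus ?thesis by (meson dvd_antisym dvd_refl)
qed

abbreviation "L \<equiv> field.alg_closure F"
abbreviation \<iota> :: "'z \<Rightarrow> ('z list \<times> nat) multiset \<Rightarrow> 'z" where "\<iota> \<equiv> ring.indexed_const F"

lemma aclL: "algebraic_closure L (base_field F)" using field.alg_closureE(1)[OF field_F] by (simp add: base_field_def)

lemma base_eq: "base_field F = \<iota> ` fixf" by (simp add: base_field_def F_simps)

lemma hom_\<iota>: "\<iota> \<in> ring_hom F L" by (rule field.alg_closureE(2)[OF field_F])

lemma field_L: "field L" using aclL by (simp add: algebraic_closure_def)

lemma \<iota>:
 assumes "x \<in> fixf" "y \<in> fixf"
 shows "\<iota> x \<in> carrier L" "\<iota> (x \<oplus> y) = \<iota> x \<oplus>\<^bsub>L\<^esub> \<iota> y" "\<iota> (x \<otimes> y) = \<iota> x \<otimes>\<^bsub>L\<^esub> \<iota> y"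
  "\<iota> (x \<ominus> y) = \<iota> x \<ominus>\<^bsub>L\<^esub> \<iota> y" "\<iota> \<one> = \<one>\<^bsub>L\<^esub>" "\<iota> \<zero> = \<zero>\<^bsub>L\<^esub>" "\<iota> x = \<zero>\<^bsub>L\<^esub> \<longleftrightarrow> x = \<zero>"
proof -
 interpret L: field L by (rule field_L)
 interpret FF: field F by (rule field_F)
 have c: "\<iota> x \<in> carrier L" if "x \<in> fixf" for x using ring_hom_closed[OF hom_\<iota>] that by (simp add: F_simps)
 thus "\<iota> x \<in> carrier L" using assms by simp
 have add: "\<iota> (x \<oplus> y) = \<iota> x \<oplus>\<^bsub>L\<^esub> \<iota> y" if "x \<in> fixf" "y \<in> fixf" for x y
  using ring_hom_add[OF hom_\<iota>] that by (simp add: F_simps)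
 thus "\<iota> (x \<oplus> y) = \<iota> x \<oplus>\<^bsub>L\<^esub> \<iota> y" using assms by simp
 show "\<iota> (x \<otimes> y) = \<iota> x \<otimes>\<^bsub>L\<^esub> \<iota> y" using ring_hom_mult[OF hom_\<iota>] assms by (simp add: F_simps)
 show "\<iota> \<one> = \<one>\<^bsub>L\<^esub>" using ring_hom_one[OF hom_\<iota>] by (simp add: F_simps)
 show z: "\<iota> \<zero> = \<zero>\<^bsub>L\<^esub>" using ring_hom_zero[OF hom_\<iota> FF.ring_axioms L.ring_axioms] by (simp add: F_simps)
 have m: "x \<ominus> y \<in> fixf" using assms subringE(5,7)[OF subfieldE(1)[OF subfield_fixf]] by (simp add: a_minus_def)
 have "x \<ominus> y \<oplus> y = x" using assms fixf_carrier by (simp add: a_minus_def a_assoc l_neg)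
 hence "\<iota> x = \<iota> (x \<ominus> y) \<oplus>\<^bsub>L\<^esub> \<iota> y" using add[OF m assms(2)] by simp
 thus "\<iota> (x \<ominus> y) = \<iota> x \<ominus>\<^bsub>L\<^esub> \<iota> y" using c[OF m] c[OF assms(2)] by (simp add: a_minus_def L.a_assoc L.r_neg)
 have "inj_on \<iota> fixf" using non_trivial_field_hom_is_inj[OF hom_\<iota> field_F field_L] by (simp add: F_simps)
 thus "\<iota> x = \<zero>\<^bsub>L\<^esub> \<longleftrightarrow> x = \<zero>" using z assms(1) subringE(2)[OF subfieldE(1)[OF subfield_fixf]] by (metis inj_on_eq_iff)
qed

lemma acfield_L: "acfield L"
proof -
 interpret A: aclos L "base_field F" using aclL by (simp add: aclos_def)
 show ?thesis by (rule A.acfield_axioms)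
qed

text \<open>The closure \<open>L\<close> on which the absolute Galois group of \<open>F\<close> is
  defined is not \<open>S\<close>. The two are identified by extending this correspondence, the
  identity of the fixed field.\<close>

definition \<tau>b :: "(((('z list \<times> nat) multiset \<Rightarrow> 'z), int) mpol \<times> ('z, int) mpol) set" where
 "\<tau>b = {(a, b). mev b \<in> fixf \<and> cring.mev L a = \<iota> (mev b)}"

lemma corr_\<tau>b: "corr {z. cring.mev L z = \<zero>\<^bsub>L\<^esub>} {z. mev z = \<zero>} \<tau>b" unfolding corr_def
proof (intro conjI allI impI)
 interpret L: acfield L by (rule acfield_L)
 note sub = subfieldE(1)[OF subfield_fixf]
 have o: "\<one> \<in> fixf" by (rule subringE(3)[OF sub])
 show "(1, 1) \<in> \<tau>b" using o \<iota>(5)[OF o o] by (simp add: \<tau>b_def mev_one L.mev_one)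
 fix a b c d assume "(a, b) \<in> \<tau>b" "(c, d) \<in> \<tau>b"
 hence ab: "mev b \<in> fixf" "L.mev a = \<iota> (mev b)" "mev d \<in> fixf" "L.mev c = \<iota> (mev d)" by (auto simp: \<tau>b_def)
 have m: "mev b \<ominus> mev d \<in> fixf" using ab subringE(5,7)[OF sub] by (simp add: a_minus_def)
 show "(a - c, b - d) \<in> \<tau>b" using ab m \<iota>(4)[OF ab(1,3)] by (simp add: \<tau>b_def mevD(7) L.mevD(7))
 show "(a * c, b * d) \<in> \<tau>b" using ab subringE(6)[OF sub ab(1,3)] \<iota>(3)[OF ab(1,3)] by (simp add: \<tau>b_def mev_mult L.mev_mult)
next
 interpret L: acfield L by (rule acfield_L)
 fix a b assume "(a, b) \<in> \<tau>b"
 thus "(a \<in> {z. L.mev z = \<zero>\<^bsub>L\<^esub>}) = (b \<in> {z. mev z = \<zero>})" using \<iota>(7) by (auto simp: \<tau>b_def)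
qed

text \<open>The extension reaches all of \<open>L\<close>, which is algebraic over the base field,
  and all of \<open>S\<close>, where each element is a root of the polynomial formed with its finite
  orbit, whose coefficients are fixed by \<open>P\<close>.\<close>

lemma corr_total_ex:
 "\<exists>\<tau>. \<tau>b \<subseteq> \<tau> \<and> corr {z. cring.mev L z = \<zero>\<^bsub>L\<^esub>} {z. mev z = \<zero>} \<tau> \<and>
   (\<forall>x\<in>carrier L. \<exists>b. (mvar x, b) \<in> \<tau>) \<and> (\<forall>s\<in>carrier S. \<exists>a. (a, mvar s) \<in> \<tau>)"
proof -
 interpret L: acfield L by (rule acfield_L)
 let ?N = "{z. L.mev z = \<zero>\<^bsub>L\<^esub>}" and ?M = "{z. mev z = \<zero>}"
 note sub = subfieldE(1)[OF subfield_fixf]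
 obtain \<tau> where t: "\<tau>b \<subseteq> \<tau>" "corr ?N ?M \<tau>"
  "\<forall>f g i a. prp \<tau> f g \<longrightarrow> pcoeff f i \<notin> ?N \<longrightarrow> poly f a \<in> ?N \<longrightarrow> (\<exists>b. (a, b) \<in> \<tau>)"
  "\<forall>f g i b. prp \<tau> f g \<longrightarrow> pcoeff g i \<notin> ?M \<longrightarrow> poly g b \<in> ?M \<longrightarrow> (\<exists>a. (a, b) \<in> \<tau>)"
  using corr_extension[OF L.pideal_ker pideal_ker L.acl_ker acl_ker corr_\<tau>b] by blast
 have mono: "prp \<tau> f g" if "prp \<tau>b f g" for f g using that t(1) by (auto simp: prp_def)
 have "\<exists>b. (mvar x, b) \<in> \<tau>" if x: "x \<in> carrier L" for x
 proof -
  interpret A: aclos L "base_field F" using aclL by (simp add: aclos_def)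
  let ?I = "L.Irr (base_field F) x"
  note IE = L.IrrE[OF A.subfieldK x A.alg[OF A.subfieldK subset_refl x]]
  have sI: "set ?I \<subseteq> base_field F" using IE(1) univ_poly_carrier L.polynomial_incl by blast
  have sL: "set ?I \<subseteq> carrier L" using sI A.K_sub by blast
  have ne: "?I \<noteq> []" using L.pirreducible_degree[OF A.subfieldK IE(1,2)] by auto
  have z: "\<zero> \<in> fixf" by (rule subringE(2)[OF sub])
  have cK: "\<exists>y\<in>fixf. L.coeff ?I j = \<iota> y" for j
   using L.coeff_mem[OF sI subringE(2)[OF subfieldE(1)[OF A.subfieldK]]] base_eq by blast
  define c where "c j = (SOME y. y \<in> fixf \<and> L.coeff ?I j = \<iota> y)" for j
  have c: "c j \<in> fixf \<and> L.coeff ?I j = \<iota> (c j)" for j unfolding c_def by (rule someI_ex) (use cK[of j] in blast)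
  let ?g = "\<Sum>j\<le>length ?I. pmonom (mvar (c j)) j :: ('z, int) mpol poly"
  have cg: "pcoeff ?g j = (if j \<le> length ?I then mvar (c j) else 0)" for j by (auto simp: coeff_sum)
  have "prp \<tau>b (L.tp ?I) ?g" unfolding prp_def \<tau>b_def
  proof (intro allI, clarify, intro conjI)
   fix j
   have cj: "c j \<in> carrier S" using c fixf_carrier by blast
   show "mev (pcoeff ?g j) \<in> fixf" using c cj z by (simp add: cg mev_zero)
   show "L.mev (pcoeff (L.tp ?I) j) = \<iota> (mev (pcoeff ?g j))"
    unfolding L.tp_coeff[OF sL] cg using c cj \<iota>(6)[OF z z] L.coeff_length[of ?I j] by (auto simp: mev_zero)
  qed
  moreover have "L.mev (pcoeff (L.tp ?I) (length ?I - 1)) \<noteq> \<zero>\<^bsub>L\<^esub>"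
   unfolding L.tp_coeff[OF sL] using L.lead_coeff_simp[OF ne] IE(3) by simp
  moreover have "L.mev (poly (L.tp ?I) (mvar x)) = \<zero>\<^bsub>L\<^esub>" using L.tp_eval[OF sL, of "mvar x"] IE(4) x by simp
  ultimately show ?thesis using t(3) mono by blast
 qed
 moreover have "\<exists>a. (a, mvar s) \<in> \<tau>" if s: "s \<in> carrier S" for s
 proof -
  let ?O = "(\<lambda>g. act g s) ` carrier P"
  have fin: "finite ?O" by (rule lconst_finite_range[OF M_compact M_top act_lconst[OF s]])
  have cl: "x \<in> carrier S" if "x \<in> ?O" for x using that ring_hom_closed[OF act_hom s] by auto
  let ?p = "\<Prod>x\<in>?O. [:- mvar x, 1:] :: ('z, int) mpol poly"
  interpret P: group P by (rule M)
  have Oact: "act g x \<in> ?O" if "g \<in> carrier P" "x \<in> ?O" for g x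
  proof -
   obtain h where h: "h \<in> carrier P" "x = act h s" using \<open>x \<in> ?O\<close> by blast
   hence "act g x = act (g \<otimes>\<^bsub>P\<^esub> h) s" using act_mult[OF that(1) h(1) s] by simp
   thus ?thesis using P.m_closed[OF that(1) h(1)] by blast
  qed
  have inv: "act (inv\<^bsub>P\<^esub> g) (act g x) = x" "act g (act (inv\<^bsub>P\<^esub> g) x) = x" if "g \<in> carrier P" "x \<in> carrier S" for g x
   using act_mult[of "inv\<^bsub>P\<^esub> g" g x] act_mult[of g "inv\<^bsub>P\<^esub> g" x] that act_one by simp_all
  have pp: "prp (hrel (act g)) ?p ?p" if g: "g \<in> carrier P" for g
  proof -
   note ch = corr_hrel[OF act_hom[OF g]]
   have bij: "bij_betw (act g) ?O ?O" by (rule bij_betwI[of _ _ _ "act (inv\<^bsub>P\<^esub> g)"]) (use g Oact inv cl in auto)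
   have "prp (hrel (act g)) ?p (\<Prod>x\<in>?O. [:- mvar (act g x), 1:])" by (rule prp_prod[OF pideal_ker pideal_ker ch fin])
     (rule prp_root[OF ch hrel_mvar[OF cl]], use cl[OF Oact[OF g]] in auto)
   thus ?thesis using prod.reindex_bij_betw[OF bij, of "\<lambda>x. [:- mvar x, 1:] :: ('z, int) mpol poly"] by simp
  qed
  have cf: "mev (pcoeff ?p j) \<in> fixf" for j unfolding fixf_def using pp by (auto simp: prp_def hrel_def)
  let ?f = "\<Sum>j\<le>pdegree ?p. pmonom (mvar (\<iota> (mev (pcoeff ?p j)))) j :: (('z list \<times> nat) multiset \<Rightarrow> 'z, int) mpol poly"
  have c: "pcoeff ?f j = (if j \<le> pdegree ?p then mvar (\<iota> (mev (pcoeff ?p j))) else 0)" for j by (auto simp: coeff_sum)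
  have z: "\<zero> \<in> fixf" by (rule subringE(2)[OF sub])
  have "prp \<tau>b ?f ?p" unfolding prp_def \<tau>b_def
  proof (intro allI, clarify, intro conjI)
   fix j
   show "mev (pcoeff ?p j) \<in> fixf" by (rule cf)
   show "L.mev (pcoeff ?f j) = \<iota> (mev (pcoeff ?p j))"
   proof (cases "j \<le> pdegree ?p")
    case True
    thus ?thesis unfolding c using \<iota>(1)[OF cf cf] by simp
   next
    case False
    thus ?thesis unfolding c using coeff_eq_0[of ?p j] \<iota>(6)[OF z z] by (simp add: mev_zero L.mev_zero)
   qed
  qed
  moreover have "mev (pcoeff ?p (card ?O)) \<noteq> \<zero>"
   using coeff_prod_monic[OF fin, of "mvar :: 'z \<Rightarrow> ('z, int) mpol"] by (simp add: mev_one)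
  moreover have "poly ?p (mvar s) = 0"
  proof -
   have "s \<in> ?O" using act_one[OF s] P.one_closed by (metis image_eqI)
   thus ?thesis unfolding poly_prod by (intro prod_zero[OF fin] bexI[of _ s]) simp
  qed
  ultimately show ?thesis using t(4) mono by (metis (mono_tags, lifting) mem_Collect_eq mev_zero)
 qed
 ultimately show ?thesis using t(1,2) by blast
qed

lemma iso_ex: "\<exists>\<theta> \<in> ring_iso L S. \<forall>x\<in>fixf. \<theta> (\<iota> x) = x"
proof -
 interpret L: acfield L by (rule acfield_L)
 let ?N = "{z. L.mev z = \<zero>\<^bsub>L\<^esub>}" and ?M = "{z. mev z = \<zero>}"
 obtain \<tau> where t: "\<tau>b \<subseteq> \<tau>" "corr ?N ?M \<tau>" "\<And>x. x \<in> carrier L \<Longrightarrow> \<exists>b. (mvar x, b) \<in> \<tau>"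
  "\<And>s. s \<in> carrier S \<Longrightarrow> \<exists>a. (a, mvar s) \<in> \<tau>" using corr_total_ex by blast
 define \<theta> where "\<theta> x = mev (SOME b. (mvar x, b) \<in> \<tau>)" for x
 \<comment> \<open>The value of \<theta> is insensitive to the choice of a partner and of a
   polynomial representing the argument.\<close>
 have key: "\<theta> (L.mev a) = mev b" if ab: "(a, b) \<in> \<tau>" for a b
 proof -
  let ?b = "SOME b. (mvar (L.mev a), b) \<in> \<tau>"
  have "(mvar (L.mev a), ?b) \<in> \<tau>" using t(3)[of "L.mev a"] by (auto intro: someI_ex)
  hence d: "(mvar (L.mev a) - a, ?b - b) \<in> \<tau>" using corrD(3)[OF t(2)] ab by blast
  have "mvar (L.mev a) - a \<in> ?N" by (simp add: L.mevD(7) a_minus_def L.r_neg)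
  hence "mev (?b - b) = \<zero>" using corrD(8)[OF t(2) d] by simp
  thus ?thesis unfolding \<theta>_def using mevD(10) by blast
 qed
 have pick: "\<exists>b. (mvar x, b) \<in> \<tau> \<and> mev b = \<theta> x" if x: "x \<in> carrier L" for x
 proof -
  obtain b where "(mvar x, b) \<in> \<tau>" using t(3)[OF x] by blast
  thus ?thesis using key[of "mvar x" b] x by auto
 qed
 have hom: "\<theta> \<in> ring_hom L S"
 proof (rule ring_hom_memI)
  fix x assume x: "x \<in> carrier L"
  obtain b where b: "(mvar x, b) \<in> \<tau>" "mev b = \<theta> x" using pick[OF x] by blast
  show "\<theta> x \<in> carrier S" using b(2) mevD(1)[of b] by simp
  fix y assume y: "y \<in> carrier L"
  obtain c where c: "(mvar y, c) \<in> \<tau>" "mev c = \<theta> y" using pick[OF y] by blast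
  show "\<theta> (x \<otimes>\<^bsub>L\<^esub> y) = \<theta> x \<otimes> \<theta> y" using key[OF corrD(5)[OF t(2) b(1) c(1)]] x y b(2) c(2) by (simp add: L.mev_mult mev_mult)
  show "\<theta> (x \<oplus>\<^bsub>L\<^esub> y) = \<theta> x \<oplus> \<theta> y" using key[OF corrD(4)[OF t(2) b(1) c(1)]] x y b(2) c(2) by (simp add: L.mev_add mev_add)
 next
  show "\<theta> \<one>\<^bsub>L\<^esub> = \<one>" using key[OF corrD(1)[OF t(2)]] by (simp add: L.mev_one mev_one)
 qed
 have surj: "s \<in> \<theta> ` carrier L" if s: "s \<in> carrier S" for s
 proof -
  obtain a where "(a, mvar s) \<in> \<tau>" using t(4)[OF s] by blast
  hence "\<theta> (L.mev a) = s" using key s by fastforce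
  thus ?thesis using L.mev_closed by blast
 qed
 have "bij_betw \<theta> (carrier L) (carrier S)" unfolding bij_betw_def
  using non_trivial_field_hom_is_inj[OF hom field_L field_axioms] surj ring_hom_closed[OF hom] by blast
 hence "\<theta> \<in> ring_iso L S" using hom by (simp add: ring_iso_def)
 moreover have "\<theta> (\<iota> x) = x" if x: "x \<in> fixf" for x
 proof -
  have "(mvar (\<iota> x), mvar x) \<in> \<tau>b" using x fixf_carrier \<iota>(1)[OF x x] by (simp add: \<tau>b_def)
  thus ?thesis using key t(1) x fixf_carrier \<iota>(1)[OF x x] by fastforce
 qed
 ultimately show ?thesis by blast
qed

text \<open>The action is moved to \<open>L\<close> along the isomorphism with \<open>S\<close>; its
  fixed field there is the copy of \<open>F\<close>, and \<open>galois_group_of_action\<close>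
  applies.\<close>

theorem absolute_galois_F:
 assumes q: "char_of S q"
 shows "top_group_isomorphic P (absolute_galois_group F)"
proof -
 interpret L: acfield L by (rule acfield_L)
 obtain \<theta> where \<theta>: "\<theta> \<in> ring_iso L S" "\<And>x. x \<in> fixf \<Longrightarrow> \<theta> (\<iota> x) = x" using iso_ex by blast
 define \<theta>' where "\<theta>' = inv_into (carrier L) \<theta>"
 have \<theta>': "\<theta>' \<in> ring_iso S L" unfolding \<theta>'_def by (rule ring_iso_set_sym[OF L.ring_axioms \<theta>(1)])
 have h: "\<theta> \<in> ring_hom L S" "\<theta>' \<in> ring_hom S L" and b: "bij_betw \<theta> (carrier L) (carrier S)"
  using \<theta>(1) \<theta>' by (auto simp: ring_iso_def)
 have i1: "\<theta>' (\<theta> x) = x" if "x \<in> carrier L" for x unfolding \<theta>'_def using b that by (simp add: bij_betw_def)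
 have i2: "\<theta> (\<theta>' s) = s" if "s \<in> carrier S" for s unfolding \<theta>'_def using b that by (simp add: bij_betw_def f_inv_into_f)
 have c1: "\<theta> x \<in> carrier S" if "x \<in> carrier L" for x using ring_hom_closed[OF h(1) that] .
 define act' where "act' g x = \<theta>' (act g (\<theta> x))" for g x
 have ac: "act g a \<in> carrier S" if "g \<in> carrier P" "a \<in> carrier S" for g a
  using ring_hom_closed[OF act_hom[OF that(1)] that(2)] .
 have gL: "gact L P act'"
 proof (rule gact.intro[OF field_L], rule gact_axioms.intro)
  show "act' g \<in> ring_hom L L" if "g \<in> carrier P" for g
  proof -
   have "act' g = \<theta>' \<circ> (act g \<circ> \<theta>)" by (rule ext) (simp add: act'_def)
   thus ?thesis using ring_hom_trans[OF ring_hom_trans[OF h(1) act_hom[OF that]] h(2)] by simp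
  qed
  show "act' \<one>\<^bsub>P\<^esub> a = a" if "a \<in> carrier L" for a using that act_one c1 i1 by (simp add: act'_def)
  show "act' (g \<otimes>\<^bsub>P\<^esub> k) a = act' g (act' k a)" if "g \<in> carrier P" "k \<in> carrier P" "a \<in> carrier L" for g k a
   using that act_mult c1 i2 ac by (simp add: act'_def)
  show "lconst P (\<lambda>g. act' g a)" if "a \<in> carrier L" for a
   unfolding act'_def by (rule lconst_comp[OF act_lconst[OF c1[OF that]]])
 qed (rule M M_top M_compact)+
 have eq': "act' g x = act' k x \<longleftrightarrow> act g (\<theta> x) = act k (\<theta> x)" if "g \<in> carrier P" "k \<in> carrier P" "x \<in> carrier L" for g k x
  unfolding act'_def using i2[OF ac[OF that(1) c1[OF that(3)]]] i2[OF ac[OF that(2) c1[OF that(3)]]] by metis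
 have fx: "(\<forall>g\<in>carrier P. act' g x = x) \<longleftrightarrow> x \<in> base_field F" if x: "x \<in> carrier L" for x
 proof -
  have e: "act' g x = x \<longleftrightarrow> act g (\<theta> x) = \<theta> x" if "g \<in> carrier P" for g
   unfolding act'_def using i1[OF x] i2[OF ac[OF that c1[OF x]]] by metis
  have "(\<forall>g\<in>carrier P. act' g x = x) \<longleftrightarrow> \<theta> x \<in> fixf" using e c1[OF x] by (auto simp: fixf_def)
  also have "\<dots> \<longleftrightarrow> x \<in> base_field F"
  proof
   assume f: "\<theta> x \<in> fixf"
   have "x = \<theta>' (\<theta> (\<iota> (\<theta> x)))" using \<theta>(2)[OF f] i1[OF x] by simp
   hence "x = \<iota> (\<theta> x)" using i1[OF \<iota>(1)[OF f f]] by simp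
   thus "x \<in> base_field F" using f base_eq by blast
  next
   assume "x \<in> base_field F"
   thus "\<theta> x \<in> fixf" using base_eq \<theta>(2) by auto
  qed
  finally show ?thesis .
 qed
 have fa: "g = k" if gk: "g \<in> carrier P" "k \<in> carrier P" "\<And>a. a \<in> carrier L \<Longrightarrow> act' g a = act' k a" for g k
 proof (rule faithful[OF gk(1,2)])
  fix s assume s: "s \<in> carrier S"
  have "\<theta>' s \<in> carrier L" using ring_hom_closed[OF h(2) s] .
  thus "act g s = act k s" using eq'[OF gk(1,2)] gk(3) i2[OF s] by metis
 qed
 have "char_of L q" by (rule char_of_hom[OF field_axioms field_L h(2) q])
 then interpret C: char_exp L "base_field F" "if q = 0 then 1 else q" by (rule char_expI[OF aclL])
 note G = C.galois_group_of_action[OF prof gL fx fa]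
 have Sc: "carrier (sep_closure F) = C.sepc" unfolding C.sepc_def by (simp add: sep_closure_def)
 have SL: "sep_closure F = L\<lparr>carrier := C.sepc\<rparr>" unfolding C.sepc_def by (simp add: sep_closure_def)
 have Gc: "absolute_galois_carrier F = C.gal" unfolding absolute_galois_carrier_def C.gal_def Sc SL by simp
 have T: "krull_topology F = C.galtop" unfolding krull_topology_def C.galtop_def Gc SL by simp
 obtain \<Psi> where \<Psi>: "bij_betw \<Psi> (carrier P) C.gal" "homeomorphic_map (topol P) C.galtop \<Psi>"
  "\<And>g h. g \<in> carrier P \<Longrightarrow> h \<in> carrier P \<Longrightarrow> \<Psi> (g \<otimes>\<^bsub>P\<^esub> h) = compose (carrier L) (\<Psi> g) (\<Psi> h)" using G(2) by blast
 have "\<Psi> \<in> iso P (absolute_galois_group F)" using \<Psi>(1,3) bij_betw_imp_funcset[OF \<Psi>(1)]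
  by (auto simp: iso_def hom_def absolute_galois_group_def Gc Sc G(1))
 thus ?thesis unfolding top_group_isomorphic_def using \<Psi>(2) by (intro bexI[of _ \<Psi>]) (auto simp: absolute_galois_group_def T)
qed

end

section \<open>From the given fields to a field realizing the free product\<close>

lemma galois_act_ex:
 fixes K :: "('k, 'm) ring_scheme" and M :: "('h, 'n) top_group_scheme" and G :: "('g, 'l) top_group_scheme"
 assumes K: "field K" and G: "profinite_group G" and iso: "top_group_isomorphic G (absolute_galois_group K)" "top_group_isomorphic G M"
  and M: "group M" "topspace (topol M) = carrier M" "compact_space (topol M)"
 defines "L \<equiv> field.alg_closure K"
 shows "\<exists>act. gact L M act \<and> (\<forall>g\<in>carrier M. act g \<in> acfield.autos L) \<and>
  (\<forall>g\<in>carrier M. \<forall>h\<in>carrier M. (\<forall>a\<in>carrier L. act g a = act h a) \<longrightarrow> g = h)"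
proof -
 interpret L: acfield L unfolding L_def by (rule galois_extension(1)[OF K])
 let ?A = "absolute_galois_group K"
 have Gt: "group G" "topspace (topol G) = carrier G" using G by (simp_all add: profinite_group_def topological_group_def)
 obtain h where h: "h \<in> iso G ?A" "homeomorphic_map (topol G) (topol ?A) h" using iso(1) by (auto simp: top_group_isomorphic_def)
 obtain f where f: "f \<in> iso G M" "homeomorphic_map (topol G) (topol M) f" using iso(2) by (auto simp: top_group_isomorphic_def)
 obtain f' where f': "homeomorphic_maps (topol G) (topol M) f f'" using f(2) homeomorphic_map_maps by blast
 have fb: "bij_betw f (carrier G) (carrier M)" "bij_betw h (carrier G) (carrier ?A)" using f(1) h(1) by (auto simp: iso_def)
 have ff: "f' (f x) = x" if "x \<in> carrier G" for x using f' that Gt by (simp add: homeomorphic_maps_def)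
 have Mim: "\<exists>x\<in>carrier G. u = f x" if "u \<in> carrier M" for u using fb(1) that by (auto simp: bij_betw_def)
 \<comment> \<open>The isomorphism from the closed subgroup \<open>M\<close> to the Galois group,
   composed through \<open>G\<close>.\<close>
 define \<phi> where "\<phi> u = h (f' u)" for u
 have \<phi>f: "\<phi> (f x) = h x" if "x \<in> carrier G" for x using ff[OF that] by (simp add: \<phi>_def)
 have hom: "\<phi> (u \<otimes>\<^bsub>M\<^esub> v) = \<phi> u \<otimes>\<^bsub>?A\<^esub> \<phi> v" if uv: "u \<in> carrier M" "v \<in> carrier M" for u v
 proof -
  obtain x z where x: "x \<in> carrier G" "u = f x" "z \<in> carrier G" "v = f z" using Mim uv by meson
  have c: "x \<otimes>\<^bsub>G\<^esub> z \<in> carrier G" using x Gt(1) by (simp add: group.is_monoid monoid.m_closed)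
  have "u \<otimes>\<^bsub>M\<^esub> v = f (x \<otimes>\<^bsub>G\<^esub> z)" using f(1) x by (simp add: iso_def hom_def)
  thus ?thesis using h(1) x \<phi>f c by (simp add: iso_def hom_def)
 qed
 have cl: "\<phi> u \<in> carrier ?A" if "u \<in> carrier M" for u using Mim[OF that] \<phi>f fb(2) by (auto simp: bij_betw_def)
 have inj: "u = v" if uv: "u \<in> carrier M" "v \<in> carrier M" "\<phi> u = \<phi> v" for u v
 proof -
  obtain x z where x: "x \<in> carrier G" "u = f x" "z \<in> carrier G" "v = f z" using Mim uv(1,2) by meson
  hence "h x = h z" using uv(3) \<phi>f by simp
  thus ?thesis using fb(2) x by (auto simp: bij_betw_def dest: inj_onD)
 qed
 have "continuous_map (topol M) (topol G) f'" using f' by (simp add: homeomorphic_maps_def)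
 hence cont: "continuous_map (topol M) (topol ?A) \<phi>"
  using continuous_map_compose[OF _ homeomorphic_imp_continuous_map[OF h(2)]] unfolding \<phi>_def o_def by blast
 obtain ext where ext: "\<And>\<tau>. \<tau> \<in> carrier ?A \<Longrightarrow> ext \<tau> \<in> L.autos"
  "\<And>\<tau> \<rho> x. \<tau> \<in> carrier ?A \<Longrightarrow> \<rho> \<in> carrier ?A \<Longrightarrow> \<tau> \<otimes>\<^bsub>?A\<^esub> \<rho> \<in> carrier ?A \<Longrightarrow> ext (\<tau> \<otimes>\<^bsub>?A\<^esub> \<rho>) x = ext \<tau> (ext \<rho> x)"
  "inj_on ext (carrier ?A)" "\<And>x y. x \<in> carrier L \<Longrightarrow> openin (topol ?A) {\<tau> \<in> carrier ?A. ext \<tau> x = y}"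
  using galois_extension(3)[OF K] unfolding L_def by blast
 define act where "act u = ext (\<phi> u)" for u
 have au: "act u \<in> L.autos" if "u \<in> carrier M" for u unfolding act_def by (rule ext(1)[OF cl[OF that]])
 hence rh: "act u \<in> ring_hom L L" if "u \<in> carrier M" for u using that by (simp add: L.autos_def)
 interpret M: group M by (rule M(1))
 have mult: "act (u \<otimes>\<^bsub>M\<^esub> v) x = act u (act v x)" if uv: "u \<in> carrier M" "v \<in> carrier M" for u v x
  unfolding act_def hom[OF uv] by (rule ext(2)[OF cl[OF uv(1)] cl[OF uv(2)]]) (use hom[OF uv] cl[OF M.m_closed[OF uv]] in simp)
 have "gact L M act"
 proof (rule gact.intro[OF L.field_axioms], rule gact_axioms.intro)
  fix a assume a: "a \<in> carrier L"
  \<comment> \<open>The unit acts as an idempotent, and field homomorphisms are injective, so it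
    acts as the identity.\<close>
  have c: "act \<one>\<^bsub>M\<^esub> a \<in> carrier L" by (rule ring_hom_closed[OF rh[OF M.one_closed] a])
  have "act \<one>\<^bsub>M\<^esub> (act \<one>\<^bsub>M\<^esub> a) = act \<one>\<^bsub>M\<^esub> a" using mult[OF M.one_closed M.one_closed] by simp
  thus "act \<one>\<^bsub>M\<^esub> a = a" using inj_onD[OF L.hom_inj_on[OF rh[OF M.one_closed]]] c a by blast
  show "lconst M (\<lambda>g. act g a)" unfolding lconst_def act_def
  proof
   fix b
   have "{g \<in> carrier M. ext (\<phi> g) a = b} = {g \<in> topspace (topol M). \<phi> g \<in> {\<tau> \<in> carrier ?A. ext \<tau> a = b}}"
    using cl M(2) by auto
   thus "openin (topol M) {g \<in> carrier M. ext (\<phi> g) a = b}"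
    using openin_continuous_map_preimage[OF cont ext(4)[OF a]] by simp
  qed
 qed (use M rh mult in auto)
 moreover have "g = k" if gk: "g \<in> carrier M" "k \<in> carrier M" "\<forall>a\<in>carrier L. act g a = act k a" for g k
 proof -
  have "act g a = act k a" for a using au[OF gk(1)] au[OF gk(2)] gk(3) by (cases "a \<in> carrier L") (auto simp: L.autos_def)
  hence "ext (\<phi> g) = ext (\<phi> k)" unfolding act_def by (rule HOL.ext)
  hence "\<phi> g = \<phi> k" using inj_onD[OF ext(3)] cl gk(1,2) by blast
  thus ?thesis using inj gk(1,2) by blast
 qed
 ultimately show ?thesis using au by (intro exI[of _ act]) blast
qed

text \<open>Covers both assertions: \<open>q = 0\<close> is admissible for arbitrary fields, and a
  common characteristic may be kept.\<close>

lemma free_product_realization: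
 fixes P :: "'h top_group" and G :: "nat \<Rightarrow> 'g top_group" and K :: "nat \<Rightarrow> 'k ring"
 assumes n: "n \<ge> 1" and G: "\<And>i. i \<in> {1..n} \<Longrightarrow> profinite_group (G i)"
  and free: "is_free_profinite_product TYPE('u::infinite) P n G"
  and K: "\<And>i. i \<in> {1..n} \<Longrightarrow> field (K i)" "\<And>i. i \<in> {1..n} \<Longrightarrow> top_group_isomorphic (G i) (absolute_galois_group (K i))"
  and q: "\<And>i. i \<in> {1..n} \<Longrightarrow> q = ring_characteristic (K i) \<or> q = 0"
 shows "\<exists>F :: ('k, 'h) field_universe ring. field F \<and> ring_characteristic F = q \<and>
  top_group_isomorphic P (absolute_galois_group F)"
proof -
 obtain A where A: "internal_free_product TYPE('u) P n A"
  "\<And>i. i \<in> {1..n} \<Longrightarrow> top_group_isomorphic (G i) (top_subgroup P (A i))"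
  using free unfolding is_free_profinite_product_def by blast
 interpret I: ifp "TYPE('u)" P n A by unfold_locales (rule A(1))
 interpret PP: profin P using I.profinite by (simp add: profin_def)
 interpret GP: group P by (rule I.group)
 let ?M = "\<lambda>i. top_subgroup P (A i)"
 define R where "R i = field.alg_closure (K i)" for i
 have tops: "carrier (?M i) = A i" "\<one>\<^bsub>?M i\<^esub> = \<one>\<^bsub>P\<^esub>" "x \<otimes>\<^bsub>?M i\<^esub> y = x \<otimes>\<^bsub>P\<^esub> y"
  "topol (?M i) = subtopology (topol P) (A i)" for i x y by (simp_all add: top_subgroup_def)
 have M: "group (?M i)" "topspace (topol (?M i)) = carrier (?M i)" "compact_space (topol (?M i))"
  if i: "i \<in> {1..n}" for i
 proof -
  note s = I.A(1)[OF i]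
  show "group (?M i)"
  proof (rule groupI)
   fix x assume x: "x \<in> carrier (?M i)"
   thus "\<exists>y\<in>carrier (?M i). y \<otimes>\<^bsub>?M i\<^esub> x = \<one>\<^bsub>?M i\<^esub>"
    using subgroup.m_inv_closed[OF s] I.A_sub[OF i] by (intro bexI[of _ "inv\<^bsub>P\<^esub> x"]) (simp_all add: tops)
  qed (use subgroup.m_closed[OF s] subgroup.one_closed[OF s] I.A_sub[OF i] in "auto simp: tops GP.m_assoc")
  show "topspace (topol (?M i)) = carrier (?M i)" using I.A_sub[OF i] by (auto simp: tops I.topspace)
  show "compact_space (topol (?M i))"
   unfolding tops by (rule compact_space_subtopology[OF closedin_compact_space[OF PP.compact I.A(2)[OF i]]])
 qed
 have ac: "acfield (R i)" "char_of (R i) (ring_characteristic (K i))" if "i \<in> {1..n}" for i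
  using galois_extension(1,2)[OF K(1)[OF that]] by (simp_all add: R_def)
 have "\<forall>i\<in>{1..n}. \<exists>act. gact (R i) (?M i) act \<and> (\<forall>g\<in>carrier (?M i). act g \<in> acfield.autos (R i)) \<and>
  (\<forall>g\<in>carrier (?M i). \<forall>h\<in>carrier (?M i). (\<forall>a\<in>carrier (R i). act g a = act h a) \<longrightarrow> g = h)"
  unfolding R_def using galois_act_ex[OF K(1) G K(2) A(2) M] by blast
 from bchoice[OF this] obtain act where
  act: "\<forall>i\<in>{1..n}. gact (R i) (?M i) (act i) \<and> (\<forall>g\<in>carrier (?M i). act i g \<in> acfield.autos (R i)) \<and>
  (\<forall>g\<in>carrier (?M i). \<forall>h\<in>carrier (?M i). (\<forall>a\<in>carrier (R i). act i g a = act i h a) \<longrightarrow> g = h)" by (elim exE)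
 \<comment> \<open>The generator reserved for the residue characteristic, the same for all
   factors.\<close>
 let ?e = "gb (Inl None) :: (('h set \<times> 'h set) option + ('h set \<times> nat)) gam"
 let ?Q = "\<lambda>i N. hahn_quot (cring.mev (R i)) (acfield.ker (R i)) (carrier (R i)) (acfield.tch (R i)) \<zero>\<^bsub>R i\<^esub> ?e N \<and>
   pideal N \<and> acl N \<and> (\<forall>m. of_int m \<in> N \<longleftrightarrow> int q dvd m) \<and>
   (\<forall>\<tau>\<in>acfield.autos (R i). \<forall>c\<in>N. hmap (acfield.vmap \<tau>) c \<in> N)"
 have "\<forall>i\<in>{1..n}. \<exists>N. ?Q i N"
 proof
  fix i assume i: "i \<in> {1..n}"
  show "\<exists>N. ?Q i N" by (rule acfield.hahn_field[OF ac(1)[OF i] gb_pos ac(2)[OF i] q[OF i]])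
 qed
 from bchoice[OF this] obtain N where N: "\<forall>i\<in>{1..n}. ?Q i (N i)" by (elim exE)
 have lcM: "lconst (?M i) (\<lambda>g. ltr P g x)" if i: "i \<in> {1..n}" for i x unfolding lconst_def
 proof
  fix v
  have "{g \<in> carrier (?M i). ltr P g x = v} = A i \<inter> {g \<in> carrier P. ltr P g x = v}" using I.A_sub[OF i] by (auto simp: tops)
  moreover have "openin (topol P) {g \<in> carrier P. ltr P g x = v}" using PP.ltr_lconst unfolding lconst_def by blast
  ultimately show "openin (topol (?M i)) {g \<in> carrier (?M i). ltr P g x = v}" by (simp add: tops openin_subtopology_Int2)
 qed
 have fac: "factor (R i) (?M i) (act i) (N i) (ltr P) q" if i: "i \<in> {1..n}" for i
 proof (rule factor.intro[OF _ ac(1)[OF i]])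
  show "gact (R i) (?M i) (act i)" using act i by blast
  show "hahn_quot (cring.mev (R i)) (acfield.ker (R i)) (carrier (R i)) (acfield.tch (R i)) \<zero>\<^bsub>R i\<^esub> ?e (N i)" using N i by blast
  show "factor_axioms (R i) (?M i) (act i) (N i) (ltr P) q"
  proof (rule factor_axioms.intro)
   show "act i g \<in> acfield.autos (R i)" if "g \<in> carrier (?M i)" for g using act i that by blast
   show "g = h" if "g \<in> carrier (?M i)" "h \<in> carrier (?M i)" "\<And>a. a \<in> carrier (R i) \<Longrightarrow> act i g a = act i h a" for g h
    using act i that by blast
   show "ltr P \<one>\<^bsub>?M i\<^esub> x = x" for x by (simp add: tops PP.ltr_one)
   show "ltr P (g \<otimes>\<^bsub>?M i\<^esub> h) x = ltr P g (ltr P h x)" if "g \<in> carrier (?M i)" "h \<in> carrier (?M i)" for g h x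
    using that I.A_sub[OF i] by (simp add: tops PP.ltr_mult)
   show "lconst (?M i) (\<lambda>g. ltr P g x)" for x by (rule lcM[OF i])
   show "hmap (acfield.vmap \<tau>) c \<in> N i" if "\<tau> \<in> acfield.autos (R i)" "c \<in> N i" for \<tau> c using N i that by blast
   show "of_int m \<in> N i \<longleftrightarrow> int q dvd m" for m using N i by blast
  qed
 qed
 have aN: "acl (N i)" if i: "i \<in> {1..n}" for i using bspec[OF N i] by (elim conjE)
 interpret AM: amalgam "TYPE('u)" P n A R act N q
  by (rule amalgam.intro[OF I.ifp_axioms], rule amalgam_axioms.intro[OF n fac aN])
 interpret CA: corr_action "TYPE('u)" P n A "N 1" AM.mv "AM.Y 1" "ltr P" by (rule AM.corr_action)
 obtain \<Phi> where \<Phi>: "CA.W_action \<Phi>" using CA.action_ex by (elim exE)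
 obtain \<kappa> :: "_ \<Rightarrow> ('k, 'h) field_universe" where \<kappa>: "inj_on \<kappa> CA.W" using CA.W_inj[OF inj_on_id] by blast
 interpret WA: waction "TYPE('u)" P n A "N 1" AM.mv "AM.Y 1" "ltr P" \<Phi> \<kappa> q
 proof (rule waction.intro[OF CA.corr_action_axioms], rule waction_axioms.intro)
  show "x = z" if "AM.Y 1 x - AM.Y 1 z \<in> N 1" for x z by (rule AM.Y_inj[OF that])
  show "g = h" if "g \<in> carrier P" "h \<in> carrier P" "\<And>x. ltr P g x = ltr P h x" for g h by (rule PP.ltr_faithful[OF that])
  show "of_int m \<in> N 1 \<longleftrightarrow> int q dvd m" for m using N AM.one_in by blast
 qed (use \<Phi> \<kappa> in simp_all)
 interpret GA: galois_action WA.wr P WA.actw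
  by (intro galois_action.intro WA.gact_wr WA.acfield_wr galois_action_axioms.intro I.profinite WA.actw_faithful)
 show ?thesis by (rule exI[of _ GA.F])
   (use GA.field_F GA.ring_characteristic_F[OF WA.char_wr] GA.absolute_galois_F[OF WA.char_wr] in simp)
qed

theorem mainTheorem1:
  fixes n :: nat
    and G :: "nat \<Rightarrow> 'g top_group"
    and P :: "'h top_group"
  assumes "n \<ge> 1"
    and "\<forall>i \<in> {1..n}. profinite_group (G i)"
    and "is_free_profinite_product TYPE('u::infinite) P n G"
  shows
    "((\<forall>i \<in> {1..n}. \<exists>K :: 'k ring. field K \<and>
          top_group_isomorphic (G i) (absolute_galois_group K)) \<longrightarrow>
        (\<exists>F :: ('k, 'h) field_universe ring. field F \<and> ring_characteristic F = 0 \<and>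
          top_group_isomorphic P (absolute_galois_group F))) \<and>
     (\<forall>p :: nat.
        (\<forall>i \<in> {1..n}. \<exists>K :: 'k ring. field K \<and> ring_characteristic K = p \<and>
          top_group_isomorphic (G i) (absolute_galois_group K)) \<longrightarrow>
        (\<exists>F :: ('k, 'h) field_universe ring. field F \<and> ring_characteristic F = p \<and>
          top_group_isomorphic P (absolute_galois_group F)))"
proof (intro conjI allI impI)
 note prof = assms(2)[rule_format]
 assume "\<forall>i \<in> {1..n}. \<exists>K :: 'k ring. field K \<and> top_group_isomorphic (G i) (absolute_galois_group K)"
 from bchoice[OF this] obtain K :: "nat \<Rightarrow> 'k ring" where
  "\<forall>i \<in> {1..n}. field (K i) \<and> top_group_isomorphic (G i) (absolute_galois_group (K i))" by (elim exE)
 thus "\<exists>F :: ('k, 'h) field_universe ring. field F \<and> ring_characteristic F = 0 \<and>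
   top_group_isomorphic P (absolute_galois_group F)"
  by (intro free_product_realization[OF assms(1) prof assms(3), where K = K]) auto
next
 note prof = assms(2)[rule_format]
 fix p :: nat
 assume "\<forall>i \<in> {1..n}. \<exists>K :: 'k ring. field K \<and> ring_characteristic K = p \<and> top_group_isomorphic (G i) (absolute_galois_group K)"
 from bchoice[OF this] obtain K :: "nat \<Rightarrow> 'k ring" where
  "\<forall>i \<in> {1..n}. field (K i) \<and> ring_characteristic (K i) = p \<and> top_group_isomorphic (G i) (absolute_galois_group (K i))"
  by (elim exE)
 thus "\<exists>F :: ('k, 'h) field_universe ring. field F \<and> ring_characteristic F = p \<and>
   top_group_isomorphic P (absolute_galois_group F)"
  by (intro free_product_realization[OF assms(1) prof assms(3), where K = K]) auto
qed

end
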